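(* Let $p$ be an odd prime and let $1\leq k\leq p-1$. Then $\operatorname{index}_{\mathbb{Z}/p}\Delta_{k,p}=H^{\geq k}(\mathrm{B}(\mathbb{Z}/p);\mathbb{F}_p)$.
   Context: The chessboard complex $\Delta_{k,p}$ has vertex set $[k]\times[p]$, simplices being vertex sets with pairwise distinct first and pairwise distinct second coordinates; $\mathbb{Z}/p$ (generated by $(12\cdots p)\in\mathfrak{S}_p$) acts by permuting the second coordinate. For a $G$-space $X$, $\operatorname{index}_G X=\ker\big(H^*(\mathrm{B}G;\mathbb{F}_p)\to H^*(\mathrm{E}G\times_G X;\mathbb{F}_p)\big)$ (Fadell–Husseini index). $H^{\geq m}$ denotes the ideal of elements of degree at least $m$ in $H^*(\mathrm{B}(\mathbb{Z}/p);\mathbb{F}_p)=\mathbb{F}_p[t]\otimes\Lambda[e]$, $\deg t=2$, $\deg e=1$. *)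

theory Defs
  imports
    "HOL-Homology.Homology"
    "HOL-Algebra.Group_Action"
    "HOL-Algebra.QuotRing"
    "HOL-Algebra.Sym_Groups"
    "HOL-Number_Theory.Residues"
begin

section \<open>Geometric realization of abstract simplicial complexes\<close>

text \<open>An abstract simplicial complex is given by its set of (finite) simplices; whether the empty
  simplex is included is irrelevant, since it contributes no point to the realization.\<close>

definition closed_face :: "'v set \<Rightarrow> ('v \<Rightarrow> real) set" where
  "closed_face S = {x. (\<forall>v. 0 \<le> x v) \<and> (\<forall>v. v \<notin> S \<longrightarrow> x v = 0) \<and> (\<Sum>v\<in>S. x v) = 1}"

text \<open>Points are described by barycentric coordinates. The topology is the weak (CW) topology: a set
  is open iff its trace on every closed face is open in the Euclidean topology of that face.\<close>

definition realization :: "'v set set \<Rightarrow> ('v \<Rightarrow> real) topology" where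
  "realization K = topology (\<lambda>U. U \<subseteq> (\<Union>S\<in>K. closed_face S) \<and>
     (\<forall>S\<in>K. openin (subtopology (powertop_real UNIV) (closed_face S)) (U \<inter> closed_face S)))"

lemma openin_realization:
  "openin (realization K) U \<longleftrightarrow> U \<subseteq> (\<Union>S\<in>K. closed_face S) \<and>
     (\<forall>S\<in>K. openin (subtopology (powertop_real UNIV) (closed_face S)) (U \<inter> closed_face S))"
proof -
  let ?P = "\<lambda>U. U \<subseteq> (\<Union>S\<in>K. closed_face S) \<and>
     (\<forall>S\<in>K. openin (subtopology (powertop_real UNIV) (closed_face S)) (U \<inter> closed_face S))"
  have "istopology ?P"
    unfolding istopology_def
  proof (intro conjI allI impI)
    fix U V assume U: "?P U" and V: "?P V"
    show "U \<inter> V \<subseteq> (\<Union>S\<in>K. closed_face S)" using U by blast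
    show "\<forall>S\<in>K. openin (subtopology (powertop_real UNIV) (closed_face S)) (U \<inter> V \<inter> closed_face S)"
    proof
      fix S assume "S \<in> K"
      then have "openin (subtopology (powertop_real UNIV) (closed_face S))
                   ((U \<inter> closed_face S) \<inter> (V \<inter> closed_face S))"
        using U V by (blast intro: openin_Int[of _ "U \<inter> closed_face S" "V \<inter> closed_face S"])
      then show "openin (subtopology (powertop_real UNIV) (closed_face S)) (U \<inter> V \<inter> closed_face S)"
        by (simp add: Int_ac)
    qed
  next
    fix \<U> assume \<U>: "\<forall>U\<in>\<U>. ?P U"
    then show "\<Union>\<U> \<subseteq> (\<Union>S\<in>K. closed_face S)" by blast
    show "\<forall>S\<in>K. openin (subtopology (powertop_real UNIV) (closed_face S)) (\<Union>\<U> \<inter> closed_face S)"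
      using \<U> unfolding Int_Union2 by (intro ballI openin_Union) blast
  qed
  then show ?thesis
    unfolding realization_def by (simp add: topology_inverse')
qed

lemma topspace_realization: "topspace (realization K) = (\<Union>S\<in>K. closed_face S)"
proof
  show "topspace (realization K) \<subseteq> (\<Union>S\<in>K. closed_face S)"
    using openin_realization openin_topspace by blast
  have "openin (realization K) (\<Union>S\<in>K. closed_face S)"
    unfolding openin_realization
  proof (intro conjI subset_refl ballI)
    fix S assume "S \<in> K"
    then have "(\<Union>S\<in>K. closed_face S) \<inter> closed_face S
                 = topspace (subtopology (powertop_real UNIV) (closed_face S))"
      by auto
    then show "openin (subtopology (powertop_real UNIV) (closed_face S))
                 ((\<Union>S\<in>K. closed_face S) \<inter> closed_face S)"
      by (metis openin_topspace)
  qed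
  then show "(\<Union>S\<in>K. closed_face S) \<subseteq> topspace (realization K)"
    by (rule openin_subset)
qed

text \<open>The map induced on realizations by a simplicial map given on vertices (the affine extension).\<close>

definition realization_map :: "('v \<Rightarrow> 'w) \<Rightarrow> ('v \<Rightarrow> real) \<Rightarrow> ('w \<Rightarrow> real)" where
  "realization_map f x = (\<lambda>w. \<Sum>v | x v \<noteq> 0 \<and> f v = w. x v)"

section \<open>Orbit spaces and the Borel construction\<close>

definition orbit_space ::
  "('g, 'm) monoid_scheme \<Rightarrow> 'a topology \<Rightarrow> ('g \<Rightarrow> 'a \<Rightarrow> 'a) \<Rightarrow> 'a set topology" where
  "orbit_space G X \<phi> = topology (\<lambda>\<U>. \<U> \<subseteq> orbits G (topspace X) \<phi> \<and>
     openin X {x \<in> topspace X. orbit G \<phi> x \<in> \<U>})"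

lemma openin_orbit_space:
  "openin (orbit_space G X \<phi>) \<U> \<longleftrightarrow>
     \<U> \<subseteq> orbits G (topspace X) \<phi> \<and> openin X {x \<in> topspace X. orbit G \<phi> x \<in> \<U>}"
proof -
  have "istopology (\<lambda>\<U>. \<U> \<subseteq> orbits G (topspace X) \<phi> \<and>
          openin X {x \<in> topspace X. orbit G \<phi> x \<in> \<U>})"
    unfolding istopology_def
  proof (intro conjI allI impI)
    fix U V
    assume U: "U \<subseteq> orbits G (topspace X) \<phi> \<and> openin X {x \<in> topspace X. orbit G \<phi> x \<in> U}"
      and V: "V \<subseteq> orbits G (topspace X) \<phi> \<and> openin X {x \<in> topspace X. orbit G \<phi> x \<in> V}"
    show "U \<inter> V \<subseteq> orbits G (topspace X) \<phi>" using U by blast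
    have "{x \<in> topspace X. orbit G \<phi> x \<in> U \<inter> V} =
          {x \<in> topspace X. orbit G \<phi> x \<in> U} \<inter> {x \<in> topspace X. orbit G \<phi> x \<in> V}"
      by blast
    then show "openin X {x \<in> topspace X. orbit G \<phi> x \<in> U \<inter> V}"
      using U V by (simp add: openin_Int)
  next
    fix \<K>
    assume *: "\<forall>U\<in>\<K>. U \<subseteq> orbits G (topspace X) \<phi> \<and> openin X {x \<in> topspace X. orbit G \<phi> x \<in> U}"
    then show "\<Union>\<K> \<subseteq> orbits G (topspace X) \<phi>" by blast
    have "{x \<in> topspace X. orbit G \<phi> x \<in> \<Union>\<K>} =
          (\<Union>U\<in>\<K>. {x \<in> topspace X. orbit G \<phi> x \<in> U})"
      by blast
    then show "openin X {x \<in> topspace X. orbit G \<phi> x \<in> \<Union>\<K>}"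
      using * by auto
  qed
  then show ?thesis
    unfolding orbit_space_def by (simp add: topology_inverse')
qed

lemma topspace_orbit_space: "topspace (orbit_space G X \<phi>) = orbits G (topspace X) \<phi>"
proof
  show "topspace (orbit_space G X \<phi>) \<subseteq> orbits G (topspace X) \<phi>"
    using openin_orbit_space openin_topspace by blast
  have "{x \<in> topspace X. orbit G \<phi> x \<in> orbits G (topspace X) \<phi>} = topspace X"
    by (auto simp: orbits_def)
  then have "openin (orbit_space G X \<phi>) (orbits G (topspace X) \<phi>)"
    by (simp add: openin_orbit_space)
  then show "orbits G (topspace X) \<phi> \<subseteq> topspace (orbit_space G X \<phi>)"
    by (rule openin_subset)
qed

text \<open>Milnor's model of \<open>EG\<close> for a discrete group \<open>G\<close>: the infinite join \<open>G * G * \<dots>\<close>, realized (with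
  the weak topology) as the simplicial complex on \<open>\<nat> \<times> G\<close> whose simplices are the finite vertex sets
  with at most one vertex in each join factor. \<open>G\<close> acts freely by left multiplication.\<close>

definition EG_space :: "('g, 'm) monoid_scheme \<Rightarrow> (nat \<times> 'g \<Rightarrow> real) topology" where
  "EG_space G = realization {S. finite S \<and> S \<subseteq> UNIV \<times> carrier G \<and> inj_on fst S}"

definition EG_action ::
  "('g, 'm) monoid_scheme \<Rightarrow> 'g \<Rightarrow> (nat \<times> 'g \<Rightarrow> real) \<Rightarrow> (nat \<times> 'g \<Rightarrow> real)" where
  "EG_action G g = realization_map (\<lambda>(n, h). (n, g \<otimes>\<^bsub>G\<^esub> h))"

definition BG_space :: "('g, 'm) monoid_scheme \<Rightarrow> (nat \<times> 'g \<Rightarrow> real) set topology" where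
  "BG_space G = orbit_space G (EG_space G) (EG_action G)"

definition borel_space ::
  "('g, 'm) monoid_scheme \<Rightarrow> 'a topology \<Rightarrow> ('g \<Rightarrow> 'a \<Rightarrow> 'a)
     \<Rightarrow> ((nat \<times> 'g \<Rightarrow> real) \<times> 'a) set topology" where
  "borel_space G X \<phi> = orbit_space G (prod_topology (EG_space G) X)
     (\<lambda>g. map_prod (EG_action G g) (\<phi> g))"

text \<open>The projection \<open>EG \<times>\<^sub>G X \<rightarrow> BG\<close>; on orbits, viewed as subsets of \<open>EG \<times> X\<close>, it is the image under
  the first projection.\<close>

definition borel_projection :: "('e \<times> 'a) set \<Rightarrow> 'e set" where
  "borel_projection A = fst ` A"

section \<open>The singular cohomology ring with coefficients in a ring\<close>

text \<open>An element of the total singular cochain ring \<open>\<Oplus>\<^sub>n C\<^sup>n(X; R)\<close> is a family \<open>c\<close> whose component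
  \<open>c n\<close> is an \<open>R\<close>-valued function on the singular \<open>n\<close>-simplices, only finitely many components being
  nonzero. Multiplication is the cup product: front face times back face.\<close>

definition front_face :: "nat \<Rightarrow> ((nat \<Rightarrow> real) \<Rightarrow> 'a) \<Rightarrow> (nat \<Rightarrow> real) \<Rightarrow> 'a" where
  "front_face i \<sigma> = restrict \<sigma> (standard_simplex i)"

text \<open>\<open>back_face i j \<sigma>\<close> is the restriction of the \<open>(i + j)\<close>-simplex \<open>\<sigma>\<close> to its last \<open>j + 1\<close> vertices.\<close>

definition back_face :: "nat \<Rightarrow> nat \<Rightarrow> ((nat \<Rightarrow> real) \<Rightarrow> 'a) \<Rightarrow> (nat \<Rightarrow> real) \<Rightarrow> 'a" where
  "back_face i j \<sigma> = restrict (\<lambda>x. \<sigma> (\<lambda>l. if l < i then 0 else x (l - i))) (standard_simplex j)"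

type_synonym ('a, 'r) cochain = "nat \<Rightarrow> ((nat \<Rightarrow> real) \<Rightarrow> 'a) \<Rightarrow> 'r"

definition cochain_ring :: "('r, 'm) ring_scheme \<Rightarrow> 'a topology \<Rightarrow> ('a, 'r) cochain ring" where
  "cochain_ring R X =
     \<lparr>carrier = {c. (\<forall>n. c n \<in> singular_simplex_set n X \<rightarrow>\<^sub>E carrier R) \<and>
                    finite {n. \<exists>\<sigma>\<in>singular_simplex_set n X. c n \<sigma> \<noteq> \<zero>\<^bsub>R\<^esub>}},
      monoid.mult = (\<lambda>a b n. \<lambda>\<sigma>\<in>singular_simplex_set n X.
                \<Oplus>\<^bsub>R\<^esub>i\<in>{..n}. a i (front_face i \<sigma>) \<otimes>\<^bsub>R\<^esub> b (n - i) (back_face i (n - i) \<sigma>)),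
      one = (\<lambda>n. \<lambda>\<sigma>\<in>singular_simplex_set n X. if n = 0 then \<one>\<^bsub>R\<^esub> else \<zero>\<^bsub>R\<^esub>),
      zero = (\<lambda>n. \<lambda>\<sigma>\<in>singular_simplex_set n X. \<zero>\<^bsub>R\<^esub>),
      add = (\<lambda>a b n. \<lambda>\<sigma>\<in>singular_simplex_set n X. a n \<sigma> \<oplus>\<^bsub>R\<^esub> b n \<sigma>)\<rparr>"

text \<open>The dual of \<^const>\<open>chain_boundary\<close>, on all degrees at once.\<close>

definition coboundary ::
  "('r, 'm) ring_scheme \<Rightarrow> 'a topology \<Rightarrow> ('a, 'r) cochain \<Rightarrow> ('a, 'r) cochain" where
  "coboundary R X c = (\<lambda>n. \<lambda>\<sigma>\<in>singular_simplex_set n X.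
     if n = 0 then \<zero>\<^bsub>R\<^esub>
     else \<Oplus>\<^bsub>R\<^esub>i\<in>{..n}. [((- 1) ^ i :: int)] \<cdot>\<^bsub>R\<^esub> c (n - 1) (singular_face n i \<sigma>))"

definition cocycle_ring :: "('r, 'm) ring_scheme \<Rightarrow> 'a topology \<Rightarrow> ('a, 'r) cochain ring" where
  "cocycle_ring R X = (cochain_ring R X)
     \<lparr>carrier := {c \<in> carrier (cochain_ring R X). coboundary R X c = \<zero>\<^bsub>cochain_ring R X\<^esub>}\<rparr>"

definition coboundaries :: "('r, 'm) ring_scheme \<Rightarrow> 'a topology \<Rightarrow> ('a, 'r) cochain set" where
  "coboundaries R X = coboundary R X ` carrier (cochain_ring R X)"

definition cohomology_ring ::
  "('r, 'm) ring_scheme \<Rightarrow> 'a topology \<Rightarrow> ('a, 'r) cochain set ring" where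
  "cohomology_ring R X = cocycle_ring R X Quot coboundaries R X"

text \<open>The ideal \<open>H\<^sup>\<ge>\<^sup>m(X; R)\<close>: classes of cocycles whose components in degrees below \<open>m\<close> vanish.\<close>

definition cohomology_geq ::
  "('r, 'm) ring_scheme \<Rightarrow> 'a topology \<Rightarrow> nat \<Rightarrow> ('a, 'r) cochain set set" where
  "cohomology_geq R X m =
     {coboundaries R X +>\<^bsub>cocycle_ring R X\<^esub> z | z.
        z \<in> carrier (cocycle_ring R X) \<and> (\<forall>n<m. z n = \<zero>\<^bsub>cochain_ring R X\<^esub> n)}"

definition cochain_pullback :: "'a topology \<Rightarrow> ('a \<Rightarrow> 'b) \<Rightarrow> ('b, 'r) cochain \<Rightarrow> ('a, 'r) cochain" where
  "cochain_pullback X f c = (\<lambda>n. \<lambda>\<sigma>\<in>singular_simplex_set n X. c n (simplex_map n f \<sigma>))"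

text \<open>The homomorphism \<open>f\<^sup>* : H\<^sup>*(Y; R) \<rightarrow> H\<^sup>*(X; R)\<close> induced by a continuous map \<open>f : X \<rightarrow> Y\<close>. As in the
  library's definition of multiplication in quotient rings, the union ranges over all representatives
  of the class; they all yield the same coset.\<close>

definition cohomology_map ::
  "('r, 'm) ring_scheme \<Rightarrow> 'a topology \<Rightarrow> ('a \<Rightarrow> 'b) \<Rightarrow> ('b, 'r) cochain set \<Rightarrow> ('a, 'r) cochain set" where
  "cohomology_map R X f A =
     (\<Union>c\<in>A. coboundaries R X +>\<^bsub>cocycle_ring R X\<^esub> cochain_pullback X f c)"

section \<open>The Fadell--Husseini index\<close>

definition fadell_husseini_index ::
  "('r, 'm) ring_scheme \<Rightarrow> ('g, 'n) monoid_scheme \<Rightarrow> 'a topology \<Rightarrow> ('g \<Rightarrow> 'a \<Rightarrow> 'a)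
     \<Rightarrow> (((nat \<times> 'g \<Rightarrow> real) set, 'r) cochain set) set" where
  "fadell_husseini_index R G X \<phi> =
     a_kernel (cohomology_ring R (BG_space G)) (cohomology_ring R (borel_space G X \<phi>))
       (cohomology_map R (borel_space G X \<phi>) borel_projection)"

section \<open>Chessboard complexes and the cyclic action\<close>

definition chessboard_complex :: "nat \<Rightarrow> nat \<Rightarrow> (nat \<times> nat) set set" where
  "chessboard_complex k p = {S. S \<subseteq> {1..k} \<times> {1..p} \<and> inj_on fst S \<and> inj_on snd S}"

definition chessboard_space :: "nat \<Rightarrow> nat \<Rightarrow> (nat \<times> nat \<Rightarrow> real) topology" where
  "chessboard_space k p = realization (chessboard_complex k p)"

text \<open>\<open>\<int>/p\<close> as the subgroup of the symmetric group generated by the cycle \<open>(1 2 \<dots> p)\<close>.\<close>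

definition cyclic_perm_group :: "nat \<Rightarrow> (nat \<Rightarrow> nat) monoid" where
  "cyclic_perm_group p = subgroup_generated (sym_group p) {cycle_of_list [1..<Suc p]}"

definition chessboard_action ::
  "(nat \<Rightarrow> nat) \<Rightarrow> (nat \<times> nat \<Rightarrow> real) \<Rightarrow> (nat \<times> nat \<Rightarrow> real)" where
  "chessboard_action \<pi> = realization_map (\<lambda>(i, j). (i, \<pi> j))"

end

theory Submission
  imports Defs
begin

text \<open>
  Write \<open>G = \<int>/p\<close>, \<open>X = \<Delta>\<^sub>k\<^sub>,\<^sub>p\<close>. Since \<open>EG\<close> and \<open>EG \<times> X\<close> cover \<open>BG\<close> and \<open>EG \<times>\<^sub>G X\<close>, classes on the
  quotients are represented by invariant cochains upstairs, and since \<open>EG\<close> is acyclic, any two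
  equivariant chain maps into it from a complex with a free action pull an invariant cocycle back
  to cohomologous ones. So a class \<open>z\<close> of degree \<open>n\<close> on \<open>BG\<close> may be evaluated on tuples: tuples of
  vertices of \<open>X\<close>, or tuples in \<open>{1..p}\<close>.

  If \<open>n \<ge> k\<close>, the pullback of \<open>z\<close> vanishes: on small simplices it is computed by tuples of vertices
  of a common simplex of \<open>X\<close>, which may be sorted by the first coordinate with signs; a tuple of
  length \<open>n + 1 > k\<close> repeats a first coordinate, so sorting kills it.

  If \<open>n < k\<close> and the pullback of \<open>z\<close> vanishes, evaluate \<open>z\<close> on the simplices with vertices
  \<open>(1, x\<^sub>0), \<dots>, (n + 1, x\<^sub>n)\<close>: the invariant cocycle \<open>f\<close> on tuples in \<open>{1..p}\<close> that represents \<open>z\<close> agrees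
  on tuples of distinct entries with the coboundary of an invariant function of levelled tuples.
  Periodicity of the cohomology of \<open>\<int>/p\<close> gives \<open>f \<sim> c \<sqdot> t\<^sup>m\<close> or \<open>f \<sim> c \<sqdot> e t\<^sup>m\<close>. Multiply by powers of
  \<open>t\<close> (and by \<open>e\<close> if \<open>n\<close> is even) to reach degree \<open>p - 2\<close>, and sum against the sign of a permutation of
  \<open>{1..p}\<close>, with its last entry summed out. All marginals of this weight vanish, so levelled coboundaries
  contribute nothing, whereas \<open>e t\<^sup>(\<^sup>p\<^sup>-\<^sup>3\<^sup>)\<^sup>/\<^sup>2\<close> has nonzero value because the weight is itself an
  invariant cocycle whose square sums to \<open>(p - 1)!\<close>. Hence \<open>c = 0\<close>.
\<close>

section \<open>Cochains on tuples\<close>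

text \<open>Chessboard complexes are in general not connected up to their dimension, so a
  connectivity bound for \<open>X\<close> does not reach all degrees below \<open>k\<close>.
  Orientability takes its place: for \<open>k = p - 1\<close> the facets, read row by row, are the
  words of \<open>p - 1\<close> distinct letters, each completed by its missing letter to a
  permutation, and the signs of these permutations form a fundamental cycle. The vanishing marginals
  are its cycle condition. Rotation preserves the orientation because \<open>p\<close> is odd, so
  the cycle descends to the orbit space, where the top class is evaluated on it. Smaller
  \<open>k\<close> are covered by the same cycle: in the cup product \<open>z\<close> sees only
  \<open>n + 1\<close> consecutive letters, which placed in the first \<open>n + 1\<close> rows span
  a simplex of \<open>X\<close>, as \<open>n < k\<close>. Cochains are integer-valued. Cocycle
  conditions hold modulo \<open>p\<close> while invariance is an equality, so representatives are at
  times reduced to residues. A sum of invariant values over all words is \<open>p\<close> times the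
  sum over orbit representatives, so its vanishing is proved over the integers before
  \<open>p\<close> is cancelled.\<close>

fun lcob :: "('a list \<Rightarrow> int) \<Rightarrow> 'a list \<Rightarrow> int" where
  "lcob f [] = 0"
| "lcob f (x # xs) = f xs - lcob (\<lambda>ys. f (x # ys)) xs"

lemma lcob_add: "lcob (\<lambda>ys. f ys + g ys) xs = lcob f xs + lcob g xs"
  by (induction xs arbitrary: f g) auto

lemma lcob_diff: "lcob (\<lambda>ys. f ys - g ys) xs = lcob f xs - lcob g xs"
  by (induction xs arbitrary: f g) auto

lemma lcob_cmul: "lcob (\<lambda>ys. c * f ys) xs = c * lcob f xs"
  by (induction xs arbitrary: f) (auto simp: algebra_simps)

lemma lcob_zero [simp]: "lcob (\<lambda>ys. 0) xs = 0"
  using lcob_cmul[of 0 "\<lambda>_. 0" xs] by simp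

lemma lcob_sum: "lcob (\<lambda>ys. \<Sum>i\<in>I. f i ys) xs = (\<Sum>i\<in>I. lcob (f i) xs)"
  by (induction I rule: infinite_finite_induct) (auto simp: lcob_add)

lemma lcob_lcob: "lcob (lcob f) xs = 0"
  by (induction xs arbitrary: f) (auto simp: lcob_diff)

lemma lcob_map: "lcob (\<lambda>ys. f (map h ys)) xs = lcob f (map h xs)"
proof (induction xs arbitrary: f)
  case (Cons x xs)
  show ?case using Cons.IH[of "\<lambda>ys. f (h x # ys)"] by simp
qed simp

lemma lcob_mod_cong:
  assumes "\<And>u x w. xs = u @ x # w \<Longrightarrow> [f (u @ w) = g (u @ w)] (mod m)"
  shows "[lcob f xs = lcob g xs] (mod m)"
  using assms
proof (induction xs arbitrary: f g)
  case (Cons x xs)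
  have "[lcob (\<lambda>ys. f (x # ys)) xs = lcob (\<lambda>ys. g (x # ys)) xs] (mod m)"
  proof (rule Cons.IH)
    fix u y w assume "xs = u @ y # w"
    then show "[f (x # u @ w) = g (x # u @ w)] (mod m)"
      using Cons.prems[of "x # u" y w] by simp
  qed
  moreover have "[f xs = g xs] (mod m)" using Cons.prems[of "[]" x xs] by simp
  ultimately show ?case by (simp add: cong_diff)
qed simp

lemma lcob_cong:
  assumes "\<And>u x w. xs = u @ x # w \<Longrightarrow> f (u @ w) = g (u @ w)"
  shows "lcob f xs = lcob g xs"
  \<comment> \<open>Congruence modulo 0 is equality.\<close>
  using lcob_mod_cong[of xs f g 0] assms by simp

lemma lcob_snoc: "lcob f (xs @ [x]) = lcob (\<lambda>ys. f (ys @ [x])) xs + (- 1) ^ length xs * f xs"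
  by (induction xs arbitrary: f) auto

lemma lcob_eq_sum: "lcob f xs = (\<Sum>i<length xs. (- 1) ^ i * f (take i xs @ drop (Suc i) xs))"
proof (induction xs arbitrary: f)
  case (Cons x xs)
  show ?case
    by (simp add: Cons.IH sum.lessThan_Suc_shift sum_negf del: sum.lessThan_Suc)
qed simp

section \<open>Cup products of cochains on tuples\<close>

definition cup :: "nat \<Rightarrow> ('a list \<Rightarrow> int) \<Rightarrow> ('a list \<Rightarrow> int) \<Rightarrow> 'a list \<Rightarrow> int" where
  "cup n f g xs = f (take (Suc n) xs) * g (drop n xs)"

lemma cup_Suc_Cons: "cup (Suc n) f g (x # xs) = cup n (\<lambda>ys. f (x # ys)) g xs"
  by (simp add: cup_def)

lemma cup_diff_left: "cup n (\<lambda>ys. f ys - f' ys) g xs = cup n f g xs - cup n f' g xs"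
  by (simp add: cup_def algebra_simps)

lemma cup_cmul_left: "cup n (\<lambda>ys. c * f ys) g xs = c * cup n f g xs"
  by (simp add: cup_def)

text \<open>The Leibniz rule; \<open>n\<close> is the degree of the left factor, and front and back
  face share the entry at position \<open>n\<close>. The length bound guarantees that both faces
  stay complete after an entry is deleted. The induction moves the head of the tuple into the left
  factor.\<close>

lemma lcob_cup:
  assumes "n + 2 \<le> length xs"
  shows "lcob (cup n f g) xs = cup (Suc n) (lcob f) g xs + (- 1) ^ n * cup n f (lcob g) xs"
  using assms
proof (induction n arbitrary: f xs)
  case 0
  then obtain x y ys where xs: "xs = x # y # ys"
    by (cases xs; cases "tl xs") auto
  have "lcob (\<lambda>zs. f [x] * g (x # zs)) (y # ys) = f [x] * lcob (\<lambda>zs. g (x # zs)) (y # ys)"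
    by (rule lcob_cmul)
  moreover have "lcob (cup 0 f g) xs = f [y] * g (y # ys) - lcob (\<lambda>zs. f [x] * g (x # zs)) (y # ys)"
    unfolding xs lcob.simps(2)[of _ x] by (simp add: cup_def)
  ultimately show ?case by (simp add: xs cup_def ring_distribs)
next
  case (Suc n)
  then obtain x ys where xs: "xs = x # ys" by (cases xs) auto
  let ?fx = "\<lambda>zs. f (x # zs)"
  have "lcob (cup (Suc n) f g) xs = cup (Suc n) f g ys - lcob (cup n ?fx g) ys"
    by (simp add: xs cup_Suc_Cons)
  also have "\<dots> = cup (Suc n) f g ys - (cup (Suc n) (lcob ?fx) g ys + (- 1) ^ n * cup n ?fx (lcob g) ys)"
    using Suc.IH[of ys ?fx] Suc.prems xs by simp
  also have "\<dots> = cup (Suc (Suc n)) (lcob f) g xs + (- 1) ^ Suc n * cup (Suc n) f (lcob g) xs"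
    unfolding xs cup_Suc_Cons by (simp add: cup_diff_left)
  finally show ?case .
qed

lemma cup_assoc: "n + m < length xs \<Longrightarrow> cup (n + m) (cup n f g) h xs = cup n f (cup m g h) xs"
  by (simp add: cup_def drop_take min_def add.commute)

section \<open>Alternating cochains and the sign of a word\<close>

definition alternating :: "('a list \<Rightarrow> int) \<Rightarrow> bool" where
  "alternating f \<longleftrightarrow> (\<forall>u x y w. f (u @ x # y # w) = - f (u @ y # x # w))"

lemma alternatingD: "alternating f \<Longrightarrow> f (u @ x # y # w) = - f (u @ y # x # w)"
  unfolding alternating_def by blast

lemma alternating_Cons: "alternating f \<Longrightarrow> alternating (\<lambda>ys. f (a # ys))"
  unfolding alternating_def by (metis append_Cons)

lemma alternating_move:
  assumes "alternating f"
  shows "f (u @ y # w @ v) = (- 1) ^ length w * f (u @ w @ y # v)"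
proof (induction w arbitrary: u)
  case (Cons a w)
  show ?case using alternatingD[OF assms, of u y a "w @ v"] Cons.IH[of "u @ [a]"] by simp
qed simp

text \<open>Bringing two equal entries next to each other changes at most the sign, and an adjacent
  equal pair forces \<open>f = - f\<close> over the integers.\<close>

lemma alternating_not_distinct:
  assumes "alternating f" "\<not> distinct xs"
  shows "f xs = 0"
proof -
  obtain u x v w where "xs = u @ [x] @ v @ [x] @ w"
    using not_distinct_decomp[OF assms(2)] by blast
  then have "f xs = (- 1) ^ length v * f (u @ v @ x # x # w)"
    using alternating_move[OF assms(1), of u x v "x # w"] by simp
  moreover have "f (u @ v @ x # x # w) = 0"
    using alternatingD[OF assms(1), of "u @ v" x x w] unfolding append_assoc by linarith
  ultimately show ?thesis by simp
qed

text \<open>Applied at a word with a repeated letter: there the coboundary vanishes although its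
  individual terms need not. This is the source of the cocycle property of \<open>s\<close>.\<close>

lemma alternating_lcob:
  assumes "alternating f"
  shows "alternating (lcob f)"
proof -
  have "lcob f (u @ x # y # w) = - lcob f (u @ y # x # w)" for u x y w
    using assms
  proof (induction u arbitrary: f)
    case Nil
    have "lcob (\<lambda>ys. f (x # y # ys)) w = lcob (\<lambda>ys. - 1 * f (y # x # ys)) w"
    proof (rule lcob_cong)
      fix u z v
      show "f (x # y # u @ v) = - 1 * f (y # x # u @ v)"
        using alternatingD[OF Nil, of "[]" x y "u @ v"] by simp
    qed
    then show ?case by (simp only: lcob_cmul) simp
  next
    case (Cons a u)
    show ?case
      using Cons.IH[OF alternating_Cons[OF Cons.prems]] alternatingD[OF Cons.prems, of u x y w] by simp
  qed
  then show ?thesis unfolding alternating_def by blast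
qed

text \<open>The sign of a word through its inversions. Since \<open>sgn 0 = 0\<close> it vanishes on
  repeated letters, so sums against it may range over all words.\<close>

fun inv_sign :: "nat list \<Rightarrow> int" where
  "inv_sign [] = 1"
| "inv_sign (x # xs) = (\<Prod>y\<leftarrow>xs. sgn (int y - int x)) * inv_sign xs"

lemma alternating_inv_sign: "alternating inv_sign"
proof -
  have "inv_sign (u @ x # y # w) = - inv_sign (u @ y # x # w)" for u x y w
  proof (induction u)
    case Nil
    have "sgn (int x - int y) = - sgn (int y - int x)" by (simp add: sgn_if)
    then show ?case by simp
  next
    case (Cons a u)
    have "(\<Prod>z\<leftarrow>u @ x # y # w. sgn (int z - int a)) = (\<Prod>z\<leftarrow>u @ y # x # w. sgn (int z - int a))"
      by simp
    with Cons show ?case by simp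
  qed
  then show ?thesis unfolding alternating_def by blast
qed

lemma inv_sign_square:
  assumes "distinct xs"
  shows "inv_sign xs * inv_sign xs = 1"
  using assms
proof (induction xs)
  case (Cons x xs)
  have "(\<Prod>y\<leftarrow>xs. sgn (int y - int x)) * (\<Prod>y\<leftarrow>xs. sgn (int y - int x)) = 1"
    using Cons.prems by (induction xs) (auto simp: sgn_if)
  moreover have "inv_sign xs * inv_sign xs = 1" using Cons by simp
  ultimately show ?case by (metis inv_sign.simps(2) mult.assoc mult.commute mult.right_neutral)
qed simp

section \<open>Invariant cochains on words in a cyclic alphabet\<close>

locale cyclic_cochains =
  fixes p :: nat
  assumes prime_p: "prime p" and odd_p: "odd p"
begin

text \<open>An explicit form of the cycle \<open>(1 2 ... p)\<close>. Being the identity elsewhere,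
  it equals the generating permutation as a total function.\<close>

definition T :: "nat \<Rightarrow> nat" where "T j = (if j \<in> {1..p} then j mod p + 1 else j)"

definition L :: "nat \<Rightarrow> nat list set" where "L n = {xs. set xs \<subseteq> {1..p} \<and> length xs = n}"

definition invariant :: "(nat list \<Rightarrow> int) \<Rightarrow> bool" where
  "invariant f \<longleftrightarrow> (\<forall>xs. set xs \<subseteq> {1..p} \<longrightarrow> f (map T xs) = f xs)"

definition cocyc :: "nat \<Rightarrow> (nat list \<Rightarrow> int) \<Rightarrow> bool" where
  "cocyc n f \<longleftrightarrow> (\<forall>xs \<in> L (n + 2). [lcob f xs = 0] (mod int p))"

text \<open>The case distinction removes the augmentation: \<open>lcob a [x]\<close> is
  \<open>a []\<close>, which would make every constant a coboundary in degree 0.\<close>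

definition cob :: "nat \<Rightarrow> (nat list \<Rightarrow> int) \<Rightarrow> bool" where
  "cob n f \<longleftrightarrow> (\<exists>a. invariant a \<and>
     (\<forall>xs \<in> L (n + 1). [f xs = (if n = 0 then 0 else lcob a xs)] (mod int p)))"

lemma p_ge: "p \<ge> 3" using prime_p odd_p
  by (metis One_nat_def Suc_leI even_numeral le_neq_implies_less numeral_2_eq_2 numeral_3_eq_3 prime_ge_2_nat)

lemma finite_L: "finite (L n)"
  unfolding L_def by (rule finite_lists_length_eq) simp

lemma T_in: "j \<in> {1..p} \<Longrightarrow> T j \<in> {1..p}"
  using p_ge mod_less_divisor[of p j] by (auto simp: T_def Suc_le_eq)

lemma T_eq: "j \<in> {1..p} \<Longrightarrow> T j = (if j = p then 1 else Suc j)"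
  using p_ge by (auto simp: T_def)

lemma T_pow: "j \<in> {1..p} \<Longrightarrow> (T ^^ i) j = (j - 1 + i) mod p + 1"
proof (induction i)
  case 0 then show ?case by auto
next
  case (Suc i)
  have "(j - 1 + i) mod p + 1 \<in> {1..p}" using p_ge by (simp add: Suc_leI)
  then have "T ((j - 1 + i) mod p + 1) = ((j - 1 + i) mod p + 1) mod p + 1"
    by (simp add: T_def)
  also have "\<dots> = (j - 1 + Suc i) mod p + 1" by (simp add: mod_Suc_eq)
  finally show ?case using Suc by simp
qed

lemma T_pow_in: "j \<in> {1..p} \<Longrightarrow> (T ^^ i) j \<in> {1..p}"
  using p_ge by (simp add: T_pow Suc_leI)

lemma T_pow_p: "j \<in> {1..p} \<Longrightarrow> (T ^^ p) j = j"
  by (cases j) (auto simp: T_pow)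

lemma map_T_pow_set: "set xs \<subseteq> {1..p} \<Longrightarrow> set (map (T ^^ i) xs) \<subseteq> {1..p}"
  using T_pow_in by auto

lemma map_T_set: "set xs \<subseteq> {1..p} \<Longrightarrow> set (map T xs) \<subseteq> {1..p}"
  using T_in by auto

lemma map_T_pow_p: "set xs \<subseteq> {1..p} \<Longrightarrow> map (T ^^ p) xs = xs"
  by (intro map_idI T_pow_p) blast

lemma map_T_pow_Suc: "map (T ^^ Suc i) xs = map T (map (T ^^ i) xs)" by simp

lemma map_T_pow_Suc': "map (T ^^ Suc i) xs = map (T ^^ i) (map T xs)"
  by (simp add: funpow_swap1)

lemma L_map: "xs \<in> L n \<Longrightarrow> map T xs \<in> L n"
  using map_T_set by (auto simp: L_def)

lemma L_map_pow: "xs \<in> L n \<Longrightarrow> map (T ^^ i) xs \<in> L n"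
  using map_T_pow_set by (auto simp: L_def)

lemma L_del: "u @ x # w \<in> L (Suc n) \<Longrightarrow> u @ w \<in> L n"
  by (auto simp: L_def)

lemma L_take: "xs \<in> L n \<Longrightarrow> k \<le> n \<Longrightarrow> take k xs \<in> L k"
  by (auto simp: L_def dest: in_set_takeD)

lemma L_drop: "xs \<in> L n \<Longrightarrow> k \<le> n \<Longrightarrow> drop k xs \<in> L (n - k)"
  by (auto simp: L_def dest: in_set_dropD)

lemma invariantD: "invariant f \<Longrightarrow> set xs \<subseteq> {1..p} \<Longrightarrow> f (map T xs) = f xs"
  by (simp add: invariant_def)

lemma invariant_pow: "invariant f \<Longrightarrow> set xs \<subseteq> {1..p} \<Longrightarrow> f (map (T ^^ i) xs) = f xs"
proof (induction i)
  case (Suc i)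
  then show ?case
    unfolding map_T_pow_Suc by (simp only: invariantD[OF _ map_T_pow_set])
qed simp

lemma lcob_shift: "lcob f (map T xs) = lcob (\<lambda>ys. f (map T ys)) xs"
  by (rule lcob_map[symmetric])

lemma invariant_cup: "invariant f \<Longrightarrow> invariant g \<Longrightarrow> invariant (cup n f g)"
  unfolding invariant_def cup_def take_map drop_map
  by (metis order_trans[OF set_drop_subset] order_trans[OF set_take_subset])

lemma invariant_diff: "invariant f \<Longrightarrow> invariant g \<Longrightarrow> invariant (\<lambda>xs. f xs - g xs)"
  by (auto simp: invariant_def)

lemma invariant_cmul: "invariant f \<Longrightarrow> invariant (\<lambda>xs. c * f xs)"
  by (auto simp: invariant_def)

text \<open>A primitive is given by the cone with apex \<open>1\<close>.\<close>
lemma cocyc_exact: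
  assumes "cocyc n f"
  obtains g where "\<And>xs. xs \<in> L (n + 1) \<Longrightarrow> [f xs = lcob g xs] (mod int p)"
proof (rule that)
  fix xs assume "xs \<in> L (n + 1)"
  then have "1 # xs \<in> L (n + 2)" using p_ge by (auto simp: L_def)
  then have "[f xs - lcob (\<lambda>ys. f (1 # ys)) xs = 0] (mod int p)"
    using assms unfolding cocyc_def by (metis lcob.simps(2))
  then show "[f xs = lcob (\<lambda>ys. f (1 # ys)) xs] (mod int p)"
    by (simp add: cong_iff_dvd_diff)
qed

text \<open>\<open>chi\<close> marks the letter at which rotation wraps around, and
  \<open>carry\<close> marks a descent. Two dimension shifts lead from \<open>tri\<close> through
  \<open>carry\<close> to \<open>chi\<close>, whose norm is the constant 1; this is why
  \<open>tri\<close> is the periodicity class.\<close>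

definition chi :: "nat list \<Rightarrow> int" where
  "chi xs = (case xs of [x] \<Rightarrow> of_bool (x = p) | _ \<Rightarrow> 0)"

definition carry :: "nat list \<Rightarrow> int" where
  "carry xs = (case xs of [x, y] \<Rightarrow> of_bool (y < x) | _ \<Rightarrow> 0)"

text \<open>The cocycles \<open>edge\<close> and \<open>tri\<close> represent the generators \<open>e\<close> and \<open>t\<close>.\<close>
definition edge :: "nat list \<Rightarrow> int" where
  "edge xs = (case xs of [x, y] \<Rightarrow> (int y - int x) mod int p | _ \<Rightarrow> 0)"

definition tri :: "nat list \<Rightarrow> int" where "tri = lcob carry"

lemma list_cases3:
  obtains "xs = []" | x where "xs = [x]" | x y where "xs = [x, y]" | x y z zs where "xs = x # y # z # zs"
  by (metis neq_Nil_conv)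

text \<open>Rotation preserves the comparison of two letters unless exactly one of them is
  \<open>p\<close>, which drops to 1 and flips it. For words of any other length both sides
  vanish.\<close>

lemma carry_shift:
  assumes "set xs \<subseteq> {1..p}"
  shows "carry (map T xs) = carry xs + lcob chi xs"
proof (cases xs rule: list_cases3)
  case (3 x y)
  then show ?thesis using assms by (auto simp: carry_def chi_def T_eq)
next
  case (4 x y z zs)
  have "lcob chi xs = lcob (\<lambda>_. 0) xs"
    by (rule lcob_cong) (use 4 in \<open>auto simp: chi_def Cons_eq_append_conv split: list.splits\<close>)
  then show ?thesis using 4 by (simp add: carry_def)
qed (auto simp: carry_def chi_def)

text \<open>Rotation changes \<open>carry\<close> by a coboundary, which the second coboundary
  annihilates.\<close>

lemma invariant_tri: "invariant tri"
  unfolding invariant_def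
proof (intro allI impI)
  fix xs :: "nat list" assume xs: "set xs \<subseteq> {1..p}"
  have "tri (map T xs) = lcob (\<lambda>ys. carry ys + lcob chi ys) xs"
    unfolding tri_def lcob_shift
  proof (rule lcob_cong)
    fix u x w assume "xs = u @ x # w"
    then have "set (u @ w) \<subseteq> {1..p}" using xs by auto
    then show "carry (map T (u @ w)) = carry (u @ w) + lcob chi (u @ w)" by (rule carry_shift)
  qed
  then show "tri (map T xs) = tri xs" by (simp add: lcob_add lcob_lcob tri_def)
qed

lemma lcob_tri: "lcob tri xs = 0" unfolding tri_def by (rule lcob_lcob)

text \<open>The difference \<open>y - x\<close> is itself a coboundary, so the coboundary of
  \<open>edge\<close> is \<open>p\<close> times that of \<open>carry\<close>. Hence
  \<open>edge\<close> is a cocycle modulo \<open>p\<close>, and \<open>tri\<close> is its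
  Bockstein.\<close>

lemma edge_eq:
  assumes "x \<in> {1..p}" "y \<in> {1..p}"
  shows "edge [x, y] = int y - int x + int p * carry [x, y]"
proof (cases "y < x")
  case True
  then have "(int y - int x) mod int p = (int y - int x + int p) mod int p" by simp
  also have "\<dots> = int y - int x + int p" using assms True by (intro mod_pos_pos_trivial) auto
  finally show ?thesis using True by (simp add: edge_def carry_def)
next
  case False
  then have "(int y - int x) mod int p = int y - int x" using assms by (intro mod_pos_pos_trivial) auto
  then show ?thesis using False by (simp add: edge_def carry_def)
qed

lemma invariant_edge: "invariant edge"
  unfolding invariant_def
proof (intro allI impI)
  fix xs :: "nat list" assume xs: "set xs \<subseteq> {1..p}"
  show "edge (map T xs) = edge xs"
  proof (cases xs rule: list_cases3)
    case (3 x y)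
    have "edge (map T xs) = (int (T y) - int (T x)) mod int p" by (simp add: 3 edge_def)
    also have "[int (T y) - int (T x) = (int y + 1) - (int x + 1)] (mod int p)"
    proof (rule cong_diff)
      have "[int (T z) = int z + 1] (mod int p)" if "z \<in> {1..p}" for z
        using that by (cases "z = p") (simp_all add: T_eq cong_def add.commute)
      then show "[int (T y) = int y + 1] (mod int p)" "[int (T x) = int x + 1] (mod int p)"
        using xs 3 by auto
    qed
    then have "(int (T y) - int (T x)) mod int p = edge xs" by (simp add: cong_def 3 edge_def)
    finally show ?thesis .
  qed (auto simp: edge_def)
qed

lemma cocyc_edge: "cocyc 1 edge"
  unfolding cocyc_def
proof
  fix xs assume "xs \<in> L (1 + 2)"
  then obtain x y z where xs: "xs = [x, y, z]" "x \<in> {1..p}" "y \<in> {1..p}" "z \<in> {1..p}"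
    by (auto simp: L_def length_Suc_conv numeral_3_eq_3)
  have "lcob edge xs = edge [y, z] - (edge [x, z] - edge [x, y])" by (simp add: xs edge_def)
  also have "\<dots> = int p * (carry [y, z] - carry [x, z] + carry [x, y])"
    using xs by (simp add: edge_eq algebra_simps)
  finally show "[lcob edge xs = 0] (mod int p)" by (simp add: cong_0_iff)
qed

lemma sum_rotate:
  assumes "set xs \<subseteq> {1..p}"
  shows "(\<Sum>i<p. g (map (T ^^ i) (map T xs))) = (\<Sum>i<p. g (map (T ^^ i) xs) :: int)"
proof -
  have "(\<Sum>i<p. g (map (T ^^ i) (map T xs))) = (\<Sum>i<p. g (map (T ^^ Suc i) xs))"
    by (simp only: map_T_pow_Suc')
  also have "\<dots> = (\<Sum>i<Suc p. g (map (T ^^ i) xs)) - g xs"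
    by (subst sum.lessThan_Suc_shift) simp
  also have "\<dots> = (\<Sum>i<p. g (map (T ^^ i) xs))" using map_T_pow_p[OF assms] by simp
  finally show ?thesis .
qed

text \<open>Exactly one of the \<open>p\<close> translates of a letter is \<open>p\<close>.
  Consequently the cup product of an invariant \<open>\<xi>\<close> with \<open>chi\<close> has norm
  \<open>\<xi>\<close>.\<close>

lemma sum_chi:
  assumes "xs \<noteq> []" "set xs \<subseteq> {1..p}"
  shows "(\<Sum>i<p. chi [last (map (T ^^ i) xs)]) = 1"
proof -
  have l: "last xs \<in> {1..p}" using assms last_in_set by blast
  have "chi [last (map (T ^^ i) xs)] = (if i = p - last xs then 1 else 0)" if "i < p" for i
  proof -
    have "chi [last (map (T ^^ i) xs)] = of_bool ((last xs - 1 + i) mod p + 1 = p)"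
      using assms by (simp add: last_map T_pow[OF l] chi_def)
    moreover have "(last xs - 1 + i) mod p + 1 = p \<longleftrightarrow> i = p - last xs"
    proof (cases "last xs - 1 + i < p")
      case True then show ?thesis using l by auto
    next
      case False
      then have "(last xs - 1 + i) mod p = last xs - 1 + i - p"
        using l that by (subst mod_if) (auto simp: le_mod_geq)
      then show ?thesis using l that False by auto
    qed
    ultimately show ?thesis by simp
  qed
  then have "(\<Sum>i<p. chi [last (map (T ^^ i) xs)]) = (\<Sum>i<p. if i = p - last xs then 1 else 0)"
    by simp
  also have "\<dots> = 1" using l by simp
  finally show ?thesis .
qed

text \<open>The words of a fixed length form free orbits, and on a free module over the group ring
  the kernel of the norm is the image of \<open>T - 1\<close>. The solution is a partial sum along
  each orbit, which closes up because the full sum is zero.\<close>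

lemma norm_zero_imp_shift_diff:
  fixes g :: "nat list \<Rightarrow> int"
  assumes "\<And>xs. xs \<in> L (Suc n) \<Longrightarrow> (\<Sum>i<p. g (map (T ^^ i) xs)) = 0"
  obtains h where "\<And>xs. xs \<in> L (Suc n) \<Longrightarrow> h (map T xs) - h xs = g xs"
proof (rule that)
  \<comment> \<open>The summation runs over the translates from the one with head \<open>p\<close>
    up to the one just before \<open>xs\<close>; applying \<open>T\<close> therefore appends the
    term \<open>g xs\<close>.\<close>
  define h where "h xs = (\<Sum>l<hd xs. g (map (T ^^ (p - hd xs + l)) xs))" for xs
  fix xs assume xs: "xs \<in> L (Suc n)"
  then have ne: "xs \<noteq> []" and hd: "hd xs \<in> {1..p}" and sub: "set xs \<subseteq> {1..p}"
    by (auto simp: L_def length_Suc_conv)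
  show "h (map T xs) - h xs = g xs"
  proof (cases "hd xs = p")
    case True
    then have "hd (map T xs) = 1" using ne hd by (simp add: hd_map T_eq)
    then have "h (map T xs) = g (map (T ^^ (p - 1)) (map T xs))" by (simp add: h_def)
    also have "\<dots> = g (map (T ^^ p) xs)"
      unfolding map_T_pow_Suc'[symmetric] using p_ge by simp
    also have "\<dots> = g xs" by (simp only: map_T_pow_p[OF sub])
    finally have "h (map T xs) = g xs" .
    moreover have "h xs = 0" using assms[OF xs] True by (simp add: h_def)
    ultimately show ?thesis by simp
  next
    case False
    then have hd': "hd (map T xs) = Suc (hd xs)" using ne hd by (simp add: hd_map T_eq)
    have "h (map T xs) = (\<Sum>l<Suc (hd xs). g (map (T ^^ (p - hd xs + l)) xs))"
      unfolding h_def hd'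
    proof (rule sum.cong[OF refl])
      fix l
      have eq: "Suc (p - Suc (hd xs) + l) = p - hd xs + l" using hd False by auto
      show "g (map (T ^^ (p - Suc (hd xs) + l)) (map T xs)) = g (map (T ^^ (p - hd xs + l)) xs)"
        unfolding map_T_pow_Suc'[symmetric] eq ..
    qed
    also have "\<dots> = h xs + g (map (T ^^ (p - hd xs + hd xs)) xs)" by (simp add: h_def)
    also have "map (T ^^ (p - hd xs + hd xs)) xs = xs" using hd map_T_pow_p[OF sub] by simp
    finally show ?thesis by simp
  qed
qed

lemma cob_diff:
  assumes "cob n f" "cob n g" shows "cob n (\<lambda>xs. f xs - g xs)"
proof -
  obtain a b where a: "invariant a" "\<forall>xs \<in> L (n + 1). [f xs = (if n = 0 then 0 else lcob a xs)] (mod int p)"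
    and b: "invariant b" "\<forall>xs \<in> L (n + 1). [g xs = (if n = 0 then 0 else lcob b xs)] (mod int p)"
    using assms unfolding cob_def by blast
  show ?thesis
    unfolding cob_def
  proof (intro exI[of _ "\<lambda>xs. a xs - b xs"] conjI ballI invariant_diff a b)
    fix xs assume "xs \<in> L (n + 1)"
    then show "[f xs - g xs = (if n = 0 then 0 else lcob (\<lambda>xs. a xs - b xs) xs)] (mod int p)"
      using cong_diff[OF a(2)[rule_format] b(2)[rule_format], of xs xs]
      by (auto simp: lcob_diff split: if_splits)
  qed
qed

lemma cob_cmul:
  assumes "cob n f" shows "cob n (\<lambda>xs. c * f xs)"
proof -
  obtain a where a: "invariant a" "\<forall>xs \<in> L (n + 1). [f xs = (if n = 0 then 0 else lcob a xs)] (mod int p)"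
    using assms unfolding cob_def by blast
  show ?thesis
    unfolding cob_def
  proof (intro exI[of _ "\<lambda>xs. c * a xs"] conjI ballI invariant_cmul a)
    fix xs assume "xs \<in> L (n + 1)"
    then show "[c * f xs = (if n = 0 then 0 else lcob (\<lambda>xs. c * a xs) xs)] (mod int p)"
      using cong_scalar_left[OF a(2)[rule_format], of xs c] by (auto simp: lcob_cmul split: if_splits)
  qed
qed

lemma cob_cong:
  assumes "cob n f" "\<And>xs. xs \<in> L (n + 1) \<Longrightarrow> [g xs = f xs] (mod int p)"
  shows "cob n g"
  using assms unfolding cob_def by (meson cong_trans)

lemma cup_lcob_left:
  assumes "cocyc k g" "xs \<in> L (n + k + 2)"
  shows "[cup (Suc n) (lcob a) g xs = lcob (cup n a g) xs] (mod int p)"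
proof -
  have "[lcob g (drop n xs) = 0] (mod int p)"
    using assms(1) L_drop[OF assms(2), of n] by (simp add: cocyc_def)
  then have "[cup n a (lcob g) xs = 0] (mod int p)"
    unfolding cup_def using cong_scalar_left by fastforce
  then have "[(- 1) ^ n * cup n a (lcob g) xs = 0] (mod int p)"
    using cong_scalar_left by fastforce
  moreover have "n + 2 \<le> length xs" using assms(2) by (simp add: L_def)
  ultimately show ?thesis
    by (simp add: lcob_cup cong_iff_dvd_diff)
qed

lemma cocyc_cup:
  assumes "cocyc n f" "cocyc k g"
  shows "cocyc (n + k) (cup n f g)"
  unfolding cocyc_def
proof
  fix xs assume xs: "xs \<in> L (n + k + 2)"
  have "[lcob f (take (Suc (Suc n)) xs) = 0] (mod int p)"
    using assms(1) L_take[OF xs, of "Suc (Suc n)"] by (simp add: cocyc_def)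
  then have "[cup (Suc n) (lcob f) g xs = 0] (mod int p)"
    unfolding cup_def using cong_scalar_right by fastforce
  then show "[lcob (cup n f g) xs = 0] (mod int p)"
    using cup_lcob_left[OF assms(2) xs, of f] by (meson cong_sym cong_trans)
qed

lemma cob_cup_right:
  assumes "cob n f" "invariant g" "cocyc k g"
  shows "cob (n + k) (cup n f g)"
proof -
  obtain a where a: "invariant a" "\<forall>xs \<in> L (n + 1). [f xs = (if n = 0 then 0 else lcob a xs)] (mod int p)"
    using assms(1) unfolding cob_def by blast
  show ?thesis
  \<comment> \<open>In degree 0 a coboundary is zero modulo \<open>p\<close>, and so is its product
    with anything. In positive degree the primitive is multiplied by the cocycle.\<close>
  proof (cases n)
    case 0
    show ?thesis
      unfolding cob_def
    proof (intro exI[of _ "\<lambda>_. 0"] conjI ballI)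
      show "invariant (\<lambda>_. 0)" by (simp add: invariant_def)
      fix xs assume xs: "xs \<in> L (n + k + 1)"
      have "[f (take (Suc n) xs) = 0] (mod int p)"
        using a(2) 0 L_take[OF xs, of "Suc n"] by auto
      then have "[cup n f g xs = 0] (mod int p)"
        unfolding cup_def using cong_scalar_right by fastforce
      then show "[cup n f g xs = (if n + k = 0 then 0 else lcob (\<lambda>_. 0) xs)] (mod int p)"
        by (cases "n + k = 0") (simp_all only: if_True if_False lcob_zero simp_thms)
    qed
  next
    case (Suc m)
    show ?thesis
      unfolding cob_def
    proof (intro exI[of _ "cup m a g"] conjI ballI invariant_cup a assms)
      fix xs assume xs: "xs \<in> L (n + k + 1)"
      have "[f (take (Suc n) xs) = lcob a (take (Suc n) xs)] (mod int p)"
        using a(2) Suc L_take[OF xs, of "Suc n"] by auto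
      then have "[cup n f g xs = cup n (lcob a) g xs] (mod int p)"
        unfolding cup_def using cong_scalar_right by fastforce
      also have "[cup n (lcob a) g xs = lcob (cup m a g) xs] (mod int p)"
        using cup_lcob_left[OF assms(3), of xs m a] xs Suc by (simp add: add.assoc)
      finally show "[cup n f g xs = (if n + k = 0 then 0 else lcob (cup m a g) xs)] (mod int p)"
        using Suc by simp
    qed
  qed
qed

lemma cup_edge_lcob:
  assumes "xs \<in> L (m + 3)"
  shows "[cup 1 edge (lcob a) xs = - lcob (cup 1 edge a) xs] (mod int p)"
proof -
  have "[lcob edge (take 3 xs) = 0] (mod int p)"
    using cocyc_edge L_take[OF assms, of 3] by (simp add: cocyc_def numeral_3_eq_3)
  then have "[cup 2 (lcob edge) a xs = 0] (mod int p)"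
    unfolding cup_def using cong_scalar_right by (fastforce simp: numeral_3_eq_3 numeral_2_eq_2)
  moreover have "lcob (cup 1 edge a) xs = cup 2 (lcob edge) a xs - cup 1 edge (lcob a) xs"
    using lcob_cup[of 1 xs edge a] assms by (simp add: L_def numeral_2_eq_2)
  ultimately show ?thesis by (simp add: cong_iff_dvd_diff)
qed

lemma cob_cup_edge:
  assumes "cob (Suc m) f"
  shows "cob (Suc (Suc m)) (cup 1 edge f)"
proof -
  obtain a where a: "invariant a" "\<forall>xs \<in> L (Suc m + 1). [f xs = lcob a xs] (mod int p)"
    using assms unfolding cob_def by auto
  show ?thesis
    unfolding cob_def
  \<comment> \<open>The sign is the Leibniz sign caused by the degree one factor
    \<open>edge\<close>.\<close>
  proof (intro exI[of _ "\<lambda>xs. - 1 * cup 1 edge a xs"] conjI ballI invariant_cup invariant_cmul a invariant_edge)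
    fix xs assume xs: "xs \<in> L (Suc (Suc m) + 1)"
    have "[f (drop 1 xs) = lcob a (drop 1 xs)] (mod int p)"
      using a(2) L_drop[OF xs, of 1] by auto
    then have "[cup 1 edge f xs = cup 1 edge (lcob a) xs] (mod int p)"
      unfolding cup_def using cong_scalar_left by fastforce
    also have "[cup 1 edge (lcob a) xs = - lcob (cup 1 edge a) xs] (mod int p)"
      using xs by (intro cup_edge_lcob[of _ m]) (simp add: numeral_3_eq_3)
    finally show "[cup 1 edge f xs = (if Suc (Suc m) = 0 then 0 else lcob (\<lambda>xs. - 1 * cup 1 edge a xs) xs)] (mod int p)"
      by (simp only: lcob_cmul) simp
  qed
qed

lemma cocyc_tri: "cocyc 2 tri"
  unfolding cocyc_def by (simp add: lcob_tri)

text \<open>Periodicity: \<open>\<xi> = N\<gamma>\<^sub>2\<close> is obtained by two dimension shifts \<open>f = d\<gamma>\<^sub>1\<close>, \<open>T\<gamma>\<^sub>1 - \<gamma>\<^sub>1 = d\<gamma>\<^sub>2\<close>. Since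
  \<open>tri = d carry\<close> and \<open>T carry - carry = d chi\<close>, the cochains \<open>\<xi> \<union> carry\<close> and \<open>\<xi> \<union> chi\<close> play
  the same roles for \<open>\<xi> \<union> tri\<close>; the differences satisfy \<open>N(\<gamma>\<^sub>2 - \<xi> \<union> chi) = 0\<close>.\<close>
lemma periodicity:
  assumes inv: "invariant f" and coc: "cocyc (m + 2) f"
  obtains \<xi> where "invariant \<xi>" "cocyc m \<xi>" "cob (m + 2) (\<lambda>xs. f xs - cup m \<xi> tri xs)"
proof -
  obtain g1 where g1: "\<And>xs. xs \<in> L (m + 2 + 1) \<Longrightarrow> [f xs = lcob g1 xs] (mod int p)"
    using cocyc_exact[OF coc] by blast
  \<comment> \<open>The primitive \<open>g1\<close> need not be invariant. Its defect under rotation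
    is again a cocycle, one degree lower, because \<open>f\<close> is invariant.\<close>
  define \<delta> where "\<delta> = (\<lambda>xs. g1 (map T xs) - g1 xs)"
  have "cocyc (m + 1) \<delta>"
    unfolding cocyc_def
  proof
    fix xs assume "xs \<in> L (m + 1 + 2)"
    then have xs: "xs \<in> L (m + 2 + 1)" by (simp add: add.commute)
    have "lcob \<delta> xs = lcob g1 (map T xs) - lcob g1 xs"
      by (simp add: \<delta>_def lcob_diff lcob_shift)
    also have "[lcob g1 (map T xs) - lcob g1 xs = f (map T xs) - f xs] (mod int p)"
      by (intro cong_diff cong_sym[OF g1] xs L_map)
    also have "f (map T xs) - f xs = 0" using invariantD[OF inv] xs by (simp add: L_def)
    finally show "[lcob \<delta> xs = 0] (mod int p)" .
  qed
  then obtain g2 where g2: "\<And>xs. xs \<in> L (m + 2) \<Longrightarrow> [\<delta> xs = lcob g2 xs] (mod int p)"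
    using cocyc_exact[of "m + 1" \<delta>] by (metis Suc_1 add_Suc_right add.right_neutral One_nat_def)
  define \<xi> where "\<xi> = (\<lambda>xs. \<Sum>i<p. g2 (map (T ^^ i) xs))"
  have inv\<xi>: "invariant \<xi>"
    unfolding invariant_def \<xi>_def using sum_rotate by blast
  have dxi: "[lcob \<xi> xs = 0] (mod int p)" if xs: "xs \<in> L (m + 2)" for xs
  proof -
    have "lcob \<xi> xs = (\<Sum>i<p. lcob g2 (map (T ^^ i) xs))"
      unfolding \<xi>_def lcob_sum lcob_map[of g2, symmetric] ..
    also have "[(\<Sum>i<p. lcob g2 (map (T ^^ i) xs)) = (\<Sum>i<p. \<delta> (map (T ^^ i) xs))] (mod int p)"
      by (intro cong_sum cong_sym[OF g2] L_map_pow xs)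
    also have "(\<Sum>i<p. \<delta> (map (T ^^ i) xs)) = (\<Sum>i<p. g1 (map (T ^^ Suc i) xs) - g1 (map (T ^^ i) xs))"
      by (simp add: \<delta>_def)
    also have "\<dots> = g1 (map (T ^^ p) xs) - g1 (map (T ^^ 0) xs)"
      by (rule sum_lessThan_telescope)
    also have "\<dots> = 0" using map_T_pow_p xs by (simp add: L_def)
    finally show ?thesis .
  qed
  then have coc\<xi>: "cocyc m \<xi>" by (simp add: cocyc_def)
  \<comment> \<open>This sign cancels the Leibniz sign, so that \<open>\<eta>\<close> has coboundary
    \<open>cup m \<xi> tri\<close> modulo \<open>p\<close>.\<close>
  define \<epsilon> :: int where "\<epsilon> = (- 1) ^ m"
  have \<epsilon>\<epsilon>: "\<epsilon> * \<epsilon> = 1" by (simp add: \<epsilon>_def flip: power_add)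
  define \<eta> where "\<eta> = (\<lambda>xs. \<epsilon> * cup m \<xi> carry xs)"
  have dxi_take: "[cup (Suc m) (lcob \<xi>) g xs = 0] (mod int p)" if "m + 2 \<le> length xs" "set xs \<subseteq> {1..p}" for g xs
  proof -
    have "take (Suc (Suc m)) xs \<in> L (m + 2)" using that by (auto simp: L_def dest: in_set_takeD)
    from cong_scalar_right[OF dxi[OF this]] show ?thesis unfolding cup_def by simp
  qed
  have d\<eta>: "[lcob \<eta> xs = cup m \<xi> tri xs] (mod int p)" if xs: "xs \<in> L (m + 3)" for xs
  proof -
    have "lcob \<eta> xs = \<epsilon> * (cup (Suc m) (lcob \<xi>) carry xs + \<epsilon> * cup m \<xi> tri xs)"
      unfolding \<eta>_def lcob_cmul using xs by (subst lcob_cup) (auto simp: L_def tri_def \<epsilon>_def)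
    also have "\<dots> = \<epsilon> * cup (Suc m) (lcob \<xi>) carry xs + cup m \<xi> tri xs"
      using \<epsilon>\<epsilon> by (simp add: ring_distribs mult.assoc[symmetric])
    also have "[\<epsilon> * cup (Suc m) (lcob \<xi>) carry xs + cup m \<xi> tri xs = \<epsilon> * 0 + cup m \<xi> tri xs] (mod int p)"
      using xs by (intro cong_add cong_scalar_left dxi_take) (auto simp: L_def)
    finally show ?thesis by simp
  qed
  have \<eta>T: "[\<eta> (map T xs) - \<eta> xs = lcob (cup m \<xi> chi) xs] (mod int p)" if xs: "xs \<in> L (m + 2)" for xs
  proof -
    have sub: "set xs \<subseteq> {1..p}" and len: "length xs = m + 2" using xs by (auto simp: L_def)
    have "\<xi> (map T (take (Suc m) xs)) = \<xi> (take (Suc m) xs)"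
      by (rule invariantD[OF inv\<xi>]) (use sub in \<open>auto dest: in_set_takeD\<close>)
    moreover have "carry (map T (drop m xs)) = carry (drop m xs) + lcob chi (drop m xs)"
      by (rule carry_shift) (use sub in \<open>auto dest: in_set_dropD\<close>)
    ultimately have "\<eta> (map T xs) - \<eta> xs = \<epsilon> * cup m \<xi> (lcob chi) xs"
      by (simp add: \<eta>_def cup_def take_map drop_map ring_distribs)
    also have "\<dots> = lcob (cup m \<xi> chi) xs - cup (Suc m) (lcob \<xi>) chi xs"
      using len by (subst lcob_cup) (auto simp: \<epsilon>_def)
    also have "[lcob (cup m \<xi> chi) xs - cup (Suc m) (lcob \<xi>) chi xs = lcob (cup m \<xi> chi) xs - 0] (mod int p)"
      using sub len by (intro cong_diff dxi_take) auto
    finally show ?thesis by simp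
  qed
  \<comment> \<open>The norm of this difference is zero as an integer, not only modulo
    \<open>p\<close>, because \<open>\<xi>\<close> is by definition the norm of \<open>g2\<close>.
    Hence it has the form \<open>T g3 - g3\<close>.\<close>
  define g2' where "g2' = (\<lambda>xs. g2 xs - cup m \<xi> chi xs)"
  have norm0: "(\<Sum>i<p. g2' (map (T ^^ i) xs)) = 0" if xs: "xs \<in> L (Suc m)" for xs
  proof -
    have sub: "set xs \<subseteq> {1..p}" and len: "length xs = Suc m" using xs by (auto simp: L_def)
    have ne: "xs \<noteq> []" using len by auto
    have "cup m \<xi> chi (map (T ^^ i) xs) = \<xi> xs * chi [last (map (T ^^ i) xs)]" for i
    proof -
      have "drop m (map (T ^^ i) xs) = [last (map (T ^^ i) xs)]"
        using len by (cases xs rule: rev_cases) auto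
      then show ?thesis using len invariant_pow[OF inv\<xi> sub] by (simp add: cup_def)
    qed
    then have "(\<Sum>i<p. cup m \<xi> chi (map (T ^^ i) xs)) = \<xi> xs * (\<Sum>i<p. chi [last (map (T ^^ i) xs)])"
      by (simp add: sum_distrib_left)
    also have "\<dots> = \<xi> xs" using sum_chi[OF ne sub] by simp
    finally show ?thesis by (simp add: g2'_def sum_subtractf) (simp add: \<xi>_def)
  qed
  obtain g3 where g3: "\<And>xs. xs \<in> L (Suc m) \<Longrightarrow> g3 (map T xs) - g3 xs = g2' xs"
    using norm_zero_imp_shift_diff[of m g2', OF norm0] by blast
  \<comment> \<open>Rotation changes \<open>g1\<close> by \<open>lcob g2\<close> and
    \<open>\<eta>\<close> by the coboundary of \<open>cup m \<xi> chi\<close>. The difference of the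
    two is \<open>lcob g2'\<close>, which is exactly the change of \<open>lcob g3\<close>; so
    \<open>a0\<close> is invariant modulo \<open>p\<close>.\<close>
  define a0 where "a0 = (\<lambda>xs. g1 xs - \<eta> xs - lcob g3 xs)"
  have a0T: "[a0 (map T xs) = a0 xs] (mod int p)" if xs: "xs \<in> L (m + 2)" for xs
  proof -
    have "lcob g3 (map T xs) - lcob g3 xs = lcob (\<lambda>ys. g3 (map T ys) - g3 ys) xs"
      by (simp add: lcob_diff lcob_shift)
    also have "\<dots> = lcob g2' xs"
    proof (rule lcob_cong)
      fix u x w assume "xs = u @ x # w"
      then show "g3 (map T (u @ w)) - g3 (u @ w) = g2' (u @ w)"
        using xs L_del[of u x w "Suc m"] by (intro g3) simp
    qed
    finally have "a0 (map T xs) - a0 xs = \<delta> xs - (\<eta> (map T xs) - \<eta> xs) - lcob g2' xs"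
      by (simp add: a0_def \<delta>_def)
    also have "[\<delta> xs - (\<eta> (map T xs) - \<eta> xs) - lcob g2' xs
       = lcob g2 xs - lcob (cup m \<xi> chi) xs - lcob g2' xs] (mod int p)"
      by (intro cong_diff g2 \<eta>T xs cong_refl)
    also have "lcob g2 xs - lcob (cup m \<xi> chi) xs - lcob g2' xs = 0"
      by (simp add: g2'_def lcob_diff)
    finally show ?thesis by (simp add: cong_iff_dvd_diff)
  qed
  \<comment> \<open>Taking residues turns invariance modulo \<open>p\<close> into the equality that
    \<open>cob\<close> asks of a primitive. The value 0 on other lengths keeps it invariant
    there.\<close>
  define a where "a = (\<lambda>xs. if xs \<in> L (m + 2) then a0 xs mod int p else 0)"
  have "invariant a"
    unfolding invariant_def
  proof (intro allI impI)
    fix xs :: "nat list" assume sub: "set xs \<subseteq> {1..p}"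
    show "a (map T xs) = a xs"
    proof (cases "length xs = m + 2")
      case True
      then have "xs \<in> L (m + 2)" "map T xs \<in> L (m + 2)" using sub L_map by (auto simp: L_def)
      then show ?thesis using a0T by (simp add: a_def cong_def)
    qed (simp add: a_def L_def)
  qed
  moreover have "[f xs - cup m \<xi> tri xs = lcob a xs] (mod int p)" if xs: "xs \<in> L (m + 3)" for xs
  proof -
    have "[lcob a xs = lcob a0 xs] (mod int p)"
    proof (rule lcob_mod_cong)
      fix u x w assume "xs = u @ x # w"
      then have "u @ w \<in> L (m + 2)" using xs L_del[of u x w "m + 2"] by (simp add: numeral_3_eq_3)
      then show "[a (u @ w) = a0 (u @ w)] (mod int p)" by (simp add: a_def cong_def)
    qed
    also have "lcob a0 xs = lcob g1 xs - lcob \<eta> xs"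
      by (simp add: a0_def lcob_diff lcob_lcob)
    also have "[lcob g1 xs - lcob \<eta> xs = f xs - cup m \<xi> tri xs] (mod int p)"
      using xs by (intro cong_diff d\<eta> cong_sym[OF g1]) (auto simp: numeral_3_eq_3)
    finally show ?thesis by (rule cong_sym)
  qed
  ultimately have "cob (m + 2) (\<lambda>xs. f xs - cup m \<xi> tri xs)"
    unfolding cob_def by (intro exI[of _ a]) (auto simp: numeral_3_eq_3)
  with inv\<xi> coc\<xi> show ?thesis by (rule that)
qed

fun tri_power :: "nat \<Rightarrow> nat list \<Rightarrow> int" where
  "tri_power 0 = (\<lambda>_. 1)"
| "tri_power (Suc m) = cup (2 * m) (tri_power m) tri"

lemma invariant_tri_power: "invariant (tri_power m)"
  by (induction m) (auto intro: invariant_cup invariant_tri simp: invariant_def[of "\<lambda>_. 1"])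

lemma cocyc_tri_power: "cocyc (2 * m) (tri_power m)"
proof (induction m)
  case 0
  show ?case by (auto simp: cocyc_def L_def length_Suc_conv numeral_2_eq_2)
next
  case (Suc m)
  from cocyc_cup[OF this cocyc_tri] show ?case by simp
qed

lemma tri_power_add: "length xs = Suc (2 * m + 2 * r) \<Longrightarrow> cup (2 * m) (tri_power m) (tri_power r) xs = tri_power (m + r) xs"
proof (induction r arbitrary: xs)
  case 0 then show ?case by (simp add: cup_def)
next
  case (Suc r)
  have "cup (2 * m) (tri_power m) (tri_power (Suc r)) xs
      = cup (2 * m + 2 * r) (cup (2 * m) (tri_power m) (tri_power r)) tri xs"
    using Suc.prems by (simp add: cup_assoc)
  also have "\<dots> = cup (2 * (m + r)) (tri_power (m + r)) tri xs"
    unfolding cup_def[of "2 * m + 2 * r"] cup_def[of "2 * (m + r)"]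
    using Suc.IH[of "take (Suc (2 * m + 2 * r)) xs"] Suc.prems by (simp add: algebra_simps)
  finally show ?case by simp
qed

text \<open>Periodicity splits off one factor \<open>tri\<close> at a time until degree 0, where a
  cocycle is constant modulo \<open>p\<close>; the value at 1 is the coefficient.\<close>

lemma even_normal_form:
  assumes "invariant f" "cocyc (2 * m) f"
  obtains c where "cob (2 * m) (\<lambda>xs. f xs - c * tri_power m xs)"
  using assms
proof (induction m arbitrary: f thesis)
  case 0
  have "cob 0 (\<lambda>xs. f xs - f [1] * tri_power 0 xs)"
    unfolding cob_def
  proof (intro exI[of _ "\<lambda>_. 0"] conjI ballI)
    fix xs assume "xs \<in> L (0 + 1)"
    then obtain x where xs: "xs = [x]" "x \<in> {1..p}" by (auto simp: L_def length_Suc_conv)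
    then have "[1, x] \<in> L (0 + 2)" using p_ge by (simp add: L_def)
    then have "[f [x] - f [1] = 0] (mod int p)" using 0(3) unfolding cocyc_def by fastforce
    then show "[f xs - f [1] * tri_power 0 xs = (if (0::nat) = 0 then 0 else lcob (\<lambda>_. 0) xs)] (mod int p)"
      by (simp add: xs)
  qed (simp add: invariant_def)
  then show ?case using 0(1) by simp
next
  case (Suc m)
  have "cocyc (2 * m + 2) f" using Suc.prems(3) by simp
  then obtain \<xi> where \<xi>: "invariant \<xi>" "cocyc (2 * m) \<xi>" "cob (2 * m + 2) (\<lambda>xs. f xs - cup (2 * m) \<xi> tri xs)"
    using periodicity[OF Suc.prems(2)] by metis
  obtain c where c: "cob (2 * m) (\<lambda>xs. \<xi> xs - c * tri_power m xs)"
    using Suc.IH[OF _ \<xi>(1,2)] by blast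
  \<comment> \<open>Subtracting \<open>- 1\<close> times a coboundary expresses a sum through
    closure under differences.\<close>
  have "cob (2 * m + 2) (\<lambda>xs. (f xs - cup (2 * m) \<xi> tri xs) - (- 1) * cup (2 * m) (\<lambda>xs. \<xi> xs - c * tri_power m xs) tri xs)"
    by (intro cob_diff \<xi>(3) cob_cmul cob_cup_right c invariant_tri cocyc_tri)
  then have "cob (2 * Suc m) (\<lambda>xs. f xs - c * tri_power (Suc m) xs)"
    by (simp add: cup_def algebra_simps)
  then show ?case by (rule Suc.prems(1))
qed

text \<open>A cocycle of degree 1 is additive along paths, and invariance makes all steps from
  \<open>j\<close> to \<open>j + 1\<close> equal. So it is \<open>c\<close> times
  \<open>edge\<close> modulo \<open>p\<close>, already on the level of cochains, and the zero
  primitive suffices.\<close>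

lemma cocyc_one_normal_form:
  assumes "invariant f" "cocyc 1 f"
  obtains c where "cob 1 (\<lambda>xs. f xs - c * edge xs)"
proof -
  have add: "[f [x, z] = f [x, y] + f [y, z]] (mod int p)" if "x \<in> {1..p}" "y \<in> {1..p}" "z \<in> {1..p}" for x y z
  proof -
    have "[x, y, z] \<in> L (1 + 2)" using that by (simp add: L_def)
    then have "[lcob f [x, y, z] = 0] (mod int p)" using assms(2) unfolding cocyc_def by blast
    then show ?thesis by (simp add: cong_iff_dvd_diff dvd_diff_commute algebra_simps)
  qed
  define c where "c = f [1, 2]"
  have edges: "f [j, Suc j] = c" if "1 \<le> j" "j < p" for j
    using that
  proof (induction j rule: dec_induct)
    case base then show ?case by (simp add: c_def numeral_2_eq_2)
  next
    case (step j)
    have "f (map T [j, Suc j]) = f [j, Suc j]"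
      by (rule invariantD[OF assms(1)]) (use step in auto)
    then show ?case using step by (simp add: T_eq)
  qed
  have base: "[f [1, j] = c * (int j - 1)] (mod int p)" if "1 \<le> j" "j \<le> p" for j
    using that
  proof (induction j rule: dec_induct)
    case base
    show ?case using add[of 1 1 1] p_ge by (simp add: cong_iff_dvd_diff)
  next
    case (step j)
    have "[f [1, Suc j] = f [1, j] + f [j, Suc j]] (mod int p)" using step by (intro add) auto
    also have "[f [1, j] + f [j, Suc j] = c * (int j - 1) + c] (mod int p)"
      using step edges[of j] by (intro cong_add step.IH) auto
    finally show ?case by (simp add: algebra_simps)
  qed
  have "cob 1 (\<lambda>xs. f xs - c * edge xs)"
    unfolding cob_def
  proof (intro exI[of _ "\<lambda>_. 0"] conjI ballI)
    fix xs assume "xs \<in> L (1 + 1)"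
    then obtain x y where xs: "xs = [x, y]" "x \<in> {1..p}" "y \<in> {1..p}" by (auto simp: L_def length_Suc_conv numeral_2_eq_2)
    have "[f [1, y] = f [1, x] + f [x, y]] (mod int p)" using xs p_ge by (intro add) auto
    then have "[f [x, y] = f [1, y] - f [1, x]] (mod int p)"
      by (simp add: cong_iff_dvd_diff dvd_diff_commute algebra_simps)
    also have "[f [1, y] - f [1, x] = c * (int y - 1) - c * (int x - 1)] (mod int p)"
      using xs by (intro cong_diff base) auto
    also have "c * (int y - 1) - c * (int x - 1) = c * (int y - int x)" by (simp add: algebra_simps)
    also have "[c * (int y - int x) = c * edge xs] (mod int p)"
      by (intro cong_scalar_left) (simp add: xs edge_def cong_def)
    finally show "[f xs - c * edge xs = (if (1::nat) = 0 then 0 else lcob (\<lambda>_. 0) xs)] (mod int p)"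
      by (simp add: xs(1) cong_iff_dvd_diff)
  qed (simp add: invariant_def)
  then show ?thesis by (rule that)
qed

abbreviation odd_class :: "nat \<Rightarrow> nat list \<Rightarrow> int" where
  "odd_class m \<equiv> cup 1 edge (tri_power m)"

lemma odd_class_Suc: "2 * m + 3 < length xs \<Longrightarrow> cup (2 * m + 1) (odd_class m) tri xs = odd_class (Suc m) xs"
  using cup_assoc[of 1 "2 * m" xs edge "tri_power m" tri] by simp

text \<open>As in even degrees, but the descent ends in degree 1. Associativity of the cup product
  regroups the factor \<open>tri\<close> to the right of \<open>edge\<close>.\<close>

lemma odd_normal_form:
  assumes "invariant f" "cocyc (2 * m + 1) f"
  obtains c where "cob (2 * m + 1) (\<lambda>xs. f xs - c * odd_class m xs)"
  using assms
proof (induction m arbitrary: f thesis)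
  case 0
  then obtain c where "cob 1 (\<lambda>xs. f xs - c * edge xs)" using cocyc_one_normal_form[of f] by auto
  then have "cob 1 (\<lambda>xs. f xs - c * odd_class 0 xs)"
    by (rule cob_cong) (auto simp: cup_def L_def)
  then show ?case using 0(1)[of c] by simp
next
  case (Suc m)
  have "cocyc ((2 * m + 1) + 2) f" using Suc.prems(3) by simp
  then obtain \<xi> where \<xi>: "invariant \<xi>" "cocyc (2 * m + 1) \<xi>"
      "cob ((2 * m + 1) + 2) (\<lambda>xs. f xs - cup (2 * m + 1) \<xi> tri xs)"
    using periodicity[OF Suc.prems(2)] by metis
  obtain c where c: "cob (2 * m + 1) (\<lambda>xs. \<xi> xs - c * odd_class m xs)"
    using Suc.IH[OF _ \<xi>(1,2)] by blast
  have *: "cob ((2 * m + 1) + 2) (\<lambda>xs. (f xs - cup (2 * m + 1) \<xi> tri xs)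
       - (- 1) * cup (2 * m + 1) (\<lambda>xs. \<xi> xs - c * odd_class m xs) tri xs)"
    by (intro cob_diff \<xi>(3) cob_cmul cob_cup_right c invariant_tri cocyc_tri)
  have "cob ((2 * m + 1) + 2) (\<lambda>xs. f xs - c * odd_class (Suc m) xs)"
  proof (rule cob_cong[OF *])
    fix xs assume "xs \<in> L (2 * m + 1 + 2 + 1)"
    then have eq: "odd_class (Suc m) xs = cup (2 * m + 1) (odd_class m) tri xs"
      by (intro odd_class_Suc[symmetric]) (simp add: L_def)
    show "[f xs - c * odd_class (Suc m) xs = (f xs - cup (2 * m + 1) \<xi> tri xs)
       - (- 1) * cup (2 * m + 1) (\<lambda>xs. \<xi> xs - c * odd_class m xs) tri xs] (mod int p)"
      unfolding eq by (simp add: cup_diff_left cup_cmul_left)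
  qed
  then show ?case using Suc.prems(1)[of c] by simp
qed

section \<open>Pairing with the sign cochain\<close>

text \<open>On distinct letters only the missing letter contributes, which gives the orientation of
  the facet of the board with \<open>p - 1\<close> rows that carries these letters in order.\<close>

definition s :: "nat list \<Rightarrow> int" where
  "s xs = (if length xs = p - 1 then \<Sum>x\<in>{1..p}. inv_sign (xs @ [x]) else 0)"

text \<open>Rotation preserves the order of the letters except that \<open>p\<close>, the largest,
  becomes 1, the smallest. Precisely the pairs containing \<open>p\<close> change their sign, and
  there is one for each of the other letters.\<close>

lemma inv_sign_shift:
  assumes "distinct xs" "set xs \<subseteq> {1..p}"
  shows "inv_sign (map T xs) = (if p \<in> set xs then (- 1) ^ (length xs - 1) else 1) * inv_sign xs"
  using assms
proof (induction xs)
  case (Cons x xs)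
  have x: "x \<in> {1..p}" and sub: "set xs \<subseteq> {1..p}" and d: "distinct xs" "x \<notin> set xs" using Cons.prems by auto
  have IH: "inv_sign (map T xs) = (if p \<in> set xs then (- 1) ^ (length xs - 1) else 1) * inv_sign xs"
    using Cons by simp
  let ?P = "\<lambda>ys. \<Prod>y\<leftarrow>ys. sgn (int y - int x)"
  let ?Q = "\<lambda>ys. \<Prod>y\<leftarrow>ys. sgn (int (T y) - int (T x))"
  have Q: "inv_sign (map T (x # xs)) = ?Q xs * inv_sign (map T xs)" by (simp add: o_def)
  show ?case
  proof (cases "x = p")
    case True
    have "?P ys = (- 1) ^ length ys \<and> ?Q ys = 1" if "set ys \<subseteq> {1..p}" "p \<notin> set ys" for ys
      using that
    proof (induction ys)
      case (Cons y ys)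
      then have "y \<in> {1..p}" "y \<noteq> p" by auto
      then show ?case using Cons True x by (auto simp: T_eq sgn_if)
    qed simp
    then show ?thesis using Q IH True d sub by simp
  next
    case False
    have "?Q ys = (if p \<in> set ys then - 1 else 1) * ?P ys" if "set ys \<subseteq> {1..p}" "distinct ys" for ys
      using that
    proof (induction ys)
      case (Cons y ys)
      then have "y \<in> {1..p}" by auto
      then have "sgn (int (T y) - int (T x)) = (if y = p then - 1 else 1) * sgn (int y - int x)"
        using False x by (auto simp: T_eq sgn_if)
      then show ?case using Cons by auto
    qed simp
    from this[OF sub d(1)] have "inv_sign (map T (x # xs)) = (if p \<in> set xs then - 1 else 1) * ?P xs * inv_sign (map T xs)"
      using Q by simp
    also have "\<dots> = (if p \<in> set xs then (- 1) ^ length xs else 1) * inv_sign (x # xs)"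
      unfolding IH by (cases xs) auto
    finally show ?thesis using False by simp
  qed
qed simp

lemma distinct_full:
  assumes "distinct xs" "set xs \<subseteq> {1..p}" "length xs = p"
  shows "set xs = {1..p}"
proof (rule card_subset_eq[OF finite_atLeastAtMost assms(2)])
  show "card (set xs) = card {1..p}" using assms(1,3) by (simp add: distinct_card)
qed

lemma inj_T: "inj_on T {1..p}"
proof (rule inj_onI)
  fix x y assume xy: "x \<in> {1..p}" "y \<in> {1..p}" and eq: "T x = T y"
  have "(T ^^ p) z = (T ^^ (p - 1)) (T z)" for z
    using p_ge by (cases p) (simp_all add: funpow_swap1)
  then show "x = y" using xy eq T_pow_p by metis
qed

text \<open>A full permutation has \<open>p - 1\<close> pairs containing \<open>p\<close>, an even
  number. Here the oddness of \<open>p\<close> makes the action orientation-preserving.\<close>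

lemma inv_sign_shift_full:
  assumes "set xs \<subseteq> {1..p}" "length xs = p"
  shows "inv_sign (map T xs) = inv_sign xs"
proof (cases "distinct xs")
  case True
  then have "p \<in> set xs" using distinct_full[OF True assms] p_ge by simp
  then show ?thesis using inv_sign_shift[OF True assms(1)] odd_p assms(2) by simp
next
  case False
  have "inj_on T (set xs)" by (rule inj_on_subset[OF inj_T assms(1)])
  then have "\<not> distinct (map T xs)" using False by (simp add: distinct_map)
  then show ?thesis using False alternating_not_distinct[OF alternating_inv_sign] by simp
qed

lemma T_image: "bij_betw T {1..p} {1..p}"
proof -
  have "T ` {1..p} \<subseteq> {1..p}" using T_in by blast
  then show ?thesis unfolding bij_betw_def using endo_inj_surj[OF finite_atLeastAtMost _ inj_T] inj_T by blast
qed

lemma invariant_s: "invariant s"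
  unfolding invariant_def
proof (intro allI impI)
  fix xs :: "nat list" assume xs: "set xs \<subseteq> {1..p}"
  show "s (map T xs) = s xs"
  proof (cases "length xs = p - 1")
    case True
    have "(\<Sum>x\<in>{1..p}. inv_sign (map T xs @ [x])) = (\<Sum>x\<in>{1..p}. inv_sign (map T xs @ [T x]))"
      by (rule sum.reindex_bij_betw[OF T_image, symmetric])
    also have "\<dots> = (\<Sum>x\<in>{1..p}. inv_sign (xs @ [x]))"
    proof (rule sum.cong[OF refl])
      fix x assume "x \<in> {1..p}"
      then have "inv_sign (map T (xs @ [x])) = inv_sign (xs @ [x])"
        using xs True p_ge by (intro inv_sign_shift_full) auto
      then show "inv_sign (map T xs @ [T x]) = inv_sign (xs @ [x])" by simp
    qed
    finally show ?thesis using True by (simp add: s_def)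
  qed (simp add: s_def)
qed

text \<open>A word of \<open>p\<close> letters extended by any further letter repeats one, so the
  coboundary of \<open>inv_sign\<close> vanishes there. Separating the last face shows that each of
  the \<open>p\<close> summands of \<open>lcob s xs\<close> equals \<open>inv_sign xs\<close>, and
  their total is a multiple of \<open>p\<close>.\<close>

lemma cocyc_s: "cocyc (p - 2) s"
  unfolding cocyc_def
proof
  fix xs assume "xs \<in> L (p - 2 + 2)"
  then have xs: "set xs \<subseteq> {1..p}" "length xs = p" using p_ge by (auto simp: L_def)
  have "lcob s xs = lcob (\<lambda>ys. \<Sum>x\<in>{1..p}. inv_sign (ys @ [x])) xs"
    by (rule lcob_cong) (use xs in \<open>auto simp: s_def\<close>)
  also have "\<dots> = (\<Sum>x\<in>{1..p}. lcob (\<lambda>ys. inv_sign (ys @ [x])) xs)" by (rule lcob_sum)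
  also have "\<dots> = (\<Sum>x\<in>{1..p}. inv_sign xs)"
  proof (rule sum.cong[OF refl])
    fix x assume x: "x \<in> {1..p}"
    have "\<not> distinct (xs @ [x])"
    proof
      assume "distinct (xs @ [x])"
      then have "distinct xs" "x \<notin> set xs" by simp_all
      then show False using distinct_full[OF _ xs] x by blast
    qed
    then have "lcob inv_sign (xs @ [x]) = 0"
      by (intro alternating_not_distinct alternating_lcob alternating_inv_sign)
    then show "lcob (\<lambda>ys. inv_sign (ys @ [x])) xs = inv_sign xs"
      using odd_p xs by (simp add: lcob_snoc)
  qed
  also have "\<dots> = int p * inv_sign xs" by simp
  finally show "[lcob s xs = 0] (mod int p)" by (simp add: cong_0_iff)
qed

text \<open>Fubini for words: it isolates the letter at one position so that this letter can be
  summed out.\<close>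

lemma sum_L_split:
  fixes F :: "nat list \<Rightarrow> nat \<Rightarrow> nat list \<Rightarrow> int"
  assumes "i < n"
  shows "(\<Sum>xs\<in>L n. F (take i xs) (xs ! i) (drop (Suc i) xs))
       = (\<Sum>u\<in>L i. \<Sum>w\<in>L (n - 1 - i). \<Sum>y\<in>{1..p}. F u y w)"
proof -
  have "(\<Sum>xs\<in>L n. F (take i xs) (xs ! i) (drop (Suc i) xs))
      = (\<Sum>(u, w, y)\<in>L i \<times> L (n - 1 - i) \<times> {1..p}. F u y w)"
  proof (rule sum.reindex_bij_witness[of _ "\<lambda>(u, w, y). u @ y # w" "\<lambda>xs. (take i xs, drop (Suc i) xs, xs ! i)"])
    fix xs assume xs: "xs \<in> L n"
    then have "i < length xs" using assms by (simp add: L_def)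
    then show "(case (take i xs, drop (Suc i) xs, xs ! i) of (u, w, y) \<Rightarrow> u @ y # w) = xs"
      by (simp add: id_take_nth_drop[symmetric])
    show "(take i xs, drop (Suc i) xs, xs ! i) \<in> L i \<times> L (n - 1 - i) \<times> {1..p}"
      using xs assms L_take[OF xs, of i] L_drop[OF xs, of "Suc i"] subsetD[OF _ nth_mem[of i xs], of "{1..p}"]
      by (simp add: L_def)
    show "(case (take i xs, drop (Suc i) xs, xs ! i) of (u, w, y) \<Rightarrow> F u y w) =
         F (take i xs) (xs ! i) (drop (Suc i) xs)" by simp
  next
    fix b assume b: "b \<in> L i \<times> L (n - 1 - i) \<times> {1..p}"
    obtain u w y where buwy: "b = (u, w, y)" by (cases b) auto
    then show "(case b of (u, w, y) \<Rightarrow> u @ y # w) \<in> L n"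
      using b assms by (auto simp: L_def)
    show "(take i (case b of (u, w, y) \<Rightarrow> u @ y # w), drop (Suc i) (case b of (u, w, y) \<Rightarrow> u @ y # w),
         (case b of (u, w, y) \<Rightarrow> u @ y # w) ! i) = b"
      using b by (auto simp: buwy L_def nth_append)
  qed
  also have "\<dots> = (\<Sum>u\<in>L i. \<Sum>w\<in>L (n - 1 - i). \<Sum>y\<in>{1..p}. F u y w)"
    by (simp add: sum.cartesian_product)
  finally show ?thesis .
qed

text \<open>In the double sum over the letter \<open>y\<close> and the completing letter
  \<open>x\<close>, exchanging the two reverses the sign. Geometrically, the two facets sharing a
  ridge induce opposite orientations on it.\<close>

lemma s_marginal:
  assumes "length u + length w = p - 2"
  shows "(\<Sum>y\<in>{1..p}. s (u @ y # w)) = 0"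
proof -
  have anti: "inv_sign (u @ y # w @ [x]) = - inv_sign (u @ x # w @ [y])" for x y
    using alternating_move[OF alternating_inv_sign, of u y w "[x]"]
      alternating_move[OF alternating_inv_sign, of u x w "[y]"]
      alternatingD[OF alternating_inv_sign, of "u @ w" y x "[]"] by simp
  let ?S = "\<Sum>y\<in>{1..p}. \<Sum>x\<in>{1..p}. inv_sign (u @ y # w @ [x])"
  have "?S = (\<Sum>y\<in>{1..p}. \<Sum>x\<in>{1..p}. - inv_sign (u @ x # w @ [y]))"
    by (intro sum.cong refl anti)
  also have "\<dots> = - ?S" by (subst sum.swap) (simp add: sum_negf)
  finally have "?S = 0" by simp
  moreover have "Suc (p - 2) = p - 1" using p_ge by simp
  then have "(\<Sum>y\<in>{1..p}. s (u @ y # w)) = ?S"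
    using assms by (simp add: s_def)
  ultimately show ?thesis by simp
qed

text \<open>The first entry is normalised to \<open>1\<close> because an invariant summand takes the same value on all \<open>p\<close>
  translates of a tuple.\<close>
definition pairing :: "(nat list \<Rightarrow> int) \<Rightarrow> int" where
  "pairing g = (\<Sum>xs\<in>{xs \<in> L (p - 1). hd xs = 1}. s xs * g xs)"

text \<open>Every word has exactly one translate with head 1, and the summand is constant on orbits.
  The full sum is useless modulo \<open>p\<close>, being a multiple of it; equality over the
  integers is what later allows the factor to be cancelled.\<close>

lemma pairing_invariant:
  assumes "invariant g"
  shows "(\<Sum>xs\<in>L (p - 1). s xs * g xs) = int p * pairing g"
proof -
  let ?h = "\<lambda>xs. s xs * g xs"
  let ?L1 = "{xs \<in> L (p - 1). hd xs = 1}"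
  have ne: "xs \<noteq> []" if "xs \<in> L (p - 1)" for xs using that p_ge by (auto simp: L_def)
  have "(\<Sum>xs\<in>L (p - 1). ?h xs) = (\<Sum>(i, xs)\<in>{..<p} \<times> ?L1. ?h xs)"
  proof (rule sum.reindex_bij_witness[of _ "\<lambda>(i, xs). map (T ^^ i) xs"
        "\<lambda>xs. (hd xs - 1, map (T ^^ (p - (hd xs - 1))) xs)"])
    fix xs assume xs: "xs \<in> L (p - 1)"
    then have sub: "set xs \<subseteq> {1..p}" by (simp add: L_def)
    have hd: "hd xs \<in> {1..p}" using hd_in_set[OF ne[OF xs]] sub by blast
    have "map (T ^^ (hd xs - 1)) (map (T ^^ (p - (hd xs - 1))) xs) = map (T ^^ (hd xs - 1 + (p - (hd xs - 1)))) xs"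
      by (simp add: funpow_add)
    also have "hd xs - 1 + (p - (hd xs - 1)) = p" using hd by auto
    finally show "(case (hd xs - 1, map (T ^^ (p - (hd xs - 1))) xs) of (i, xs) \<Rightarrow> map (T ^^ i) xs) = xs"
      using map_T_pow_p[OF sub] by simp
    have "hd (map (T ^^ (p - (hd xs - 1))) xs) = 1"
      using hd by (subst hd_map[OF ne[OF xs]], subst T_pow) auto
    then show "(hd xs - 1, map (T ^^ (p - (hd xs - 1))) xs) \<in> {..<p} \<times> ?L1"
      using hd L_map_pow[OF xs] by (auto simp del: map_map)
    show "(case (hd xs - 1, map (T ^^ (p - (hd xs - 1))) xs) of (i, xs) \<Rightarrow> ?h xs) = ?h xs"
      using invariant_pow[OF assms sub] invariant_pow[OF invariant_s sub] by simp
  next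
    fix b assume b: "b \<in> {..<p} \<times> ?L1"
    obtain i xs where bx: "b = (i, xs)" by (cases b)
    have i: "i < p" and xs: "xs \<in> L (p - 1)" "hd xs = 1" using b bx by auto
    then have sub: "set xs \<subseteq> {1..p}" by (simp add: L_def)
    show "(case b of (i, xs) \<Rightarrow> map (T ^^ i) xs) \<in> L (p - 1)" using xs L_map_pow bx by simp
    have hd: "hd (map (T ^^ i) xs) = Suc i"
      using xs i ne p_ge by (simp add: hd_map T_pow)
    have "map (T ^^ (p - i)) (map (T ^^ i) xs) = map (T ^^ (p - i + i)) xs"
      by (simp add: funpow_add)
    then have "map (T ^^ (p - i)) (map (T ^^ i) xs) = xs" using map_T_pow_p[OF sub] i by simp
    then show "(hd (case b of (i, xs) \<Rightarrow> map (T ^^ i) xs) - 1,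
          map (T ^^ (p - (hd (case b of (i, xs) \<Rightarrow> map (T ^^ i) xs) - 1))) (case b of (i, xs) \<Rightarrow> map (T ^^ i) xs)) = b"
      using hd bx by simp
  qed
  also have "\<dots> = int p * pairing g"
    by (simp add: pairing_def sum.cartesian_product[symmetric])
  finally show ?thesis .
qed

text \<open>A cochain on the chessboard complex sees the row of each vertex. Primitives obtained
  there are therefore functions of words of pairs, with the group acting on the letters
  only.\<close>

definition levelled_invariant :: "((nat \<times> nat) list \<Rightarrow> int) \<Rightarrow> bool" where
  "levelled_invariant b \<longleftrightarrow> (\<forall>w. snd ` set w \<subseteq> {1..p} \<longrightarrow> b (map (apsnd T) w) = b w)"

text \<open>The weight vanishes on words with a repeated letter, so agreement is demanded only on
  words that are simplices of the board.\<close>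

lemma pairing_cong:
  assumes "\<And>xs. xs \<in> L (p - 1) \<Longrightarrow> distinct xs \<Longrightarrow> [f xs = g xs] (mod m)"
  shows "[pairing f = pairing g] (mod m)"
  unfolding pairing_def
proof (rule cong_sum)
  fix xs assume xs: "xs \<in> {xs \<in> L (p - 1). hd xs = 1}"
  show "[s xs * f xs = s xs * g xs] (mod m)"
  proof (cases "distinct xs")
    case False
    then have "inv_sign (xs @ [x]) = 0" for x
      by (intro alternating_not_distinct[OF alternating_inv_sign]) auto
    then show ?thesis by (simp add: s_def)
  qed (use assms xs in \<open>auto intro: cong_scalar_left\<close>)
qed

lemma pairing_eqI: "(\<And>xs. xs \<in> L (p - 1) \<Longrightarrow> f xs = g xs) \<Longrightarrow> pairing f = pairing g"
  unfolding pairing_def by (rule sum.cong) auto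

text \<open>The face omitting position \<open>i\<close> depends on the remaining letters and on rows
  determined by position. Summing over the omitted letter therefore leaves a marginal of
  \<open>s\<close>, which is zero.\<close>

lemma pairing_levelled_coboundary:
  assumes b: "levelled_invariant b"
    and g: "\<And>xs. xs \<in> L (p - 1) \<Longrightarrow> distinct xs \<Longrightarrow> [g xs = lcob b (zip [1..<p] xs)] (mod int p)"
  shows "[pairing g = 0] (mod int p)"
proof -
  \<comment> \<open>The integer argument is carried out for \<open>h\<close>, which is invariant on
    all words; \<open>g\<close> is known only modulo \<open>p\<close> and only on distinct
    words.\<close>
  define h where "h xs = lcob b (zip [1..<p] xs)" for xs
  have inv: "invariant h"
    unfolding invariant_def
  proof (intro allI impI)
    fix xs :: "nat list" assume xs: "set xs \<subseteq> {1..p}"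
    have "zip [1..<p] (map T xs) = map (apsnd T) (zip [1..<p] xs)"
      by (simp add: zip_map2 apsnd_def map_prod_def id_def)
    then have "h (map T xs) = lcob (\<lambda>w. b (map (apsnd T) w)) (zip [1..<p] xs)"
      by (simp add: h_def lcob_map)
    also have "\<dots> = h xs"
      unfolding h_def
    proof (rule lcob_cong)
      fix u x w assume eq: "zip [1..<p] xs = u @ x # w"
      have "set (u @ w) \<subseteq> set (zip [1..<p] xs)" unfolding eq by auto
      then have "snd ` set (u @ w) \<subseteq> {1..p}" using xs by (auto dest!: set_zip_rightD)
      then show "b (map (apsnd T) (u @ w)) = b (u @ w)" using b unfolding levelled_invariant_def by blast
    qed
    finally show "h (map T xs) = h xs" .
  qed
  have "(\<Sum>xs\<in>L (p - 1). s xs * h xs) = 0"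
  proof -
    let ?lv = "[1..<p]"
    let ?B = "\<lambda>i u w. b (zip (take i ?lv) u @ zip (drop (Suc i) ?lv) w)"
    have "(\<Sum>xs\<in>L (p - 1). s xs * h xs)
        = (\<Sum>xs\<in>L (p - 1). \<Sum>i<p - 1. (- 1) ^ i * (s xs * ?B i (take i xs) (drop (Suc i) xs)))"
    proof (rule sum.cong[OF refl])
      fix xs assume "xs \<in> L (p - 1)"
      then have "length (zip ?lv xs) = p - 1" by (simp add: L_def)
      then show "s xs * h xs = (\<Sum>i<p - 1. (- 1) ^ i * (s xs * ?B i (take i xs) (drop (Suc i) xs)))"
        unfolding h_def lcob_eq_sum sum_distrib_left by (intro sum.cong) (auto simp: take_zip drop_zip)
    qed
    also have "\<dots> = (\<Sum>i<p - 1. \<Sum>xs\<in>L (p - 1). (- 1) ^ i * (s xs * ?B i (take i xs) (drop (Suc i) xs)))"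
      by (rule sum.swap)
    also have "\<dots> = 0"
    proof (rule sum.neutral, rule ballI)
      fix i assume i: "i \<in> {..<p - 1}"
      have "(\<Sum>xs\<in>L (p - 1). (- 1) ^ i * (s xs * ?B i (take i xs) (drop (Suc i) xs)))
          = (\<Sum>xs\<in>L (p - 1). (- 1) ^ i * (s (take i xs @ (xs ! i) # drop (Suc i) xs) * ?B i (take i xs) (drop (Suc i) xs)))"
      proof (rule sum.cong[OF refl])
        fix xs assume "xs \<in> L (p - 1)"
        then have "take i xs @ (xs ! i) # drop (Suc i) xs = xs"
          using i by (intro id_take_nth_drop[symmetric]) (auto simp: L_def)
        then show "(- 1) ^ i * (s xs * ?B i (take i xs) (drop (Suc i) xs))
          = (- 1) ^ i * (s (take i xs @ (xs ! i) # drop (Suc i) xs) * ?B i (take i xs) (drop (Suc i) xs))"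
          by (simp only:)
      qed
      also have "\<dots> = (\<Sum>u\<in>L i. \<Sum>w\<in>L (p - 1 - 1 - i). \<Sum>y\<in>{1..p}. (- 1) ^ i * (s (u @ y # w) * ?B i u w))"
        using i by (intro sum_L_split[where F = "\<lambda>u y w. (- 1) ^ i * (s (u @ y # w) * ?B i u w)"]) simp
      also have "\<dots> = (\<Sum>u\<in>L i. \<Sum>w\<in>L (p - 1 - 1 - i). (- 1) ^ i * ((\<Sum>y\<in>{1..p}. s (u @ y # w)) * ?B i u w))"
        by (simp add: sum_distrib_left sum_distrib_right)
      also have "\<dots> = 0"
      proof (intro sum.neutral ballI)
        fix u w assume "u \<in> L i" "w \<in> L (p - 1 - 1 - i)"
        then have "(\<Sum>y\<in>{1..p}. s (u @ y # w)) = 0" using i by (intro s_marginal) (auto simp: L_def)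
        then show "(- 1) ^ i * ((\<Sum>y\<in>{1..p}. s (u @ y # w)) * ?B i u w) = 0" by simp
      qed
      finally show "(\<Sum>xs\<in>L (p - 1). (- 1) ^ i * (s xs * ?B i (take i xs) (drop (Suc i) xs))) = 0" .
    qed
    finally show ?thesis .
  qed
  then have "pairing h = 0" using pairing_invariant[OF inv] p_ge by simp
  moreover have "[pairing g = pairing h] (mod int p)"
  proof (rule pairing_cong)
    fix xs assume "xs \<in> L (p - 1)" "distinct xs"
    then show "[g xs = h xs] (mod int p)" unfolding h_def by (rule g)
  qed
  ultimately show ?thesis by simp
qed

text \<open>An invariant primitive on letters becomes a levelled one by forgetting the rows, so the
  pairing depends only on the cohomology class.\<close>

lemma pairing_cob:
  assumes "cob (p - 2) f"
  shows "[pairing f = 0] (mod int p)"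
proof -
  obtain a where a: "invariant a" "\<forall>xs \<in> L (p - 2 + 1). [f xs = lcob a xs] (mod int p)"
    using assms p_ge unfolding cob_def by auto
  show ?thesis
  proof (rule pairing_levelled_coboundary)
    show "levelled_invariant (\<lambda>w. a (map snd w))"
      unfolding levelled_invariant_def
    proof (intro allI impI)
      fix w :: "(nat \<times> nat) list" assume "snd ` set w \<subseteq> {1..p}"
      then have "a (map T (map snd w)) = a (map snd w)" by (intro invariantD[OF a(1)]) simp
      then show "a (map snd (map (apsnd T) w)) = a (map snd w)" by (simp add: o_def)
    qed
    fix xs assume xs: "xs \<in> L (p - 1)"
    then have "map snd (zip [1..<p] xs) = xs" by (simp add: L_def)
    then show "[f xs = lcob (\<lambda>w. a (map snd w)) (zip [1..<p] xs)] (mod int p)"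
      using a(2) xs p_ge by (simp add: lcob_map Suc_diff_Suc numeral_2_eq_2)
  qed
qed

text \<open>The square of \<open>s\<close> is the indicator of distinct words. There are
  \<open>p!\<close> of them, and passing to orbit representatives divides the count by
  \<open>p\<close>.\<close>

lemma pairing_s: "pairing s = fact (p - 1)"
proof -
  have "s xs * s xs = of_bool (distinct xs)" if xs: "xs \<in> L (p - 1)" for xs
  proof (cases "distinct xs")
    case False
    then have "inv_sign (xs @ [x]) = 0" for x
      by (intro alternating_not_distinct[OF alternating_inv_sign]) auto
    then show ?thesis using False by (simp add: s_def)
  next
    case True
    have sub: "set xs \<subseteq> {1..p}" and len: "length xs = p - 1" using xs by (auto simp: L_def)
    have "card ({1..p} - set xs) = 1"
      using True sub len p_ge by (simp add: card_Diff_subset distinct_card)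
    then obtain m where "{1..p} - set xs = {m}" by (meson card_1_singletonE)
    then have m: "m \<in> {1..p}" "m \<notin> set xs" and in_xs: "\<And>x. x \<in> {1..p} \<Longrightarrow> x \<noteq> m \<Longrightarrow> x \<in> set xs"
      by blast+
    have "s xs = (\<Sum>x\<in>{1..p}. inv_sign (xs @ [x]))" using len by (simp add: s_def)
    also have "\<dots> = (\<Sum>x\<in>{m}. inv_sign (xs @ [x]))"
    proof (rule sum.mono_neutral_right)
      show "\<forall>x\<in>{1..p} - {m}. inv_sign (xs @ [x]) = 0"
      proof
        fix x assume "x \<in> {1..p} - {m}"
        then have "\<not> distinct (xs @ [x])" using in_xs[of x] by simp
        then show "inv_sign (xs @ [x]) = 0" by (rule alternating_not_distinct[OF alternating_inv_sign])
      qed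
    qed (use m(1) in simp_all)
    finally have "s xs = inv_sign (xs @ [m])" by simp
    moreover have "distinct (xs @ [m])" using True m by auto
    ultimately show ?thesis using inv_sign_square True by simp
  qed
  then have "(\<Sum>xs\<in>L (p - 1). s xs * s xs) = (\<Sum>xs\<in>L (p - 1). of_bool (distinct xs))"
    by (intro sum.cong) auto
  also have "\<dots> = int (card {xs. length xs = p - 1 \<and> distinct xs \<and> set xs \<subseteq> {1..p}})"
  proof -
    have "L (p - 1) \<inter> {xs. distinct xs} = {xs. length xs = p - 1 \<and> distinct xs \<and> set xs \<subseteq> {1..p}}"
      by (auto simp: L_def)
    then show ?thesis using finite_L[of "p - 1"] by (simp add: of_bool_def sum.If_cases del: One_nat_def)
  qed
  also have "card {xs. length xs = p - 1 \<and> distinct xs \<and> set xs \<subseteq> {1..p}} = \<Prod>{2..p}"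
  proof -
    have "card {1..p} - (p - 1) + 1 = 2" using p_ge by simp
    then show ?thesis using card_lists_distinct_length_eq[of "{1..p}" "p - 1"]
      by (simp add: numeral_2_eq_2)
  qed
  also have "\<Prod>{2..p} = fact p"
    using p_ge prod.atLeast_Suc_atMost[of 1 p "\<lambda>x. x"] by (simp add: fact_prod numeral_2_eq_2)
  also have "int (fact p) = int p * fact (p - 1)" using p_ge by (simp add: fact_reduce)
  finally have "int p * pairing s = int p * fact (p - 1)"
    unfolding pairing_invariant[OF invariant_s] .
  moreover have "int p \<noteq> 0" using p_ge by simp
  ultimately show ?thesis by (simp only: mult_cancel_left simp_thms)
qed

lemma pairing_s_nonzero: "\<not> [pairing s = 0] (mod int p)"
proof -
  have "\<not> p \<le> p - 1" using p_ge by simp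
  then have "\<not> int p dvd int (fact (p - 1))"
    unfolding int_dvd_int_iff prime_dvd_fact_iff[OF prime_p] .
  then show ?thesis by (simp only: pairing_s cong_0_iff of_nat_fact not_False_eq_True)
qed

lemma pairing_diff_cmul: "pairing (\<lambda>xs. f xs - c * g xs) = pairing f - c * pairing g"
proof -
  have "pairing (\<lambda>xs. f xs - c * g xs) = (\<Sum>xs\<in>{xs \<in> L (p - 1). hd xs = 1}. s xs * f xs - c * (s xs * g xs))"
    unfolding pairing_def by (rule sum.cong[OF refl]) (simp only: right_diff_distrib mult.left_commute)
  then show ?thesis by (simp only: pairing_def sum_subtractf sum_distrib_left)
qed

text \<open>The number of factors \<open>tri\<close> that, together with \<open>edge\<close>, reach
  the top degree \<open>p - 2\<close>.\<close>

definition M :: nat where "M = (p - 3) div 2"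

lemma M_eq: "2 * M + 1 = p - 2"
proof -
  have "even (p - 3)" using odd_p p_ge by simp
  then have "2 * ((p - 3) div 2) = p - 3" by simp
  then show ?thesis using p_ge by (simp only: M_def)
qed

lemma pairing_odd_class: "\<not> [pairing (odd_class M) = 0] (mod int p)"
proof
  assume 0: "[pairing (odd_class M) = 0] (mod int p)"
  obtain c where "cob (2 * M + 1) (\<lambda>xs. s xs - c * odd_class M xs)"
    using odd_normal_form[of s M] invariant_s cocyc_s unfolding M_eq by blast
  then have "[pairing s - c * pairing (odd_class M) = 0] (mod int p)"
    unfolding M_eq using pairing_cob pairing_diff_cmul by metis
  moreover have "[c * pairing (odd_class M) = c * 0] (mod int p)" by (rule cong_scalar_left[OF 0])
  ultimately have "[(pairing s - c * pairing (odd_class M)) + c * pairing (odd_class M) = 0 + c * 0] (mod int p)"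
    by (rule cong_add)
  then have "[pairing s = 0] (mod int p)" by simp
  then show False using pairing_s_nonzero by blast
qed

lemma levelled_zip_take:
  "k < p \<Longrightarrow> take k (zip [1..<p] xs) = zip [1..<Suc k] (take k xs)"
  by (simp add: take_zip)

text \<open>Multiplying the primitive \<open>b\<close> by the invariant cocycle, which ignores rows,
  gives a levelled primitive of the product. The factor \<open>f\<close> meets only the first
  \<open>2 * m + 2\<close> rows, and a subword of a distinct word is distinct, so the hypothesis on
  \<open>f\<close> applies.\<close>

lemma pairing_cup_levelled:
  assumes b: "levelled_invariant b" and mr: "m + r = M"
    and f: "\<And>xs. xs \<in> L (2 * m + 2) \<Longrightarrow> distinct xs \<Longrightarrow> [f xs = lcob b (zip [1..<2 * m + 3] xs)] (mod int p)"
  shows "[pairing (cup (2 * m + 1) f (tri_power r)) = 0] (mod int p)"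
proof -
  have p: "p - 1 = 2 * m + 2 * r + 2" using M_eq mr p_ge by linarith
  define g where "g w = tri_power r (map snd w)" for w :: "(nat \<times> nat) list"
  show ?thesis
  proof (rule pairing_levelled_coboundary)
    show "levelled_invariant (cup (2 * m) b g)"
      unfolding levelled_invariant_def
    proof (intro allI impI)
      fix w :: "(nat \<times> nat) list" assume w: "snd ` set w \<subseteq> {1..p}"
      have "snd ` set (take (Suc (2 * m)) w) \<subseteq> {1..p}" using w by (auto dest: in_set_takeD)
      then have "b (map (apsnd T) (take (Suc (2 * m)) w)) = b (take (Suc (2 * m)) w)"
        using b by (simp add: levelled_invariant_def)
      moreover have "set (map snd (drop (2 * m) w)) \<subseteq> {1..p}" using w by (auto dest: in_set_dropD)
      then have "tri_power r (map T (map snd (drop (2 * m) w))) = tri_power r (map snd (drop (2 * m) w))"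
        by (rule invariantD[OF invariant_tri_power])
      ultimately show "cup (2 * m) b g (map (apsnd T) w) = cup (2 * m) b g w"
        by (simp add: cup_def g_def take_map drop_map o_def)
    qed
    fix xs assume xs: "xs \<in> L (p - 1)" and d: "distinct xs"
    let ?z = "zip [1..<p] xs"
    have len: "length ?z = p - 1" using xs by (simp add: L_def)
    have snd_z: "map snd ?z = xs" using xs by (simp add: L_def)
    have "[cup (2 * m + 1) f (tri_power r) xs = lcob b (zip [1..<2 * m + 3] (take (2 * m + 2) xs)) * tri_power r (drop (2 * m + 1) xs)] (mod int p)"
      unfolding cup_def using L_take[OF xs, of "2 * m + 2"] d p
      by (intro cong_scalar_right) (use f[of "take (2 * m + 2) xs"] in auto)
    also have "lcob b (zip [1..<2 * m + 3] (take (2 * m + 2) xs)) * tri_power r (drop (2 * m + 1) xs)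
       = cup (Suc (2 * m)) (lcob b) g ?z"
      using levelled_zip_take[of "2 * m + 2" xs] p p_ge snd_z
      by (simp add: cup_def g_def drop_map[symmetric] numeral_3_eq_3)
    also have "\<dots> = lcob (cup (2 * m) b g) ?z - cup (2 * m) b (lcob g) ?z"
      using len p by (subst lcob_cup) auto
    also have "[lcob (cup (2 * m) b g) ?z - cup (2 * m) b (lcob g) ?z = lcob (cup (2 * m) b g) ?z - b (take (Suc (2 * m)) ?z) * 0] (mod int p)"
      unfolding cup_def[of _ _ "lcob g"]
    proof (intro cong_diff cong_scalar_left cong_refl)
      have "lcob g (drop (2 * m) ?z) = lcob (tri_power r) (map snd (drop (2 * m) ?z))"
        unfolding g_def by (rule lcob_map)
      also have "map snd (drop (2 * m) ?z) = drop (2 * m) xs" by (simp only: drop_map[symmetric] snd_z)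
      finally have *: "lcob g (drop (2 * m) ?z) = lcob (tri_power r) (drop (2 * m) xs)" .
      have "p - 1 - 2 * m = 2 * r + 2" using p by simp
      then have "drop (2 * m) xs \<in> L (2 * r + 2)" using L_drop[OF xs, of "2 * m"] p by (simp only:)
      then show "[lcob g (drop (2 * m) ?z) = 0] (mod int p)"
        unfolding * using cocyc_tri_power[of r] by (simp only: cocyc_def)
    qed
    finally show "[cup (2 * m + 1) f (tri_power r) xs = lcob (cup (2 * m) b g) ?z] (mod int p)"
      by simp
  qed
qed

text \<open>After multiplication by \<open>tri_power r\<close> the class is \<open>c\<close> times
  the top odd class. Its pairing is nonzero modulo the prime \<open>p\<close> and can be
  cancelled.\<close>

lemma odd_coefficient:
  assumes mr: "m + r = M" and c: "cob (2 * m + 1) (\<lambda>xs. f xs - c * odd_class m xs)"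
    and 0: "[pairing (cup (2 * m + 1) f (tri_power r)) = 0] (mod int p)"
  shows "int p dvd c"
proof -
  have p: "p - 1 = 2 * m + 2 * r + 2" using M_eq mr p_ge by linarith
  have deg: "2 * m + 1 + 2 * r = p - 2" using M_eq mr by simp
  have "cob (p - 2) (cup (2 * m + 1) (\<lambda>xs. f xs - c * odd_class m xs) (tri_power r))"
    using cob_cup_right[OF c invariant_tri_power cocyc_tri_power, of r] unfolding deg .
  then have "[pairing (cup (2 * m + 1) (\<lambda>xs. f xs - c * odd_class m xs) (tri_power r)) = 0] (mod int p)"
    by (rule pairing_cob)
  moreover have "pairing (cup (2 * m + 1) (\<lambda>xs. f xs - c * odd_class m xs) (tri_power r))
      = pairing (cup (2 * m + 1) f (tri_power r)) - c * pairing (odd_class M)"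
    unfolding pairing_diff_cmul[symmetric]
  proof (rule pairing_eqI)
    fix xs assume xs: "xs \<in> L (p - 1)"
    have "cup (1 + 2 * m) (odd_class m) (tri_power r) xs = cup 1 edge (cup (2 * m) (tri_power m) (tri_power r)) xs"
      using xs p by (intro cup_assoc) (simp add: L_def)
    also have "\<dots> = odd_class M xs"
      unfolding cup_def[of 1] using tri_power_add[of "drop 1 xs" m r] xs p mr by (simp add: L_def)
    finally have "cup (2 * m + 1) (odd_class m) (tri_power r) xs = odd_class M xs" by simp
    then show "cup (2 * m + 1) (\<lambda>xs. f xs - c * odd_class m xs) (tri_power r) xs =
      cup (2 * m + 1) f (tri_power r) xs - c * odd_class M xs"
      by (simp only: cup_diff_left cup_cmul_left)
  qed
  ultimately have "[pairing (cup (2 * m + 1) f (tri_power r)) - c * pairing (odd_class M) = 0] (mod int p)"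
    by (simp only:)
  from cong_diff[OF 0 this] have "[c * pairing (odd_class M) = 0] (mod int p)"
    by (simp only: diff_diff_eq2 add_diff_cancel_left' diff_zero)
  then have "int p dvd c * pairing (odd_class M)" by (simp add: cong_0_iff)
  then show ?thesis
    using pairing_odd_class prime_p prime_dvd_mult_iff[of "int p" c] by (simp add: cong_0_iff)
qed

lemma cob_drop_multiple:
  assumes "cob n (\<lambda>xs. f xs - c * g xs)" "int p dvd c"
  shows "cob n f"
proof (rule cob_cong[OF assms(1)])
  fix xs show "[f xs = f xs - c * g xs] (mod int p)"
    using assms(2) by (simp add: cong_iff_dvd_diff)
qed

lemma cob_if_levelled_coboundary_odd:
  assumes "invariant f" "cocyc (2 * m + 1) f" "m \<le> M" "levelled_invariant b"
    and "\<And>xs. xs \<in> L (2 * m + 2) \<Longrightarrow> distinct xs \<Longrightarrow> [f xs = lcob b (zip [1..<2 * m + 3] xs)] (mod int p)"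
  shows "cob (2 * m + 1) f"
proof -
  obtain c where c: "cob (2 * m + 1) (\<lambda>xs. f xs - c * odd_class m xs)"
    using odd_normal_form assms(1,2) by blast
  have "m + (M - m) = M" using assms(3) by simp
  from odd_coefficient[OF this c pairing_cup_levelled[OF assms(4) this assms(5)]]
  show ?thesis using cob_drop_multiple[OF c] by blast
qed

lemma cup_one_lcob:
  "3 \<le> length z \<Longrightarrow> e (take 2 z) * lcob b (drop 1 z) = lcob e (take 3 z) * b (drop 2 z) - lcob (cup 1 e b) z"
  using lcob_cup[of 1 z e b] by (simp add: cup_def numeral_2_eq_2 numeral_3_eq_3)

text \<open>Multiplication by \<open>edge\<close> carries \<open>t^m\<close> to \<open>e t^m\<close>
  with the same coefficient, so the even case reduces to the odd one. The primitive of the product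
  acquires a Leibniz sign.\<close>

lemma cob_if_levelled_coboundary_even:
  assumes f: "invariant f" "cocyc (2 * m) f" and m: "1 \<le> m" "m \<le> M" and b: "levelled_invariant b"
    and eq: "\<And>xs. xs \<in> L (2 * m + 1) \<Longrightarrow> distinct xs \<Longrightarrow> [f xs = lcob b (zip [1..<2 * m + 2] xs)] (mod int p)"
  shows "cob (2 * m) f"
proof -
  obtain c where c: "cob (2 * m) (\<lambda>xs. f xs - c * tri_power m xs)"
    using even_normal_form f by blast
  have "cob (2 * m + 1) (cup 1 edge (\<lambda>xs. f xs - c * tri_power m xs))"
    using cob_cup_edge[of "2 * m - 1"] c m(1) by simp
  moreover have "cup 1 edge (\<lambda>xs. f xs - c * tri_power m xs) = (\<lambda>xs. cup 1 edge f xs - c * odd_class m xs)"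
    by (rule ext) (simp add: cup_def right_diff_distrib)
  ultimately have c': "cob (2 * m + 1) (\<lambda>xs. cup 1 edge f xs - c * odd_class m xs)"
    by (simp only:)
  have mr: "m + (M - m) = M" using m by simp
  \<comment> \<open>In the product with \<open>edge\<close>, the factor \<open>f\<close> reads the
    word from row 2 on. Lowering the rows by one returns to the rows in which \<open>b\<close> is a
    primitive.\<close>
  define sh :: "nat \<times> nat \<Rightarrow> nat \<times> nat" where "sh = apfst (\<lambda>i. i - 1)"
  define e where "e w = edge (map snd w)" for w :: "(nat \<times> nat) list"
  define b' where "b' w = b (map sh w)" for w
  define b'' where "b'' w = - 1 * cup 1 e b' w" for w
  have "[pairing (cup (2 * m + 1) (cup 1 edge f) (tri_power (M - m))) = 0] (mod int p)"
  proof (rule pairing_cup_levelled[OF _ mr])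
    show "levelled_invariant b''"
      unfolding levelled_invariant_def
    proof (intro allI impI)
      fix w :: "(nat \<times> nat) list" assume w: "snd ` set w \<subseteq> {1..p}"
      have "snd ` set (map sh (drop 1 w)) \<subseteq> {1..p}"
        using w by (auto simp: sh_def dest!: in_set_dropD)
      then have "b (map (apsnd T) (map sh (drop 1 w))) = b (map sh (drop 1 w))"
        using b unfolding levelled_invariant_def by blast
      moreover have "apsnd T \<circ> sh = sh \<circ> apsnd T" by (auto simp: sh_def)
      moreover have "set (map snd (take 2 w)) \<subseteq> {1..p}" using w by (auto dest: in_set_takeD)
      then have "edge (map T (map snd (take 2 w))) = edge (map snd (take 2 w))"
        by (rule invariantD[OF invariant_edge])
      ultimately show "b'' (map (apsnd T) w) = b'' w"
        by (simp add: b''_def b'_def e_def cup_def take_map drop_map o_def numeral_2_eq_2)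
    qed
    fix xs assume xs: "xs \<in> L (2 * m + 2)" and d: "distinct xs"
    let ?z = "zip [1..<2 * m + 3] xs"
    have len: "length xs = 2 * m + 2" using xs by (simp add: L_def)
    have snd_z: "map snd ?z = xs" using len by (intro map_snd_zip) simp
    have "drop 1 ?z = zip [2..<2 * m + 3] (drop 1 xs)" by (simp only: drop_zip drop_upt one_add_one)
    then have "map sh (drop 1 ?z) = zip (map (\<lambda>i. i - 1) [2..<2 * m + 3]) (drop 1 xs)"
      by (simp add: sh_def zip_map1 apfst_def map_prod_def id_def)
    also have "map (\<lambda>i. i - 1) [2..<2 * m + 3] = [1..<2 * m + 2]"
    proof (rule nth_equalityI)
      fix i assume "i < length (map (\<lambda>i. i - 1) [2..<2 * m + 3])"
      then have "i < 2 * m + 1" by simp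
      then show "map (\<lambda>i. i - 1) [2..<2 * m + 3] ! i = [1..<2 * m + 2] ! i"
        by (simp del: upt_Suc)
    qed simp
    finally have sh_z: "map sh (drop 1 ?z) = zip [1..<2 * m + 2] (drop 1 xs)" .
    have "[f (drop 1 xs) = lcob b (map sh (drop 1 ?z))] (mod int p)"
      unfolding sh_z
    proof (rule eq)
      show "drop 1 xs \<in> L (2 * m + 1)" using L_drop[OF xs, of 1] by simp
      show "distinct (drop 1 xs)" using d by (rule distinct_drop)
    qed
    then have "[cup 1 edge f xs = edge (take 2 xs) * lcob b' (drop 1 ?z)] (mod int p)"
      unfolding cup_def b'_def lcob_map numeral_2_eq_2 One_nat_def by (rule cong_scalar_left)
    also have "edge (take 2 xs) = e (take 2 ?z)" by (simp only: e_def take_map[symmetric] snd_z)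
    also have "e (take 2 ?z) * lcob b' (drop 1 ?z) = lcob e (take 3 ?z) * b' (drop 2 ?z) - lcob (cup 1 e b') ?z"
    proof (rule cup_one_lcob)
      have "length ?z = 2 * m + 2" by (simp only: length_zip length_upt len)
      then show "3 \<le> length ?z" using m(1) by linarith
    qed
    also have "lcob e (take 3 ?z) = lcob edge (take 3 xs)"
    proof -
      have "lcob (\<lambda>w. edge (map snd w)) (take 3 ?z) = lcob edge (map snd (take 3 ?z))"
        by (rule lcob_map)
      moreover have "e = (\<lambda>w. edge (map snd w))" by (rule ext) (rule e_def)
      moreover have "map snd (take 3 ?z) = take 3 xs" by (simp only: take_map[symmetric] snd_z)
      ultimately show ?thesis by (simp only:)
    qed
    also have "[lcob edge (take 3 xs) * b' (drop 2 ?z) - lcob (cup 1 e b') ?z = 0 * b' (drop 2 ?z) - lcob (cup 1 e b') ?z] (mod int p)"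
    proof (intro cong_diff cong_scalar_right cong_refl)
      have "take 3 xs \<in> L (1 + 2)" using L_take[OF xs, of 3] m by (simp add: numeral_3_eq_3)
      then show "[lcob edge (take 3 xs) = 0] (mod int p)" using cocyc_edge unfolding cocyc_def by blast
    qed
    also have "0 * b' (drop 2 ?z) - lcob (cup 1 e b') ?z = lcob b'' ?z"
      unfolding b''_def lcob_cmul by (simp only: mult_minus1 mult_zero_left diff_0)
    finally show "[cup 1 edge f xs = lcob b'' ?z] (mod int p)" .
  qed
  from odd_coefficient[OF mr c' this] show ?thesis using cob_drop_multiple[OF c] by blast
qed

text \<open>The combinatorial core of the low-degree half: in these degrees, classes on all words
  are detected by distinct letters in successive rows, even when the primitive may depend on the
  rows.\<close>

theorem cob_if_levelled_coboundary:
  assumes "invariant f" "cocyc n f" "1 \<le> n" "n \<le> p - 2" "levelled_invariant b"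
    and "\<And>xs. xs \<in> L (n + 1) \<Longrightarrow> distinct xs \<Longrightarrow> [f xs = lcob b (zip [1..<n + 2] xs)] (mod int p)"
  shows "cob n f"
proof (cases "odd n")
  case True
  then obtain m where n: "n = 2 * m + 1" by (auto elim: oddE)
  with assms(4) M_eq have "m \<le> M" by linarith
  with assms n show ?thesis by (intro cob_if_levelled_coboundary_odd[of f m b, folded n]) (auto simp: n numeral_3_eq_3)
next
  case False
  then obtain m where n: "n = 2 * m" by (auto elim: evenE)
  with assms(3,4) M_eq have "m \<le> M" "1 \<le> m" by linarith+
  with assms n show ?thesis by (intro cob_if_levelled_coboundary_even[of f m b, folded n]) (auto simp: n)
qed

end

section \<open>Cochains as integer-valued functions on basis elements\<close>

text \<open>The evaluation of a cochain on a chain. Integer values match the integral chains of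
  singular homology; reduction modulo \<open>p\<close> enters through congruences.\<close>

definition ev :: "('b \<Rightarrow> int) \<Rightarrow> ('b \<Rightarrow>\<^sub>0 int) \<Rightarrow> int" where
  "ev f c = (\<Sum>b\<in>Poly_Mapping.keys c. Poly_Mapping.lookup c b * f b)"

lemma ev_superset:
  assumes "finite S" "Poly_Mapping.keys c \<subseteq> S"
  shows "ev f c = (\<Sum>b\<in>S. Poly_Mapping.lookup c b * f b)"
  unfolding ev_def using assms by (intro sum.mono_neutral_left) (auto simp: in_keys_iff)

lemma ev_0 [simp]: "ev f 0 = 0" by (simp add: ev_def)

lemma ev_zero_left [simp]: "ev (\<lambda>_. 0) c = 0" by (simp add: ev_def)

lemma ev_of [simp]: "ev f (frag_of b) = f b" by (simp add: ev_def)

lemma ev_add: "ev f (c + d) = ev f c + ev f d"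
proof -
  let ?S = "Poly_Mapping.keys c \<union> Poly_Mapping.keys d"
  have "ev f (c + d) = (\<Sum>b\<in>?S. Poly_Mapping.lookup (c + d) b * f b)"
    by (rule ev_superset) (auto simp: keys_add)
  also have "\<dots> = (\<Sum>b\<in>?S. Poly_Mapping.lookup c b * f b) + (\<Sum>b\<in>?S. Poly_Mapping.lookup d b * f b)"
    by (simp add: lookup_add ring_distribs sum.distrib)
  also have "\<dots> = ev f c + ev f d"
    by (intro arg_cong2[where f = "(+)"] ev_superset[symmetric]) auto
  finally show ?thesis .
qed

lemma ev_cmul: "ev f (frag_cmul k c) = k * ev f c"
proof -
  have "ev f (frag_cmul k c) = (\<Sum>b\<in>Poly_Mapping.keys c. Poly_Mapping.lookup (frag_cmul k c) b * f b)"
    by (rule ev_superset) (auto simp: keys_cmul)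
  then show ?thesis by (simp add: ev_def sum_distrib_left mult.assoc)
qed

lemma ev_minus: "ev f (- c) = - ev f c"
  using ev_cmul[of f "- 1" c] by simp

lemma ev_diff: "ev f (c - d) = ev f c - ev f d"
  using ev_add[of f c "- d"] by (simp add: ev_minus)

lemma ev_sum: "ev f (sum g I) = (\<Sum>i\<in>I. ev f (g i))"
  by (induction I rule: infinite_finite_induct) (auto simp: ev_add)

lemma ev_frag_extend: "ev f (frag_extend h c) = ev (\<lambda>b. ev f (h b)) c"
  unfolding frag_extend_def ev_sum ev_cmul by (simp add: ev_def)

lemma ev_cong: "(\<And>b. b \<in> Poly_Mapping.keys c \<Longrightarrow> f b = g b) \<Longrightarrow> ev f c = ev g c"
  unfolding ev_def by (rule sum.cong) auto

lemma ev_mod_cong: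
  "(\<And>b. b \<in> Poly_Mapping.keys c \<Longrightarrow> [f b = g b] (mod m)) \<Longrightarrow> [ev f c = ev g c] (mod m)"
  unfolding ev_def by (intro cong_sum cong_scalar_left)

lemma ev_diff_left: "ev (\<lambda>b. f b - g b) c = ev f c - ev g c"
  by (simp add: ev_def sum_subtractf right_diff_distrib)

lemma ev_add_left: "ev (\<lambda>b. f b + g b) c = ev f c + ev g c"
  by (simp add: ev_def sum.distrib ring_distribs)

abbreviation aug :: "('b \<Rightarrow>\<^sub>0 int) \<Rightarrow> int" where "aug \<equiv> ev (\<lambda>_. 1)"

lemma frag_extend_frag_extend:
  "frag_extend f (frag_extend h c) = frag_extend (\<lambda>b. frag_extend f (h b)) c"
proof -
  have "Poly_Mapping.keys c \<subseteq> UNIV" by simp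
  then show ?thesis
    by (induction c rule: frag_induction) (auto simp: frag_extend_diff)
qed

lemma frag_extend_zero: "frag_extend (\<lambda>_. 0) c = 0"
  by (rule frag_extend_eq_0) simp

lemma frag_extend_diff_left: "frag_extend (\<lambda>b. f b - g b) c = frag_extend f c - frag_extend g c"
proof -
  have "Poly_Mapping.keys c \<subseteq> UNIV" by simp
  then show ?thesis
    by (induction c rule: frag_induction) (auto simp: frag_extend_diff)
qed

lemma keys_frag_extend_subset:
  assumes "\<And>b. b \<in> Poly_Mapping.keys c \<Longrightarrow> Poly_Mapping.keys (f b) \<subseteq> S"
  shows "Poly_Mapping.keys (frag_extend f c) \<subseteq> S"
  using keys_frag_extend[of f c] assms by blast

lemma keys_frag_extend_on:
  "Poly_Mapping.keys c \<subseteq> S \<Longrightarrow> (\<And>b. b \<in> S \<Longrightarrow> Poly_Mapping.keys (f b) \<subseteq> T) \<Longrightarrow>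
    Poly_Mapping.keys (frag_extend f c) \<subseteq> T"
  by (rule keys_frag_extend_subset) blast

lemma frag_extend_cong_on:
  "Poly_Mapping.keys c \<subseteq> S \<Longrightarrow> (\<And>b. b \<in> S \<Longrightarrow> f b = g b) \<Longrightarrow> frag_extend f c = frag_extend g c"
  by (rule frag_extend_eq) blast

lemma frag_extend_zero_on:
  "Poly_Mapping.keys c \<subseteq> S \<Longrightarrow> (\<And>b. b \<in> S \<Longrightarrow> f b = 0) \<Longrightarrow> frag_extend f c = 0"
  by (rule frag_extend_eq_0) blast

lemma ev_cong_on:
  "Poly_Mapping.keys c \<subseteq> S \<Longrightarrow> (\<And>b. b \<in> S \<Longrightarrow> f b = g b) \<Longrightarrow> ev f c = ev g c"
  by (rule ev_cong) blast

lemma ev_mod_cong_on: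
  "Poly_Mapping.keys c \<subseteq> S \<Longrightarrow> (\<And>b. b \<in> S \<Longrightarrow> [f b = g b] (mod m)) \<Longrightarrow> [ev f c = ev g c] (mod m)"
  by (rule ev_mod_cong) blast

section \<open>Complexes with a free group action on a basis\<close>

text \<open>A common format for singular complexes and complexes of words. Every field carries the
  degree because one type of basis elements serves all degrees.\<close>

record ('b, 'g) gcx =
  Bas :: "nat \<Rightarrow> 'b set"
  Bd :: "nat \<Rightarrow> 'b \<Rightarrow> ('b \<Rightarrow>\<^sub>0 int)"
  Act :: "nat \<Rightarrow> 'g \<Rightarrow> 'b \<Rightarrow> 'b"

definition bdry :: "('b, 'g) gcx \<Rightarrow> nat \<Rightarrow> ('b \<Rightarrow>\<^sub>0 int) \<Rightarrow> ('b \<Rightarrow>\<^sub>0 int)" where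
  "bdry C n = frag_extend (Bd C n)"

definition act :: "('b, 'g) gcx \<Rightarrow> nat \<Rightarrow> 'g \<Rightarrow> ('b \<Rightarrow>\<^sub>0 int) \<Rightarrow> ('b \<Rightarrow>\<^sub>0 int)" where
  "act C n g = frag_extend (\<lambda>b. frag_of (Act C n g b))"

abbreviation chn :: "('b, 'g) gcx \<Rightarrow> nat \<Rightarrow> ('b \<Rightarrow>\<^sub>0 int) \<Rightarrow> bool" where
  "chn C n c \<equiv> Poly_Mapping.keys c \<subseteq> Bas C n"

text \<open>Freeness on basis elements makes every chain group a free module over the integral group
  ring, so equivariant maps can be prescribed on orbit representatives.\<close>

locale gcomplex = group G for G :: "('g, 'm) monoid_scheme" (structure) +
  fixes C :: "('b, 'g) gcx"
  assumes Act_closed: "\<And>n g b. g \<in> carrier G \<Longrightarrow> b \<in> Bas C n \<Longrightarrow> Act C n g b \<in> Bas C n"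
    and Act_one: "\<And>n b. b \<in> Bas C n \<Longrightarrow> Act C n \<one> b = b"
    and Act_mult: "\<And>n g h b. g \<in> carrier G \<Longrightarrow> h \<in> carrier G \<Longrightarrow> b \<in> Bas C n \<Longrightarrow>
          Act C n (g \<otimes> h) b = Act C n g (Act C n h b)"
    and Act_free: "\<And>n g b. g \<in> carrier G \<Longrightarrow> b \<in> Bas C n \<Longrightarrow> Act C n g b = b \<Longrightarrow> g = \<one>"
    and Bd_closed: "\<And>n b. b \<in> Bas C n \<Longrightarrow> chn C (n - 1) (Bd C n b)"
    and Bd_0: "\<And>b. b \<in> Bas C 0 \<Longrightarrow> Bd C 0 b = 0"
    and Bd_Act: "\<And>n g b. g \<in> carrier G \<Longrightarrow> b \<in> Bas C n \<Longrightarrow> Bd C n (Act C n g b) = act C (n - 1) g (Bd C n b)"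
    and Bd_Bd: "\<And>n b. b \<in> Bas C n \<Longrightarrow> bdry C (n - 1) (Bd C n b) = 0"
    and aug_Bd: "\<And>b. b \<in> Bas C 1 \<Longrightarrow> aug (Bd C 1 b) = 0"
begin

lemma act_mult:
  "g \<in> carrier G \<Longrightarrow> h \<in> carrier G \<Longrightarrow> chn C n c \<Longrightarrow> act C n (g \<otimes> h) c = act C n g (act C n h c)"
  unfolding act_def frag_extend_frag_extend by (rule frag_extend_eq) (auto simp: Act_mult)

lemma chn_act: "g \<in> carrier G \<Longrightarrow> chn C n c \<Longrightarrow> chn C n (act C n g c)"
  unfolding act_def by (rule keys_frag_extend_subset) (auto simp: Act_closed)

lemma bdry_act:
  assumes "g \<in> carrier G" "chn C n c"
  shows "bdry C n (act C n g c) = act C (n - 1) g (bdry C n c)"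
  unfolding bdry_def act_def frag_extend_frag_extend
proof (rule frag_extend_eq)
  fix b assume "b \<in> Poly_Mapping.keys c"
  then show "frag_extend (Bd C n) (frag_of (Act C n g b)) = frag_extend (\<lambda>b. frag_of (Act C (n - 1) g b)) (Bd C n b)"
    using assms Bd_Act[of g b n] by (auto simp: act_def)
qed

lemma aug_act: "aug (act C n g c) = aug c"
  unfolding act_def ev_frag_extend by simp

text \<open>Choose a value at one representative of each orbit and transport it; freeness makes this
  consistent.\<close>
lemma equivariant_choice:
  fixes w :: "'g \<Rightarrow> 'v \<Rightarrow> 'v"
  assumes ex: "\<And>b. b \<in> Bas C n \<Longrightarrow> \<exists>v. R b v"
    and R: "\<And>g b v. g \<in> carrier G \<Longrightarrow> b \<in> Bas C n \<Longrightarrow> R b v \<Longrightarrow> R (Act C n g b) (w g v)"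
    and w1: "\<And>g h b v. g \<in> carrier G \<Longrightarrow> h \<in> carrier G \<Longrightarrow> b \<in> Bas C n \<Longrightarrow> R b v \<Longrightarrow> w (g \<otimes> h) v = w g (w h v)"
  obtains F where "\<And>b. b \<in> Bas C n \<Longrightarrow> R b (F b)"
    "\<And>g b. g \<in> carrier G \<Longrightarrow> b \<in> Bas C n \<Longrightarrow> F (Act C n g b) = w g (F b)"
proof -
  define orb where "orb b = {Act C n g b | g. g \<in> carrier G}" for b
  define rep where "rep b = (SOME x. x \<in> orb b)" for b
  have orb_sub: "orb b \<subseteq> Bas C n" if "b \<in> Bas C n" for b
    using that Act_closed by (auto simp: orb_def)
  have rep_in: "rep b \<in> orb b" if "b \<in> Bas C n" for b
    unfolding rep_def by (rule someI[of _ "Act C n \<one> b"]) (auto simp: orb_def)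
  have orb_act: "orb (Act C n g b) = orb b" if "g \<in> carrier G" "b \<in> Bas C n" for g b
  proof
    show "orb (Act C n g b) \<subseteq> orb b"
      using that by (auto simp: orb_def Act_mult[symmetric])
    show "orb b \<subseteq> orb (Act C n g b)"
    proof
      fix x assume "x \<in> orb b"
      then obtain h where h: "h \<in> carrier G" "x = Act C n h b" by (auto simp: orb_def)
      then have "x = Act C n ((h \<otimes> inv g) \<otimes> g) b" using that by (simp add: m_assoc)
      also have "\<dots> = Act C n (h \<otimes> inv g) (Act C n g b)" using that h by (intro Act_mult) auto
      finally show "x \<in> orb (Act C n g b)" using that h by (auto simp: orb_def)
    qed
  qed
  have ex1: "\<exists>h. h \<in> carrier G \<and> b = Act C n h (rep b)" if b: "b \<in> Bas C n" for b
  proof -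
    obtain g where g: "g \<in> carrier G" "rep b = Act C n g b" using rep_in[OF b] by (auto simp: orb_def)
    then have "Act C n (inv g) (rep b) = b" using b by (simp add: Act_mult[symmetric] Act_one)
    then show ?thesis using g by (intro exI[of _ "inv g"]) auto
  qed
  define el where "el b = (SOME h. h \<in> carrier G \<and> b = Act C n h (rep b))" for b
  have el: "el b \<in> carrier G" "b = Act C n (el b) (rep b)" if "b \<in> Bas C n" for b
    using someI_ex[OF ex1[OF that]] by (auto simp: el_def)
  have rep_bas: "rep b \<in> Bas C n" if "b \<in> Bas C n" for b using rep_in orb_sub that by blast
  define F where "F b = w (el b) (SOME v. R (rep b) v)" for b
  have v: "R (rep b) (SOME v. R (rep b) v)" if "b \<in> Bas C n" for b
    by (rule someI_ex[OF ex[OF rep_bas[OF that]]])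
  show ?thesis
  proof (rule that)
    fix b assume b: "b \<in> Bas C n"
    show "R b (F b)" using R[OF el(1)[OF b] rep_bas[OF b] v[OF b]] el(2)[OF b] by (simp add: F_def)
    fix g assume g: "g \<in> carrier G"
    let ?b = "Act C n g b"
    have b': "?b \<in> Bas C n" using g b Act_closed by blast
    have rep: "rep ?b = rep b" unfolding rep_def orb_act[OF g b] ..
    have "Act C n (el ?b) (rep b) = ?b" using el(2)[OF b'] rep by simp
    also have "?b = Act C n (g \<otimes> el b) (rep b)"
      using el[OF b] g rep_bas[OF b] by (simp add: Act_mult)
    finally have eq: "Act C n (el ?b) (rep b) = Act C n (g \<otimes> el b) (rep b)" .
    have c: "el ?b \<in> carrier G" "g \<otimes> el b \<in> carrier G" using el(1)[OF b'] el(1)[OF b] g by auto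
    have "Act C n (inv (g \<otimes> el b) \<otimes> el ?b) (rep b) = Act C n (inv (g \<otimes> el b)) (Act C n (g \<otimes> el b) (rep b))"
      using c rep_bas[OF b] eq by (simp add: Act_mult)
    also have "\<dots> = rep b" using c rep_bas[OF b] by (simp add: Act_mult[symmetric] Act_one)
    finally have "inv (g \<otimes> el b) \<otimes> el ?b = \<one>" using Act_free[OF _ rep_bas[OF b]] c by auto
    then have "el ?b = g \<otimes> el b" using c by (metis inv_equality inv_inv inv_closed)
    then show "F ?b = w g (F b)"
      unfolding F_def rep using w1[OF g el(1)[OF b] rep_bas[OF b] v[OF b]] by simp
  qed
qed

end

text \<open>The augmented complex is a resolution of the integers.\<close>

definition acyclic_cx :: "('b, 'g) gcx \<Rightarrow> bool" where
  "acyclic_cx D \<longleftrightarrow> (\<exists>c. chn D 0 c \<and> aug c = 1) \<and>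
     (\<forall>n c. chn D n c \<longrightarrow> bdry D n c = 0 \<longrightarrow> (n = 0 \<longrightarrow> aug c = 0) \<longrightarrow>
        (\<exists>b. chn D (Suc n) b \<and> bdry D (Suc n) b = c))"

definition equivariant_chain_map ::
  "('g, 'm) monoid_scheme \<Rightarrow> ('b, 'g) gcx \<Rightarrow> ('c, 'g) gcx \<Rightarrow> (nat \<Rightarrow> 'b \<Rightarrow> ('c \<Rightarrow>\<^sub>0 int)) \<Rightarrow> bool" where
  "equivariant_chain_map G C D \<mu> \<longleftrightarrow>
     (\<forall>n. \<forall>b\<in>Bas C n. chn D n (\<mu> n b) \<and> bdry D n (\<mu> n b) = frag_extend (\<mu> (n - 1)) (Bd C n b) \<and>
        (\<forall>g\<in>carrier G. \<mu> n (Act C n g b) = act D n g (\<mu> n b))) \<and>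
     (\<forall>b\<in>Bas C 0. aug (\<mu> 0 b) = 1)"

lemma equivariant_chain_mapD:
  assumes "equivariant_chain_map G C D \<mu>"
  shows "b \<in> Bas C n \<Longrightarrow> chn D n (\<mu> n b)"
    "b \<in> Bas C n \<Longrightarrow> bdry D n (\<mu> n b) = frag_extend (\<mu> (n - 1)) (Bd C n b)"
    "b \<in> Bas C n \<Longrightarrow> g \<in> carrier G \<Longrightarrow> \<mu> n (Act C n g b) = act D n g (\<mu> n b)"
    "b \<in> Bas C 0 \<Longrightarrow> aug (\<mu> 0 b) = 1"
  using assms by (auto simp: equivariant_chain_map_def)

lemma equivariant_chain_map_bdry:
  assumes "equivariant_chain_map G C D \<mu>" "chn C n c"
  shows "bdry D n (frag_extend (\<mu> n) c) = frag_extend (\<mu> (n - 1)) (bdry C n c)"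
  unfolding bdry_def frag_extend_frag_extend
  by (rule frag_extend_cong_on[OF assms(2)], rule equivariant_chain_mapD(2)[OF assms(1), unfolded bdry_def])

lemma equivariant_chain_map_chn:
  assumes "equivariant_chain_map G C D \<mu>" "chn C n c"
  shows "chn D n (frag_extend (\<mu> n) c)"
  by (rule keys_frag_extend_on[OF assms(2)], rule equivariant_chain_mapD(1)[OF assms(1)])

lemma equivariant_chain_map_act:
  assumes "equivariant_chain_map G C D \<mu>" "chn C n c" "g \<in> carrier G"
  shows "frag_extend (\<mu> n) (act C n g c) = act D n g (frag_extend (\<mu> n) c)"
  unfolding act_def frag_extend_frag_extend frag_extend_of
  by (rule frag_extend_cong_on[OF assms(2)], rule equivariant_chain_mapD(3)[OF assms(1) _ assms(3), unfolded act_def])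

lemma equivariant_chain_map_aug:
  assumes "equivariant_chain_map G C D \<mu>" "chn C 0 c"
  shows "aug (frag_extend (\<mu> 0) c) = aug c"
  unfolding ev_frag_extend
  by (rule ev_cong_on[OF assms(2)], rule equivariant_chain_mapD(4)[OF assms(1)])

lemma equivariant_chain_map_comp:
  assumes "equivariant_chain_map G C D \<mu>" "equivariant_chain_map G D E \<nu>"
  shows "equivariant_chain_map G C E (\<lambda>n b. frag_extend (\<nu> n) (\<mu> n b))"
  unfolding equivariant_chain_map_def
proof (intro conjI allI ballI)
  fix n b assume b: "b \<in> Bas C n"
  note \<mu> = equivariant_chain_mapD[OF assms(1)]
  show "chn E n (frag_extend (\<nu> n) (\<mu> n b))"
    by (rule equivariant_chain_map_chn[OF assms(2) \<mu>(1)[OF b]])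
  show "bdry E n (frag_extend (\<nu> n) (\<mu> n b)) = frag_extend (\<lambda>b. frag_extend (\<nu> (n - 1)) (\<mu> (n - 1) b)) (Bd C n b)"
    unfolding equivariant_chain_map_bdry[OF assms(2) \<mu>(1)[OF b]] \<mu>(2)[OF b] frag_extend_frag_extend ..
  fix g assume g: "g \<in> carrier G"
  show "frag_extend (\<nu> n) (\<mu> n (Act C n g b)) = act E n g (frag_extend (\<nu> n) (\<mu> n b))"
    unfolding \<mu>(3)[OF b g] by (rule equivariant_chain_map_act[OF assms(2) \<mu>(1)[OF b] g])
next
  fix b assume b: "b \<in> Bas C 0"
  show "aug (frag_extend (\<nu> 0) (\<mu> 0 b)) = 1"
    using equivariant_chain_map_aug[OF assms(2) equivariant_chain_mapD(1)[OF assms(1) b]]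
      equivariant_chain_mapD(4)[OF assms(1) b] by simp
qed

locale gcomplex_pair = C: gcomplex G C + D: gcomplex G D
  for G :: "('g, 'm) monoid_scheme" (structure) and C :: "('b, 'g) gcx" and D :: "('c, 'g) gcx" +
  assumes acyclic: "acyclic_cx D"
begin

lemma fill:
  assumes "chn D n c" "bdry D n c = 0" "n = 0 \<Longrightarrow> aug c = 0"
  obtains b where "chn D (Suc n) b" "bdry D (Suc n) b = c"
  using acyclic assms unfolding acyclic_cx_def by blast

text \<open>One lifting step of the comparison theorem: a cycle is filled at one representative of
  each orbit and the filling is transported by the action.\<close>

lemma equivariant_fill:
  assumes r: "\<And>b. b \<in> Bas C m \<Longrightarrow> chn D n (r b) \<and> bdry D n (r b) = 0 \<and> (n = 0 \<longrightarrow> aug (r b) = 0)"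
    and rG: "\<And>g b. g \<in> carrier G \<Longrightarrow> b \<in> Bas C m \<Longrightarrow> r (Act C m g b) = act D n g (r b)"
  obtains F where "\<And>b. b \<in> Bas C m \<Longrightarrow> chn D (Suc n) (F b) \<and> bdry D (Suc n) (F b) = r b"
    "\<And>g b. g \<in> carrier G \<Longrightarrow> b \<in> Bas C m \<Longrightarrow> F (Act C m g b) = act D (Suc n) g (F b)"
proof (rule C.equivariant_choice[where n = m and w = "act D (Suc n)"
      and R = "\<lambda>b v. chn D (Suc n) v \<and> bdry D (Suc n) v = r b"])
  show "\<exists>v. chn D (Suc n) v \<and> bdry D (Suc n) v = r b" if "b \<in> Bas C m" for b
    using r[OF that] by (elim conjE, rule_tac fill[where n = n and c = "r b"]) blast+
  show "chn D (Suc n) (act D (Suc n) g v) \<and> bdry D (Suc n) (act D (Suc n) g v) = r (Act C m g b)"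
    if "g \<in> carrier G" "b \<in> Bas C m" "chn D (Suc n) v \<and> bdry D (Suc n) v = r b" for g b v
  proof
    show "chn D (Suc n) (act D (Suc n) g v)" using that D.chn_act by blast
    have "bdry D (Suc n) (act D (Suc n) g v) = act D n g (bdry D (Suc n) v)"
      using that(1,3) D.bdry_act[of g v "Suc n"] unfolding diff_Suc_1 by blast
    also have "\<dots> = r (Act C m g b)" using that(3) rG[OF that(1,2)] by (elim conjE) (simp only:)
    finally show "bdry D (Suc n) (act D (Suc n) g v) = r (Act C m g b)" .
  qed
  show "act D (Suc n) (g \<otimes> h) v = act D (Suc n) g (act D (Suc n) h v)"
    if "g \<in> carrier G" "h \<in> carrier G" "b \<in> Bas C m" "chn D (Suc n) v \<and> bdry D (Suc n) v = r b" for g h b v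
    using that D.act_mult by blast
qed (use that in blast)

text \<open>The comparison theorem: a free complex maps to every free resolution, by induction on
  the degree.\<close>

lemma chain_map_exists: obtains \<mu> where "equivariant_chain_map G C D \<mu>"
proof -
  \<comment> \<open>The choice principle passes on only the preceding stage. So \<open>P\<close>
    records that cycles go to cycles, the one consequence of compatibility with earlier stages that
    makes the next filling problem solvable.\<close>
  define P where "P n m \<longleftrightarrow> (\<forall>b\<in>Bas C n. chn D n (m b)) \<and>
      (\<forall>g\<in>carrier G. \<forall>b\<in>Bas C n. m (Act C n g b) = act D n g (m b)) \<and>
      (\<forall>c. chn C n c \<longrightarrow> bdry C n c = 0 \<longrightarrow> bdry D n (frag_extend m c) = 0) \<and>
      (n = 0 \<longrightarrow> (\<forall>b\<in>Bas C n. aug (m b) = 1))" for n and m :: "'b \<Rightarrow> ('c \<Rightarrow>\<^sub>0 int)"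
  define Q where "Q n m m' \<longleftrightarrow> (\<forall>b\<in>Bas C (Suc n). bdry D (Suc n) (m' b) = frag_extend m (Bd C (Suc n) b))"
    for n and m m' :: "'b \<Rightarrow> ('c \<Rightarrow>\<^sub>0 int)"
  have bd0: "bdry D 0 c = 0" if "chn D 0 c" for c
    unfolding bdry_def by (rule frag_extend_zero_on[OF that], rule D.Bd_0)
  have "\<exists>m. P 0 m"
  proof (rule C.equivariant_choice[where n = 0 and R = "\<lambda>b v. chn D 0 v \<and> aug v = 1" and w = "act D 0"])
    show "\<exists>v. chn D 0 v \<and> aug v = 1" using acyclic unfolding acyclic_cx_def by blast
    show "chn D 0 (act D 0 g v) \<and> aug (act D 0 g v) = 1"
      if "g \<in> carrier G" "chn D 0 v \<and> aug v = 1" for g v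
      using that D.chn_act D.aug_act by metis
    show "act D 0 (g \<otimes> h) v = act D 0 g (act D 0 h v)"
      if "g \<in> carrier G" "h \<in> carrier G" "chn D 0 v \<and> aug v = 1" for g h v
      using that D.act_mult by blast
    fix F assume F: "\<And>b. b \<in> Bas C 0 \<Longrightarrow> chn D 0 (F b) \<and> aug (F b) = 1"
      "\<And>g b. g \<in> carrier G \<Longrightarrow> b \<in> Bas C 0 \<Longrightarrow> F (Act C 0 g b) = act D 0 g (F b)"
    have "bdry D 0 (frag_extend F c) = 0" if "chn C 0 c" for c
      using F(1) by (intro bd0 keys_frag_extend_on[OF that]) blast
    then show "\<exists>m. P 0 m" using F unfolding P_def by blast
  qed
  moreover have "\<exists>m'. P (Suc n) m' \<and> Q n m m'" if Pm: "P n m" for n m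
  proof (rule equivariant_fill[where m = "Suc n" and n = n and r = "\<lambda>b. frag_extend m (Bd C (Suc n) b)"])
    fix b assume b: "b \<in> Bas C (Suc n)"
    have c: "chn C n (Bd C (Suc n) b)" using C.Bd_closed[OF b] by simp
    have "chn D n (frag_extend m (Bd C (Suc n) b))"
      by (rule keys_frag_extend_on[OF c]) (use Pm in \<open>unfold P_def, blast\<close>)
    moreover have "bdry D n (frag_extend m (Bd C (Suc n) b)) = 0"
      using Pm c C.Bd_Bd[OF b] unfolding P_def diff_Suc_1 by blast
    moreover have "aug (frag_extend m (Bd C (Suc n) b)) = 0" if "n = 0"
    proof -
      have "aug (frag_extend m (Bd C (Suc n) b)) = aug (Bd C (Suc n) b)"
        unfolding ev_frag_extend by (rule ev_cong_on[OF c]) (use that Pm in \<open>unfold P_def, blast\<close>)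
      then show ?thesis using that C.aug_Bd b by (simp only: One_nat_def)
    qed
    ultimately show "chn D n (frag_extend m (Bd C (Suc n) b)) \<and> bdry D n (frag_extend m (Bd C (Suc n) b)) = 0
       \<and> (n = 0 \<longrightarrow> aug (frag_extend m (Bd C (Suc n) b)) = 0)" by blast
    fix g assume g: "g \<in> carrier G"
    show "frag_extend m (Bd C (Suc n) (Act C (Suc n) g b)) = act D n g (frag_extend m (Bd C (Suc n) b))"
      unfolding C.Bd_Act[OF g b] act_def frag_extend_frag_extend frag_extend_of diff_Suc_1
      by (rule frag_extend_cong_on[OF c]) (use Pm g in \<open>unfold P_def act_def, blast\<close>)
  next
    fix F assume F: "\<And>b. b \<in> Bas C (Suc n) \<Longrightarrow> chn D (Suc n) (F b) \<and> bdry D (Suc n) (F b) = frag_extend m (Bd C (Suc n) b)"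
      "\<And>g b. g \<in> carrier G \<Longrightarrow> b \<in> Bas C (Suc n) \<Longrightarrow> F (Act C (Suc n) g b) = act D (Suc n) g (F b)"
    have "bdry D (Suc n) (frag_extend F c) = 0" if c: "chn C (Suc n) c" "bdry C (Suc n) c = 0" for c
    proof -
      have "bdry D (Suc n) (frag_extend F c) = frag_extend m (bdry C (Suc n) c)"
        unfolding bdry_def frag_extend_frag_extend
        by (rule frag_extend_cong_on[OF c(1)]) (use F(1) in \<open>unfold bdry_def, blast\<close>)
      then show ?thesis using c(2) by (simp only: frag_extend_0)
    qed
    then have "P (Suc n) F \<and> Q n m F" using F unfolding P_def Q_def by auto
    then show "\<exists>m'. P (Suc n) m' \<and> Q n m m'" by blast
  qed
  ultimately obtain \<mu> where \<mu>: "\<And>n. P n (\<mu> n)" "\<And>n. Q n (\<mu> n) (\<mu> (Suc n))"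
    using dependent_nat_choice[of P Q] by metis
  have "bdry D n (\<mu> n b) = frag_extend (\<mu> (n - 1)) (Bd C n b)" if "b \<in> Bas C n" for n b
  proof (cases n)
    case 0
    then show ?thesis using that \<mu>(1)[of 0] C.Bd_0 bd0 by (simp add: P_def)
  next
    case (Suc m)
    then show ?thesis using that \<mu>(2)[of m] by (simp add: Q_def)
  qed
  moreover have "chn D n (\<mu> n b)" "\<forall>g\<in>carrier G. \<mu> n (Act C n g b) = act D n g (\<mu> n b)"
    "n = 0 \<longrightarrow> aug (\<mu> n b) = 1" if "b \<in> Bas C n" for n b
    using \<mu>(1)[of n] that unfolding P_def by blast+
  ultimately have "equivariant_chain_map G C D \<mu>"
    unfolding equivariant_chain_map_def by blast
  then show ?thesis by (rule that)
qed

text \<open>The uniqueness half of the comparison theorem. At each stage the cycle to be filled is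
  the difference of the two maps minus the contribution of the homotopy already built.\<close>

lemma chain_homotopy_exists:
  assumes "equivariant_chain_map G C D \<mu>" "equivariant_chain_map G C D \<nu>"
  obtains h where "\<And>n b. b \<in> Bas C n \<Longrightarrow> chn D (Suc n) (h n b)"
    "\<And>n g b. g \<in> carrier G \<Longrightarrow> b \<in> Bas C n \<Longrightarrow> h n (Act C n g b) = act D (Suc n) g (h n b)"
    "\<And>n b. b \<in> Bas C n \<Longrightarrow> bdry D (Suc n) (h n b) = \<mu> n b - \<nu> n b - frag_extend (h (n - 1)) (Bd C n b)"
proof -
  note \<mu> = equivariant_chain_mapD[OF assms(1)] and \<nu> = equivariant_chain_mapD[OF assms(2)]
  define P where "P n m \<longleftrightarrow> (\<forall>b\<in>Bas C n. chn D (Suc n) (m b)) \<and>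
      (\<forall>g\<in>carrier G. \<forall>b\<in>Bas C n. m (Act C n g b) = act D (Suc n) g (m b)) \<and>
      (\<forall>c. chn C n c \<longrightarrow> bdry C n c = 0 \<longrightarrow>
          bdry D (Suc n) (frag_extend m c) = frag_extend (\<mu> n) c - frag_extend (\<nu> n) c)"
      for n and m :: "'b \<Rightarrow> ('c \<Rightarrow>\<^sub>0 int)"
  define Q where "Q n m m' \<longleftrightarrow> (\<forall>b\<in>Bas C (Suc n). bdry D (Suc (Suc n)) (m' b) =
      \<mu> (Suc n) b - \<nu> (Suc n) b - frag_extend m (Bd C (Suc n) b))"
    for n and m m' :: "'b \<Rightarrow> ('c \<Rightarrow>\<^sub>0 int)"
  have bd_diff: "bdry D n (a - b) = bdry D n a - bdry D n b" for n a b
    unfolding bdry_def by (rule frag_extend_diff)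
  have act_diff: "act D n g (a - b) = act D n g a - act D n g b" for n g a b
    unfolding act_def by (rule frag_extend_diff)
  have chn_diff: "chn D n (a - b)" if "chn D n a" "chn D n b" for n a b
    using that keys_diff[of a b] by blast
  have bd0: "bdry D 0 c = 0" if "chn D 0 c" for c
    unfolding bdry_def by (rule frag_extend_zero_on[OF that], rule D.Bd_0)
  have P0: "\<exists>m. P 0 m \<and> (\<forall>b\<in>Bas C 0. bdry D 1 (m b) = \<mu> 0 b - \<nu> 0 b)"
  proof (rule equivariant_fill[where m = 0 and n = 0 and r = "\<lambda>b. \<mu> 0 b - \<nu> 0 b"])
    fix b assume b: "b \<in> Bas C 0"
    have "chn D 0 (\<mu> 0 b - \<nu> 0 b)" by (intro chn_diff \<mu>(1)[OF b] \<nu>(1)[OF b])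
    then show "chn D 0 (\<mu> 0 b - \<nu> 0 b) \<and> bdry D 0 (\<mu> 0 b - \<nu> 0 b) = 0 \<and> (0 = (0::nat) \<longrightarrow> aug (\<mu> 0 b - \<nu> 0 b) = 0)"
      using bd0 \<mu>(4)[OF b] \<nu>(4)[OF b] by (simp add: ev_diff)
    fix g assume "g \<in> carrier G"
    then show "\<mu> 0 (Act C 0 g b) - \<nu> 0 (Act C 0 g b) = act D 0 g (\<mu> 0 b - \<nu> 0 b)"
      using \<mu>(3)[OF b] \<nu>(3)[OF b] by (simp add: act_diff)
  next
    fix F assume F: "\<And>b. b \<in> Bas C 0 \<Longrightarrow> chn D (Suc 0) (F b) \<and> bdry D (Suc 0) (F b) = \<mu> 0 b - \<nu> 0 b"
      "\<And>g b. g \<in> carrier G \<Longrightarrow> b \<in> Bas C 0 \<Longrightarrow> F (Act C 0 g b) = act D (Suc 0) g (F b)"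
    have "bdry D (Suc 0) (frag_extend F c) = frag_extend (\<mu> 0) c - frag_extend (\<nu> 0) c" if "chn C 0 c" for c
      unfolding bdry_def frag_extend_frag_extend frag_extend_diff_left[symmetric]
      by (rule frag_extend_cong_on[OF that]) (use F(1) in \<open>unfold bdry_def, blast\<close>)
    then have "P 0 F" using F unfolding P_def by blast
    then show "\<exists>m. P 0 m \<and> (\<forall>b\<in>Bas C 0. bdry D 1 (m b) = \<mu> 0 b - \<nu> 0 b)" using F by auto
  qed
  \<comment> \<open>\<open>Q\<close> relates consecutive stages only, so the boundary formula in
    degree 0 has to be kept in the invariant of the recursion.\<close>
  define P' where "P' n m \<longleftrightarrow> P n m \<and> (n = 0 \<longrightarrow> (\<forall>b\<in>Bas C 0. bdry D 1 (m b) = \<mu> 0 b - \<nu> 0 b))" for n m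
  have "\<exists>m. P' 0 m" using P0 by (simp add: P'_def)
  moreover have "\<exists>m'. P' (Suc n) m' \<and> Q n m m'" if "P' n m" for n m
  proof -
    have Pm: "P n m" using that by (simp add: P'_def)
    have "\<exists>m'. P (Suc n) m' \<and> Q n m m'"
    proof (rule equivariant_fill[where m = "Suc n" and n = "Suc n"
          and r = "\<lambda>b. \<mu> (Suc n) b - \<nu> (Suc n) b - frag_extend m (Bd C (Suc n) b)"])
      fix b assume b: "b \<in> Bas C (Suc n)"
      have c: "chn C n (Bd C (Suc n) b)" "bdry C n (Bd C (Suc n) b) = 0"
        using C.Bd_closed[OF b] C.Bd_Bd[OF b] by simp_all
      have "chn D (Suc n) (frag_extend m (Bd C (Suc n) b))"
        by (rule keys_frag_extend_on[OF c(1)]) (use Pm in \<open>unfold P_def, blast\<close>)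
      then have "chn D (Suc n) (\<mu> (Suc n) b - \<nu> (Suc n) b - frag_extend m (Bd C (Suc n) b))"
        by (intro chn_diff \<mu>(1)[OF b] \<nu>(1)[OF b])
      moreover have "bdry D (Suc n) (frag_extend m (Bd C (Suc n) b))
          = frag_extend (\<mu> n) (Bd C (Suc n) b) - frag_extend (\<nu> n) (Bd C (Suc n) b)"
        using Pm c unfolding P_def by blast
      then have "bdry D (Suc n) (\<mu> (Suc n) b - \<nu> (Suc n) b - frag_extend m (Bd C (Suc n) b)) = 0"
        by (simp only: bd_diff \<mu>(2)[OF b] \<nu>(2)[OF b] diff_Suc_1 diff_self)
      ultimately show "chn D (Suc n) (\<mu> (Suc n) b - \<nu> (Suc n) b - frag_extend m (Bd C (Suc n) b)) \<and>
         bdry D (Suc n) (\<mu> (Suc n) b - \<nu> (Suc n) b - frag_extend m (Bd C (Suc n) b)) = 0 \<and>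
         (Suc n = 0 \<longrightarrow> aug (\<mu> (Suc n) b - \<nu> (Suc n) b - frag_extend m (Bd C (Suc n) b)) = 0)" by blast
      fix g assume g: "g \<in> carrier G"
      have "frag_extend m (Bd C (Suc n) (Act C (Suc n) g b)) = act D (Suc n) g (frag_extend m (Bd C (Suc n) b))"
        unfolding C.Bd_Act[OF g b] act_def frag_extend_frag_extend frag_extend_of diff_Suc_1
        by (rule frag_extend_cong_on[OF c(1)]) (use Pm g in \<open>unfold P_def act_def, blast\<close>)
      then show "\<mu> (Suc n) (Act C (Suc n) g b) - \<nu> (Suc n) (Act C (Suc n) g b) - frag_extend m (Bd C (Suc n) (Act C (Suc n) g b))
         = act D (Suc n) g (\<mu> (Suc n) b - \<nu> (Suc n) b - frag_extend m (Bd C (Suc n) b))"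
        by (simp only: act_diff \<mu>(3)[OF b g] \<nu>(3)[OF b g])
    next
      fix F assume F: "\<And>b. b \<in> Bas C (Suc n) \<Longrightarrow> chn D (Suc (Suc n)) (F b) \<and> bdry D (Suc (Suc n)) (F b) =
           \<mu> (Suc n) b - \<nu> (Suc n) b - frag_extend m (Bd C (Suc n) b)"
        "\<And>g b. g \<in> carrier G \<Longrightarrow> b \<in> Bas C (Suc n) \<Longrightarrow> F (Act C (Suc n) g b) = act D (Suc (Suc n)) g (F b)"
      have "bdry D (Suc (Suc n)) (frag_extend F c) = frag_extend (\<mu> (Suc n)) c - frag_extend (\<nu> (Suc n)) c"
        if c: "chn C (Suc n) c" "bdry C (Suc n) c = 0" for c
      proof -
        have "bdry D (Suc (Suc n)) (frag_extend F c)
            = frag_extend (\<lambda>b. \<mu> (Suc n) b - \<nu> (Suc n) b - frag_extend m (Bd C (Suc n) b)) c"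
          unfolding bdry_def frag_extend_frag_extend
          by (rule frag_extend_cong_on[OF c(1)]) (use F(1) in \<open>unfold bdry_def, blast\<close>)
        also have "\<dots> = frag_extend (\<mu> (Suc n)) c - frag_extend (\<nu> (Suc n)) c - frag_extend m (bdry C (Suc n) c)"
          unfolding bdry_def frag_extend_frag_extend frag_extend_diff_left ..
        finally show ?thesis using c(2) by (simp only: frag_extend_0 diff_zero)
      qed
      then have "P (Suc n) F \<and> Q n m F" using F unfolding P_def Q_def by blast
      then show "\<exists>m'. P (Suc n) m' \<and> Q n m m'" by blast
    qed
    then show ?thesis by (simp add: P'_def)
  qed
  ultimately obtain h where h: "\<And>n. P' n (h n)" "\<And>n. Q n (h n) (h (Suc n))"
    using dependent_nat_choice[of P' Q] by metis
  show ?thesis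
  proof (rule that)
    fix n b assume b: "b \<in> Bas C n"
    show "chn D (Suc n) (h n b)" using h(1)[of n] b by (simp add: P'_def P_def)
    show "h n (Act C n g b) = act D (Suc n) g (h n b)" if "g \<in> carrier G" for g
      using h(1)[of n] b that by (simp add: P'_def P_def)
    show "bdry D (Suc n) (h n b) = \<mu> n b - \<nu> n b - frag_extend (h (n - 1)) (Bd C n b)"
    proof (cases n)
      case 0
      then show ?thesis using h(1)[of 0] b C.Bd_0 by (simp add: P'_def)
    next
      case (Suc m)
      then show ?thesis using h(2)[of m] b by (simp add: Q_def)
    qed
  qed
qed

end

section \<open>Invariant cochains modulo an integer\<close>

definition inv_cochain :: "('g, 'm) monoid_scheme \<Rightarrow> ('b, 'g) gcx \<Rightarrow> nat \<Rightarrow> ('b \<Rightarrow> int) \<Rightarrow> bool" where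
  "inv_cochain G C n f \<longleftrightarrow> (\<forall>g\<in>carrier G. \<forall>b\<in>Bas C n. f (Act C n g b) = f b)"

definition cocycle_mod :: "int \<Rightarrow> ('b, 'g) gcx \<Rightarrow> nat \<Rightarrow> ('b \<Rightarrow> int) \<Rightarrow> bool" where
  "cocycle_mod m C n f \<longleftrightarrow> (\<forall>b\<in>Bas C (Suc n). [ev f (Bd C (Suc n) b) = 0] (mod m))"

text \<open>For \<open>n = 0\<close>, where \<open>n - 1\<close> truncates, the boundary vanishes, so the condition is \<open>f \<equiv> 0\<close>.\<close>
definition inv_coboundary :: "int \<Rightarrow> ('g, 'm) monoid_scheme \<Rightarrow> ('b, 'g) gcx \<Rightarrow> nat \<Rightarrow> ('b \<Rightarrow> int) \<Rightarrow> bool" where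
  "inv_coboundary m G C n f \<longleftrightarrow> (\<exists>a. inv_cochain G C (n - 1) a \<and> (\<forall>b\<in>Bas C n. [f b = ev a (Bd C n b)] (mod m)))"

lemma inv_coboundary_diff:
  assumes "inv_coboundary m G C n f" "inv_coboundary m G C n g"
  shows "inv_coboundary m G C n (\<lambda>b. f b - g b)"
proof -
  obtain a b where "inv_cochain G C (n - 1) a" "\<forall>x\<in>Bas C n. [f x = ev a (Bd C n x)] (mod m)"
    "inv_cochain G C (n - 1) b" "\<forall>x\<in>Bas C n. [g x = ev b (Bd C n x)] (mod m)"
    using assms unfolding inv_coboundary_def by blast
  then show ?thesis
    unfolding inv_coboundary_def
    by (intro exI[of _ "\<lambda>x. a x - b x"] conjI ballI)
      (simp add: inv_cochain_def, unfold ev_diff_left, blast intro: cong_diff)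
qed

lemma inv_coboundary_diff_iff:
  assumes "inv_coboundary m G C n (\<lambda>b. f b - g b)"
  shows "inv_coboundary m G C n f \<longleftrightarrow> inv_coboundary m G C n g"
proof
  assume "inv_coboundary m G C n f"
  from inv_coboundary_diff[OF this assms] show "inv_coboundary m G C n g" by simp
next
  assume g: "inv_coboundary m G C n g"
  have "inv_coboundary m G C n (\<lambda>b. 0)"
    unfolding inv_coboundary_def by (intro exI[of _ "\<lambda>_. 0"]) (simp add: inv_cochain_def ev_def)
  from inv_coboundary_diff[OF assms inv_coboundary_diff[OF this g]] show "inv_coboundary m G C n f" by simp
qed

lemma (in gcomplex) ev_act:
  assumes "inv_cochain G C n f" "g \<in> carrier G" "chn C n c"
  shows "ev f (act C n g c) = ev f c"
  unfolding act_def ev_frag_extend ev_of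
  by (rule ev_cong_on[OF assms(3)]) (use assms in \<open>unfold inv_cochain_def, blast\<close>)

lemma cocycle_mod_ev:
  assumes "cocycle_mod m C n f" "chn C (Suc n) c"
  shows "[ev f (bdry C (Suc n) c) = 0] (mod m)"
proof -
  have "[ev (\<lambda>b. ev f (Bd C (Suc n) b)) c = ev (\<lambda>_. 0) c] (mod m)"
    by (rule ev_mod_cong_on[OF assms(2)]) (use assms(1) in \<open>unfold cocycle_mod_def, blast\<close>)
  then show ?thesis by (simp only: bdry_def ev_frag_extend ev_zero_left)
qed

lemma pullback_inv_cochain:
  assumes "gcomplex G D" "equivariant_chain_map G C D \<mu>" "inv_cochain G D n f"
  shows "inv_cochain G C n (\<lambda>b. ev f (\<mu> n b))"
  unfolding inv_cochain_def
proof (intro ballI)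
  fix g b assume g: "g \<in> carrier G" and b: "b \<in> Bas C n"
  show "ev f (\<mu> n (Act C n g b)) = ev f (\<mu> n b)"
    unfolding equivariant_chain_mapD(3)[OF assms(2) b g]
    by (rule gcomplex.ev_act[OF assms(1,3) g equivariant_chain_mapD(1)[OF assms(2) b]])
qed

lemma pullback_cocycle:
  assumes "gcomplex G C" "equivariant_chain_map G C D \<mu>" "cocycle_mod m D n f"
  shows "cocycle_mod m C n (\<lambda>b. ev f (\<mu> n b))"
  unfolding cocycle_mod_def
proof
  fix b assume b: "b \<in> Bas C (Suc n)"
  have "ev (\<lambda>b. ev f (\<mu> n b)) (Bd C (Suc n) b) = ev f (bdry D (Suc n) (\<mu> (Suc n) b))"
    unfolding ev_frag_extend[symmetric] equivariant_chain_mapD(2)[OF assms(2) b] diff_Suc_1 ..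
  then show "[ev (\<lambda>b. ev f (\<mu> n b)) (Bd C (Suc n) b) = 0] (mod m)"
    using cocycle_mod_ev[OF assms(3) equivariant_chain_mapD(1)[OF assms(2) b]] by (simp only:)
qed

lemma pullback_inv_coboundary:
  assumes C: "gcomplex G C" and D: "gcomplex G D" and \<mu>: "equivariant_chain_map G C D \<mu>" and f: "inv_coboundary m G D n f"
  shows "inv_coboundary m G C n (\<lambda>b. ev f (\<mu> n b))"
proof -
  obtain a where a: "inv_cochain G D (n - 1) a" "\<And>b. b \<in> Bas D n \<Longrightarrow> [f b = ev a (Bd D n b)] (mod m)"
    using f unfolding inv_coboundary_def by blast
  show ?thesis
    unfolding inv_coboundary_def
  proof (intro exI[of _ "\<lambda>b. ev a (\<mu> (n - 1) b)"] conjI ballI)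
    show "inv_cochain G C (n - 1) (\<lambda>b. ev a (\<mu> (n - 1) b))"
      by (rule pullback_inv_cochain[OF D \<mu> a(1)])
    fix b assume b: "b \<in> Bas C n"
    have "[ev f (\<mu> n b) = ev (\<lambda>b. ev a (Bd D n b)) (\<mu> n b)] (mod m)"
      by (rule ev_mod_cong_on[OF equivariant_chain_mapD(1)[OF \<mu> b] a(2)])
    also have "ev (\<lambda>b. ev a (Bd D n b)) (\<mu> n b) = ev (\<lambda>b. ev a (\<mu> (n - 1) b)) (Bd C n b)"
      unfolding ev_frag_extend[symmetric] bdry_def[symmetric] equivariant_chain_mapD(2)[OF \<mu> b] ..
    finally show "[ev f (\<mu> n b) = ev (\<lambda>b. ev a (\<mu> (n - 1) b)) (Bd C n b)] (mod m)" .
  qed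
qed

lemma (in gcomplex_pair) chain_maps_cohomologous:
  assumes \<mu>: "equivariant_chain_map G C D \<mu>" and \<nu>: "equivariant_chain_map G C D \<nu>"
    and f: "inv_cochain G D n f" "cocycle_mod m D n f"
  shows "inv_coboundary m G C n (\<lambda>b. ev f (\<mu> n b) - ev f (\<nu> n b))"
proof -
  obtain h where h: "\<And>n b. b \<in> Bas C n \<Longrightarrow> chn D (Suc n) (h n b)"
    "\<And>n g b. g \<in> carrier G \<Longrightarrow> b \<in> Bas C n \<Longrightarrow> h n (Act C n g b) = act D (Suc n) g (h n b)"
    "\<And>n b. b \<in> Bas C n \<Longrightarrow> bdry D (Suc n) (h n b) = \<mu> n b - \<nu> n b - frag_extend (h (n - 1)) (Bd C n b)"
    using chain_homotopy_exists[OF \<mu> \<nu>] by blast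
  have main: "[ev f (\<mu> n b) - ev f (\<nu> n b) = ev (\<lambda>b. ev f (h (n - 1) b)) (Bd C n b)] (mod m)" if b: "b \<in> Bas C n" for b
  proof -
    have "[ev f (bdry D (Suc n) (h n b)) = 0] (mod m)" by (rule cocycle_mod_ev[OF f(2) h(1)[OF b]])
    then show ?thesis
      unfolding h(3)[OF b] by (simp add: ev_diff ev_frag_extend cong_iff_dvd_diff)
  qed
  show ?thesis
  proof (cases n)
    \<comment> \<open>Here \<open>n - 1\<close> truncates to 0 and \<open>h 0\<close> takes values
      in degree 1, where nothing is known about \<open>f\<close>. As boundaries of degree 0 elements
      vanish, the zero primitive is the right one.\<close>
    case 0
    show ?thesis
      unfolding inv_coboundary_def
    proof (intro exI[of _ "\<lambda>_. 0"] conjI ballI)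
      fix b assume b: "b \<in> Bas C n"
      then show "[ev f (\<mu> n b) - ev f (\<nu> n b) = ev (\<lambda>_. 0) (Bd C n b)] (mod m)"
        using main[OF b] C.Bd_0 0 by simp
    qed (simp add: inv_cochain_def)
  next
    case (Suc k)
    show ?thesis
      unfolding inv_coboundary_def
    proof (intro exI[of _ "\<lambda>b. ev f (h (n - 1) b)"] conjI ballI main)
      show "inv_cochain G C (n - 1) (\<lambda>b. ev f (h (n - 1) b))"
        unfolding inv_cochain_def
      proof (intro ballI)
        fix g b assume "g \<in> carrier G" "b \<in> Bas C (n - 1)"
        then show "ev f (h (n - 1) (Act C (n - 1) g b)) = ev f (h (n - 1) b)"
          using h(1)[where n = "n - 1" and b = b] h(2)[where n = "n - 1" and b = b and g = g]
            D.ev_act[OF f(1), of g "h (n - 1) b"] Suc by (simp only: diff_Suc_1)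
      qed
    qed
  qed
qed

section \<open>Covering actions and singular simplices\<close>

definition sing :: "'a topology \<Rightarrow> ('g \<Rightarrow> 'a \<Rightarrow> 'a) \<Rightarrow> ((nat \<Rightarrow> real) \<Rightarrow> 'a, 'g) gcx" where
  "sing Y \<phi> = \<lparr>Bas = \<lambda>n. singular_simplex_set n Y,
                Bd = \<lambda>n \<sigma>. chain_boundary n (frag_of \<sigma>),
                Act = \<lambda>n g. simplex_map n (\<phi> g)\<rparr>"

lemma sing_simps [simp]:
  "Bas (sing Y \<phi>) n = singular_simplex_set n Y"
  "Bd (sing Y \<phi>) n \<sigma> = chain_boundary n (frag_of \<sigma>)"
  "Act (sing Y \<phi>) n g = simplex_map n (\<phi> g)"
  by (simp_all add: sing_def)

lemma bdry_sing: "bdry (sing Y \<phi>) n c = chain_boundary n c"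
proof (cases "n = 0")
  case True
  then show ?thesis by (simp add: bdry_def sing_def chain_boundary_def frag_extend_zero)
next
  case False
  then show ?thesis by (simp add: bdry_def sing_def chain_boundary_def)
qed

lemma act_sing: "act (sing Y \<phi>) n g c = chain_map n (\<phi> g) c"
  by (simp add: act_def sing_def chain_map_def o_def)

lemma simplex_vertex_in: "(\<lambda>j. if j = 0 then 1 else 0) \<in> standard_simplex n"
  by simp

lemma singular_simplex_in_topspace:
  "singular_simplex n Y \<sigma> \<Longrightarrow> x \<in> standard_simplex n \<Longrightarrow> \<sigma> x \<in> topspace Y"
  unfolding singular_simplex_def continuous_map_def by auto

lemma simplex_map_compose_on:
  "simplex_map n f (simplex_map n g \<sigma>) = simplex_map n (\<lambda>x. f (g x)) \<sigma>"
  by (auto simp: simplex_map_def restrict_def)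

text \<open>Supplies connected overlaps when a simplex is cut into boxes: the intersection of two
  boxes is convex.\<close>

lemma connectedin_convex_powertop:
  assumes "\<And>x y u. x \<in> S \<Longrightarrow> y \<in> S \<Longrightarrow> 0 \<le> u \<Longrightarrow> u \<le> (1::real) \<Longrightarrow> (\<lambda>i. (1 - u) * x i + u * y i) \<in> S"
  shows "connectedin (powertop_real (UNIV :: nat set)) S"
proof -
  have "path_connectedin (powertop_real (UNIV :: nat set)) S"
    unfolding path_connectedin_def path_connected_space_def
  proof (intro conjI ballI)
    show "S \<subseteq> topspace (powertop_real UNIV)" by simp
    fix x y assume "x \<in> topspace (subtopology (powertop_real UNIV) S)" "y \<in> topspace (subtopology (powertop_real UNIV) S)"
    then have xy: "x \<in> S" "y \<in> S" by auto
    define g where "g u = (\<lambda>i. (1 - u) * x i + u * y i)" for u :: real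
    have "continuous_map (top_of_set {0..1}) (powertop_real UNIV) g"
      unfolding g_def continuous_map_componentwise
      by (force intro: continuous_intros)
    moreover have "g \<in> {0..1} \<rightarrow> S" using assms xy by (auto simp: g_def)
    ultimately have "pathin (subtopology (powertop_real UNIV) S) g"
      unfolding pathin_def continuous_map_in_subtopology by simp
    moreover have "g 0 = x" "g 1 = y" by (auto simp: g_def)
    ultimately show "\<exists>g. pathin (subtopology (powertop_real UNIV) S) g \<and> g 0 = x \<and> g 1 = y" by blast
  qed
  then show ?thesis by (rule path_connectedin_imp_connectedin)
qed

text \<open>Actions whose orbit map is a covering. Pointwise freeness alone would not give local
  sections of the orbit map.\<close>

locale covering_action = group G for G :: "('g, 'm) monoid_scheme" (structure) +
  fixes Y :: "'a topology" and \<phi> :: "'g \<Rightarrow> 'a \<Rightarrow> 'a"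
  assumes cont: "\<And>g. g \<in> carrier G \<Longrightarrow> continuous_map Y Y (\<phi> g)"
    and one: "\<And>y. y \<in> topspace Y \<Longrightarrow> \<phi> \<one> y = y"
    and mult: "\<And>g h y. g \<in> carrier G \<Longrightarrow> h \<in> carrier G \<Longrightarrow> y \<in> topspace Y \<Longrightarrow> \<phi> (g \<otimes> h) y = \<phi> g (\<phi> h y)"
    and nbhd: "\<And>y. y \<in> topspace Y \<Longrightarrow>
          \<exists>U. openin Y U \<and> y \<in> U \<and> (\<forall>g\<in>carrier G. \<forall>u\<in>U. \<phi> g u \<in> U \<longrightarrow> g = \<one>)"
begin

lemma closed: "g \<in> carrier G \<Longrightarrow> y \<in> topspace Y \<Longrightarrow> \<phi> g y \<in> topspace Y"
  using cont[of g] unfolding continuous_map_def by auto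

lemma free: "g \<in> carrier G \<Longrightarrow> y \<in> topspace Y \<Longrightarrow> \<phi> g y = y \<Longrightarrow> g = \<one>"
  using nbhd[of y] by metis

lemma inv_left: "g \<in> carrier G \<Longrightarrow> y \<in> topspace Y \<Longrightarrow> \<phi> (inv g) (\<phi> g y) = y"
  using mult[of "inv g" g y] one[of y] by simp

abbreviation q :: "'a \<Rightarrow> 'a set" where "q \<equiv> orbit G \<phi>"

abbreviation Q :: "'a set topology" where "Q \<equiv> orbit_space G Y \<phi>"

lemma orbit_iff: "x \<in> q y \<longleftrightarrow> (\<exists>g\<in>carrier G. x = \<phi> g y)"
  by (auto simp: orbit_def)

lemma orbit_eqI:
  assumes "g \<in> carrier G" "y \<in> topspace Y"
  shows "q (\<phi> g y) = q y"
proof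
  show "q (\<phi> g y) \<subseteq> q y"
  proof
    fix x assume "x \<in> q (\<phi> g y)"
    then obtain h where h: "h \<in> carrier G" "x = \<phi> h (\<phi> g y)" unfolding orbit_iff by blast
    then have "x = \<phi> (h \<otimes> g) y" using mult assms by simp
    then show "x \<in> q y" unfolding orbit_iff using h assms by blast
  qed
  show "q y \<subseteq> q (\<phi> g y)"
  proof
    fix x assume "x \<in> q y"
    then obtain h where h: "h \<in> carrier G" "x = \<phi> h y" unfolding orbit_iff by blast
    have "\<phi> (h \<otimes> inv g) (\<phi> g y) = \<phi> h (\<phi> (inv g) (\<phi> g y))"
      using mult[of h "inv g" "\<phi> g y"] h assms closed by simp
    then have "x = \<phi> (h \<otimes> inv g) (\<phi> g y)" using inv_left assms h by simp
    then show "x \<in> q (\<phi> g y)" unfolding orbit_iff using h assms by blast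
  qed
qed

lemma orbit_eqD:
  assumes "x \<in> topspace Y" "y \<in> topspace Y" "q x = q y"
  obtains g where "g \<in> carrier G" "y = \<phi> g x"
proof -
  have "y \<in> q y" unfolding orbit_iff using one[OF assms(2)] by (metis one_closed)
  then show ?thesis using that unfolding assms(3)[symmetric] orbit_iff by blast
qed

lemma continuous_q: "continuous_map Y Q q"
  unfolding continuous_map_def
proof (intro conjI allI impI)
  show "q \<in> topspace Y \<rightarrow> topspace Q"
    by (auto simp: topspace_orbit_space orbits_def)
  fix U assume "openin Q U"
  then show "openin Y {x \<in> topspace Y. q x \<in> U}" by (simp add: openin_orbit_space)
qed

lemma open_q:
  assumes "openin Y U"
  shows "openin Q (q ` U)"
  unfolding openin_orbit_space
proof
  have U: "U \<subseteq> topspace Y" by (rule openin_subset[OF assms])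
  then show "q ` U \<subseteq> orbits G (topspace Y) \<phi>" by (auto simp: orbits_def)
  have "{x \<in> topspace Y. q x \<in> q ` U} = (\<Union>g\<in>carrier G. {x \<in> topspace Y. \<phi> g x \<in> U})"
  proof
    show "{x \<in> topspace Y. q x \<in> q ` U} \<subseteq> (\<Union>g\<in>carrier G. {x \<in> topspace Y. \<phi> g x \<in> U})"
    proof
      fix x assume "x \<in> {x \<in> topspace Y. q x \<in> q ` U}"
      then obtain u where u: "x \<in> topspace Y" "u \<in> U" "q x = q u" by blast
      then obtain g where "g \<in> carrier G" "u = \<phi> g x" using orbit_eqD U by blast
      then show "x \<in> (\<Union>g\<in>carrier G. {x \<in> topspace Y. \<phi> g x \<in> U})" using u by blast
    qed
    show "(\<Union>g\<in>carrier G. {x \<in> topspace Y. \<phi> g x \<in> U}) \<subseteq> {x \<in> topspace Y. q x \<in> q ` U}"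
      using orbit_eqI by blast
  qed
  also have "openin Y \<dots>"
    by (intro openin_Union[of "(\<lambda>g. {x \<in> topspace Y. \<phi> g x \<in> U}) ` carrier G"])
      (use cont assms in \<open>auto intro: openin_continuous_map_preimage\<close>)
  finally show "openin Y {x \<in> topspace Y. q x \<in> q ` U}" .
qed

lemma gcomplex_sing: "gcomplex G (sing Y \<phi>)"
proof (unfold_locales, simp_all only: sing_simps bdry_sing act_sing mem_Collect_eq)
  fix n g \<sigma> assume g: "g \<in> carrier G" and \<sigma>: "singular_simplex n Y \<sigma>"
  show "singular_simplex n Y (simplex_map n (\<phi> g) \<sigma>)"
    by (rule singular_simplex_simplex_map[OF \<sigma> cont[OF g]])
  show "g = \<one>" if "simplex_map n (\<phi> g) \<sigma> = \<sigma>"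
  proof -
    \<comment> \<open>Freeness on simplices is read off at a single point, the first vertex.\<close>
    let ?v = "\<lambda>j::nat. if j = 0 then 1 else (0::real)"
    have "\<phi> g (\<sigma> ?v) = \<sigma> ?v"
      using fun_cong[OF that, of ?v] unfolding simplex_map_def restrict_def o_def by (simp only: simplex_vertex_in if_True)
    then show ?thesis using free[OF g singular_simplex_in_topspace[OF \<sigma> simplex_vertex_in]] by blast
  qed
  show "chain_boundary n (frag_of (simplex_map n (\<phi> g) \<sigma>)) = chain_map (n - 1) (\<phi> g) (chain_boundary n (frag_of \<sigma>))"
    using chain_boundary_chain_map[of n Y "frag_of \<sigma>" "\<phi> g"] \<sigma> by (simp add: singular_chain_of)
next
  fix n g h \<sigma> assume g: "g \<in> carrier G" and h: "h \<in> carrier G" and \<sigma>: "singular_simplex n Y \<sigma>"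
  show "simplex_map n (\<phi> (g \<otimes> h)) \<sigma> = simplex_map n (\<phi> g) (simplex_map n (\<phi> h) \<sigma>)"
    unfolding simplex_map_compose_on by (rule simplex_map_eq[OF \<sigma>]) (rule mult[OF g h])
next
  fix n \<sigma> assume \<sigma>: "singular_simplex n Y \<sigma>"
  show "simplex_map n (\<phi> \<one>) \<sigma> = \<sigma>" by (rule simplex_map_id_gen[OF \<sigma> one])
  show "Poly_Mapping.keys (chain_boundary n (frag_of \<sigma>)) \<subseteq> singular_simplex_set (n - 1) Y"
    using singular_chain_boundary[of n Y "frag_of \<sigma>"] \<sigma> by (simp add: singular_chain_of singular_chain_def)
  show "chain_boundary (n - 1) (chain_boundary n (frag_of \<sigma>)) = 0"
    using chain_boundary_boundary[of n Y "frag_of \<sigma>"] \<sigma> by (simp add: singular_chain_of)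
next
  fix \<sigma> assume "singular_simplex 0 Y \<sigma>"
  show "chain_boundary 0 (frag_of \<sigma>) = 0" by (simp add: chain_boundary_def)
next
  fix \<sigma> assume "singular_simplex 1 Y \<sigma>"
  show "aug (chain_boundary 1 (frag_of \<sigma>)) = 0"
    by (simp add: chain_boundary_of ev_add ev_cmul ev_diff)
qed

text \<open>The sets where the two maps differ by a fixed group element are open and disjoint.\<close>
lemma lifts_differ_by_element:
  assumes C: "connectedin P C" "C \<noteq> {}"
    and f: "continuous_map (subtopology P C) Y f" and h: "continuous_map (subtopology P C) Y h"
    and eq: "\<And>x. x \<in> C \<Longrightarrow> q (f x) = q (h x)"
  obtains g where "g \<in> carrier G" "\<And>x. x \<in> C \<Longrightarrow> h x = \<phi> g (f x)"
proof -
  have CP: "C \<subseteq> topspace P" using C(1) by (simp add: connectedin_def)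
  have ts: "topspace (subtopology P C) = C" using CP by auto
  have fY: "f x \<in> topspace Y" and hY: "h x \<in> topspace Y" if "x \<in> C" for x
    using that f h unfolding continuous_map_def ts by blast+
  define S where "S g = {x \<in> C. h x = \<phi> g (f x)}" for g
  have S_open: "openin (subtopology P C) (S g)" if g: "g \<in> carrier G" for g
  proof (subst openin_subopen, intro ballI)
    fix x assume x: "x \<in> S g"
    then have xC: "x \<in> C" and hx: "h x = \<phi> g (f x)" by (auto simp: S_def)
    obtain U where U: "openin Y U" "f x \<in> U" "\<And>g u. g \<in> carrier G \<Longrightarrow> u \<in> U \<Longrightarrow> \<phi> g u \<in> U \<Longrightarrow> g = \<one>"
      using nbhd[OF fY[OF xC]] by blast
    let ?A = "{x \<in> topspace (subtopology P C). f x \<in> U}"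
    let ?B = "{x \<in> topspace (subtopology P C). (\<phi> (inv g) \<circ> h) x \<in> U}"
    have "openin (subtopology P C) ?A" by (rule openin_continuous_map_preimage[OF f U(1)])
    moreover have "openin (subtopology P C) ?B"
      by (rule openin_continuous_map_preimage[OF continuous_map_compose[OF h cont] U(1)]) (use g in simp)
    ultimately have "openin (subtopology P C) (?A \<inter> ?B)" by (rule openin_Int)
    moreover have "x \<in> ?A \<inter> ?B"
      using xC U(2) hx inv_left[OF g fY[OF xC]] unfolding ts by simp
    moreover have "?A \<inter> ?B \<subseteq> S g"
    proof
      fix y assume "y \<in> ?A \<inter> ?B"
      then have y: "y \<in> C" "f y \<in> U" "\<phi> (inv g) (h y) \<in> U" unfolding ts by auto
      obtain g' where g': "g' \<in> carrier G" "h y = \<phi> g' (f y)"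
        using orbit_eqD[OF fY[OF y(1)] hY[OF y(1)] eq[OF y(1)]] by blast
      have "\<phi> (inv g \<otimes> g') (f y) = \<phi> (inv g) (h y)"
        using mult[of "inv g" g' "f y"] g g' fY[OF y(1)] by simp
      then have "inv g \<otimes> g' = \<one>" using U(3)[of "inv g \<otimes> g'" "f y"] y g g' by simp
      then have "g' = g" using g g' by (metis inv_equality inv_inv inv_closed)
      then show "y \<in> S g" using y g' by (simp add: S_def)
    qed
    ultimately show "\<exists>T. openin (subtopology P C) T \<and> x \<in> T \<and> T \<subseteq> S g" by blast
  qed
  obtain x0 where x0: "x0 \<in> C" using C(2) by blast
  obtain g where g: "g \<in> carrier G" "h x0 = \<phi> g (f x0)"
    using orbit_eqD[OF fY[OF x0] hY[OF x0] eq[OF x0]] by blast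
  let ?R = "\<Union>g'\<in>carrier G - {g}. S g'"
  have R_open: "openin (subtopology P C) ?R" using S_open by (intro openin_Union) auto
  have cover: "C \<subseteq> S g \<union> ?R"
  proof
    fix x assume x: "x \<in> C"
    obtain g' where "g' \<in> carrier G" "h x = \<phi> g' (f x)"
      using orbit_eqD[OF fY[OF x] hY[OF x] eq[OF x]] by blast
    then show "x \<in> S g \<union> ?R" using x by (auto simp: S_def)
  qed
  have disj: "S g \<inter> ?R = {}"
  proof (rule ccontr)
    assume "S g \<inter> ?R \<noteq> {}"
    then obtain x g' where x: "x \<in> C" "h x = \<phi> g (f x)" "g' \<in> carrier G" "g' \<noteq> g" "h x = \<phi> g' (f x)"
      unfolding S_def by blast
    then have "\<phi> (inv g \<otimes> g') (f x) = \<phi> (inv g) (\<phi> g (f x))"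
      using mult[of "inv g" g' "f x"] g(1) fY[OF x(1)] by simp
    then have "\<phi> (inv g \<otimes> g') (f x) = f x" using inv_left[OF g(1) fY[OF x(1)]] by simp
    then have "inv g \<otimes> g' = \<one>" using free[OF _ fY[OF x(1)]] g(1) x(3) by simp
    then show False using g(1) x(3,4) by (metis inv_equality inv_inv inv_closed)
  qed
  have conn: "connected_space (subtopology P C)" using C(1) by (simp add: connectedin_def)
  have "?R = {}"
  proof (rule ccontr)
    assume "?R \<noteq> {}"
    moreover have "S g \<noteq> {}" using x0 g by (auto simp: S_def)
    moreover have "topspace (subtopology P C) \<subseteq> S g \<union> ?R" using cover ts by simp
    ultimately show False
      using conn S_open[OF g(1)] R_open disj unfolding connected_space_def by blast
  qed
  then have "C \<subseteq> S g" using cover by blast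
  then show ?thesis using that[OF g(1)] by (auto simp: S_def)
qed

section \<open>Lifting singular simplices to the covering space\<close>

definition liftable :: "((nat \<Rightarrow> real) \<Rightarrow> 'a set) \<Rightarrow> (nat \<Rightarrow> real) set \<Rightarrow> bool" where
  "liftable \<sigma> K \<longleftrightarrow> (\<exists>f. continuous_map (subtopology (powertop_real UNIV) K) Y f \<and> (\<forall>x\<in>K. q (f x) = \<sigma> x))"

lemma liftable_mono: "liftable \<sigma> K \<Longrightarrow> K' \<subseteq> K \<Longrightarrow> liftable \<sigma> K'"
  unfolding liftable_def using continuous_map_from_subtopology_mono by blast

text \<open>On the connected overlap the two lifts differ by one group element; translating one of
  them by it makes them paste. Connectedness here admits the empty overlap, which is treated
  separately.\<close>

lemma liftable_Un:
  assumes A: "closedin (powertop_real UNIV) A" "liftable \<sigma> A"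
    and B: "closedin (powertop_real UNIV) B" "liftable \<sigma> B"
    and AB: "connectedin (powertop_real UNIV) (A \<inter> B)"
  shows "liftable \<sigma> (A \<union> B)"
proof -
  let ?P = "powertop_real (UNIV :: nat set)"
  obtain f where f: "continuous_map (subtopology ?P A) Y f" "\<And>x. x \<in> A \<Longrightarrow> q (f x) = \<sigma> x"
    using A(2) unfolding liftable_def by blast
  obtain h where h: "continuous_map (subtopology ?P B) Y h" "\<And>x. x \<in> B \<Longrightarrow> q (h x) = \<sigma> x"
    using B(2) unfolding liftable_def by blast
  have hY: "h x \<in> topspace Y" if "x \<in> B" for x
    using h(1) that unfolding continuous_map_def by auto
  obtain h' where h': "continuous_map (subtopology ?P B) Y h'" "\<And>x. x \<in> B \<Longrightarrow> q (h' x) = \<sigma> x"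
    "\<And>x. x \<in> A \<inter> B \<Longrightarrow> h' x = f x"
  proof (cases "A \<inter> B = {}")
    case True
    then show ?thesis using that[OF h] by blast
  next
    case False
    have "continuous_map (subtopology ?P (A \<inter> B)) Y h" "continuous_map (subtopology ?P (A \<inter> B)) Y f"
      using continuous_map_from_subtopology_mono[OF h(1), of "A \<inter> B"]
        continuous_map_from_subtopology_mono[OF f(1), of "A \<inter> B"] by auto
    then obtain g where g: "g \<in> carrier G" "\<And>x. x \<in> A \<inter> B \<Longrightarrow> f x = \<phi> g (h x)"
      using lifts_differ_by_element[OF AB False, of h f] f(2) h(2) by auto
    show ?thesis
    proof (rule that[of "\<phi> g \<circ> h"])
      show "continuous_map (subtopology ?P B) Y (\<phi> g \<circ> h)" by (rule continuous_map_compose[OF h(1) cont[OF g(1)]])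
      show "q ((\<phi> g \<circ> h) x) = \<sigma> x" if "x \<in> B" for x
        using orbit_eqI[OF g(1) hY[OF that]] h(2)[OF that] by simp
      show "(\<phi> g \<circ> h) x = f x" if "x \<in> A \<inter> B" for x using g(2)[OF that] by simp
    qed
  qed
  let ?X = "subtopology ?P (A \<union> B)"
  define k where "k x = (if x \<in> A then f x else h' x)" for x
  have "continuous_map ?X Y k"
  proof (rule pasting_lemma_closed[where I = "{True, False}" and T = "\<lambda>b. if b then A else B" and f = "\<lambda>b. if b then f else h'"])
    show "closedin ?X (if i then A else B)" for i
      using A(1) B(1) by (auto intro: closedin_subset_topspace)
    show "continuous_map (subtopology ?X (if i then A else B)) Y (if i then f else h')" for i
      using f(1) h'(1) by (simp add: subtopology_subtopology Int_absorb1)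
    show "(if i then f else h') x = (if j then f else h') x"
      if "x \<in> topspace ?X \<inter> (if i then A else B) \<inter> (if j then A else B)" for i j x
      using that h'(3) by (auto split: if_splits)
    show "\<exists>j. j \<in> {True, False} \<and> x \<in> (if j then A else B) \<and> k x = (if j then f else h') x"
      if "x \<in> topspace ?X" for x
      using that by (intro exI[of _ "x \<in> A"]) (auto simp: k_def)
  qed simp
  moreover have "q (k x) = \<sigma> x" if "x \<in> A \<union> B" for x
    using that f(2) h'(2) by (auto simp: k_def)
  ultimately show ?thesis unfolding liftable_def by blast
qed

text \<open>On a set \<open>U\<close> disjoint from its translates the orbit map is injective and
  open, so its inverse \<open>s\<close> is continuous and composes with \<open>\<sigma>\<close> to a
  lift.\<close>

lemma liftable_local:
  assumes \<sigma>: "continuous_map (subtopology (powertop_real UNIV) S) Q \<sigma>" and x: "x \<in> S"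
  obtains W where "openin (powertop_real UNIV) W" "x \<in> W" "liftable \<sigma> (W \<inter> S)"
proof -
  let ?P = "powertop_real (UNIV :: nat set)"
  have ts: "topspace (subtopology ?P S) = S" by simp
  have "\<sigma> x \<in> topspace Q" using \<sigma> x unfolding continuous_map_def ts by blast
  then obtain y where y: "y \<in> topspace Y" "\<sigma> x = q y"
    by (auto simp: topspace_orbit_space orbits_def)
  obtain U where U: "openin Y U" "y \<in> U" "\<And>g u. g \<in> carrier G \<Longrightarrow> u \<in> U \<Longrightarrow> \<phi> g u \<in> U \<Longrightarrow> g = \<one>"
    using nbhd[OF y(1)] by blast
  have UY: "U \<subseteq> topspace Y" by (rule openin_subset[OF U(1)])
  have inj: "u = u'" if "u \<in> U" "u' \<in> U" "q u = q u'" for u u'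
  proof -
    have uY: "u \<in> topspace Y" "u' \<in> topspace Y" using that(1,2) UY by blast+
    note quu = that(3)
    obtain g where g: "g \<in> carrier G" "u' = \<phi> g u" using orbit_eqD[OF uY quu] by metis
    have "\<phi> g u \<in> U" using that(2) unfolding g(2) .
    then have "g = \<one>" by (rule U(3)[OF g(1) that(1)])
    then show ?thesis using g(2) one[OF uY(1)] by (simp only:)
  qed
  let ?D = "{z \<in> topspace (subtopology ?P S). \<sigma> z \<in> q ` U}"
  have "openin (subtopology ?P S) ?D"
    by (rule openin_continuous_map_preimage[OF \<sigma> open_q[OF U(1)]])
  then obtain W where W: "openin ?P W" "?D = W \<inter> S"
    unfolding openin_subtopology by blast
  define s where "s v = (SOME u. u \<in> U \<and> q u = v)" for v
  have s: "s v \<in> U" "q (s v) = v" if "v \<in> q ` U" for v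
    using that someI_ex[of "\<lambda>u. u \<in> U \<and> q u = v"] unfolding s_def by blast+
  have D: "z \<in> W \<inter> S \<longleftrightarrow> z \<in> S \<and> \<sigma> z \<in> q ` U" for z unfolding W(2)[symmetric] ts by blast
  show ?thesis
  proof (rule that[OF W(1)])
    show "x \<in> W" using D[of x] x y(2) U(2) by blast
    have "continuous_map (subtopology ?P (W \<inter> S)) Y (s \<circ> \<sigma>)"
      unfolding continuous_map_def
    proof (intro conjI allI impI)
      show "s \<circ> \<sigma> \<in> topspace (subtopology ?P (W \<inter> S)) \<rightarrow> topspace Y"
      proof (rule funcsetI)
        fix z assume "z \<in> topspace (subtopology ?P (W \<inter> S))"
        then have "z \<in> W \<inter> S" by simp
        then have "s (\<sigma> z) \<in> U" unfolding D by (intro s(1)) blast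
        then show "(s \<circ> \<sigma>) z \<in> topspace Y" using UY by auto
      qed
      fix O' assume O': "openin Y O'"
      have eq: "{z \<in> topspace (subtopology ?P (W \<inter> S)). (s \<circ> \<sigma>) z \<in> O'}
          = {z \<in> topspace (subtopology ?P S). \<sigma> z \<in> q ` (O' \<inter> U)} \<inter> (W \<inter> S)"
      proof (rule Set.set_eqI, rule iffI)
        fix z assume "z \<in> {z \<in> topspace (subtopology ?P (W \<inter> S)). (s \<circ> \<sigma>) z \<in> O'}"
        then have z: "z \<in> W \<inter> S" "s (\<sigma> z) \<in> O'" by simp_all
        then have "\<sigma> z \<in> q ` U" unfolding D by blast
        then have "\<sigma> z = q (s (\<sigma> z))" "s (\<sigma> z) \<in> O' \<inter> U" using s[of "\<sigma> z"] z(2) by simp_all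
        then show "z \<in> {z \<in> topspace (subtopology ?P S). \<sigma> z \<in> q ` (O' \<inter> U)} \<inter> (W \<inter> S)"
          using z(1) unfolding ts by blast
      next
        fix z assume "z \<in> {z \<in> topspace (subtopology ?P S). \<sigma> z \<in> q ` (O' \<inter> U)} \<inter> (W \<inter> S)"
        then obtain u where z: "z \<in> W \<inter> S" "u \<in> O'" "u \<in> U" "\<sigma> z = q u" by blast
        have "\<sigma> z \<in> q ` U" using z(3,4) by blast
        note s' = s[OF this]
        have "s (\<sigma> z) = u" by (rule inj[OF s'(1) z(3)]) (rule trans[OF s'(2) z(4)])
        then show "z \<in> {z \<in> topspace (subtopology ?P (W \<inter> S)). (s \<circ> \<sigma>) z \<in> O'}" using z by simp
      qed
      have "openin (subtopology ?P S) {z \<in> topspace (subtopology ?P S). \<sigma> z \<in> q ` (O' \<inter> U)}"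
        by (rule openin_continuous_map_preimage[OF \<sigma> open_q[OF openin_Int[OF O' U(1)]]])
      then have "openin (subtopology (subtopology ?P S) (W \<inter> S)) ({z \<in> topspace (subtopology ?P S). \<sigma> z \<in> q ` (O' \<inter> U)} \<inter> (W \<inter> S))"
        by (rule openin_subtopology_Int)
      then show "openin (subtopology ?P (W \<inter> S)) {z \<in> topspace (subtopology ?P (W \<inter> S)). (s \<circ> \<sigma>) z \<in> O'}"
        unfolding eq subtopology_subtopology by (simp add: Int_absorb1)
    qed
    then show "liftable \<sigma> (W \<inter> S)"
      unfolding liftable_def
    proof (intro exI[of _ "s \<circ> \<sigma>"] conjI ballI)
      fix z assume "z \<in> W \<inter> S"
      then have "\<sigma> z \<in> q ` U" unfolding D by blast
      then show "q ((s \<circ> \<sigma>) z) = \<sigma> z" using s(2) by simp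
    qed
  qed
qed

text \<open>The simplex is cut into boxes by bisecting the coordinates until each box lies in an evenly
  covered set; lifts on the two halves of a box are matched along their convex intersection.\<close>
lemma liftable_simplex:
  assumes \<sigma>: "continuous_map (subtopology (powertop_real UNIV) (standard_simplex n)) Q \<sigma>"
  shows "liftable \<sigma> (standard_simplex n)"
proof -
  let ?P = "powertop_real (UNIV :: nat set)" and ?D = "standard_simplex n"
  let ?C = "{W. openin ?P W \<and> liftable \<sigma> (W \<inter> ?D)}"
  have "?D \<subseteq> \<Union>?C"
  proof
    fix x assume "x \<in> ?D"
    from liftable_local[OF \<sigma> this] show "x \<in> \<Union>?C" by blast
  qed
  \<comment> \<open>The Lebesgue number of the cover by sets over which \<open>\<sigma>\<close>
    lifts.\<close>
  note small_sets = Simplices.llemma[of n ?C, OF this]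
  obtain d where d: "0 < d"
    and small: "\<And>K. K \<subseteq> ?D \<Longrightarrow> (\<And>x y i. i \<le> n \<Longrightarrow> x \<in> K \<Longrightarrow> y \<in> K \<Longrightarrow> \<bar>x i - y i\<bar> \<le> d) \<Longrightarrow> \<exists>U. U \<in> ?C \<and> K \<subseteq> U"
    by (rule small_sets) blast+
  obtain N where N: "(1/2::real) ^ N < d" using real_arch_pow_inv[OF d, of "1/2"] by auto
  define box where "box a m = {x \<in> ?D. \<forall>i\<le>n. a i \<le> x i \<and> x i \<le> a i + (1/2) ^ m i}" for a :: "nat \<Rightarrow> real" and m :: "nat \<Rightarrow> nat"
  have closed_le: "closedin ?P {x. x i \<le> c}" and closed_ge: "closedin ?P {x. c \<le> x i}" for i c
    using closedin_continuous_map_preimage[of ?P euclideanreal "\<lambda>x. x i" "{..c}"]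
      closedin_continuous_map_preimage[of ?P euclideanreal "\<lambda>x. x i" "{c..}"]
      continuous_map_product_projection[of i UNIV "\<lambda>_. euclideanreal"] by (simp_all add: closed_closedin[symmetric])
  have box_closed: "closedin ?P (box a m)" for a m
  proof -
    have "box a m = ?D \<inter> (\<Inter>i\<in>{..n}. {x. a i \<le> x i} \<inter> {x. x i \<le> a i + (1/2) ^ m i})"
      by (auto simp: box_def)
    moreover have "closedin ?P \<dots>"
      by (intro closedin_Int closedin_INT closedin_standard_simplex closed_le closed_ge) auto
    ultimately show ?thesis by simp
  qed
  have box_convex: "(\<lambda>i. (1 - u) * x i + u * y i) \<in> box a m"
    if "x \<in> box a m" "y \<in> box a m" "0 \<le> u" "u \<le> 1" for a m x y u
  proof -
    have "a i \<le> (1 - u) * x i + u * y i \<and> (1 - u) * x i + u * y i \<le> a i + (1/2) ^ m i" if i: "i \<le> n" for i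
    proof -
      have "(1 - u) * a i + u * a i \<le> (1 - u) * x i + u * y i"
        using i \<open>x \<in> box a m\<close> \<open>y \<in> box a m\<close> \<open>0 \<le> u\<close> \<open>u \<le> 1\<close> by (intro add_mono mult_left_mono) (auto simp: box_def)
      moreover have "(1 - u) * x i + u * y i \<le> (1 - u) * (a i + (1/2) ^ m i) + u * (a i + (1/2) ^ m i)"
        using i \<open>x \<in> box a m\<close> \<open>y \<in> box a m\<close> \<open>0 \<le> u\<close> \<open>u \<le> 1\<close> by (intro add_mono mult_left_mono) (auto simp: box_def)
      ultimately show ?thesis by (simp add: algebra_simps)
    qed
    then show ?thesis using that convex_standard_simplex[of x n y u] by (simp add: box_def)
  qed
  have "liftable \<sigma> (box a m)" for a m
  \<comment> \<open>The measure counts the bisections left until every side of the box is shorter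
    than the Lebesgue number \<open>d\<close>.\<close>
  proof (induction "\<Sum>i\<le>n. N - m i" arbitrary: a m rule: less_induct)
    case less
    show ?case
    proof (cases "\<forall>i\<le>n. N \<le> m i")
      case True
      have "\<exists>U. U \<in> ?C \<and> box a m \<subseteq> U"
      proof (rule small)
        show "box a m \<subseteq> ?D" by (auto simp: box_def)
        fix x y i assume i: "i \<le> n" and "x \<in> box a m" "y \<in> box a m"
        then have "a i \<le> x i" "x i \<le> a i + (1/2) ^ m i" "a i \<le> y i" "y i \<le> a i + (1/2) ^ m i"
          by (simp_all add: box_def)
        moreover have "(1/2::real) ^ m i \<le> (1/2) ^ N" using True i by (intro power_decreasing) auto
        ultimately show "\<bar>x i - y i\<bar> \<le> d" using N by linarith
      qed
      then obtain U where U: "liftable \<sigma> (U \<inter> ?D)" "box a m \<subseteq> U" by blast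
      have "box a m \<subseteq> U \<inter> ?D" using U(2) by (auto simp: box_def)
      then show ?thesis by (rule liftable_mono[OF U(1)])
    next
      case False
      then obtain i where i: "i \<le> n" "m i < N" by (meson not_le)
      define m' where "m' = m(i := Suc (m i))"
      define a' where "a' = a(i := a i + (1/2) ^ Suc (m i))"
      have "(\<Sum>j\<le>n. N - m' j) < (\<Sum>j\<le>n. N - m j)"
        using i by (intro sum_strict_mono_ex1) (auto simp: m'_def)
      then have l1: "liftable \<sigma> (box a m')" and l2: "liftable \<sigma> (box a' m')"
        using less[of m'] by blast+
      define h H :: real where "h = (1/2) ^ Suc (m i)" and "H = (1/2) ^ m i"
      have half: "h + h = H" and pos: "0 \<le> h" by (simp_all add: h_def H_def)
      have m': "(1/2::real) ^ m' i = h" "\<And>j. j \<noteq> i \<Longrightarrow> m' j = m j" by (simp_all add: m'_def h_def)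
      have a': "a' i = a i + h" "\<And>j. j \<noteq> i \<Longrightarrow> a' j = a j" by (simp_all add: a'_def h_def)
      define cond where "cond x j \<longleftrightarrow> a j \<le> x j \<and> x j \<le> a j + (1/2) ^ m j" for x :: "nat \<Rightarrow> real" and j
      have split: "(\<forall>j\<le>n. P j) \<longleftrightarrow> P i \<and> (\<forall>j\<le>n. j \<noteq> i \<longrightarrow> P j)" for P
        using i(1) by blast
      have in0: "x \<in> box a m \<longleftrightarrow> x \<in> ?D \<and> (a i \<le> x i \<and> x i \<le> a i + H) \<and> (\<forall>j\<le>n. j \<noteq> i \<longrightarrow> cond x j)" for x
        unfolding box_def mem_Collect_eq split[of "\<lambda>j. a j \<le> x j \<and> x j \<le> a j + (1/2) ^ m j"] cond_def H_def ..
      have in1: "x \<in> box a m' \<longleftrightarrow> x \<in> ?D \<and> (a i \<le> x i \<and> x i \<le> a i + h) \<and> (\<forall>j\<le>n. j \<noteq> i \<longrightarrow> cond x j)" for x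
        unfolding box_def mem_Collect_eq split[of "\<lambda>j. a j \<le> x j \<and> x j \<le> a j + (1/2) ^ m' j"] cond_def m'(1)
        using m'(2) by metis
      have in2: "x \<in> box a' m' \<longleftrightarrow> x \<in> ?D \<and> (a i + h \<le> x i \<and> x i \<le> a i + h + h) \<and> (\<forall>j\<le>n. j \<noteq> i \<longrightarrow> cond x j)" for x
        unfolding box_def mem_Collect_eq split[of "\<lambda>j. a' j \<le> x j \<and> x j \<le> a' j + (1/2) ^ m' j"] cond_def m'(1) a'(1)
        using m'(2) a'(2) by metis
      have "box a m = box a m' \<union> box a' m'"
      proof (rule Set.set_eqI)
        fix x show "x \<in> box a m \<longleftrightarrow> x \<in> box a m' \<union> box a' m'"
        proof -
          have "a i \<le> x i \<and> x i \<le> a i + H \<longleftrightarrow> (a i \<le> x i \<and> x i \<le> a i + h) \<or> (a i + h \<le> x i \<and> x i \<le> a i + h + h)"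
            using half pos by argo
          then show ?thesis unfolding Un_iff in0 in1 in2 by blast
        qed
      qed
      moreover have "liftable \<sigma> (box a m' \<union> box a' m')"
      proof (rule liftable_Un[OF box_closed l1 box_closed l2])
        show "connectedin ?P (box a m' \<inter> box a' m')"
          by (rule connectedin_convex_powertop) (use box_convex in blast)
      qed
      ultimately show ?thesis by (simp only:)
    qed
  qed
  moreover have "box (\<lambda>_. 0) (\<lambda>_. 0) = ?D"
    by (auto simp: box_def standard_simplex_def)
  ultimately show ?thesis by metis
qed

lemma simplex_lift_exists:
  assumes "singular_simplex n Q \<tau>"
  obtains \<sigma> where "singular_simplex n Y \<sigma>" "simplex_map n q \<sigma> = \<tau>"
proof -
  have "liftable \<tau> (standard_simplex n)"
    using liftable_simplex assms unfolding singular_simplex_def by blast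
  then obtain f where f: "continuous_map (subtopology (powertop_real UNIV) (standard_simplex n)) Y f"
    "\<And>x. x \<in> standard_simplex n \<Longrightarrow> q (f x) = \<tau> x" unfolding liftable_def by blast
  show ?thesis
  proof (rule that[of "restrict f (standard_simplex n)"])
    show "singular_simplex n Y (restrict f (standard_simplex n))"
      using f(1) by (simp add: singular_simplex_def)
    show "simplex_map n q (restrict f (standard_simplex n)) = \<tau>"
    proof
      fix x show "simplex_map n q (restrict f (standard_simplex n)) x = \<tau> x"
        using f(2)[of x] assms unfolding singular_simplex_def extensional_def simplex_map_def
        by (cases "x \<in> standard_simplex n") auto
    qed
  qed
qed

lemma simplex_lift_unique:
  assumes \<sigma>: "singular_simplex n Y \<sigma>" and \<rho>: "singular_simplex n Y \<rho>" and eq: "simplex_map n q \<sigma> = simplex_map n q \<rho>"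
  obtains g where "g \<in> carrier G" "\<rho> = simplex_map n (\<phi> g) \<sigma>"
proof -
  have "q (\<sigma> x) = q (\<rho> x)" if "x \<in> standard_simplex n" for x
    using fun_cong[OF eq, of x] that by (simp add: simplex_map_def)
  then obtain g where g: "g \<in> carrier G" "\<And>x. x \<in> standard_simplex n \<Longrightarrow> \<rho> x = \<phi> g (\<sigma> x)"
    using lifts_differ_by_element[OF connectedin_standard_simplex nonempty_standard_simplex, of n \<sigma> \<rho>] \<sigma> \<rho>
    unfolding singular_simplex_def by blast
  have "\<rho> = simplex_map n (\<phi> g) \<sigma>"
  proof
    fix x show "\<rho> x = simplex_map n (\<phi> g) \<sigma> x"
      using g(2)[of x] \<rho> unfolding singular_simplex_def extensional_def simplex_map_def
      by (cases "x \<in> standard_simplex n") auto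
  qed
  then show ?thesis using that g(1) by blast
qed

text \<open>Any two lifts of a simplex are translates of each other, so the value at an arbitrarily
  chosen lift is well defined.\<close>

lemma invariant_cochain_descends:
  assumes "inv_cochain G (sing Y \<phi>) n a"
  obtains w where "\<And>\<sigma>. singular_simplex n Y \<sigma> \<Longrightarrow> w (simplex_map n q \<sigma>) = a \<sigma>"
proof (rule that)
  fix \<sigma> assume \<sigma>: "singular_simplex n Y \<sigma>"
  define \<rho> where "\<rho> = (SOME \<rho>. singular_simplex n Y \<rho> \<and> simplex_map n q \<rho> = simplex_map n q \<sigma>)"
  have \<rho>: "singular_simplex n Y \<rho>" "simplex_map n q \<rho> = simplex_map n q \<sigma>"
    using someI[of "\<lambda>\<rho>. singular_simplex n Y \<rho> \<and> simplex_map n q \<rho> = simplex_map n q \<sigma>" \<sigma>] \<sigma> unfolding \<rho>_def by blast+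
  obtain g where "g \<in> carrier G" "\<rho> = simplex_map n (\<phi> g) \<sigma>"
    using simplex_lift_unique[OF \<sigma> \<rho>(1) \<rho>(2)[symmetric]] by blast
  then have "a \<rho> = a \<sigma>" using assms \<sigma> unfolding inv_cochain_def by simp
  then show "(\<lambda>\<tau>. a (SOME \<rho>. singular_simplex n Y \<rho> \<and> simplex_map n q \<rho> = \<tau>)) (simplex_map n q \<sigma>) = a \<sigma>"
    by (simp add: \<rho>_def)
qed

lemma simplex_map_q_act:
  assumes "singular_simplex n Y \<sigma>" "g \<in> carrier G"
  shows "simplex_map n q (simplex_map n (\<phi> g) \<sigma>) = simplex_map n q \<sigma>"
  unfolding simplex_map_compose_on by (rule simplex_map_eq[OF assms(1)]) (rule orbit_eqI[OF assms(2)])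

lemma inv_cochain_pull: "inv_cochain G (sing Y \<phi>) n (\<lambda>\<sigma>. z (simplex_map n q \<sigma>))"
  unfolding inv_cochain_def by (simp add: simplex_map_q_act)

lemma ev_boundary_q:
  assumes "singular_simplex n Y \<sigma>"
  shows "ev w (chain_boundary n (frag_of (simplex_map n q \<sigma>))) = ev (\<lambda>\<sigma>. w (simplex_map (n - 1) q \<sigma>)) (chain_boundary n (frag_of \<sigma>))"
proof -
  have "chain_boundary n (frag_of (simplex_map n q \<sigma>)) = chain_map (n - 1) q (chain_boundary n (frag_of \<sigma>))"
    using chain_boundary_chain_map[of n Y "frag_of \<sigma>" q] assms by (simp add: singular_chain_of)
  then show ?thesis by (simp add: chain_map_def ev_frag_extend)
qed

lemma cocycle_pull:
  assumes "\<And>\<tau>. singular_simplex (Suc n) Q \<tau> \<Longrightarrow> [ev z (chain_boundary (Suc n) (frag_of \<tau>)) = 0] (mod m)"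
  shows "cocycle_mod m (sing Y \<phi>) n (\<lambda>\<sigma>. z (simplex_map n q \<sigma>))"
  unfolding cocycle_mod_def
proof
  fix \<sigma> assume "\<sigma> \<in> Bas (sing Y \<phi>) (Suc n)"
  then have \<sigma>: "singular_simplex (Suc n) Y \<sigma>" by simp
  show "[ev (\<lambda>\<sigma>. z (simplex_map n q \<sigma>)) (Bd (sing Y \<phi>) (Suc n) \<sigma>) = 0] (mod m)"
    using assms[OF singular_simplex_simplex_map[OF \<sigma> continuous_q]] ev_boundary_q[OF \<sigma>, of z] by simp
qed

text \<open>Exactness on the quotient becomes a statement about the free complex upstairs, where
  chain maps into \<open>EG\<close> can be compared.\<close>

lemma inv_coboundary_pull_iff:
  "inv_coboundary m G (sing Y \<phi>) n (\<lambda>\<sigma>. z (simplex_map n q \<sigma>)) \<longleftrightarrow>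
   (\<exists>w. \<forall>\<tau>. singular_simplex n Q \<tau> \<longrightarrow> [z \<tau> = ev w (chain_boundary n (frag_of \<tau>))] (mod m))" (is "?L \<longleftrightarrow> ?R")
proof
  assume ?L
  then obtain a where a: "inv_cochain G (sing Y \<phi>) (n - 1) a"
    and a': "\<forall>\<sigma>\<in>Bas (sing Y \<phi>) n. [z (simplex_map n q \<sigma>) = ev a (Bd (sing Y \<phi>) n \<sigma>)] (mod m)"
    unfolding inv_coboundary_def by blast
  obtain w where w: "\<And>\<sigma>. singular_simplex (n - 1) Y \<sigma> \<Longrightarrow> w (simplex_map (n - 1) q \<sigma>) = a \<sigma>"
    using invariant_cochain_descends[OF a] by blast
  have "[z \<tau> = ev w (chain_boundary n (frag_of \<tau>))] (mod m)" if \<tau>: "singular_simplex n Q \<tau>" for \<tau>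
  proof -
    obtain \<sigma> where \<sigma>: "singular_simplex n Y \<sigma>" "simplex_map n q \<sigma> = \<tau>" using simplex_lift_exists[OF \<tau>] by blast
    have "Poly_Mapping.keys (chain_boundary n (frag_of \<sigma>)) \<subseteq> {\<rho>. singular_simplex (n - 1) Y \<rho>}"
      using singular_chain_boundary[of n Y "frag_of \<sigma>"] \<sigma>(1) by (simp add: singular_chain_of singular_chain_def)
    then have "ev (\<lambda>\<rho>. w (simplex_map (n - 1) q \<rho>)) (chain_boundary n (frag_of \<sigma>)) = ev a (chain_boundary n (frag_of \<sigma>))"
      by (rule ev_cong_on) (drule CollectD, erule w)
    moreover have "[z \<tau> = ev a (chain_boundary n (frag_of \<sigma>))] (mod m)"
      using a'[rule_format, of \<sigma>] \<sigma> by simp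
    ultimately show ?thesis using ev_boundary_q[OF \<sigma>(1), of w] unfolding \<sigma>(2) by (simp only:)
  qed
  then show ?R by blast
next
  assume ?R
  then obtain w where w: "\<And>\<tau>. singular_simplex n Q \<tau> \<Longrightarrow> [z \<tau> = ev w (chain_boundary n (frag_of \<tau>))] (mod m)" by blast
  show ?L
    unfolding inv_coboundary_def
  proof (intro exI[of _ "\<lambda>\<sigma>. w (simplex_map (n - 1) q \<sigma>)"] conjI ballI inv_cochain_pull)
    fix \<sigma> assume "\<sigma> \<in> Bas (sing Y \<phi>) n"
    then have \<sigma>: "singular_simplex n Y \<sigma>" by simp
    show "[z (simplex_map n q \<sigma>) = ev (\<lambda>\<sigma>. w (simplex_map (n - 1) q \<sigma>)) (Bd (sing Y \<phi>) n \<sigma>)] (mod m)"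
      using w[OF singular_simplex_simplex_map[OF \<sigma> continuous_q]] ev_boundary_q[OF \<sigma>, of w] by simp
  qed
qed

end

section \<open>Complexes of tuples\<close>

fun lbd :: "'a list \<Rightarrow> ('a list \<Rightarrow>\<^sub>0 int)" where
  "lbd [] = 0"
| "lbd (x # xs) = frag_of xs - frag_extend (\<lambda>ys. frag_of (x # ys)) (lbd xs)"

lemma ev_lbd: "ev f (lbd xs) = lcob f xs"
  by (induction xs arbitrary: f) (simp_all add: ev_diff ev_frag_extend)

lemma lbd_map: "lbd (map h xs) = frag_extend (\<lambda>ys. frag_of (map h ys)) (lbd xs)"
  by (induction xs) (simp_all add: frag_extend_diff frag_extend_frag_extend)

lemma lbd_lbd: "frag_extend lbd (lbd xs) = 0"
proof (induction xs)
  case (Cons x xs)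
  have "frag_extend lbd (lbd (x # xs)) = lbd xs - frag_extend (\<lambda>ys. lbd (x # ys)) (lbd xs)"
    by (simp add: frag_extend_diff frag_extend_frag_extend)
  also have "frag_extend (\<lambda>ys. lbd (x # ys)) (lbd xs)
      = frag_extend frag_of (lbd xs) - frag_extend (\<lambda>ys. frag_of (x # ys)) (frag_extend lbd (lbd xs))"
    unfolding lbd.simps(2) frag_extend_diff_left frag_extend_frag_extend ..
  finally show ?case using Cons frag_expansion[of "lbd xs"] by simp
qed simp

lemma keys_lbd: "Poly_Mapping.keys (lbd xs) \<subseteq> {u @ w |u w. \<exists>x. xs = u @ x # w}"
proof (induction xs)
  case (Cons x xs)
  have "Poly_Mapping.keys (frag_extend (\<lambda>ys. frag_of (x # ys)) (lbd xs)) \<subseteq> {u @ w |u w. \<exists>y. x # xs = u @ y # w}"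
  proof (rule keys_frag_extend_subset)
    fix b assume "b \<in> Poly_Mapping.keys (lbd xs)"
    then obtain u w y where "b = u @ w" "xs = u @ y # w" using Cons by blast
    then have "x # b = (x # u) @ w" "x # xs = (x # u) @ y # w" by simp_all
    then show "Poly_Mapping.keys (frag_of (x # b)) \<subseteq> {u @ w |u w. \<exists>y. x # xs = u @ y # w}"
      unfolding keys_frag_of by blast
  qed
  moreover have "xs \<in> {u @ w |u w. \<exists>y. x # xs = u @ y # w}"
    by (rule CollectI, rule exI[of _ "[]"], rule exI[of _ xs]) simp
  ultimately show ?case using keys_diff[of "frag_of xs" "frag_extend (\<lambda>ys. frag_of (x # ys)) (lbd xs)"]
    by (simp add: keys_frag_of) blast
qed simp

lemma lbd_eq_sum: "lbd xs = (\<Sum>i<length xs. frag_cmul ((- 1) ^ i) (frag_of (take i xs @ drop (Suc i) xs)))"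
proof (induction xs)
  case (Cons x xs)
  have "frag_extend (\<lambda>ys. frag_of (x # ys)) (lbd xs)
      = (\<Sum>i<length xs. frag_cmul ((- 1) ^ i) (frag_of (x # take i xs @ drop (Suc i) xs)))"
    unfolding Cons by (simp add: frag_extend_sum frag_extend_cmul o_def)
  then show ?case
    by (simp add: sum.lessThan_Suc_shift sum_negf[symmetric] del: sum.lessThan_Suc)
qed simp

text \<open>Words of length \<open>n + 1\<close> have degree \<open>n\<close>. The boundary in
  degree 0 is cut off by hand because \<open>lbd [x]\<close> is the empty word, that is, the
  augmentation.\<close>

definition lists_cx :: "'a list set \<Rightarrow> ('g \<Rightarrow> 'a \<Rightarrow> 'a) \<Rightarrow> ('a list, 'g) gcx" where
  "lists_cx L a = \<lparr>Bas = \<lambda>n. {xs \<in> L. length xs = Suc n},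
                   Bd = \<lambda>n xs. if n = 0 then 0 else lbd xs,
                   Act = \<lambda>n g. map (a g)\<rparr>"

lemma lists_cx_simps [simp]:
  "Bas (lists_cx L a) n = {xs \<in> L. length xs = Suc n}"
  "Bd (lists_cx L a) n xs = (if n = 0 then 0 else lbd xs)"
  "Act (lists_cx L a) n g = map (a g)"
  by (simp_all add: lists_cx_def)

text \<open>Words may repeat letters, so this is the ordered chain complex. The set \<open>L\<close>
  is instantiated both by all words and by the words that span a simplex; closure under deletion
  makes the boundary land in it.\<close>

locale list_action = group G for G :: "('g, 'm) monoid_scheme" (structure) +
  fixes V :: "'a set" and L :: "'a list set" and a :: "'g \<Rightarrow> 'a \<Rightarrow> 'a"
  assumes L_V: "\<And>xs. xs \<in> L \<Longrightarrow> set xs \<subseteq> V"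
    and L_del: "\<And>u x w. u @ x # w \<in> L \<Longrightarrow> u @ w \<in> L"
    and L_act: "\<And>g xs. g \<in> carrier G \<Longrightarrow> xs \<in> L \<Longrightarrow> map (a g) xs \<in> L"
    and a_one: "\<And>x. x \<in> V \<Longrightarrow> a \<one> x = x"
    and a_mult: "\<And>g h x. g \<in> carrier G \<Longrightarrow> h \<in> carrier G \<Longrightarrow> x \<in> V \<Longrightarrow> a (g \<otimes> h) x = a g (a h x)"
    and a_free: "\<And>g x. g \<in> carrier G \<Longrightarrow> x \<in> V \<Longrightarrow> a g x = x \<Longrightarrow> g = \<one>"
begin

lemma keys_lbd_L:
  assumes "xs \<in> L" "length xs = Suc n"
  shows "Poly_Mapping.keys (lbd xs) \<subseteq> {xs \<in> L. length xs = n}"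
proof
  fix ys assume "ys \<in> Poly_Mapping.keys (lbd xs)"
  then obtain u w x where "ys = u @ w" "xs = u @ x # w" using keys_lbd[of xs] by blast
  then show "ys \<in> {xs \<in> L. length xs = n}" using assms L_del[of u x w] by simp
qed

lemma gcomplex_lists: "gcomplex G (lists_cx L a)"
proof (unfold_locales, simp_all only: lists_cx_simps mem_Collect_eq)
  fix n g xs assume g: "g \<in> carrier G" and xs: "xs \<in> L \<and> length xs = Suc n"
  show "map (a g) xs \<in> L \<and> length (map (a g) xs) = Suc n" using L_act g xs by simp
  show "g = \<one>" if "map (a g) xs = xs"
  proof -
    obtain y ys where "xs = y # ys" using xs by (cases xs) auto
    then show ?thesis using that a_free[OF g, of y] L_V[of xs] xs by simp
  qed
  show "(if n = 0 then 0 else lbd (map (a g) xs)) = act (lists_cx L a) (n - 1) g (if n = 0 then 0 else lbd xs)"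
    by (simp add: act_def lbd_map)
next
  fix n g h xs assume "g \<in> carrier G" "h \<in> carrier G" and xs: "xs \<in> L \<and> length xs = Suc n"
  then show "map (a (g \<otimes> h)) xs = map (a g) (map (a h) xs)"
    using a_mult[of g h] L_V[of xs] by (auto simp: subset_iff)
next
  fix n xs assume xs: "xs \<in> L \<and> length xs = Suc n"
  show "map (a \<one>) xs = xs" using a_one L_V[of xs] xs by (intro map_idI) blast
  show "Poly_Mapping.keys (if n = 0 then 0 else lbd xs) \<subseteq> {xs \<in> L. length xs = Suc (n - 1)}"
    using keys_lbd_L[of xs n] xs by (cases n) simp_all
  show "bdry (lists_cx L a) (n - 1) (if n = 0 then 0 else lbd xs) = 0"
  proof (cases "n \<le> 1")
    case True
    have "frag_extend (\<lambda>xs. 0) c = 0" for c :: "'a list \<Rightarrow>\<^sub>0 int" by (rule frag_extend_zero)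
    then show ?thesis using True by (cases n) (simp_all add: bdry_def lists_cx_def)
  next
    case False
    then show ?thesis using lbd_lbd[of xs] by (simp add: bdry_def lists_cx_def)
  qed
next
  fix xs assume "xs \<in> L \<and> length xs = Suc 0"
  show "(if (0::nat) = 0 then 0 else lbd xs) = 0" by simp
next
  fix xs assume "xs \<in> L \<and> length xs = Suc 1"
  then obtain x y where "xs = [x, y]" by (auto simp: length_Suc_conv)
  then show "aug (if (1::nat) = 0 then 0 else lbd xs) = 0" by (simp add: ev_diff)
qed

end

lemma bdry_lists:
  "bdry (lists_cx L a) n c = (if n = 0 then 0 else frag_extend lbd c)"
  by (simp add: bdry_def lists_cx_def frag_extend_zero)

lemma act_lists: "act (lists_cx L a) n g c = frag_extend (\<lambda>xs. frag_of (map (a g) xs)) c"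
  by (simp add: act_def)

lemma list_map_chain_map:
  assumes "\<And>xs. xs \<in> L \<Longrightarrow> set xs \<subseteq> V" "\<And>xs. xs \<in> L \<Longrightarrow> map h xs \<in> L'"
    and "\<And>g x. g \<in> carrier G \<Longrightarrow> x \<in> V \<Longrightarrow> h (a g x) = a' g (h x)"
  shows "equivariant_chain_map G (lists_cx L a) (lists_cx L' a') (\<lambda>n xs. frag_of (map h xs))"
  unfolding equivariant_chain_map_def bdry_lists act_lists lists_cx_simps frag_extend_of
proof (intro conjI allI ballI)
  fix n xs assume xs: "xs \<in> {xs \<in> L. length xs = Suc n}"
  show "Poly_Mapping.keys (frag_of (map h xs)) \<subseteq> {xs \<in> L'. length xs = Suc n}"
    using xs assms(2) by (simp add: keys_frag_of)
  show "(if n = 0 then 0 else lbd (map h xs)) = frag_extend (\<lambda>xs. frag_of (map h xs)) (if n = 0 then 0 else lbd xs)"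
    by (simp add: lbd_map)
  fix g assume g: "g \<in> carrier G"
  have "map h (map (a g) xs) = map (a' g) (map h xs)"
    using assms(1)[of xs] assms(3)[OF g] xs by (auto simp: subset_iff)
  then show "frag_of (map h (map (a g) xs)) = frag_of (map (a' g) (map h xs))" by (simp only:)
qed simp

section \<open>The vertex map from singular simplices to tuples\<close>

definition unit_vec :: "nat \<Rightarrow> nat \<Rightarrow> real" where "unit_vec i = (\<lambda>j. if j = i then 1 else 0)"

lemma unit_vec_in: "i \<le> n \<Longrightarrow> unit_vec i \<in> standard_simplex n"
  by (simp add: unit_vec_def)

lemma simplical_face_unit_vec: "simplical_face i (unit_vec j) = unit_vec (if j < i then j else Suc j)"
  by (rule ext) (auto simp: simplical_face_def unit_vec_def)

definition vertices :: "('a \<Rightarrow> 'v) \<Rightarrow> nat \<Rightarrow> ((nat \<Rightarrow> real) \<Rightarrow> 'a) \<Rightarrow> 'v list" where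
  "vertices \<Phi> n \<sigma> = map (\<lambda>i. \<Phi> (\<sigma> (unit_vec i))) [0..<Suc n]"

lemma length_vertices [simp]: "length (vertices \<Phi> n \<sigma>) = Suc n"
  by (simp add: vertices_def del: upt_Suc)

lemma nth_vertices: "i \<le> n \<Longrightarrow> vertices \<Phi> n \<sigma> ! i = \<Phi> (\<sigma> (unit_vec i))"
  by (simp add: vertices_def del: upt_Suc)

lemma vertices_singular_face:
  assumes "0 < n" "i \<le> n"
  shows "vertices \<Phi> (n - 1) (singular_face n i \<sigma>) = take i (vertices \<Phi> n \<sigma>) @ drop (Suc i) (vertices \<Phi> n \<sigma>)"
proof (rule nth_equalityI)
  show "length (vertices \<Phi> (n - 1) (singular_face n i \<sigma>)) = length (take i (vertices \<Phi> n \<sigma>) @ drop (Suc i) (vertices \<Phi> n \<sigma>))"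
    using assms by simp
  fix j assume "j < length (vertices \<Phi> (n - 1) (singular_face n i \<sigma>))"
  then have j: "j \<le> n - 1" by simp
  have "vertices \<Phi> (n - 1) (singular_face n i \<sigma>) ! j = \<Phi> (\<sigma> (simplical_face i (unit_vec j)))"
    unfolding nth_vertices[OF j] using unit_vec_in[OF j] by (simp add: singular_face_def)
  also have "\<dots> = vertices \<Phi> n \<sigma> ! (if j < i then j else Suc j)"
    unfolding simplical_face_unit_vec using j assms by (subst nth_vertices) auto
  also have "\<dots> = (take i (vertices \<Phi> n \<sigma>) @ drop (Suc i) (vertices \<Phi> n \<sigma>)) ! j"
    using assms j by (simp add: nth_append)
  finally show "vertices \<Phi> (n - 1) (singular_face n i \<sigma>) ! j = (take i (vertices \<Phi> n \<sigma>) @ drop (Suc i) (vertices \<Phi> n \<sigma>)) ! j" .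
qed

lemma set_vertices: "set (vertices \<Phi> n \<sigma>) = (\<lambda>i. \<Phi> (\<sigma> (unit_vec i))) ` {..n}"
  by (simp add: vertices_def atLeast0LessThan lessThan_Suc_atMost del: upt_Suc)

lemma lbd_vertices:
  assumes "0 < n"
  shows "lbd (vertices \<Phi> n \<sigma>) = frag_extend (\<lambda>\<sigma>. frag_of (vertices \<Phi> (n - 1) \<sigma>)) (chain_boundary n (frag_of \<sigma>))"
proof -
  have "frag_extend (\<lambda>\<sigma>. frag_of (vertices \<Phi> (n - 1) \<sigma>)) (chain_boundary n (frag_of \<sigma>))
      = (\<Sum>i\<le>n. frag_cmul ((- 1) ^ i) (frag_of (vertices \<Phi> (n - 1) (singular_face n i \<sigma>))))"
    using assms by (simp add: chain_boundary_of frag_extend_sum frag_extend_cmul o_def)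
  also have "\<dots> = (\<Sum>i\<le>n. frag_cmul ((- 1) ^ i) (frag_of (take i (vertices \<Phi> n \<sigma>) @ drop (Suc i) (vertices \<Phi> n \<sigma>))))"
    using assms by (intro sum.cong refl) (simp only: vertices_singular_face atMost_iff)
  finally show ?thesis by (simp add: lbd_eq_sum lessThan_Suc_atMost)
qed

text \<open>Only the values of \<open>\<Phi>\<close> at the corners of a simplex enter, so a
  discontinuous labelling still yields a chain map.\<close>

lemma vertices_chain_map:
  assumes \<Phi>: "\<And>y. y \<in> topspace Y \<Longrightarrow> \<Phi> y \<in> V"
    and eq: "\<And>g y. g \<in> carrier G \<Longrightarrow> y \<in> topspace Y \<Longrightarrow> \<Phi> (\<phi> g y) = a g (\<Phi> y)"
  shows "equivariant_chain_map G (sing Y \<phi>) (lists_cx {xs. set xs \<subseteq> V} a) (\<lambda>n \<sigma>. frag_of (vertices \<Phi> n \<sigma>))"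
  unfolding equivariant_chain_map_def bdry_lists act_lists lists_cx_simps sing_simps frag_extend_of
proof (intro conjI allI ballI)
  fix n \<sigma> assume "\<sigma> \<in> singular_simplex_set n Y"
  then have \<sigma>: "singular_simplex n Y \<sigma>" by simp
  have in_Y: "\<sigma> (unit_vec i) \<in> topspace Y" if "i \<le> n" for i
    by (rule singular_simplex_in_topspace[OF \<sigma> unit_vec_in[OF that]])
  have "set (vertices \<Phi> n \<sigma>) \<subseteq> V" unfolding set_vertices using \<Phi> in_Y by blast
  then show "Poly_Mapping.keys (frag_of (vertices \<Phi> n \<sigma>)) \<subseteq> {xs \<in> {xs. set xs \<subseteq> V}. length xs = Suc n}"
    by (simp add: keys_frag_of)
  show "(if n = 0 then 0 else lbd (vertices \<Phi> n \<sigma>)) = frag_extend (\<lambda>\<sigma>. frag_of (vertices \<Phi> (n - 1) \<sigma>)) (chain_boundary n (frag_of \<sigma>))"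
    using lbd_vertices[of n \<Phi> \<sigma>] by (simp add: chain_boundary_def)
  fix g assume g: "g \<in> carrier G"
  have "vertices \<Phi> n (simplex_map n (\<phi> g) \<sigma>) = map (a g) (vertices \<Phi> n \<sigma>)"
  proof (rule nth_equalityI)
    fix i assume "i < length (vertices \<Phi> n (simplex_map n (\<phi> g) \<sigma>))"
    then have i: "i \<le> n" by simp
    then show "vertices \<Phi> n (simplex_map n (\<phi> g) \<sigma>) ! i = map (a g) (vertices \<Phi> n \<sigma>) ! i"
      using eq[OF g in_Y[OF i]] unit_vec_in[OF i] by (simp add: nth_vertices simplex_map_def)
  qed simp
  then show "frag_of (vertices \<Phi> n (simplex_map n (\<phi> g) \<sigma>)) = frag_of (map (a g) (vertices \<Phi> n \<sigma>))" by (simp only:)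
qed simp

section \<open>Sorting tuples by level\<close>

text \<open>Exterior multiplication by \<open>v\<close>: insertion into a sorted word with the sign
  of the moves, and 0 if its level is already occupied.\<close>

fun wedge :: "('a \<Rightarrow> nat) \<Rightarrow> 'a \<Rightarrow> 'a list \<Rightarrow> ('a list \<Rightarrow>\<^sub>0 int)" where
  "wedge lev v [] = frag_of [v]"
| "wedge lev v (w # ws) = (if lev v < lev w then frag_of (v # w # ws)
     else if lev v = lev w then 0 else - frag_extend (\<lambda>ys. frag_of (w # ys)) (wedge lev v ws))"

fun sort_chain :: "('a \<Rightarrow> nat) \<Rightarrow> 'a list \<Rightarrow> ('a list \<Rightarrow>\<^sub>0 int)" where
  "sort_chain lev [] = frag_of []"
| "sort_chain lev (v # vs) = frag_extend (wedge lev v) (sort_chain lev vs)"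

abbreviation level_sorted :: "('a \<Rightarrow> nat) \<Rightarrow> 'a list \<Rightarrow> bool" where
  "level_sorted lev ws \<equiv> sorted_wrt (\<lambda>x y. lev x < lev y) ws"

lemma wedge_less: "(\<forall>w\<in>set ws. lev v < lev w) \<Longrightarrow> wedge lev v ws = frag_of (v # ws)"
  by (cases ws) auto

lemma keys_wedge:
  assumes "level_sorted lev ws"
  shows "Poly_Mapping.keys (wedge lev v ws) \<subseteq> {ys. level_sorted lev ys \<and> set ys = insert v (set ws) \<and> length ys = Suc (length ws)}"
  using assms
proof (induction ws)
  case Nil
  then show ?case by (simp add: keys_frag_of)
next
  case (Cons w ws)
  consider "lev v < lev w" | "lev v = lev w" | "lev w < lev v" by linarith
  then show ?case
  proof cases
    case 1
    then show ?thesis using Cons.prems by (auto simp: keys_frag_of)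
  next
    case 3
    have "Poly_Mapping.keys (frag_extend (\<lambda>ys. frag_of (w # ys)) (wedge lev v ws)) \<subseteq>
        {ys. level_sorted lev ys \<and> set ys = insert v (set (w # ws)) \<and> length ys = Suc (length (w # ws))}"
    proof (rule keys_frag_extend_subset)
      fix b assume "b \<in> Poly_Mapping.keys (wedge lev v ws)"
      then have "level_sorted lev b" "set b = insert v (set ws)" "length b = Suc (length ws)"
        using Cons by auto
      then show "Poly_Mapping.keys (frag_of (w # b)) \<subseteq>
          {ys. level_sorted lev ys \<and> set ys = insert v (set (w # ws)) \<and> length ys = Suc (length (w # ws))}"
        using Cons.prems 3 by (auto simp: keys_frag_of)
    qed
    then show ?thesis using 3 by simp
  qed simp
qed

lemma keys_sort_chain:
  "Poly_Mapping.keys (sort_chain lev vs) \<subseteq> {ys. level_sorted lev ys \<and> set ys = set vs \<and> length ys = length vs}"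
proof (induction vs)
  case Nil
  then show ?case by (simp add: keys_frag_of)
next
  case (Cons v vs)
  show ?case
    unfolding sort_chain.simps
  proof (rule keys_frag_extend_on[OF Cons])
    fix ws assume "ws \<in> {ys. level_sorted lev ys \<and> set ys = set vs \<and> length ys = length vs}"
    then show "Poly_Mapping.keys (wedge lev v ws) \<subseteq> {ys. level_sorted lev ys \<and> set ys = set (v # vs) \<and> length ys = length (v # vs)}"
      using keys_wedge[of lev ws v] by auto
  qed
qed

text \<open>The antiderivation rule of the exterior product, \<open>d(v ws) = ws - v d(ws)\<close>.
  Equal levels have to mean equal vertices, since otherwise a product set to 0 could have a nonzero
  right-hand side.\<close>

lemma lbd_wedge:
  assumes "level_sorted lev ws" "\<And>w. w \<in> set ws \<Longrightarrow> lev v = lev w \<Longrightarrow> v = w"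
  shows "frag_extend lbd (wedge lev v ws) = frag_of ws - frag_extend (wedge lev v) (lbd ws)"
  using assms
proof (induction ws)
  case Nil
  then show ?case by simp
next
  case (Cons w ws)
  have lbd_sub: "set ys \<subseteq> set xs" if "ys \<in> Poly_Mapping.keys (lbd xs)" for xs ys :: "'a list"
    using keys_lbd[of xs] that by auto
  consider "lev v < lev w" | "lev v = lev w" | "lev w < lev v" by linarith
  then show ?case
  proof cases
    case 1
    have "\<forall>x\<in>set (w # ws). lev v < lev x" using 1 Cons.prems(1) by auto
    then have "frag_extend (wedge lev v) (lbd (w # ws)) = frag_extend (\<lambda>ys. frag_of (v # ys)) (lbd (w # ws))"
      by (intro frag_extend_eq wedge_less) (use lbd_sub in blast)
    moreover have "wedge lev v (w # ws) = frag_of (v # w # ws)" using 1 by simp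
    ultimately show ?thesis by (simp only: frag_extend_of lbd.simps(2)[of v])
  next
    \<comment> \<open>The product is 0. On the right, the face omitting \<open>w\<close> gives
      \<open>w # ws\<close> back after inserting \<open>v = w\<close>, while all other faces still
      contain \<open>w\<close> and give 0.\<close>
    case 2
    then have "v = w" using Cons.prems(2) by simp
    have less: "\<forall>x\<in>set ws. lev v < lev x" using 2 Cons.prems(1) by auto
    have "frag_extend (wedge lev v) (lbd (w # ws)) = wedge lev v ws - frag_extend (\<lambda>ys. wedge lev v (w # ys)) (lbd ws)"
      by (simp add: frag_extend_diff frag_extend_frag_extend)
    also have "(\<lambda>ys. wedge lev v (w # ys)) = (\<lambda>_. 0)" using 2 by simp
    also have "wedge lev v ws = frag_of (w # ws)" using wedge_less[OF less] \<open>v = w\<close> by simp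
    finally have "frag_extend (wedge lev v) (lbd (w # ws)) = frag_of (w # ws)" by (simp add: frag_extend_zero)
    moreover have "wedge lev v (w # ws) = 0" using 2 by simp
    ultimately show ?thesis by (simp only: frag_extend_0 diff_self)
  next
    case 3
    then have w: "wedge lev v (w # ys) = - frag_extend (\<lambda>ys. frag_of (w # ys)) (wedge lev v ys)" for ys by simp
    have IH: "frag_extend lbd (wedge lev v ws) = frag_of ws - frag_extend (wedge lev v) (lbd ws)"
      using Cons by simp
    let ?c = "\<lambda>x. frag_extend (\<lambda>ys. frag_of (w # ys)) x"
    have "frag_extend lbd (wedge lev v (w # ws)) = - frag_extend (\<lambda>ys. lbd (w # ys)) (wedge lev v ws)"
      unfolding w frag_extend_minus frag_extend_frag_extend frag_extend_of ..
    also have "frag_extend (\<lambda>ys. lbd (w # ys)) (wedge lev v ws) = wedge lev v ws - ?c (frag_extend lbd (wedge lev v ws))"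
      unfolding lbd.simps(2) frag_extend_diff_left frag_extend_frag_extend frag_expansion[symmetric] ..
    also have "?c (frag_extend lbd (wedge lev v ws)) = frag_of (w # ws) - ?c (frag_extend (wedge lev v) (lbd ws))"
      unfolding IH frag_extend_diff frag_extend_of ..
    finally have l: "frag_extend lbd (wedge lev v (w # ws))
      = - (wedge lev v ws - (frag_of (w # ws) - ?c (frag_extend (wedge lev v) (lbd ws))))" .
    have "frag_extend (wedge lev v) (lbd (w # ws)) = wedge lev v ws - frag_extend (\<lambda>ys. wedge lev v (w # ys)) (lbd ws)"
      unfolding lbd.simps(2) frag_extend_diff frag_extend_frag_extend frag_extend_of ..
    also have "frag_extend (\<lambda>ys. wedge lev v (w # ys)) (lbd ws) = - ?c (frag_extend (wedge lev v) (lbd ws))"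
    proof -
      have "frag_extend (\<lambda>ys. 0 - ?c (wedge lev v ys)) (lbd ws) = 0 - frag_extend (\<lambda>ys. ?c (wedge lev v ys)) (lbd ws)"
        unfolding frag_extend_diff_left frag_extend_zero ..
      then show ?thesis unfolding w frag_extend_frag_extend by simp
    qed
    finally show ?thesis unfolding l by simp
  qed
qed

lemma lbd_sort_chain:
  assumes "inj_on lev (set vs)"
  shows "frag_extend lbd (sort_chain lev vs) = frag_extend (sort_chain lev) (lbd vs)"
  using assms
proof (induction vs)
  case (Cons v vs)
  have IH: "frag_extend lbd (sort_chain lev vs) = frag_extend (sort_chain lev) (lbd vs)"
    using Cons by (simp add: inj_on_def)
  have "frag_extend lbd (sort_chain lev (v # vs)) = frag_extend (\<lambda>ws. frag_extend lbd (wedge lev v ws)) (sort_chain lev vs)"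
    by (simp add: frag_extend_frag_extend)
  also have "\<dots> = frag_extend (\<lambda>ws. frag_of ws - frag_extend (wedge lev v) (lbd ws)) (sort_chain lev vs)"
  proof (rule frag_extend_cong_on[OF keys_sort_chain])
    fix ws assume "ws \<in> {ys. level_sorted lev ys \<and> set ys = set vs \<and> length ys = length vs}"
    then show "frag_extend lbd (wedge lev v ws) = frag_of ws - frag_extend (wedge lev v) (lbd ws)"
      using Cons.prems by (intro lbd_wedge) (auto simp: inj_on_def)
  qed
  also have "\<dots> = sort_chain lev vs - frag_extend (wedge lev v) (frag_extend lbd (sort_chain lev vs))"
    unfolding frag_extend_diff_left frag_extend_frag_extend frag_expansion[symmetric] ..
  also have "\<dots> = frag_extend (sort_chain lev) (lbd (v # vs))"
    unfolding IH lbd.simps(2) frag_extend_diff frag_extend_frag_extend frag_extend_of sort_chain.simps ..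
  finally show ?case .
qed simp

lemma wedge_map:
  assumes "\<And>x. lev (h x) = lev x"
  shows "wedge lev (h v) (map h ws) = frag_extend (\<lambda>ys. frag_of (map h ys)) (wedge lev v ws)"
  by (induction ws) (simp_all add: assms frag_extend_frag_extend frag_extend_minus)

lemma sort_chain_map:
  assumes "\<And>x. lev (h x) = lev x"
  shows "sort_chain lev (map h vs) = frag_extend (\<lambda>ys. frag_of (map h ys)) (sort_chain lev vs)"
proof (induction vs)
  case (Cons v vs)
  have "sort_chain lev (map h (v # vs)) = frag_extend (\<lambda>ys. wedge lev (h v) (map h ys)) (sort_chain lev vs)"
    by (simp add: Cons frag_extend_frag_extend)
  also have "\<dots> = frag_extend (\<lambda>ys. frag_of (map h ys)) (sort_chain lev (v # vs))"
    by (simp add: wedge_map[of lev h, OF assms] frag_extend_frag_extend)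
  finally show ?case .
qed simp

lemma sort_chain_zero:
  assumes "\<And>v. v \<in> set vs \<Longrightarrow> lev v \<in> {1..k}" "k < length vs"
  shows "sort_chain lev vs = 0"
proof -
  have False if ws: "level_sorted lev ws" "set ws = set vs" "length ws = length vs" for ws
  proof -
    have "distinct (map lev ws)"
      using ws(1) by (simp add: distinct_conv_nth sorted_wrt_iff_nth_less) (metis less_irrefl nat_neq_iff)
    then have "length ws = card (lev ` set ws)" by (metis distinct_card length_map set_map)
    also have "\<dots> \<le> card {1..k}" using ws(2) assms(1) by (intro card_mono) auto
    finally show False using assms(2) ws(3) by simp
  qed
  then have "Poly_Mapping.keys (sort_chain lev vs) = {}" using keys_sort_chain[of lev vs] by blast
  then show ?thesis by (simp only: keys_eq_empty)
qed

text \<open>Being equivariant, sorting can be compared with the identity after mapping to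
  \<open>EG\<close>, where any two equivariant chain maps are homotopic. This replaces an explicit
  homotopy between words and sorted words.\<close>

lemma sort_chain_map_chain_map:
  assumes K: "\<And>S. S \<in> K \<Longrightarrow> inj_on lev S" and lev: "\<And>g x. g \<in> carrier G \<Longrightarrow> lev (a g x) = lev x"
  shows "equivariant_chain_map G (lists_cx {xs. set xs \<in> K} a) (lists_cx {xs. set xs \<in> K} a) (\<lambda>n. sort_chain lev)"
  unfolding equivariant_chain_map_def bdry_lists act_lists lists_cx_simps
proof (intro conjI allI ballI)
  fix n xs assume xs: "xs \<in> {xs \<in> {xs. set xs \<in> K}. length xs = Suc n}"
  show "Poly_Mapping.keys (sort_chain lev xs) \<subseteq> {xs \<in> {xs. set xs \<in> K}. length xs = Suc n}"
    using keys_sort_chain[of lev xs] xs by auto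
  show "(if n = 0 then 0 else frag_extend lbd (sort_chain lev xs)) = frag_extend (sort_chain lev) (if n = 0 then 0 else lbd xs)"
    using lbd_sort_chain[of lev xs] K xs by simp
  fix g assume "g \<in> carrier G"
  then show "sort_chain lev (map (a g) xs) = frag_extend (\<lambda>xs. frag_of (map (a g) xs)) (sort_chain lev xs)"
    using lev by (intro sort_chain_map) blast
next
  fix xs assume "xs \<in> {xs \<in> {xs. set xs \<in> K}. length xs = Suc 0}"
  then obtain x where "xs = [x]" by (auto simp: length_Suc_conv)
  then show "aug (sort_chain lev xs) = 1" by simp
qed

section \<open>Small simplices\<close>

text \<open>With the subdivision homotopy \<open>h\<close>, a primitive is \<open>\<rho> \<mapsto> - \<Sum>j. f (h (sd\<^sup>j \<rho>))\<close>, a finite sum because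
  \<open>sd\<^sup>j \<rho>\<close> becomes subordinate to the cover.\<close>
lemma small_cocycle_is_coboundary:
  fixes X :: "'a topology" and f :: "((nat \<Rightarrow> real) \<Rightarrow> 'a) \<Rightarrow> int"
  assumes \<C>: "\<And>U. U \<in> \<C> \<Longrightarrow> openin X U" and X: "topspace X \<subseteq> \<Union>\<C>"
    and f: "\<And>\<tau>. singular_simplex (Suc n) X \<tau> \<Longrightarrow> [ev f (chain_boundary (Suc n) (frag_of \<tau>)) = 0] (mod m)"
    and van: "\<And>U \<tau>. U \<in> \<C> \<Longrightarrow> singular_simplex n (subtopology X U) \<tau> \<Longrightarrow> [f \<tau> = 0] (mod m)"
  shows "\<exists>w. \<forall>\<tau>. singular_simplex n X \<tau> \<longrightarrow> [f \<tau> = ev w (chain_boundary n (frag_of \<tau>))] (mod m)"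
proof (cases n)
  case 0
  have "[f \<tau> = ev (\<lambda>_. 0) (chain_boundary n (frag_of \<tau>))] (mod m)" if \<tau>: "singular_simplex n X \<tau>" for \<tau>
  proof -
    let ?e = "\<lambda>j::nat. if j = 0 then 1 else (0::real)"
    have "\<tau> ?e \<in> topspace X" by (rule singular_simplex_in_topspace[OF \<tau> simplex_vertex_in])
    then obtain U where U: "U \<in> \<C>" "\<tau> ?e \<in> U" using X by blast
    have "\<tau> ` standard_simplex 0 \<subseteq> U" unfolding standard_simplex_0 using U(2) by simp
    then have "singular_simplex n (subtopology X U) \<tau>" using \<tau> 0 by (simp add: singular_simplex_subtopology)
    from van[OF U(1) this] show ?thesis by simp
  qed
  then show ?thesis by blast
next
  case (Suc k)
  let ?sd = "singular_subdivision :: nat \<Rightarrow> 'a chain \<Rightarrow> 'a chain"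
  obtain h :: "nat \<Rightarrow> 'a chain \<Rightarrow> 'a chain" where h0: "\<And>p. h p 0 = 0"
    and hd: "\<And>p c1 c2. h p (c1 - c2) = h p c1 - h p c2"
    and hc: "\<And>p X c. singular_chain p X c \<Longrightarrow> singular_chain (Suc p) X (h p c)"
    and hb: "\<And>p X c. singular_chain p X c \<Longrightarrow>
        chain_boundary (Suc p) (h p c) + h (p - Suc 0) (chain_boundary p c) = ?sd p c - c"
    using chain_homotopic_singular_subdivision by metis
  \<comment> \<open>With residues \<open>f\<close> vanishes exactly on small simplices, so the late
    terms of the sum are zero and not merely congruent to zero.\<close>
  define f' where "f' \<tau> = f \<tau> mod m" for \<tau>
  have f'f: "[f' \<tau> = f \<tau>] (mod m)" for \<tau> by (simp add: f'_def cong_def)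
  have f'_coc: "[ev f' (chain_boundary (Suc n) c) = 0] (mod m)" if c: "singular_chain (Suc n) X c" for c
  proof -
    have "[ev (\<lambda>\<tau>. ev f' (chain_boundary (Suc n) (frag_of \<tau>))) c = ev (\<lambda>_. 0) c] (mod m)"
    proof (rule ev_mod_cong)
      fix \<tau> assume "\<tau> \<in> Poly_Mapping.keys c"
      then have "singular_simplex (Suc n) X \<tau>" using c unfolding singular_chain_def by blast
      from f[OF this] ev_mod_cong[of "chain_boundary (Suc n) (frag_of \<tau>)" f' f m] f'f
      show "[ev f' (chain_boundary (Suc n) (frag_of \<tau>)) = 0] (mod m)" using cong_trans by blast
    qed
    then show ?thesis
      unfolding ev_frag_extend[symmetric] using bdry_sing[of X "\<lambda>_::unit. id" "Suc n" c]
      by (simp add: bdry_def sing_def)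
  qed
  define small where "small p \<tau> \<longleftrightarrow> (\<exists>U\<in>\<C>. singular_simplex p (subtopology X U) \<tau>)" for p and \<tau> :: "(nat \<Rightarrow> real) \<Rightarrow> 'a"
  have f'_small: "ev f' c = 0" if "\<And>\<tau>. \<tau> \<in> Poly_Mapping.keys c \<Longrightarrow> small n \<tau>" for c
  proof -
    have "ev f' c = ev (\<lambda>_. 0) c"
    proof (rule ev_cong)
      fix \<tau> assume "\<tau> \<in> Poly_Mapping.keys c"
      then show "f' \<tau> = 0" using that van unfolding small_def f'_def cong_def by fastforce
    qed
    then show ?thesis by simp
  qed
  have h_ext: "h p c = frag_extend (\<lambda>\<sigma>. h p (frag_of \<sigma>)) c" for p c
  proof -
    have "Poly_Mapping.keys c \<subseteq> UNIV" by simp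
    then show ?thesis by (induction c rule: frag_induction) (simp_all add: h0 hd frag_extend_diff)
  qed
  have fh_small: "ev f' (h k c) = 0" if sm: "\<And>\<tau>. \<tau> \<in> Poly_Mapping.keys c \<Longrightarrow> small k \<tau>" for c
  proof -
    have "ev (\<lambda>\<sigma>. ev f' (h k (frag_of \<sigma>))) c = ev (\<lambda>_. 0) c"
    proof (rule ev_cong)
      fix \<sigma> assume "\<sigma> \<in> Poly_Mapping.keys c"
      then obtain U where U: "U \<in> \<C>" "singular_simplex k (subtopology X U) \<sigma>" using sm unfolding small_def by blast
      then have "singular_chain (Suc k) (subtopology X U) (h k (frag_of \<sigma>))" by (intro hc) (simp add: singular_chain_of)
      then show "ev f' (h k (frag_of \<sigma>)) = 0"
        using U(1) Suc by (intro f'_small) (auto simp: singular_chain_def small_def)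
    qed
    then show ?thesis by (subst h_ext) (simp add: ev_frag_extend)
  qed
  have ex_N: "\<exists>N. \<forall>j\<ge>N. \<forall>\<tau>\<in>Poly_Mapping.keys ((?sd p ^^ j) (frag_of \<sigma>)). small p \<tau>" if \<sigma>: "singular_simplex p X \<sigma>" for p \<sigma>
  proof -
    have c: "singular_chain p X (frag_of \<sigma>)" using \<sigma> by (simp add: singular_chain_of)
    have chain: "singular_chain p X ((?sd p ^^ j) (frag_of \<sigma>))" for j
      by (induction j) (simp_all add: c singular_chain_singular_subdivision)
    obtain N where N: "\<And>j \<tau>. N \<le> j \<Longrightarrow> \<tau> \<in> Poly_Mapping.keys ((?sd p ^^ j) (frag_of \<sigma>)) \<Longrightarrow>
        \<exists>V\<in>\<C>. \<tau> \<in> standard_simplex p \<rightarrow> V"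
      using sufficient_iterated_singular_subdivision_exists[OF \<C> X c] by metis
    have "small p \<tau>" if lg: "N \<le> j" "\<tau> \<in> Poly_Mapping.keys ((?sd p ^^ j) (frag_of \<sigma>))" for j \<tau>
    proof -
      obtain V where V: "V \<in> \<C>" "\<tau> \<in> standard_simplex p \<rightarrow> V" using N[OF lg] by blast
      have "singular_simplex p X \<tau>" using chain[of j] lg(2) unfolding singular_chain_def by blast
      moreover have "\<tau> ` standard_simplex p \<subseteq> V" using V(2) by blast
      ultimately have "singular_simplex p (subtopology X V) \<tau>" by (simp add: singular_simplex_subtopology)
      then show ?thesis unfolding small_def using V(1) by blast
    qed
    then show ?thesis by blast
  qed
  define N where "N p \<sigma> = (SOME N. \<forall>j\<ge>N. \<forall>\<tau>\<in>Poly_Mapping.keys ((?sd p ^^ j) (frag_of \<sigma>)). small p \<tau>)" for p \<sigma>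
  have N: "small p \<tau>" if "singular_simplex p X \<sigma>" "N p \<sigma> \<le> j" "\<tau> \<in> Poly_Mapping.keys ((?sd p ^^ j) (frag_of \<sigma>))" for p \<sigma> j \<tau>
    using someI_ex[OF ex_N[OF that(1)]] that(2,3) unfolding N_def by blast
  define w where "w \<sigma> = - (\<Sum>j<N k \<sigma>. ev f' (h k ((?sd k ^^ j) (frag_of \<sigma>))))" for \<sigma>
  \<comment> \<open>The threshold depends on the simplex, but raising it only adds zero terms. All
    faces of a simplex can thus use a common bound.\<close>
  have w_eq: "w \<sigma> = - (\<Sum>j<M. ev f' (h k ((?sd k ^^ j) (frag_of \<sigma>))))" if \<sigma>: "singular_simplex k X \<sigma>" and M: "N k \<sigma> \<le> M" for \<sigma> M
  proof -
    have "(\<Sum>j<N k \<sigma>. ev f' (h k ((?sd k ^^ j) (frag_of \<sigma>)))) = (\<Sum>j<M. ev f' (h k ((?sd k ^^ j) (frag_of \<sigma>))))"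
    proof (rule sum.mono_neutral_left)
      show "\<forall>j\<in>{..<M} - {..<N k \<sigma>}. ev f' (h k ((?sd k ^^ j) (frag_of \<sigma>))) = 0"
      proof
        fix j assume "j \<in> {..<M} - {..<N k \<sigma>}"
        then have "N k \<sigma> \<le> j" by simp
        then show "ev f' (h k ((?sd k ^^ j) (frag_of \<sigma>))) = 0" using N[OF \<sigma>] by (intro fh_small) blast
      qed
    qed (use M in auto)
    then show ?thesis by (simp add: w_def)
  qed
  have sd_ext: "(?sd p ^^ j) c = frag_extend (\<lambda>\<sigma>. (?sd p ^^ j) (frag_of \<sigma>)) c" for p j c
  proof -
    have "Poly_Mapping.keys c \<subseteq> UNIV" by simp
    then show ?thesis
      by (induction c rule: frag_induction) (simp_all add: singular_subdivision_power_diff frag_extend_diff)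
  qed
  have main: "[f \<tau> = ev w (chain_boundary n (frag_of \<tau>))] (mod m)" if \<tau>: "singular_simplex n X \<tau>" for \<tau>
  proof -
    let ?b = "chain_boundary n (frag_of \<tau>)"
    let ?c = "\<lambda>j. (?sd n ^^ j) (frag_of \<tau>)"
    have c0: "singular_chain n X (frag_of \<tau>)" using \<tau> by (simp add: singular_chain_of)
    have c: "singular_chain n X (?c j)" for j
      by (induction j) (simp_all add: c0 singular_chain_singular_subdivision)
    have b: "singular_chain k X ?b" using singular_chain_boundary[OF c0] Suc by simp
    have bc: "(?sd k ^^ j) ?b = chain_boundary n (?c j)" for j
    proof (induction j)
      case (Suc j)
      have "(?sd k ^^ Suc j) ?b = ?sd (n - Suc 0) (chain_boundary n (?c j))" using Suc \<open>n = Suc k\<close> by simp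
      also have "\<dots> = chain_boundary n (?sd n (?c j))" by (rule chain_boundary_singular_subdivision[OF c, symmetric])
      finally show ?case by simp
    qed simp
    \<comment> \<open>Beyond the thresholds of all faces, and also large enough for the subdivided
      \<open>\<tau>\<close> itself to be small, which kills the far end of the telescoping
      sum.\<close>
    define M where "M = Max (insert (N n \<tau>) (N k ` Poly_Mapping.keys ?b))"
    have M: "N n \<tau> \<le> M" "\<And>\<sigma>. \<sigma> \<in> Poly_Mapping.keys ?b \<Longrightarrow> N k \<sigma> \<le> M"
      unfolding M_def by (auto intro!: Max_ge)
    have "ev w ?b = ev (\<lambda>\<sigma>. - (\<Sum>j<M. ev f' (h k ((?sd k ^^ j) (frag_of \<sigma>))))) ?b"
    proof (rule ev_cong)
      fix \<sigma> assume "\<sigma> \<in> Poly_Mapping.keys ?b"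
      then show "w \<sigma> = - (\<Sum>j<M. ev f' (h k ((?sd k ^^ j) (frag_of \<sigma>))))"
        using b M(2) unfolding singular_chain_def by (intro w_eq) auto
    qed
    also have "\<dots> = - (\<Sum>j<M. ev (\<lambda>\<sigma>. ev f' (h k ((?sd k ^^ j) (frag_of \<sigma>)))) ?b)"
      unfolding ev_def by (simp add: sum_distrib_left sum_negf) (rule sum.swap)
    also have "(\<Sum>j<M. ev (\<lambda>\<sigma>. ev f' (h k ((?sd k ^^ j) (frag_of \<sigma>)))) ?b) = (\<Sum>j<M. ev f' (h k (chain_boundary n (?c j))))"
    proof (rule sum.cong[OF refl])
      fix j
      have "ev f' (h k ((?sd k ^^ j) ?b)) = ev f' (frag_extend (\<lambda>\<sigma>. h k ((?sd k ^^ j) (frag_of \<sigma>))) ?b)"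
        by (subst sd_ext, subst h_ext, unfold frag_extend_frag_extend, subst h_ext[symmetric]) (rule refl)
      then show "ev (\<lambda>\<sigma>. ev f' (h k ((?sd k ^^ j) (frag_of \<sigma>)))) ?b = ev f' (h k (chain_boundary n (?c j)))"
        unfolding bc ev_frag_extend by simp
    qed
    finally have w: "ev w ?b = - (\<Sum>j<M. ev f' (h k (chain_boundary n (?c j))))" .
    \<comment> \<open>From \<open>d h + h d = sd - id\<close>, the two summands differ by a value of
      \<open>f'\<close> on a boundary, which is 0 modulo \<open>m\<close>.\<close>
    have "[(\<Sum>j<M. ev f' (h k (chain_boundary n (?c j)))) = (\<Sum>j<M. ev f' (?c (Suc j)) - ev f' (?c j))] (mod m)"
    proof (rule cong_sum)
      fix j
      have eq: "chain_boundary (Suc n) (h n (?c j)) + h k (chain_boundary n (?c j)) = ?c (Suc j) - ?c j"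
        using hb[OF c, of j] Suc by simp
      have "ev f' (chain_boundary (Suc n) (h n (?c j))) + ev f' (h k (chain_boundary n (?c j))) = ev f' (?c (Suc j)) - ev f' (?c j)"
        unfolding ev_add[symmetric] ev_diff[symmetric] eq ..
      moreover have "[ev f' (chain_boundary (Suc n) (h n (?c j))) = 0] (mod m)"
        by (rule f'_coc[OF hc[OF c]])
      ultimately show "[ev f' (h k (chain_boundary n (?c j))) = ev f' (?c (Suc j)) - ev f' (?c j)] (mod m)"
        by (metis add_0 cong_add_rcancel cong_sym)
    qed
    also have "(\<Sum>j<M. ev f' (?c (Suc j)) - ev f' (?c j)) = ev f' (?c M) - ev f' (?c 0)"
      by (rule sum_lessThan_telescope)
    also have "ev f' (?c M) = 0" using N[OF \<tau> M(1)] by (intro f'_small) blast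
    also have "0 - ev f' (?c 0) = - f' \<tau>" by simp
    finally have "[(\<Sum>j<M. ev f' (h k (chain_boundary n (?c j)))) = - f' \<tau>] (mod m)" .
    from cong_minus_minus_iff[THEN iffD2, OF this]
    have fw: "[- (\<Sum>j<M. ev f' (h k (chain_boundary n (?c j)))) = f' \<tau>] (mod m)" unfolding minus_minus .
    show ?thesis unfolding w by (rule cong_sym[OF cong_trans[OF fw f'f]])
  qed
  then show ?thesis by blast
qed

section \<open>Maps into and out of realizations\<close>

lemma closed_face_finite: "x \<in> closed_face S \<Longrightarrow> finite S"
  unfolding closed_face_def by (cases "finite S") auto

lemma closed_faceD:
  assumes "x \<in> closed_face S"
  shows "0 \<le> x v" "v \<notin> S \<Longrightarrow> x v = 0" "(\<Sum>v\<in>S. x v) = 1"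
  using assms by (auto simp: closed_face_def)

lemma closed_face_mono:
  assumes "x \<in> closed_face S" "\<And>v. x v \<noteq> 0 \<Longrightarrow> v \<in> S'" "finite S'"
  shows "x \<in> closed_face S'"
proof -
  have S: "finite S" by (rule closed_face_finite[OF assms(1)])
  have "(\<Sum>v\<in>S'. x v) = (\<Sum>v\<in>S \<union> S'. x v)"
    using assms(2,3) S by (intro sum.mono_neutral_left) auto
  also have "\<dots> = (\<Sum>v\<in>S. x v)"
    using closed_faceD(2)[OF assms(1)] assms(3) S by (intro sum.mono_neutral_right) auto
  finally have "(\<Sum>v\<in>S'. x v) = 1" using closed_faceD(3)[OF assms(1)] by simp
  then show ?thesis using closed_faceD(1)[OF assms(1)] assms(2) unfolding closed_face_def by blast
qed

lemma closed_face_pos: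
  assumes "x \<in> closed_face S"
  obtains v where "v \<in> S" "0 < x v"
proof -
  have "\<exists>v\<in>S. 0 < x v"
  proof (rule ccontr)
    assume "\<not> (\<exists>v\<in>S. 0 < x v)"
    then have "x v = 0" if "v \<in> S" for v using closed_faceD(1)[OF assms, of v] that by force
    then have "(\<Sum>v\<in>S. x v) = 0" by simp
    then show False using closed_faceD(3)[OF assms] by simp
  qed
  then show ?thesis using that by blast
qed

text \<open>On a single closed face the weak topology is no finer than the product topology, so
  continuity can be checked coordinatewise.\<close>

lemma continuous_map_into_realization:
  assumes "S \<in> K" "continuous_map Z (powertop_real UNIV) f" "\<And>z. z \<in> topspace Z \<Longrightarrow> f z \<in> closed_face S"
  shows "continuous_map Z (realization K) f"
  unfolding continuous_map_def
proof (intro conjI allI impI)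
  show "f \<in> topspace Z \<rightarrow> topspace (realization K)"
    using assms(1,3) unfolding topspace_realization by blast
  fix U assume "openin (realization K) U"
  then have U: "openin (subtopology (powertop_real UNIV) (closed_face S)) (U \<inter> closed_face S)"
    using assms(1) unfolding openin_realization by blast
  have "continuous_map Z (subtopology (powertop_real UNIV) (closed_face S)) f"
    using assms(2,3) unfolding continuous_map_in_subtopology by blast
  from openin_continuous_map_preimage[OF this U]
  have "openin Z {z \<in> topspace Z. f z \<in> U \<inter> closed_face S}" .
  moreover have "{z \<in> topspace Z. f z \<in> U \<inter> closed_face S} = {z \<in> topspace Z. f z \<in> U}" using assms(3) by blast
  ultimately show "openin Z {z \<in> topspace Z. f z \<in> U}" by simp
qed

text \<open>The weak topology is the final topology for the closed faces.\<close>

lemma continuous_map_from_realization: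
  assumes "\<And>S. S \<in> K \<Longrightarrow> continuous_map (subtopology (powertop_real UNIV) (closed_face S)) W h"
  shows "continuous_map (realization K) W h"
  unfolding continuous_map_def
proof (intro conjI allI impI)
  show "h \<in> topspace (realization K) \<rightarrow> topspace W"
  proof
    fix x assume "x \<in> topspace (realization K)"
    then obtain S where S: "S \<in> K" "x \<in> closed_face S" unfolding topspace_realization by blast
    then show "h x \<in> topspace W" using assms[OF S(1)] unfolding continuous_map_def by auto
  qed
  fix U assume U: "openin W U"
  show "openin (realization K) {x \<in> topspace (realization K). h x \<in> U}"
    unfolding openin_realization
  proof (intro conjI ballI)
    show "{x \<in> topspace (realization K). h x \<in> U} \<subseteq> (\<Union>S\<in>K. closed_face S)"
      unfolding topspace_realization by blast
    fix S assume S: "S \<in> K"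
    have "openin (subtopology (powertop_real UNIV) (closed_face S))
       {x \<in> topspace (subtopology (powertop_real UNIV) (closed_face S)). h x \<in> U}"
      by (rule openin_continuous_map_preimage[OF assms[OF S] U])
    moreover have "{x \<in> topspace (subtopology (powertop_real UNIV) (closed_face S)). h x \<in> U}
        = {x \<in> topspace (realization K). h x \<in> U} \<inter> closed_face S"
      unfolding topspace_realization using S by auto
    ultimately show "openin (subtopology (powertop_real UNIV) (closed_face S)) ({x \<in> topspace (realization K). h x \<in> U} \<inter> closed_face S)"
      by simp
  qed
qed

lemma continuous_map_realization_powertop: "continuous_map (realization K) (powertop_real UNIV) (\<lambda>x. x)"
  by (rule continuous_map_from_realization) (rule continuous_map_from_subtopology[OF continuous_map_id[unfolded id_def]])

lemma continuous_map_coordinate: "continuous_map (realization K) euclideanreal (\<lambda>x. x v)"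
  using continuous_map_compose[OF continuous_map_realization_powertop continuous_map_product_projection[of v UNIV "\<lambda>_. euclideanreal"]]
  by (simp add: o_def)

text \<open>Trading the support of \<open>x\<close> for the fixed finite set \<open>S\<close> makes
  the map visibly linear on the face, hence continuous there.\<close>

lemma realization_map_on_face:
  assumes "x \<in> closed_face S"
  shows "realization_map f x w = (\<Sum>v\<in>{v \<in> S. f v = w}. x v)"
  unfolding realization_map_def
  using closed_face_finite[OF assms] closed_faceD(2)[OF assms] by (intro sum.mono_neutral_left) auto

lemma realization_map_closed_face:
  assumes x: "x \<in> closed_face S"
  shows "realization_map f x \<in> closed_face (f ` S)"
  unfolding closed_face_def
proof (intro CollectI conjI allI impI)
  note r = realization_map_on_face[OF x]
  show "0 \<le> realization_map f x w" for w unfolding r using closed_faceD(1)[OF x] by (intro sum_nonneg) blast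
  show "realization_map f x w = 0" if "w \<notin> f ` S" for w
  proof -
    have "{v \<in> S. f v = w} = {}" using that by blast
    then show ?thesis by (simp only: r sum.empty)
  qed
  have "(\<Sum>w\<in>f ` S. realization_map f x w) = (\<Sum>v\<in>S. x v)"
    unfolding r by (rule sum.image_gen[OF closed_face_finite[OF x], symmetric])
  then show "(\<Sum>w\<in>f ` S. realization_map f x w) = 1" using closed_faceD(3)[OF x] by simp
qed

lemma realization_map_compose:
  assumes x: "x \<in> closed_face S"
  shows "realization_map g (realization_map f x) = realization_map (\<lambda>v. g (f v)) x"
proof
  fix w
  let ?S = "{v \<in> S. g (f v) = w}"
  have fin: "finite ?S" using closed_face_finite[OF x] by simp
  have "realization_map g (realization_map f x) w = (\<Sum>u\<in>{u \<in> f ` S. g u = w}. \<Sum>v\<in>{v \<in> S. f v = u}. x v)"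
    unfolding realization_map_on_face[OF realization_map_closed_face[OF x]] realization_map_on_face[OF x] ..
  also have "\<dots> = (\<Sum>u\<in>f ` ?S. \<Sum>v\<in>{v \<in> ?S. f v = u}. x v)"
    by (intro sum.cong) auto
  also have "\<dots> = (\<Sum>v\<in>?S. x v)" by (rule sum.image_gen[OF fin, symmetric])
  also have "\<dots> = realization_map (\<lambda>v. g (f v)) x w" unfolding realization_map_on_face[OF x] ..
  finally show "realization_map g (realization_map f x) w = realization_map (\<lambda>v. g (f v)) x w" .
qed

lemma realization_map_cong:
  assumes x: "x \<in> closed_face S" and eq: "\<And>v. v \<in> S \<Longrightarrow> f v = g v"
  shows "realization_map f x = realization_map g x"
proof
  fix w
  have "{v \<in> S. f v = w} = {v \<in> S. g v = w}" using eq by auto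
  then show "realization_map f x w = realization_map g x w" unfolding realization_map_on_face[OF x] by simp
qed

lemma realization_map_inj:
  assumes x: "x \<in> closed_face S" and f: "inj_on f S" and v: "v \<in> S"
  shows "realization_map f x (f v) = x v"
proof -
  have "{u \<in> S. f u = f v} = {v}" using f v by (auto simp: inj_on_def)
  then show ?thesis unfolding realization_map_on_face[OF x] by simp
qed

lemma realization_map_outside:
  assumes x: "x \<in> closed_face S" and w: "w \<notin> f ` S"
  shows "realization_map f x w = 0"
  using realization_map_closed_face[OF x] w by (rule closed_faceD(2))

lemma realization_map_ident:
  assumes x: "x \<in> closed_face S" and f: "\<And>v. v \<in> S \<Longrightarrow> f v = v"
  shows "realization_map f x = x"
proof
  fix w
  show "realization_map f x w = x w"
  proof (cases "w \<in> S")
    case True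
    have "inj_on f S" using f by (simp add: inj_on_def)
    from realization_map_inj[OF x this True] show ?thesis using f[OF True] by simp
  next
    case False
    then have "w \<notin> f ` S" using f by auto
    then show ?thesis using realization_map_outside[OF x] closed_faceD(2)[OF x False] by simp
  qed
qed

lemma continuous_realization_map_face:
  "continuous_map (subtopology (powertop_real UNIV) (closed_face S)) (powertop_real UNIV) (realization_map f)"
proof (cases "finite S")
  case True
  have "continuous_map (subtopology (powertop_real UNIV) (closed_face S)) euclideanreal (\<lambda>x. realization_map f x w)" for w
  proof (rule continuous_map_eq)
    show "continuous_map (subtopology (powertop_real UNIV) (closed_face S)) euclideanreal (\<lambda>x. \<Sum>v\<in>{v \<in> S. f v = w}. x v)"
      using True by (intro continuous_map_sum continuous_map_from_subtopology continuous_map_product_projection) auto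
    show "(\<Sum>v\<in>{v \<in> S. f v = w}. x v) = realization_map f x w"
      if "x \<in> topspace (subtopology (powertop_real UNIV) (closed_face S))" for x
      using that by (intro realization_map_on_face[symmetric]) simp
  qed
  then show ?thesis unfolding continuous_map_componentwise_UNIV by blast
next
  case False
  then have "closed_face S = {}" using closed_face_finite by blast
  then have "topspace (subtopology (powertop_real UNIV) (closed_face S)) = {}" by simp
  then show ?thesis by (simp add: continuous_map_def)
qed

lemma realization_map_continuous:
  assumes "\<And>S. S \<in> K \<Longrightarrow> f ` S \<in> K'"
  shows "continuous_map (realization K) (realization K') (realization_map f)"
proof (rule continuous_map_from_realization)
  fix S assume S: "S \<in> K"
  show "continuous_map (subtopology (powertop_real UNIV) (closed_face S)) (realization K') (realization_map f)"
    by (rule continuous_map_into_realization[OF assms[OF S] continuous_realization_map_face])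
      (simp add: realization_map_closed_face)
qed

section \<open>Linear simplices\<close>

text \<open>Turns affine maps of the standard simplex into instances of
  \<open>realization_map\<close>, so that linear simplices inherit its composition and continuity
  rules.\<close>

lemma standard_simplex_eq_closed_face: "standard_simplex n = closed_face {..n}"
proof
  show "standard_simplex n \<subseteq> closed_face {..n}"
    by (auto simp: standard_simplex_def closed_face_def)
  show "closed_face {..n} \<subseteq> standard_simplex n"
  proof
    fix x :: "nat \<Rightarrow> real" assume x: "x \<in> closed_face {..n}"
    have "x i \<le> 1" for i
    proof (cases "i \<le> n")
      case True
      have "x i \<le> (\<Sum>i\<le>n. x i)" using True closed_faceD(1)[OF x] by (intro member_le_sum) auto
      then show ?thesis using closed_faceD(3)[OF x] by simp
    next
      case False
      then show ?thesis using closed_faceD(2)[OF x, of i] by simp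
    qed
    then show "x \<in> standard_simplex n"
      using closed_faceD[OF x] by (simp add: standard_simplex_def)
  qed
qed

definition lin :: "nat \<Rightarrow> 'v list \<Rightarrow> (nat \<Rightarrow> real) \<Rightarrow> 'v \<Rightarrow> real" where
  "lin n vs = restrict (realization_map ((!) vs)) (standard_simplex n)"

lemma nth_image: "length vs = Suc n \<Longrightarrow> (!) vs ` {..n} = set vs"
  by (auto simp: set_conv_nth less_Suc_eq_le)

lemma singular_simplex_lin:
  assumes "set vs \<in> K" "length vs = Suc n"
  shows "singular_simplex n (realization K) (lin n vs)"
  unfolding singular_simplex_def lin_def
proof
  have "continuous_map (subtopology (powertop_real UNIV) (standard_simplex n)) (realization K) (realization_map ((!) vs))"
    unfolding standard_simplex_eq_closed_face
  proof (rule continuous_map_into_realization[OF assms(1) continuous_realization_map_face])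
    fix z assume "z \<in> topspace (subtopology (powertop_real UNIV) (closed_face {..n}))"
    then have "z \<in> closed_face {..n}" by simp
    from realization_map_closed_face[OF this, of "(!) vs"]
    show "realization_map ((!) vs) z \<in> closed_face (set vs)" unfolding nth_image[OF assms(2)] .
  qed
  then show "continuous_map (subtopology (powertop_real UNIV) (standard_simplex n)) (realization K) (restrict (realization_map ((!) vs)) (standard_simplex n))"
    by (rule continuous_map_eq) simp
qed simp

lemma simplex_map_lin:
  assumes "length vs = Suc n"
  shows "simplex_map n (realization_map h) (lin n vs) = lin n (map h vs)"
proof
  fix x
  show "simplex_map n (realization_map h) (lin n vs) x = lin n (map h vs) x"
  proof (cases "x \<in> standard_simplex n")
    case True
    then have x: "x \<in> closed_face {..n}" by (simp add: standard_simplex_eq_closed_face)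
    have "realization_map h (realization_map ((!) vs) x) = realization_map ((!) (map h vs)) x"
      unfolding realization_map_compose[OF x]
      by (rule realization_map_cong[OF x]) (use assms in simp)
    then show ?thesis using True by (simp add: simplex_map_def lin_def)
  qed (simp add: simplex_map_def lin_def)
qed

text \<open>A face inclusion is the affine extension of the vertex map that skips \<open>i\<close>.
  Composing with it then amounts to deleting one entry of the vertex list.\<close>

lemma simplical_face_eq:
  assumes x: "x \<in> closed_face {..n}"
  shows "simplical_face i x = realization_map (\<lambda>j. if j < i then j else Suc j) x"
proof
  let ?d = "\<lambda>j::nat. if j < i then j else Suc j"
  have inj: "inj_on ?d {..n}" by (auto simp: inj_on_def split: if_splits)
  fix j
  consider "j < i" | "j = i" | "i < j" by linarith
  then show "simplical_face i x j = realization_map ?d x j"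
  proof cases
    case 1
    show ?thesis
    proof (cases "j \<le> n")
      case True
      then show ?thesis using realization_map_inj[OF x inj, of j] 1 by (simp add: simplical_face_def)
    next
      case False
      then have "j \<notin> ?d ` {..n}" using 1 by (auto split: if_splits)
      from realization_map_outside[OF x this] show ?thesis using closed_faceD(2)[OF x, of j] False 1
        by (simp add: simplical_face_def)
    qed
  next
    case 2
    then have "j \<notin> ?d ` {..n}" by (auto split: if_splits)
    from realization_map_outside[OF x this] show ?thesis using 2 by (simp add: simplical_face_def)
  next
    case 3
    then obtain l where l: "j = Suc l" "i \<le> l" by (cases j) auto
    show ?thesis
    proof (cases "l \<le> n")
      case True
      then show ?thesis using realization_map_inj[OF x inj, of l] l by (simp add: simplical_face_def)
    next
      case False
      then have "j \<notin> ?d ` {..n}" using l by (auto split: if_splits)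
      from realization_map_outside[OF x this] show ?thesis using closed_faceD(2)[OF x, of l] False l
        by (simp add: simplical_face_def)
    qed
  qed
qed

lemma lin_simplical_face:
  assumes "length vs = Suc (Suc n)" "i \<le> Suc n" "x \<in> standard_simplex n"
  shows "realization_map ((!) vs) (simplical_face i x) = realization_map ((!) (take i vs @ drop (Suc i) vs)) x"
proof -
  have x: "x \<in> closed_face {..n}" using assms(3) by (simp add: standard_simplex_eq_closed_face)
  show ?thesis
    unfolding simplical_face_eq[OF x] realization_map_compose[OF x]
    by (rule realization_map_cong[OF x]) (use assms(1,2) in \<open>auto simp: nth_append\<close>)
qed

section \<open>The contractible free space EG\<close>

definition EG_complex :: "('g, 'm) monoid_scheme \<Rightarrow> (nat \<times> 'g) set set" where
  "EG_complex G = {S. finite S \<and> S \<subseteq> UNIV \<times> carrier G \<and> inj_on fst S}"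

definition EG_vertex_action :: "('g, 'm) monoid_scheme \<Rightarrow> 'g \<Rightarrow> nat \<times> 'g \<Rightarrow> nat \<times> 'g" where
  "EG_vertex_action G g = (\<lambda>(n, h). (n, g \<otimes>\<^bsub>G\<^esub> h))"

lemma EG_space_eq: "EG_space G = realization (EG_complex G)"
  by (simp add: EG_space_def EG_complex_def)

lemma EG_action_eq: "EG_action G g = realization_map (EG_vertex_action G g)"
  by (simp add: EG_action_def EG_vertex_action_def)

lemma EG_vertex_action_simp [simp]: "EG_vertex_action G g (n, h) = (n, g \<otimes>\<^bsub>G\<^esub> h)"
  by (simp add: EG_vertex_action_def)

context group
begin

lemma EG_complex_action: "g \<in> carrier G \<Longrightarrow> S \<in> EG_complex G \<Longrightarrow> EG_vertex_action G g ` S \<in> EG_complex G"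
proof -
  assume g: "g \<in> carrier G" and S: "S \<in> EG_complex G"
  have [simp]: "fst (EG_vertex_action G g v) = fst v" for v by (cases v) simp
  have "inj_on (fst \<circ> EG_vertex_action G g) S" using S by (simp add: EG_complex_def comp_def)
  then have "inj_on fst (EG_vertex_action G g ` S)" by (rule inj_on_imageI)
  moreover have "EG_vertex_action G g v \<in> UNIV \<times> carrier G" if "v \<in> S" for v
    using S g that by (cases v) (auto simp: EG_complex_def)
  ultimately show ?thesis using S unfolding EG_complex_def by blast
qed

lemma EG_action_compose:
  assumes "g \<in> carrier G" "h \<in> carrier G" "x \<in> topspace (EG_space G)"
  shows "EG_action G (g \<otimes> h) x = EG_action G g (EG_action G h x)"
proof -
  obtain S where S: "S \<in> EG_complex G" "x \<in> closed_face S"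
    using assms(3) unfolding EG_space_eq topspace_realization by blast
  show ?thesis
    unfolding EG_action_eq realization_map_compose[OF S(2)]
  proof (rule realization_map_cong[OF S(2)])
    fix v assume "v \<in> S"
    then have "snd v \<in> carrier G" using S(1) by (auto simp: EG_complex_def)
    then show "EG_vertex_action G (g \<otimes> h) v = EG_vertex_action G g (EG_vertex_action G h v)"
      using assms(1,2) by (cases v) (simp add: m_assoc)
  qed
qed

lemma EG_action_one:
  assumes "x \<in> topspace (EG_space G)"
  shows "EG_action G \<one> x = x"
proof -
  obtain S where S: "S \<in> EG_complex G" "x \<in> closed_face S"
    using assms unfolding EG_space_eq topspace_realization by blast
  show ?thesis
    unfolding EG_action_eq
  proof (rule realization_map_ident[OF S(2)])
    fix v assume "v \<in> S"
    then have "snd v \<in> carrier G" using S(1) by (auto simp: EG_complex_def)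
    then show "EG_vertex_action G \<one> v = v" by (cases v) simp
  qed
qed

lemma EG_action_continuous: "g \<in> carrier G \<Longrightarrow> continuous_map (EG_space G) (EG_space G) (EG_action G g)"
  unfolding EG_space_eq EG_action_eq by (rule realization_map_continuous) (rule EG_complex_action)

text \<open>The neighbourhood is the open star of a vertex \<open>(n, h)\<close>. If
  \<open>u\<close> and its translate by \<open>g\<close> both lie in it, the support of
  \<open>u\<close> contains \<open>h\<close> and also some \<open>h'\<close> with
  \<open>g h' = h\<close> in the join factor \<open>n\<close>; a simplex has only one vertex there,
  so \<open>g\<close> is the identity.\<close>

lemma EG_nbhd:
  assumes "x \<in> topspace (EG_space G)"
  obtains U where "openin (EG_space G) U" "x \<in> U"
    "\<And>g u. g \<in> carrier G \<Longrightarrow> u \<in> U \<Longrightarrow> EG_action G g u \<in> U \<Longrightarrow> g = \<one>"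
proof -
  obtain S where S: "S \<in> EG_complex G" "x \<in> closed_face S"
    using assms unfolding EG_space_eq topspace_realization by blast
  obtain v where v: "v \<in> S" "0 < x v" by (rule closed_face_pos[OF S(2)])
  obtain n h where nh: "v = (n, h)" by (cases v)
  let ?U = "{y \<in> topspace (EG_space G). y v \<in> {0<..}}"
  show ?thesis
  proof (rule that[of ?U])
    show "openin (EG_space G) ?U"
      unfolding EG_space_eq by (rule openin_continuous_map_preimage[OF continuous_map_coordinate]) simp
    show "x \<in> ?U" using assms v by simp
    fix g u assume g: "g \<in> carrier G" and u: "u \<in> ?U" and gu: "EG_action G g u \<in> ?U"
    obtain S' where S': "S' \<in> EG_complex G" "u \<in> closed_face S'"
      using u unfolding EG_space_eq topspace_realization by blast
    have v': "v \<in> S'" using closed_faceD(2)[OF S'(2), of v] u by auto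
    have "v \<in> EG_vertex_action G g ` S'"
      using realization_map_outside[OF S'(2), of v "EG_vertex_action G g"] gu unfolding EG_action_eq by auto
    then obtain h' where h': "(n, h') \<in> S'" "h = g \<otimes> h'" unfolding nh by auto
    have "h' = h" using S'(1) v' h'(1) unfolding nh EG_complex_def inj_on_def by fastforce
    moreover have "h' \<in> carrier G" using S'(1) h'(1) by (auto simp: EG_complex_def)
    ultimately show "g = \<one>" using h'(2) g by (metis r_cancel_one')
  qed
qed

lemma covering_action_EG: "covering_action G (EG_space G) (EG_action G)"
proof (unfold_locales)
  show "continuous_map (EG_space G) (EG_space G) (EG_action G g)" if "g \<in> carrier G" for g
    by (rule EG_action_continuous[OF that])
  show "EG_action G \<one> y = y" if "y \<in> topspace (EG_space G)" for y by (rule EG_action_one[OF that])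
  show "EG_action G (g \<otimes> h) y = EG_action G g (EG_action G h y)"
    if "g \<in> carrier G" "h \<in> carrier G" "y \<in> topspace (EG_space G)" for g h y
    by (rule EG_action_compose[OF that])
  show "\<exists>U. openin (EG_space G) U \<and> y \<in> U \<and> (\<forall>g\<in>carrier G. \<forall>u\<in>U. EG_action G g u \<in> U \<longrightarrow> g = \<one>)"
    if "y \<in> topspace (EG_space G)" for y
    using EG_nbhd[OF that] by metis
qed

lemma covering_action_borel:
  assumes cont: "\<And>g. g \<in> carrier G \<Longrightarrow> continuous_map X X (\<psi> g)"
    and one: "\<And>x. x \<in> topspace X \<Longrightarrow> \<psi> \<one> x = x"
    and mult: "\<And>g h x. g \<in> carrier G \<Longrightarrow> h \<in> carrier G \<Longrightarrow> x \<in> topspace X \<Longrightarrow> \<psi> (g \<otimes> h) x = \<psi> g (\<psi> h x)"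
  shows "covering_action G (prod_topology (EG_space G) X) (\<lambda>g. map_prod (EG_action G g) (\<psi> g))"
proof (unfold_locales)
  show "continuous_map (prod_topology (EG_space G) X) (prod_topology (EG_space G) X) (map_prod (EG_action G g) (\<psi> g))"
    if g: "g \<in> carrier G" for g
  proof -
    have "continuous_map (prod_topology (EG_space G) X) (EG_space G) (EG_action G g \<circ> fst)"
      "continuous_map (prod_topology (EG_space G) X) X (\<psi> g \<circ> snd)"
      by (rule continuous_map_compose[OF continuous_map_fst EG_action_continuous[OF g]])
        (rule continuous_map_compose[OF continuous_map_snd cont[OF g]])
    then have "continuous_map (prod_topology (EG_space G) X) (prod_topology (EG_space G) X)
        (\<lambda>z. ((EG_action G g \<circ> fst) z, (\<psi> g \<circ> snd) z))"
      by (rule continuous_map_pairedI)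
    moreover have "(\<lambda>z. ((EG_action G g \<circ> fst) z, (\<psi> g \<circ> snd) z)) = map_prod (EG_action G g) (\<psi> g)"
      by (rule ext) (simp add: map_prod_def split_beta)
    ultimately show ?thesis by simp
  qed
  show "map_prod (EG_action G \<one>) (\<psi> \<one>) y = y" if "y \<in> topspace (prod_topology (EG_space G) X)" for y
    using that one[of "snd y"] EG_action_one[of "fst y"] by (cases y) simp
  show "map_prod (EG_action G (g \<otimes> h)) (\<psi> (g \<otimes> h)) y = map_prod (EG_action G g) (\<psi> g) (map_prod (EG_action G h) (\<psi> h) y)"
    if "g \<in> carrier G" "h \<in> carrier G" "y \<in> topspace (prod_topology (EG_space G) X)" for g h y
    using that mult[of g h "snd y"] EG_action_compose[of g h "fst y"] by (cases y) simp
  show "\<exists>U. openin (prod_topology (EG_space G) X) U \<and> y \<in> U \<and>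
      (\<forall>g\<in>carrier G. \<forall>u\<in>U. map_prod (EG_action G g) (\<psi> g) u \<in> U \<longrightarrow> g = \<one>)"
    if y: "y \<in> topspace (prod_topology (EG_space G) X)" for y
  proof -
    have y': "fst y \<in> topspace (EG_space G)" "snd y \<in> topspace X" using y by (cases y; simp)+
    obtain U where U: "openin (EG_space G) U" "fst y \<in> U"
      "\<And>g u. g \<in> carrier G \<Longrightarrow> u \<in> U \<Longrightarrow> EG_action G g u \<in> U \<Longrightarrow> g = \<one>"
      using EG_nbhd[OF y'(1)] by metis
    show ?thesis
    proof (intro exI[of _ "U \<times> topspace X"] conjI ballI impI)
      show "openin (prod_topology (EG_space G) X) (U \<times> topspace X)"
        unfolding openin_prod_Times_iff using U(1) by simp
      show "y \<in> U \<times> topspace X" using U(2) y'(2) by (cases y) simp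
      fix g u assume "g \<in> carrier G" "u \<in> U \<times> topspace X" "map_prod (EG_action G g) (\<psi> g) u \<in> U \<times> topspace X"
      then show "g = \<one>" using U(3)[of g "fst u"] by (cases u) simp
    qed
  qed
qed

end

text \<open>Otherwise a linear functional with suitable weights per level would be continuous on \<open>EG\<close> but
  unbounded on \<open>C\<close>.\<close>
lemma compactin_EG_bounded_level:
  assumes C: "compactin (EG_space G) C"
  obtains N where "\<And>x m h. x \<in> C \<Longrightarrow> N \<le> m \<Longrightarrow> x (m, h) = 0"
proof -
  define hit where "hit m z \<longleftrightarrow> fst z \<in> C \<and> 0 < fst z (m, snd z)" for m and z :: "(nat \<times> 'a \<Rightarrow> real) \<times> 'a"
  define y where "y m = (SOME z. hit m z)" for m
  \<comment> \<open>The weight is chosen so that the functional is at least \<open>m\<close> at the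
    selected point whose support meets level \<open>m\<close>.\<close>
  define c where "c m = (if \<exists>z. hit m z then real m / fst (y m) (m, snd (y m)) else 0)" for m
  have y: "hit m (y m)" if "\<exists>z. hit m z" for m using someI_ex[OF that] by (simp add: y_def)
  have c_nonneg: "0 \<le> c m" for m
  proof (cases "\<exists>z. hit m z")
    case True
    from y[OF this] have "0 < fst (y m) (m, snd (y m))" by (simp add: hit_def)
    then show ?thesis using True by (simp add: c_def)
  qed (unfold c_def, simp)
  define F where "F x = (\<Sum>v | x v \<noteq> 0. c (fst v) * x v)" for x :: "nat \<times> 'a \<Rightarrow> real"
  have F_face: "F x = (\<Sum>v\<in>S. c (fst v) * x v)" if "x \<in> closed_face S" for x S
    unfolding F_def using closed_face_finite[OF that] closed_faceD(2)[OF that]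
    by (intro sum.mono_neutral_left) auto
  have "continuous_map (EG_space G) euclideanreal F"
    unfolding EG_space_eq
  proof (rule continuous_map_from_realization)
    fix S assume "S \<in> EG_complex G"
    then have fin: "finite S" by (simp add: EG_complex_def)
    show "continuous_map (subtopology (powertop_real UNIV) (closed_face S)) euclideanreal F"
    proof (rule continuous_map_eq)
      show "continuous_map (subtopology (powertop_real UNIV) (closed_face S)) euclideanreal (\<lambda>x. \<Sum>v\<in>S. c (fst v) * x v)"
        using fin by (intro continuous_map_sum continuous_map_real_mult continuous_map_from_subtopology
            continuous_map_product_projection) auto
      show "(\<Sum>v\<in>S. c (fst v) * x v) = F x" if "x \<in> topspace (subtopology (powertop_real UNIV) (closed_face S))" for x
        using that F_face[of x S] by simp
    qed
  qed
  from image_compactin[OF C this] have "compact (F ` C)" by simp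
  then have "bounded (F ` C)" by (rule compact_imp_bounded)
  then obtain B where B: "\<And>x. x \<in> C \<Longrightarrow> \<bar>F x\<bar> \<le> B" by (auto simp: bounded_iff)
  obtain N where N: "B < real N" using reals_Archimedean2 by blast
  have CT: "C \<subseteq> topspace (EG_space G)" using C by (rule compactin_subset_topspace)
  show ?thesis
  proof (rule that)
    fix x m h assume x: "x \<in> C" and m: "N \<le> m"
    show "x (m, h) = 0"
    proof (rule ccontr)
      assume ne: "x (m, h) \<noteq> 0"
      have face: "\<exists>S. z \<in> closed_face S" if "z \<in> C" for z
        using that CT unfolding EG_space_eq topspace_realization by blast
      obtain S where "x \<in> closed_face S" using face[OF x] by blast
      then have "hit m (x, h)" using x ne closed_faceD(1)[of x S "(m, h)"] unfolding hit_def by simp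
      then have ex: "\<exists>z. hit m z" by blast
      obtain z h' where zh: "y m = (z, h')" by (cases "y m")
      have z: "z \<in> C" "0 < z (m, h')" using y[OF ex] unfolding zh hit_def by simp_all
      obtain S where S: "z \<in> closed_face S" using face[OF z(1)] by blast
      have "(m, h') \<in> S" using closed_faceD(2)[OF S, of "(m, h')"] z(2) by auto
      then have "c m * z (m, h') \<le> F z"
        unfolding F_face[OF S] using closed_face_finite[OF S] c_nonneg closed_faceD(1)[OF S]
        by (intro order_trans[OF _ member_le_sum[of "(m, h')"]]) auto
      moreover have "c m * z (m, h') = real m" using ex z(2) by (simp add: c_def zh)
      ultimately show False using B[OF z(1)] N m by linarith
    qed
  qed
qed

context group
begin

text \<open>The straight-line homotopy to a vertex of level \<open>N\<close> stays in simplices,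
  because the points involved have no other vertex on that level. Finiteness of the group leaves
  finitely many simplices, so continuity on the product with the interval follows by pasting closed
  pieces.\<close>

lemma EG_cone_homotopy:
  assumes fin: "finite (carrier G)"
  defines "Y \<equiv> \<lambda>N. {x \<in> topspace (EG_space G). \<forall>m h. x (m, h) \<noteq> 0 \<longrightarrow> m < N \<or> m = N \<and> h = \<one>}"
  defines "e \<equiv> \<lambda>N v. if v = (N, \<one>) then 1 else (0::real)"
  shows "homotopic_with (\<lambda>h. h \<in> {} \<rightarrow> {}) (subtopology (EG_space G) (Y N)) (EG_space G) id (\<lambda>_. e N)"
proof -
  let ?E = "EG_space G" and ?v = "(N, \<one>)"
  let ?X = "prod_topology (top_of_set {0..1::real}) (subtopology ?E (Y N))"
  let ?V = "insert ?v ({..<N} \<times> carrier G)"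
  let ?I = "EG_complex G \<inter> Pow ?V"
  define H where "H z = (\<lambda>v. (1 - fst z) * snd z v + fst z * e N v)" for z :: "real \<times> (nat \<times> 'a \<Rightarrow> real)"
  have finI: "finite ?I" using fin by simp
  have YT: "Y N \<subseteq> topspace ?E" by (auto simp: Y_def)
  have in_face: "\<exists>S\<in>?I. x \<in> closed_face S" if x: "x \<in> Y N" for x
  proof -
    obtain S where S: "S \<in> EG_complex G" "x \<in> closed_face S"
      using x unfolding Y_def EG_space_eq topspace_realization by blast
    let ?S = "{v \<in> S. x v \<noteq> 0}"
    have "?S \<in> EG_complex G" using S(1) unfolding EG_complex_def by (auto intro: inj_on_subset)
    moreover have "?S \<subseteq> ?V"
    proof
      fix v assume v: "v \<in> ?S"
      obtain m h where mh: "v = (m, h)" by (cases v)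
      have "h \<in> carrier G" using S(1) v mh unfolding EG_complex_def by auto
      moreover have "m < N \<or> m = N \<and> h = \<one>" using x v mh unfolding Y_def by blast
      ultimately show "v \<in> ?V" unfolding mh by auto
    qed
    moreover have "x \<in> closed_face ?S"
      using S closed_faceD(2)[OF S(2)] closed_face_finite[OF S(2)] by (intro closed_face_mono[OF S(2)]) auto
    ultimately show ?thesis by blast
  qed
  have cone: "insert ?v S \<in> EG_complex G" if "S \<in> ?I" for S
    using that unfolding EG_complex_def by (auto simp: inj_on_def)
  define T where "T S = {z \<in> topspace ?X. \<forall>v. v \<notin> S \<longrightarrow> snd z v = 0}" for S
  have snd_cont: "continuous_map ?X euclideanreal (\<lambda>z. snd z v)" for v
  proof -
    have "continuous_map (subtopology ?E (Y N)) euclideanreal (\<lambda>x. x v)"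
      unfolding EG_space_eq by (rule continuous_map_from_subtopology[OF continuous_map_coordinate])
    from continuous_map_compose[OF continuous_map_snd this] show ?thesis by (simp add: o_def)
  qed
  have fst_cont: "continuous_map ?X euclideanreal fst"
    using continuous_map_fst[of "top_of_set {0..1::real}" "subtopology ?E (Y N)"]
    by (simp add: continuous_map_in_subtopology)
  have "continuous_map ?X ?E H"
  proof (rule pasting_lemma_closed[where I = ?I and T = T and f = "\<lambda>_. H"])
    show "finite ?I" by (rule finI)
    fix S assume S: "S \<in> ?I"
    then have finS: "finite S" by (simp add: EG_complex_def)
    \<comment> \<open>Closedness is seen from the coordinates outside \<open>S\<close>. There are
      such coordinates, since \<open>S\<close> is finite and the set of levels is not.\<close>
    have "T S = (\<Inter>v\<in>- S. {z \<in> topspace ?X. snd z v \<in> {0}})"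
    proof -
      have "(n, \<one>) \<in> S" if "- S = {}" for n :: nat using that by blast
      then have "- S \<noteq> {}" using finS infinite_UNIV_nat finite_subset[of "(\<lambda>n. (n, \<one>)) ` (UNIV :: nat set)" S]
        by (auto dest!: finite_imageD intro: inj_onI)
      then show ?thesis unfolding T_def by blast
    qed
    moreover have "closedin ?X (\<Inter>v\<in>- S. {z \<in> topspace ?X. snd z v \<in> {0}})"
    proof (rule closedin_INT)
      have "infinite (UNIV :: (nat \<times> 'a) set)" by (simp add: finite_prod)
      then show "- S \<noteq> {}" using finS by (metis Compl_empty_eq double_compl)
      show "closedin ?X {z \<in> topspace ?X. snd z v \<in> {0}}" if "v \<in> - S" for v
        by (rule closedin_continuous_map_preimage[OF snd_cont]) simp
    qed
    ultimately show "closedin ?X (T S)" by simp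
    show "continuous_map (subtopology ?X (T S)) ?E H"
      unfolding EG_space_eq
    proof (rule continuous_map_into_realization[OF cone[OF S]])
      have "continuous_map ?X euclideanreal (\<lambda>z. H z v)" for v
        unfolding H_def using fst_cont snd_cont
        by (intro continuous_map_add continuous_map_real_mult continuous_map_diff) auto
      then have "continuous_map ?X (powertop_real UNIV) H" unfolding continuous_map_componentwise_UNIV by blast
      then show "continuous_map (subtopology (prod_topology (top_of_set {0..1}) (subtopology (realization (EG_complex G)) (Y N))) (T S)) (powertop_real UNIV) H"
        unfolding EG_space_eq by (rule continuous_map_from_subtopology)
      fix z assume "z \<in> topspace (subtopology (prod_topology (top_of_set {0..1}) (subtopology (realization (EG_complex G)) (Y N))) (T S))"
      then have z: "z \<in> T S" "fst z \<in> {0..1}" "snd z \<in> Y N" by (auto simp: T_def)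
      obtain S0 where S0: "snd z \<in> closed_face S0" using in_face[OF z(3)] by blast
      have x: "snd z \<in> closed_face (insert ?v S)"
        using z(1) finS by (intro closed_face_mono[OF S0]) (auto simp: T_def)
      show "H z \<in> closed_face (insert ?v S)"
        unfolding closed_face_def
      proof (intro CollectI conjI allI impI)
        show "0 \<le> H z v" for v using z(2) closed_faceD(1)[OF x] by (simp add: H_def e_def)
        show "H z v = 0" if "v \<notin> insert ?v S" for v
          using that closed_faceD(2)[OF x that] by (simp add: H_def e_def)
        have e1: "(\<Sum>v\<in>insert ?v S. e N v) = 1" using finS by (simp add: e_def sum.delta)
        have "(\<Sum>v\<in>insert ?v S. H z v) = (1 - fst z) * (\<Sum>v\<in>insert ?v S. snd z v) + fst z * (\<Sum>v\<in>insert ?v S. e N v)"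
          unfolding H_def sum.distrib sum_distrib_left ..
        then show "(\<Sum>v\<in>insert ?v S. H z v) = 1" unfolding e1 closed_faceD(3)[OF x] by simp
      qed
    qed
  next
    fix z assume z: "z \<in> topspace ?X"
    then have "snd z \<in> Y N" by (auto simp: topspace_prod_topology)
    from in_face[OF this] obtain S where S: "S \<in> ?I" "snd z \<in> closed_face S" ..
    have "z \<in> T S" unfolding T_def using z closed_faceD(2)[OF S(2)] by blast
    then show "\<exists>S. S \<in> ?I \<and> z \<in> T S \<and> H z = H z" using S(1) by blast
  qed simp
  moreover have "H (0, x) = id x" "H (1, x) = e N" for x by (auto simp: H_def)
  ultimately show ?thesis
    unfolding homotopic_with_def by (intro exI[of _ H] conjI) simp_all
qed

lemma aug_chain_map: "aug (chain_map n f c) = aug c"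
  by (simp add: chain_map_def ev_frag_extend)

text \<open>The simplices of a cycle have compact images and hence occupy finitely many levels.
  There the cycle contracts to a vertex on a free level, and a point has no reduced
  homology.\<close>

lemma acyclic_EG:
  assumes fin: "finite (carrier G)"
  shows "acyclic_cx (sing (EG_space G) (EG_action G))"
  unfolding acyclic_cx_def bdry_sing sing_simps
proof (intro conjI allI impI)
  have "{(0, \<one>)} \<in> EG_complex G" by (simp add: EG_complex_def)
  then have "singular_simplex 0 (EG_space G) (lin 0 [(0, \<one>)])"
    unfolding EG_space_eq by (intro singular_simplex_lin) simp_all
  then show "\<exists>c. Poly_Mapping.keys c \<subseteq> singular_simplex_set 0 (EG_space G) \<and> aug c = 1"
    by (intro exI[of _ "frag_of (lin 0 [(0, \<one>)])"]) (simp add: keys_frag_of)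
next
  let ?E = "EG_space G"
  fix n c
  assume c: "Poly_Mapping.keys c \<subseteq> singular_simplex_set n ?E" and bc: "chain_boundary n c = 0" and aug: "n = 0 \<longrightarrow> aug c = 0"
  have "\<exists>N. \<forall>x\<in>\<sigma> ` standard_simplex n. \<forall>m\<ge>N. \<forall>h. x (m, h) = 0" if "\<sigma> \<in> Poly_Mapping.keys c" for \<sigma>
  proof -
    have "continuous_map (subtopology (powertop_real UNIV) (standard_simplex n)) ?E \<sigma>"
      using c that unfolding singular_simplex_def by blast
    then have "compactin ?E (\<sigma> ` standard_simplex n)"
      by (rule image_compactin[rotated]) (simp add: compactin_subtopology compactin_standard_simplex)
    then show ?thesis using compactin_EG_bounded_level by metis
  qed
  then obtain NN where NN: "\<And>\<sigma> x m h. \<sigma> \<in> Poly_Mapping.keys c \<Longrightarrow> x \<in> \<sigma> ` standard_simplex n \<Longrightarrow> NN \<sigma> \<le> m \<Longrightarrow> x (m, h) = 0"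
    by metis
  define N where "N = Max (insert 0 (NN ` Poly_Mapping.keys c))"
  have N: "NN \<sigma> \<le> N" if "\<sigma> \<in> Poly_Mapping.keys c" for \<sigma> using that unfolding N_def by (intro Max_ge) auto
  define Y where "Y = {x \<in> topspace ?E. \<forall>m h. x (m, h) \<noteq> 0 \<longrightarrow> m < N \<or> m = N \<and> h = \<one>}"
  define e where "e = (\<lambda>v. if v = (N, \<one>) then 1 else (0::real))"
  have cE: "singular_chain n ?E c" using c by (simp add: singular_chain_def)
  have cY: "singular_chain n (subtopology ?E Y) c"
    unfolding singular_chain_subtopology
  proof (intro conjI ballI cE subsetI)
    fix \<sigma> x assume \<sigma>: "\<sigma> \<in> Poly_Mapping.keys c" and x: "x \<in> \<sigma> ` standard_simplex n"
    have "x \<in> topspace ?E" using x c \<sigma> singular_simplex_in_topspace by blast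
    moreover have "m < N" if "x (m, h) \<noteq> 0" for m h
      using NN[OF \<sigma> x, of m h] N[OF \<sigma>] that by (meson le_trans not_le)
    ultimately show "x \<in> Y" unfolding Y_def by blast
  qed
  have hom: "homotopic_with (\<lambda>h. h \<in> {} \<rightarrow> {}) (subtopology ?E Y) ?E id (\<lambda>_. e)"
    using EG_cone_homotopy[OF fin, of N] unfolding Y_def e_def .
  have rc: "singular_relcycle n (subtopology ?E Y) {} c" unfolding singular_cycle using cY bc by blast
  have "homologous_rel n ?E {} (chain_map n id c) (chain_map n (\<lambda>_. e) c)"
    by (rule homotopic_imp_homologous_rel_chain_maps[OF hom rc])
  then have "singular_relboundary n ?E {} (c - chain_map n (\<lambda>_. e) c)"
    unfolding homologous_rel_def chain_map_ident[OF cE] .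
  moreover have "singular_relboundary n ?E {} (chain_map n (\<lambda>_. e) c)"
  proof -
    let ?P = "subtopology ?E {e}"
    have "continuous_map (subtopology ?E Y) ?E (\<lambda>_. e)" using homotopic_with_imp_continuous_maps[OF hom] by blast
    have "{(N, \<one>)} \<in> EG_complex G" by (simp add: EG_complex_def)
    moreover have "e \<in> closed_face {(N, \<one>)}" by (simp add: closed_face_def e_def)
    ultimately have eE: "e \<in> topspace ?E" unfolding EG_space_eq topspace_realization by blast
    then have tP: "topspace ?P = {e}" by simp
    have cont: "continuous_map ?E ?P (\<lambda>_. e)" using eE by (simp add: continuous_map_in_subtopology)
    have ch: "singular_chain n ?P (chain_map n (\<lambda>_. e) c)" by (rule singular_chain_chain_map[OF cE cont])
    have cyc: "chain_boundary n (chain_map n (\<lambda>_. e) c) = 0"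
      using chain_boundary_chain_map[OF cE, of "\<lambda>_. e"] bc by simp
    have "singular_relboundary n ?P {} (chain_map n (\<lambda>_. e) c)"
    proof (cases "n = 0")
      case True
      obtain b where b: "chain_map n (\<lambda>_. e) c = frag_cmul b (frag_of (restrict (\<lambda>x. e) (standard_simplex n)))"
        using ch singular_chain_singleton[OF tP] by blast
      have "b = aug (chain_map n (\<lambda>_. e) c)" unfolding b ev_cmul by simp
      also have "\<dots> = 0" unfolding aug_chain_map using aug True by blast
      finally have "chain_map n (\<lambda>_. e) c = 0" using b by simp
      then show ?thesis by simp
    next
      case False
      then have "1 \<le> n" by simp
      moreover have "singular_relcycle n ?P {} (chain_map n (\<lambda>_. e) c)" unfolding singular_cycle using ch cyc by blast
      ultimately show ?thesis using singular_boundary_eq_cycle_singleton[OF tP] by blast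
    qed
    then obtain d where d: "singular_chain (Suc n) ?P d" "chain_boundary (Suc n) d = chain_map n (\<lambda>_. e) c"
      unfolding singular_boundary by blast
    have "singular_chain (Suc n) ?E d" using d(1) unfolding singular_chain_subtopology by blast
    then show ?thesis unfolding singular_boundary using d(2) by blast
  qed
  ultimately have "singular_relboundary n ?E {} ((c - chain_map n (\<lambda>_. e) c) + chain_map n (\<lambda>_. e) c)"
    by (rule singular_relboundary_add)
  then have "singular_relboundary n ?E {} c" by simp
  then show "\<exists>b. Poly_Mapping.keys b \<subseteq> singular_simplex_set (Suc n) ?E \<and> chain_boundary (Suc n) b = c"
    unfolding singular_boundary singular_chain_def by blast
qed

end

lemma identity_chain_map:
  assumes "gcomplex G C"
  shows "equivariant_chain_map G C C (\<lambda>_. frag_of)"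
proof -
  interpret gcomplex G C by (rule assms)
  show ?thesis
    unfolding equivariant_chain_map_def
  proof (intro conjI allI ballI)
    fix n b assume b: "b \<in> Bas C n"
    show "chn C n (frag_of b)" using b by (simp add: keys_frag_of)
    show "bdry C n (frag_of b) = frag_extend frag_of (Bd C n b)"
      unfolding bdry_def frag_extend_of by (rule frag_expansion)
    show "frag_of (Act C n g b) = act C n g (frag_of b)" if "g \<in> carrier G" for g
      unfolding act_def frag_extend_of ..
  qed simp
qed

lemma simplex_chain_map:
  assumes h: "continuous_map Y Y' h"
    and eq: "\<And>g y. g \<in> carrier G \<Longrightarrow> y \<in> topspace Y \<Longrightarrow> h (\<phi> g y) = \<phi>' g (h y)"
  shows "equivariant_chain_map G (sing Y \<phi>) (sing Y' \<phi>') (\<lambda>n \<sigma>. frag_of (simplex_map n h \<sigma>))"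
  unfolding equivariant_chain_map_def bdry_sing act_sing sing_simps
proof (intro conjI allI ballI)
  fix n \<sigma> assume "\<sigma> \<in> singular_simplex_set n Y"
  then have \<sigma>: "singular_simplex n Y \<sigma>" by simp
  show "Poly_Mapping.keys (frag_of (simplex_map n h \<sigma>)) \<subseteq> singular_simplex_set n Y'"
    using singular_simplex_simplex_map[OF \<sigma> h] by (simp add: keys_frag_of)
  show "chain_boundary n (frag_of (simplex_map n h \<sigma>)) = frag_extend (\<lambda>\<sigma>. frag_of (simplex_map (n - 1) h \<sigma>)) (chain_boundary n (frag_of \<sigma>))"
    using chain_boundary_chain_map[of n Y "frag_of \<sigma>" h] \<sigma> by (simp add: singular_chain_of chain_map_def o_def)
  fix g assume g: "g \<in> carrier G"
  have "simplex_map n h (simplex_map n (\<phi> g) \<sigma>) = simplex_map n (\<phi>' g) (simplex_map n h \<sigma>)"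
    unfolding simplex_map_compose_on by (rule simplex_map_eq[OF \<sigma>]) (rule eq[OF g])
  then show "frag_of (simplex_map n h (simplex_map n (\<phi> g) \<sigma>)) = chain_map n (\<phi>' g) (frag_of (simplex_map n h \<sigma>))"
    by simp
qed simp

context covering_action
begin

text \<open>Points are viewed as singular 0-simplices, which makes the orbitwise choice for basis
  elements applicable.\<close>

lemma equivariant_point_choice:
  fixes w :: "'g \<Rightarrow> 'v \<Rightarrow> 'v"
  assumes ex: "\<And>y. y \<in> topspace Y \<Longrightarrow> \<exists>v. R y v"
    and R: "\<And>g y v. g \<in> carrier G \<Longrightarrow> y \<in> topspace Y \<Longrightarrow> R y v \<Longrightarrow> R (\<phi> g y) (w g v)"
    and w: "\<And>g h y v. g \<in> carrier G \<Longrightarrow> h \<in> carrier G \<Longrightarrow> y \<in> topspace Y \<Longrightarrow> R y v \<Longrightarrow> w (g \<otimes> h) v = w g (w h v)"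
  obtains F where "\<And>y. y \<in> topspace Y \<Longrightarrow> R y (F y)"
    "\<And>g y. g \<in> carrier G \<Longrightarrow> y \<in> topspace Y \<Longrightarrow> F (\<phi> g y) = w g (F y)"
proof -
  interpret S: gcomplex G "sing Y \<phi>" by (rule gcomplex_sing)
  have u: "unit_vec 0 \<in> standard_simplex 0" by (rule unit_vec_in) simp
  have at: "simplex_map 0 (\<phi> g) \<sigma> (unit_vec 0) = \<phi> g (\<sigma> (unit_vec 0))" for g \<sigma>
    using u by (simp add: simplex_map_def)
  define pt where "pt y = restrict (\<lambda>_. y) (standard_simplex 0)" for y :: 'a
  have pt: "singular_simplex 0 Y (pt y)" if "y \<in> topspace Y" for y
    using that unfolding singular_simplex_def pt_def
    by (simp add: continuous_map_eq[OF continuous_map_const[THEN iffD2]])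
  have pt_at: "pt y (unit_vec 0) = y" for y using u by (simp add: pt_def)
  have pt_act: "simplex_map 0 (\<phi> g) (pt y) = pt (\<phi> g y)" for g y
    by (rule ext) (simp add: simplex_map_def pt_def)
  show ?thesis
  proof (rule S.equivariant_choice[where n = 0 and w = w and R = "\<lambda>\<sigma>. R (\<sigma> (unit_vec 0))"])
    show "\<exists>v. R (b (unit_vec 0)) v" if "b \<in> Bas (sing Y \<phi>) 0" for b
      using that singular_simplex_in_topspace[OF _ u] by (intro ex) simp
    show "R (Act (sing Y \<phi>) 0 g b (unit_vec 0)) (w g v)"
      if "g \<in> carrier G" "b \<in> Bas (sing Y \<phi>) 0" "R (b (unit_vec 0)) v" for g b v
      unfolding sing_simps at using that singular_simplex_in_topspace[OF _ u] by (intro R) simp_all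
    show "w (g \<otimes> h) v = w g (w h v)"
      if "g \<in> carrier G" "h \<in> carrier G" "b \<in> Bas (sing Y \<phi>) 0" "R (b (unit_vec 0)) v" for g h b v
      using that singular_simplex_in_topspace[OF _ u] by (intro w) simp_all
    fix F assume F: "\<And>b. b \<in> Bas (sing Y \<phi>) 0 \<Longrightarrow> R (b (unit_vec 0)) (F b)"
      "\<And>g b. g \<in> carrier G \<Longrightarrow> b \<in> Bas (sing Y \<phi>) 0 \<Longrightarrow> F (Act (sing Y \<phi>) 0 g b) = w g (F b)"
    show ?thesis
    proof (rule that[of "\<lambda>y. F (pt y)"])
      show "R y (F (pt y))" if "y \<in> topspace Y" for y
        using F(1)[of "pt y"] pt[OF that] unfolding pt_at by simp
      show "F (pt (\<phi> g y)) = w g (F (pt y))" if "g \<in> carrier G" "y \<in> topspace Y" for g y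
        using F(2)[OF that(1), of "pt y"] pt[OF that(2)] pt_act by simp
    qed
  qed
qed

lemma simplex_lift_into:
  assumes W: "openin Y W" "\<And>g u. g \<in> carrier G \<Longrightarrow> u \<in> W \<Longrightarrow> \<phi> g u \<in> W \<Longrightarrow> g = \<one>"
    and \<tau>: "singular_simplex n (subtopology Q (q ` W)) \<tau>"
  obtains \<sigma> where "singular_simplex n Y \<sigma>" "simplex_map n q \<sigma> = \<tau>" "\<sigma> ` standard_simplex n \<subseteq> W"
proof -
  let ?D = "standard_simplex n"
  have \<tau>Q: "singular_simplex n Q \<tau>" and \<tau>W: "\<tau> ` ?D \<subseteq> q ` W" using \<tau> by (auto simp: singular_simplex_subtopology)
  have WY: "W \<subseteq> topspace Y" by (rule openin_subset[OF W(1)])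
  obtain \<rho> where \<rho>: "singular_simplex n Y \<rho>" "simplex_map n q \<rho> = \<tau>" by (rule simplex_lift_exists[OF \<tau>Q])
  have \<rho>Y: "\<rho> x \<in> topspace Y" if "x \<in> ?D" for x by (rule singular_simplex_in_topspace[OF \<rho>(1) that])
  have tr: "\<exists>g\<in>carrier G. \<phi> g (\<rho> x) \<in> W" if x: "x \<in> ?D" for x
  proof -
    have "q (\<rho> x) = \<tau> x" using \<rho>(2) x by (auto simp: simplex_map_def)
    then obtain u where u: "u \<in> W" "q (\<rho> x) = q u" using \<tau>W x by (metis imageE image_subset_iff)
    obtain g where "g \<in> carrier G" "u = \<phi> g (\<rho> x)" by (rule orbit_eqD[OF \<rho>Y[OF x] _ u(2)]) (use u WY in blast)+
    then show ?thesis using u(1) by blast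
  qed
  obtain x0 where x0: "x0 \<in> ?D" using nonempty_standard_simplex by blast
  obtain g where g: "g \<in> carrier G" "\<phi> g (\<rho> x0) \<in> W" using tr[OF x0] by blast
  define \<sigma> where "\<sigma> = simplex_map n (\<phi> g) \<rho>"
  have \<sigma>: "singular_simplex n Y \<sigma>" unfolding \<sigma>_def by (rule singular_simplex_simplex_map[OF \<rho>(1) cont[OF g(1)]])
  have \<sigma>_at: "\<sigma> x = \<phi> g (\<rho> x)" if "x \<in> ?D" for x using that by (simp add: \<sigma>_def simplex_map_def)
  have \<sigma>q: "simplex_map n q \<sigma> = \<tau>" unfolding \<sigma>_def simplex_map_q_act[OF \<rho>(1) g(1)] by (rule \<rho>(2))
  let ?B = "\<Union>h\<in>carrier G - {\<one>}. {y \<in> topspace Y. \<phi> h y \<in> W}"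
  have B: "openin Y ?B"
    using openin_continuous_map_preimage[OF cont W(1)] by (intro openin_Union) blast
  have conn: "connectedin Y (\<sigma> ` ?D)"
    using connectedin_continuous_map_image[of _ Y \<sigma> ?D] \<sigma> connectedin_standard_simplex[of n]
    unfolding singular_simplex_def by (metis connectedin_subtopology subset_refl)
  have cover: "\<sigma> ` ?D \<subseteq> W \<union> ?B"
  proof
    fix y assume "y \<in> \<sigma> ` ?D"
    then obtain x where x: "x \<in> ?D" "y = \<sigma> x" by blast
    obtain h where h: "h \<in> carrier G" "\<phi> h (\<rho> x) \<in> W" using tr[OF x(1)] by blast
    have "\<phi> (h \<otimes> inv g) y = \<phi> h (\<rho> x)"
      unfolding x(2) \<sigma>_at[OF x(1)] using mult[of "h \<otimes> inv g" g "\<rho> x"] h g \<rho>Y[OF x(1)] by (simp add: m_assoc)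
    moreover have "y \<in> topspace Y" unfolding x(2) by (rule singular_simplex_in_topspace[OF \<sigma> x(1)])
    ultimately have "y \<in> {y \<in> topspace Y. \<phi> (h \<otimes> inv g) y \<in> W}" "h \<otimes> inv g \<in> carrier G" using h g by simp_all
    moreover have "y \<in> W" if "h \<otimes> inv g = \<one>"
      using \<open>y \<in> {y \<in> topspace Y. \<phi> (h \<otimes> inv g) y \<in> W}\<close> one[of y] unfolding that by simp
    ultimately show "y \<in> W \<union> ?B" by blast
  qed
  have disj: "W \<inter> ?B = {}" using W(2) by blast
  have "\<sigma> ` ?D \<subseteq> W"
  proof (rule ccontr)
    assume "\<not> \<sigma> ` ?D \<subseteq> W"
    then have "?B \<inter> \<sigma> ` ?D \<noteq> {}" using cover by blast
    moreover have "W \<inter> \<sigma> ` ?D \<noteq> {}" using \<sigma>_at[OF x0] g(2) x0 by force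
    ultimately show False using conn W(1) B cover disj unfolding connectedin by blast
  qed
  then show ?thesis using that \<sigma> \<sigma>q by blast
qed

end

section \<open>Complexes with coloured vertices\<close>

text \<open>Isolates the features of the board behind the high-degree half: an action free on
  vertices and preserving \<open>k\<close> levels, with no simplex meeting a level twice.\<close>

locale colored_complex = group G for G :: "('g, 'm) monoid_scheme" (structure) +
  fixes V :: "'v set" and K :: "'v set set" and a :: "'g \<Rightarrow> 'v \<Rightarrow> 'v" and lev :: "'v \<Rightarrow> nat" and k :: nat
  assumes finite_G: "finite (carrier G)" and finite_V: "finite V"
    and K_V: "\<And>S. S \<in> K \<Longrightarrow> S \<subseteq> V"
    and K_down: "\<And>S T. S \<in> K \<Longrightarrow> T \<subseteq> S \<Longrightarrow> T \<in> K"
    and K_act: "\<And>g S. g \<in> carrier G \<Longrightarrow> S \<in> K \<Longrightarrow> a g ` S \<in> K"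
    and V_act: "\<And>g v. g \<in> carrier G \<Longrightarrow> v \<in> V \<Longrightarrow> a g v \<in> V"
    and a_one: "\<And>v. v \<in> V \<Longrightarrow> a \<one> v = v"
    and a_mult: "\<And>g h v. g \<in> carrier G \<Longrightarrow> h \<in> carrier G \<Longrightarrow> v \<in> V \<Longrightarrow> a (g \<otimes> h) v = a g (a h v)"
    and a_free: "\<And>g v. g \<in> carrier G \<Longrightarrow> v \<in> V \<Longrightarrow> a g v = v \<Longrightarrow> g = \<one>"
    and lev_inj: "\<And>S. S \<in> K \<Longrightarrow> inj_on lev S"
    and lev_V: "\<And>v. v \<in> V \<Longrightarrow> lev v \<in> {1..k}"
    and lev_act: "\<And>g v. lev (a g v) = lev v"
begin

abbreviation X :: "('v \<Rightarrow> real) topology" where "X \<equiv> realization K"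

abbreviation \<psi> :: "'g \<Rightarrow> ('v \<Rightarrow> real) \<Rightarrow> ('v \<Rightarrow> real)" where "\<psi> g \<equiv> realization_map (a g)"

abbreviation E :: "((nat \<times> 'g \<Rightarrow> real) \<times> ('v \<Rightarrow> real)) topology" where "E \<equiv> prod_topology (EG_space G) X"

abbreviation \<phi> :: "'g \<Rightarrow> (nat \<times> 'g \<Rightarrow> real) \<times> ('v \<Rightarrow> real) \<Rightarrow> (nat \<times> 'g \<Rightarrow> real) \<times> ('v \<Rightarrow> real)" where
  "\<phi> g \<equiv> map_prod (EG_action G g) (\<psi> g)"

lemma covering_E: "covering_action G E \<phi>"
proof (rule covering_action_borel)
  show "continuous_map X X (\<psi> g)" if "g \<in> carrier G" for g
    by (rule realization_map_continuous) (rule K_act[OF that])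
  show "\<psi> \<one> x = x" if "x \<in> topspace X" for x
  proof -
    obtain S where S: "S \<in> K" "x \<in> closed_face S" using \<open>x \<in> topspace X\<close> unfolding topspace_realization by blast
    show ?thesis by (rule realization_map_ident[OF S(2)]) (use K_V[OF S(1)] a_one in blast)
  qed
  show "\<psi> (g \<otimes> h) x = \<psi> g (\<psi> h x)" if "g \<in> carrier G" "h \<in> carrier G" "x \<in> topspace X" for g h x
  proof -
    obtain S where S: "S \<in> K" "x \<in> closed_face S" using \<open>x \<in> topspace X\<close> unfolding topspace_realization by blast
    show ?thesis
      unfolding realization_map_compose[OF S(2)]
      by (rule realization_map_cong[OF S(2)]) (use K_V[OF S(1)] a_mult[OF that(1,2)] in blast)
  qed
qed

text \<open>A substitute for simplicial approximation. Near the open simplex \<open>T\<close> the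
  largest coordinates belong to \<open>T\<close>, so choosing such a vertex turns small singular
  simplices into words that span a simplex of \<open>K\<close>.\<close>

definition max_at :: "('v \<Rightarrow> real) \<Rightarrow> 'v \<Rightarrow> bool" where
  "max_at x v \<longleftrightarrow> v \<in> V \<and> (\<forall>w\<in>V. x w \<le> x v)"

lemma max_at_exists:
  assumes "x \<in> topspace X"
  shows "\<exists>v. max_at x v"
proof -
  obtain S where S: "S \<in> K" "x \<in> closed_face S" using assms unfolding topspace_realization by blast
  obtain v where "v \<in> S" by (rule closed_face_pos[OF S(2)])
  then have "V \<noteq> {}" using K_V[OF S(1)] by blast
  then have "Max (x ` V) \<in> x ` V" using finite_V by (intro Max_in) blast+
  then obtain v where v: "v \<in> V" "Max (x ` V) = x v" by blast
  have "x w \<le> x v" if "w \<in> V" for w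
    unfolding v(2)[symmetric] by (rule Max_ge) (use that finite_V in blast)+
  then show ?thesis unfolding max_at_def using v(1) by blast
qed

text \<open>The action is injective on vertices, so it transports the coordinates of
  \<open>x\<close> without adding any of them up; vertices outside the image get coordinate
  0.\<close>

lemma max_at_act:
  assumes g: "g \<in> carrier G" and x: "x \<in> topspace X" and v: "max_at x v"
  shows "max_at (\<psi> g x) (a g v)"
  unfolding max_at_def
proof (intro conjI ballI)
  have v': "v \<in> V" "\<And>w. w \<in> V \<Longrightarrow> x w \<le> x v" using v by (auto simp: max_at_def)
  show "a g v \<in> V" by (rule V_act[OF g v'(1)])
  obtain S where S: "S \<in> K" "x \<in> closed_face S" using x unfolding topspace_realization by blast
  have inj: "inj_on (a g) V"
  proof (rule inj_onI)
    fix u w assume uw: "u \<in> V" "w \<in> V" "a g u = a g w"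
    have "a (inv g) (a g v) = v" if "v \<in> V" for v using a_mult[of "inv g" g v] a_one[of v] g that by simp
    then show "u = w" using uw by metis
  qed
  have xV: "x \<in> closed_face V" using K_V[OF S(1)] closed_faceD(2)[OF S(2)] finite_V by (intro closed_face_mono[OF S(2)]) blast+
  fix w assume "w \<in> V"
  show "\<psi> g x w \<le> \<psi> g x (a g v)"
  proof (cases "w \<in> a g ` V")
    case True
    then obtain u where u: "u \<in> V" "w = a g u" by blast
    show ?thesis unfolding u(2) realization_map_inj[OF xV inj u(1)] realization_map_inj[OF xV inj v'(1)] by (rule v'(2)[OF u(1)])
  next
    case False
    show ?thesis
      unfolding realization_map_outside[OF xV False] realization_map_inj[OF xV inj v'(1)] by (rule closed_faceD(1)[OF xV])
  qed
qed

text \<open>An open neighbourhood of the open simplex \<open>T\<close>, disjoint from its translates because a simplex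
  contains at most one vertex of each level.\<close>
definition nbd :: "'v set \<Rightarrow> ('v \<Rightarrow> real) set" where
  "nbd T = {x \<in> topspace X. \<forall>v\<in>V - T. \<exists>w\<in>T. x v < x w}"

lemma max_at_nbd:
  assumes "x \<in> nbd T" "max_at x v" "T \<subseteq> V"
  shows "v \<in> T"
proof (rule ccontr)
  assume "v \<notin> T"
  then obtain w where w: "w \<in> T" "x v < x w" using assms(1,2) unfolding nbd_def max_at_def by blast
  have "x w \<le> x v" using assms(2,3) w(1) unfolding max_at_def by blast
  then show False using w(2) by simp
qed

lemma openin_nbd:
  assumes "T \<subseteq> V"
  shows "openin X (nbd T)"
proof -
  have "openin X {x \<in> topspace X. x w - x v \<in> {0<..}}" for v w
    by (rule openin_continuous_map_preimage[OF continuous_map_diff[OF continuous_map_coordinate continuous_map_coordinate]]) simp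
  then have o: "openin X (\<Union>w\<in>T. {x \<in> topspace X. x w - x v \<in> {0<..}})" for v
    by (intro openin_Union) blast
  have "openin X (\<Inter>v\<in>V - T. \<Union>w\<in>T. {x \<in> topspace X. x w - x v \<in> {0<..}})" if "V - T \<noteq> {}"
    using that finite_V o by (intro openin_INT2) simp_all
  moreover have "nbd T = (\<Inter>v\<in>V - T. \<Union>w\<in>T. {x \<in> topspace X. x w - x v \<in> {0<..}})" if "V - T \<noteq> {}"
    using that unfolding nbd_def by fastforce
  moreover have "nbd T = topspace X" if "V - T = {}" using that unfolding nbd_def by blast
  ultimately show ?thesis by (cases "V - T = {}") simp_all
qed

lemma nbd_cover:
  assumes x: "x \<in> topspace X"
  shows "\<exists>T\<in>K. x \<in> nbd T"
proof -
  obtain S where S: "S \<in> K" "x \<in> closed_face S" using x unfolding topspace_realization by blast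
  let ?T = "{v \<in> S. x v \<noteq> 0}"
  obtain w where w: "w \<in> S" "0 < x w" by (rule closed_face_pos[OF S(2)])
  have "\<exists>w\<in>?T. x v < x w" if "v \<in> V - ?T" for v
  proof -
    have "x v = 0" using that closed_faceD(2)[OF S(2), of v] by blast
    then show ?thesis using w by (intro bexI[of _ w]) simp_all
  qed
  then have "x \<in> nbd ?T" unfolding nbd_def using x by blast
  moreover have "?T \<in> K" by (rule K_down[OF S(1)]) blast
  ultimately show ?thesis by blast
qed

lemma nbd_translates:
  assumes T: "T \<in> K" and g: "g \<in> carrier G" and x: "x \<in> nbd T" "\<psi> g x \<in> nbd T"
  shows "g = \<one>"
proof -
  have xX: "x \<in> topspace X" using x(1) by (simp add: nbd_def)
  obtain v where v: "max_at x v" using max_at_exists[OF xX] by blast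
  have vT: "v \<in> T" by (rule max_at_nbd[OF x(1) v K_V[OF T]])
  have "a g v \<in> T" by (rule max_at_nbd[OF x(2) max_at_act[OF g xX v] K_V[OF T]])
  then have "a g v = v" using lev_inj[OF T] vT lev_act unfolding inj_on_def by blast
  then show ?thesis using a_free[OF g] K_V[OF T] vT by blast
qed

lemma full_lists: "list_action G V {xs. set xs \<subseteq> V} a"
  by unfold_locales (use V_act a_one a_mult a_free in auto)

lemma simplex_lists: "list_action G V {xs. set xs \<in> K} a"
proof unfold_locales
  show "u @ w \<in> {xs. set xs \<in> K}" if "u @ x # w \<in> {xs. set xs \<in> K}" for u w x
    using that K_down[of "set (u @ x # w)" "set (u @ w)"] by auto
qed (use K_V K_act a_one a_mult a_free in auto)

lemma projection_chain_map:
  "equivariant_chain_map G (sing E \<phi>) (sing (EG_space G) (EG_action G)) (\<lambda>n \<sigma>. frag_of (simplex_map n fst \<sigma>))"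
  by (rule simplex_chain_map[OF continuous_map_fst]) simp

lemma borel_projection_orbit: "borel_projection (orbit G \<phi> y) = orbit G (EG_action G) (fst y)"
  unfolding borel_projection_def orbit_def by (cases y) force

lemma borel_projection_simplex:
  "simplex_map n borel_projection (simplex_map n (orbit G \<phi>) \<sigma>) = simplex_map n (orbit G (EG_action G)) (simplex_map n fst \<sigma>)"
  unfolding simplex_map_compose_on borel_projection_orbit ..

text \<open>In degree at least \<open>k\<close> the cochain \<open>z\<close> is, up to a coboundary, computed on the tuple of vertices of
  largest coordinate of a small simplex; sorting such a tuple by level kills it, as there are only \<open>k\<close> levels.\<close>
lemma high_degree_pullback:
  fixes z :: "((nat \<Rightarrow> real) \<Rightarrow> (nat \<times> 'g \<Rightarrow> real) set) \<Rightarrow> int"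
  assumes z: "\<And>\<tau>. singular_simplex (Suc n) (BG_space G) \<tau> \<Longrightarrow> [ev z (chain_boundary (Suc n) (frag_of \<tau>)) = 0] (mod m)"
    and n: "k \<le> n" "0 < n"
  shows "\<exists>w. \<forall>\<tau>. singular_simplex n (borel_space G X \<psi>) \<tau> \<longrightarrow>
    [z (simplex_map n borel_projection \<tau>) = ev w (chain_boundary n (frag_of \<tau>))] (mod m)"
proof -
  interpret B: covering_action G "EG_space G" "EG_action G" by (rule covering_action_EG)
  interpret P: covering_action G E \<phi> by (rule covering_E)
  define f where "f \<sigma> = z (simplex_map n B.q \<sigma>)" for \<sigma>
  let ?EG = "sing (EG_space G) (EG_action G)" and ?E = "sing E \<phi>"
  let ?V = "lists_cx {xs. set xs \<subseteq> V} a" and ?K = "lists_cx {xs. set xs \<in> K} a"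
  have gEG: "gcomplex G ?EG" by (rule B.gcomplex_sing)
  have gE: "gcomplex G ?E" by (rule P.gcomplex_sing)
  have gV: "gcomplex G ?V" by (rule list_action.gcomplex_lists[OF full_lists])
  have gK: "gcomplex G ?K" by (rule list_action.gcomplex_lists[OF simplex_lists])
  have ac: "acyclic_cx ?EG" by (rule acyclic_EG[OF finite_G])
  have pV: "gcomplex_pair G ?V ?EG" and pK: "gcomplex_pair G ?K ?EG" and pE: "gcomplex_pair G ?E ?EG"
    by (intro gcomplex_pair.intro gcomplex_pair_axioms.intro gV gK gE gEG ac)+
  have f_inv: "inv_cochain G ?EG n f" unfolding f_def by (rule B.inv_cochain_pull)
  have f_coc: "cocycle_mod m ?EG n f" unfolding f_def by (rule B.cocycle_pull) (use z in \<open>simp add: BG_space_def\<close>)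
  obtain \<nu> where \<nu>: "equivariant_chain_map G ?V ?EG \<nu>" by (rule gcomplex_pair.chain_map_exists[OF pV])
  obtain \<Phi> where \<Phi>: "\<And>y. y \<in> topspace E \<Longrightarrow> max_at (snd y) (\<Phi> y)"
    "\<And>g y. g \<in> carrier G \<Longrightarrow> y \<in> topspace E \<Longrightarrow> \<Phi> (\<phi> g y) = a g (\<Phi> y)"
  proof (rule P.equivariant_point_choice[where R = "\<lambda>y. max_at (snd y)" and w = a])
    show "\<exists>v. max_at (snd y) v" if "y \<in> topspace E" for y using that by (intro max_at_exists) auto
    show "max_at (snd (\<phi> g y)) (a g v)" if "g \<in> carrier G" "y \<in> topspace E" "max_at (snd y) v" for g y v
      using that max_at_act[of g "snd y" v] by (cases y) simp
    show "a (g \<otimes> h) v = a g (a h v)" if "g \<in> carrier G" "h \<in> carrier G" "max_at (snd y) v" for g h y v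
      using that a_mult by (simp add: max_at_def)
  qed blast
  have "equivariant_chain_map G ?E ?V (\<lambda>n \<sigma>. frag_of (vertices \<Phi> n \<sigma>))"
    by (rule vertices_chain_map) (use \<Phi> in \<open>simp_all add: max_at_def\<close>)
  from equivariant_chain_map_comp[OF this \<nu>]
  have \<nu>\<Phi>: "equivariant_chain_map G ?E ?EG (\<lambda>n \<sigma>. \<nu> n (vertices \<Phi> n \<sigma>))" unfolding frag_extend_of .
  \<comment> \<open>Projection and the detour through words are two equivariant chain maps into
    \<open>EG\<close>. The primitive \<open>\<beta>\<close> below records that they agree on
    \<open>f\<close> up to a coboundary.\<close>
  have "inv_coboundary m G ?E n (\<lambda>\<sigma>. ev f (frag_of (simplex_map n fst \<sigma>)) - ev f (\<nu> n (vertices \<Phi> n \<sigma>)))"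
    by (rule gcomplex_pair.chain_maps_cohomologous[OF pE projection_chain_map \<nu>\<Phi> f_inv f_coc])
  then obtain \<beta> where \<beta>: "inv_cochain G ?E (n - 1) \<beta>"
    "\<And>\<sigma>. singular_simplex n E \<sigma> \<Longrightarrow> [f (simplex_map n fst \<sigma>) - ev f (\<nu> n (vertices \<Phi> n \<sigma>)) = ev \<beta> (chain_boundary n (frag_of \<sigma>))] (mod m)"
    unfolding inv_coboundary_def by (simp only: ev_of sing_simps mem_Collect_eq) blast
  have inc: "equivariant_chain_map G ?K ?V (\<lambda>n xs. frag_of (map (\<lambda>x. x) xs))"
    by (rule list_map_chain_map[where V = V]) (use K_V in auto)
  have \<nu>K: "equivariant_chain_map G ?K ?EG \<nu>"
    using equivariant_chain_map_comp[OF inc \<nu>] unfolding frag_extend_of by simp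
  have "equivariant_chain_map G ?K ?EG (\<lambda>n xs. frag_extend (\<nu> n) (sort_chain lev xs))"
    by (rule equivariant_chain_map_comp[OF sort_chain_map_chain_map \<nu>K]) (rule lev_inj, assumption, rule lev_act)
  \<comment> \<open>On words that span a simplex, sorting first gives another equivariant chain map.
    As sorted words vanish in this degree, \<open>\<alpha>\<close> is a primitive of
    \<open>f\<close> itself, evaluated on such words.\<close>
  from gcomplex_pair.chain_maps_cohomologous[OF pK \<nu>K this f_inv f_coc]
  obtain \<alpha> where \<alpha>: "inv_cochain G ?K (n - 1) \<alpha>"
    "\<And>xs. xs \<in> Bas ?K n \<Longrightarrow> [ev f (\<nu> n xs) - ev f (frag_extend (\<nu> n) (sort_chain lev xs)) = ev \<alpha> (Bd ?K n xs)] (mod m)"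
    unfolding inv_coboundary_def by blast
  have \<alpha>': "[ev f (\<nu> n xs) = ev \<alpha> (lbd xs)] (mod m)" if xs: "set xs \<in> K" "length xs = Suc n" for xs
  proof -
    have "sort_chain lev xs = 0" by (rule sort_chain_zero[of _ _ k]) (use K_V[OF xs(1)] lev_V xs(2) n in auto)
    then show ?thesis using \<alpha>(2)[of xs] xs n(2) by simp
  qed
  \<comment> \<open>The vertices of a large singular simplex need not span a simplex of
    \<open>K\<close>, so \<open>\<alpha>\<close> is extended by 0. The extension stays invariant
    because \<open>K\<close> is invariant under the group.\<close>
  define \<alpha>0 where "\<alpha>0 xs = (if set xs \<in> K then \<alpha> xs else 0)" for xs
  have \<alpha>0_inv: "\<alpha>0 (map (a g) xs) = \<alpha>0 xs" if g: "g \<in> carrier G" and xs: "set xs \<subseteq> V" "length xs = n" for g xs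
  proof -
    have "map (a (inv g)) (map (a g) xs) = xs"
    proof -
      have "a (inv g) (a g v) = v" if "v \<in> V" for v using a_mult[of "inv g" g v] a_one[of v] g that by simp
      then show ?thesis unfolding map_map using xs(1) by (intro map_idI) auto
    qed
    then have "set xs = a (inv g) ` set (map (a g) xs)" by (metis set_map)
    then have K_iff: "set (map (a g) xs) \<in> K \<longleftrightarrow> set xs \<in> K"
      using K_act[OF g] K_act[OF inv_closed[OF g]] by (metis set_map)
    have "\<alpha> (map (a g) xs) = \<alpha> xs" if "set xs \<in> K"
    proof -
      have "xs \<in> Bas ?K (n - 1)" using that xs n(2) by simp
      then have "\<alpha> (Act ?K (n - 1) g xs) = \<alpha> xs" using \<alpha>(1) g unfolding inv_cochain_def by blast
      then show ?thesis by simp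
    qed
    then show ?thesis unfolding \<alpha>0_def K_iff by simp
  qed
  have "inv_cochain G ?E (n - 1) (\<lambda>\<sigma>. \<beta> \<sigma> + \<alpha>0 (vertices \<Phi> (n - 1) \<sigma>))"
    unfolding inv_cochain_def
  proof (intro ballI)
    fix g \<sigma> assume g: "g \<in> carrier G" and "\<sigma> \<in> Bas ?E (n - 1)"
    then have \<sigma>: "singular_simplex (n - 1) E \<sigma>" by simp
    have at: "\<sigma> (unit_vec i) \<in> topspace E" if "i \<le> n - 1" for i
      by (rule singular_simplex_in_topspace[OF \<sigma> unit_vec_in[OF that]])
    have "vertices \<Phi> (n - 1) (simplex_map (n - 1) (\<phi> g) \<sigma>) = map (a g) (vertices \<Phi> (n - 1) \<sigma>)"
      unfolding vertices_def map_map
    proof (rule map_cong[OF refl])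
      fix i assume "i \<in> set [0..<Suc (n - 1)]"
      then have i: "i \<le> n - 1" by (simp del: upt_Suc)
      show "\<Phi> (simplex_map (n - 1) (\<phi> g) \<sigma> (unit_vec i)) = (a g \<circ> (\<lambda>i. \<Phi> (\<sigma> (unit_vec i)))) i"
        using unit_vec_in[OF i] \<Phi>(2)[OF g at[OF i]] unfolding simplex_map_def o_def by (simp only: restrict_def if_True)
    qed
    moreover have "set (vertices \<Phi> (n - 1) \<sigma>) \<subseteq> V"
      unfolding set_vertices using at \<Phi>(1) unfolding max_at_def by blast
    moreover have "length (vertices \<Phi> (n - 1) \<sigma>) = n" using n(2) by simp
    ultimately have "\<alpha>0 (vertices \<Phi> (n - 1) (simplex_map (n - 1) (\<phi> g) \<sigma>)) = \<alpha>0 (vertices \<Phi> (n - 1) \<sigma>)"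
      using \<alpha>0_inv[OF g] by (simp only:)
    moreover have "\<beta> (Act ?E (n - 1) g \<sigma>) = \<beta> \<sigma>" using \<beta>(1) g \<sigma> unfolding inv_cochain_def by simp
    ultimately show "\<beta> (Act ?E (n - 1) g \<sigma>) + \<alpha>0 (vertices \<Phi> (n - 1) (Act ?E (n - 1) g \<sigma>)) = \<beta> \<sigma> + \<alpha>0 (vertices \<Phi> (n - 1) \<sigma>)"
      by (simp only: sing_simps)
  qed
  from P.invariant_cochain_descends[OF this]
  obtain w where w: "\<And>\<sigma>. singular_simplex (n - 1) E \<sigma> \<Longrightarrow> w (simplex_map (n - 1) P.q \<sigma>) = \<beta> \<sigma> + \<alpha>0 (vertices \<Phi> (n - 1) \<sigma>)"
    by blast
  \<comment> \<open>The remaining error. It vanishes modulo \<open>m\<close> on simplices inside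
    some \<open>nbd T\<close>, where all words span simplices of \<open>K\<close>; nothing is known
    about it elsewhere, which forces the passage to small simplices.\<close>
  define y where "y \<tau> = z (simplex_map n borel_projection \<tau>) - ev w (chain_boundary n (frag_of \<tau>))" for \<tau>
  have "\<exists>u. \<forall>\<tau>. singular_simplex n P.Q \<tau> \<longrightarrow> [y \<tau> = ev u (chain_boundary n (frag_of \<tau>))] (mod m)"
  proof (rule small_cocycle_is_coboundary[where \<C> = "(\<lambda>T. P.q ` (topspace (EG_space G) \<times> nbd T)) ` K"])
    have op: "openin E (topspace (EG_space G) \<times> nbd T)" if "T \<in> K" for T
      unfolding openin_prod_Times_iff using openin_nbd[OF K_V[OF that]] by simp
    show "openin P.Q U" if "U \<in> (\<lambda>T. P.q ` (topspace (EG_space G) \<times> nbd T)) ` K" for U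
      using that P.open_q[OF op] by blast
    show "topspace P.Q \<subseteq> \<Union> ((\<lambda>T. P.q ` (topspace (EG_space G) \<times> nbd T)) ` K)"
    proof
      fix A assume "A \<in> topspace P.Q"
      then obtain e x where ex: "(e, x) \<in> topspace E" "A = P.q (e, x)" unfolding topspace_orbit_space orbits_def by force
      obtain T where "T \<in> K" "x \<in> nbd T" using nbd_cover[of x] ex(1) by auto
      then show "A \<in> \<Union> ((\<lambda>T. P.q ` (topspace (EG_space G) \<times> nbd T)) ` K)" using ex by auto
    qed
    show "[ev y (chain_boundary (Suc n) (frag_of \<tau>)) = 0] (mod m)" if \<tau>: "singular_simplex (Suc n) P.Q \<tau>" for \<tau>
    proof -
      obtain \<sigma> where \<sigma>: "singular_simplex (Suc n) E \<sigma>" "simplex_map (Suc n) P.q \<sigma> = \<tau>" by (rule P.simplex_lift_exists[OF \<tau>])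
      have c: "singular_chain (Suc n) P.Q (frag_of \<tau>)" using \<tau> by (simp add: singular_chain_of)
      have "ev (\<lambda>\<tau>. ev w (chain_boundary n (frag_of \<tau>))) (chain_boundary (Suc n) (frag_of \<tau>)) = ev w (chain_boundary n (chain_boundary (Suc n) (frag_of \<tau>)))"
        unfolding ev_frag_extend[symmetric] using bdry_sing[of P.Q "\<lambda>_::unit. id" n "chain_boundary (Suc n) (frag_of \<tau>)"]
        by (simp add: bdry_def sing_def)
      also have "\<dots> = 0" using chain_boundary_boundary[OF c] by simp
      finally have 1: "ev (\<lambda>\<tau>. ev w (chain_boundary n (frag_of \<tau>))) (chain_boundary (Suc n) (frag_of \<tau>)) = 0" .
      have "cocycle_mod m ?E n (\<lambda>\<sigma>. ev f (frag_of (simplex_map n fst \<sigma>)))"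
        by (rule pullback_cocycle[OF gE projection_chain_map f_coc])
      then have "[ev (\<lambda>\<sigma>. f (simplex_map n fst \<sigma>)) (chain_boundary (Suc n) (frag_of \<sigma>)) = 0] (mod m)"
        using \<sigma>(1) unfolding cocycle_mod_def by simp
      moreover have "ev (\<lambda>\<tau>. z (simplex_map n borel_projection \<tau>)) (chain_boundary (Suc n) (frag_of \<tau>))
          = ev (\<lambda>\<sigma>. f (simplex_map n fst \<sigma>)) (chain_boundary (Suc n) (frag_of \<sigma>))"
        unfolding \<sigma>(2)[symmetric] P.ev_boundary_q[OF \<sigma>(1)] diff_Suc_1 f_def borel_projection_simplex ..
      ultimately show ?thesis unfolding y_def ev_diff_left 1 by simp
    qed
    show "[y \<tau> = 0] (mod m)"
      if U: "U \<in> (\<lambda>T. P.q ` (topspace (EG_space G) \<times> nbd T)) ` K" and \<tau>: "singular_simplex n (subtopology P.Q U) \<tau>" for U \<tau>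
    proof -
      obtain T where T: "T \<in> K" "U = P.q ` (topspace (EG_space G) \<times> nbd T)" using U by blast
      obtain \<sigma> where \<sigma>: "singular_simplex n E \<sigma>" "simplex_map n P.q \<sigma> = \<tau>" "\<sigma> ` standard_simplex n \<subseteq> topspace (EG_space G) \<times> nbd T"
      proof (rule P.simplex_lift_into[OF op[OF T(1)] _ \<tau>[unfolded T(2)]])
        show "g = \<one>" if "g \<in> carrier G" "u \<in> topspace (EG_space G) \<times> nbd T" "\<phi> g u \<in> topspace (EG_space G) \<times> nbd T" for g u
          using that nbd_translates[OF T(1), of g "snd u"] by (cases u) simp
      qed
      have "\<Phi> (\<sigma> (unit_vec i)) \<in> T" if "i \<le> n" for i
      proof -
        have "snd (\<sigma> (unit_vec i)) \<in> nbd T" using \<sigma>(3) unit_vec_in[OF that] by force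
        then show ?thesis
          by (rule max_at_nbd[OF _ \<Phi>(1)[OF singular_simplex_in_topspace[OF \<sigma>(1) unit_vec_in[OF that]]] K_V[OF T(1)]])
      qed
      then have vT: "set (vertices \<Phi> n \<sigma>) \<subseteq> T" unfolding set_vertices by blast
      then have vK: "set (vertices \<Phi> n \<sigma>) \<in> K" by (rule K_down[OF T(1)])
      have "ev w (chain_boundary n (frag_of \<tau>)) = ev (\<lambda>\<sigma>. \<beta> \<sigma> + \<alpha>0 (vertices \<Phi> (n - 1) \<sigma>)) (chain_boundary n (frag_of \<sigma>))"
        unfolding \<sigma>(2)[symmetric] P.ev_boundary_q[OF \<sigma>(1)]
      proof (rule ev_cong)
        fix \<rho> assume "\<rho> \<in> Poly_Mapping.keys (chain_boundary n (frag_of \<sigma>))"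
        then have "singular_simplex (n - 1) E \<rho>"
          using singular_chain_boundary[of n E "frag_of \<sigma>"] \<sigma>(1) unfolding singular_chain_of singular_chain_def by auto
        then show "w (simplex_map (n - 1) P.q \<rho>) = \<beta> \<rho> + \<alpha>0 (vertices \<Phi> (n - 1) \<rho>)" by (rule w)
      qed
      also have "\<dots> = ev \<beta> (chain_boundary n (frag_of \<sigma>)) + ev \<alpha>0 (lbd (vertices \<Phi> n \<sigma>))"
        unfolding ev_add_left lbd_vertices[OF n(2)] ev_frag_extend ev_of ..
      also have "ev \<alpha>0 (lbd (vertices \<Phi> n \<sigma>)) = ev \<alpha> (lbd (vertices \<Phi> n \<sigma>))"
      proof (rule ev_cong_on)
        show "Poly_Mapping.keys (lbd (vertices \<Phi> n \<sigma>)) \<subseteq> {xs \<in> {xs. set xs \<in> K}. length xs = n}"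
          by (rule list_action.keys_lbd_L[OF simplex_lists]) (use vK in simp_all)
      qed (simp add: \<alpha>0_def)
      finally have ew: "ev w (chain_boundary n (frag_of \<tau>)) = ev \<beta> (chain_boundary n (frag_of \<sigma>)) + ev \<alpha> (lbd (vertices \<Phi> n \<sigma>))" .
      have "[(f (simplex_map n fst \<sigma>) - ev f (\<nu> n (vertices \<Phi> n \<sigma>))) + ev f (\<nu> n (vertices \<Phi> n \<sigma>))
          = ev \<beta> (chain_boundary n (frag_of \<sigma>)) + ev \<alpha> (lbd (vertices \<Phi> n \<sigma>))] (mod m)"
        by (rule cong_add[OF \<beta>(2)[OF \<sigma>(1)] \<alpha>'[OF vK]]) simp
      moreover have "z (simplex_map n borel_projection \<tau>) = f (simplex_map n fst \<sigma>)"
        unfolding \<sigma>(2)[symmetric] borel_projection_simplex f_def ..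
      ultimately show ?thesis unfolding y_def ew by (simp add: cong_iff_dvd_diff)
    qed
  qed
  then obtain u where u: "\<And>\<tau>. singular_simplex n P.Q \<tau> \<Longrightarrow> [y \<tau> = ev u (chain_boundary n (frag_of \<tau>))] (mod m)" by blast
  show ?thesis
    unfolding borel_space_def
  proof (intro exI[of _ "\<lambda>\<rho>. u \<rho> + w \<rho>"] allI impI)
    fix \<tau> assume "singular_simplex n P.Q \<tau>"
    from u[OF this] show "[z (simplex_map n borel_projection \<tau>) = ev (\<lambda>\<rho>. u \<rho> + w \<rho>) (chain_boundary n (frag_of \<tau>))] (mod m)"
      unfolding y_def ev_add_left by (simp add: cong_iff_dvd_diff algebra_simps)
  qed
qed

end

section \<open>The chessboard complex\<close>

lemma simplex_family_chain_map:
  assumes sing: "\<And>n xs. xs \<in> L \<Longrightarrow> length xs = Suc n \<Longrightarrow> singular_simplex n Y (s n xs)"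
    and face: "\<And>n i xs. xs \<in> L \<Longrightarrow> length xs = Suc (Suc n) \<Longrightarrow> i \<le> Suc n \<Longrightarrow>
          singular_face (Suc n) i (s (Suc n) xs) = s n (take i xs @ drop (Suc i) xs)"
    and act: "\<And>n g xs. g \<in> carrier G \<Longrightarrow> xs \<in> L \<Longrightarrow> length xs = Suc n \<Longrightarrow> simplex_map n (\<phi> g) (s n xs) = s n (map (a g) xs)"
  shows "equivariant_chain_map G (lists_cx L a) (sing Y \<phi>) (\<lambda>n xs. frag_of (s n xs))"
  unfolding equivariant_chain_map_def bdry_sing act_sing sing_simps lists_cx_simps
proof (intro conjI allI ballI)
  fix n xs assume "xs \<in> {xs \<in> L. length xs = Suc n}"
  then have xs: "xs \<in> L" "length xs = Suc n" by simp_all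
  show "Poly_Mapping.keys (frag_of (s n xs)) \<subseteq> singular_simplex_set n Y"
    using sing[OF xs] by (simp add: keys_frag_of)
  show "chain_boundary n (frag_of (s n xs)) = frag_extend (\<lambda>xs. frag_of (s (n - 1) xs)) (if n = 0 then 0 else lbd xs)"
  proof (cases n)
    case 0
    then show ?thesis by (simp add: chain_boundary_of)
  next
    case (Suc m)
    have "chain_boundary n (frag_of (s n xs)) = (\<Sum>i\<le>n. frag_cmul ((- 1) ^ i) (frag_of (singular_face n i (s n xs))))"
      by (simp add: chain_boundary_of Suc)
    also have "\<dots> = (\<Sum>i\<le>n. frag_cmul ((- 1) ^ i) (frag_of (s m (take i xs @ drop (Suc i) xs))))"
      unfolding Suc by (intro sum.cong refl) (use face xs Suc in simp)
    also have "\<dots> = frag_extend (\<lambda>xs. frag_of (s m xs)) (lbd xs)"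
      by (simp add: lbd_eq_sum frag_extend_sum frag_extend_cmul xs(2) lessThan_Suc_atMost o_def)
    finally show ?thesis using Suc by simp
  qed
  show "frag_of (s n (map (a g) xs)) = chain_map n (\<phi> g) (frag_of (s n xs))" if "g \<in> carrier G" for g
    using act[OF that xs] by simp
qed simp

text \<open>The graph, over a linear simplex, of the simplicial map given by \<open>\<iota>\<close>.
  It places simplices of the board in \<open>EG \<times> X\<close>, so that cochains on the Borel
  construction can be evaluated on words of vertices.\<close>

definition lin_pair :: "('v \<Rightarrow> 'w) \<Rightarrow> nat \<Rightarrow> 'v list \<Rightarrow> (nat \<Rightarrow> real) \<Rightarrow> ('w \<Rightarrow> real) \<times> ('v \<Rightarrow> real)" where
  "lin_pair \<iota> n vs = restrict (\<lambda>t. (lin n (map \<iota> vs) t, lin n vs t)) (standard_simplex n)"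

lemma singular_simplex_lin_pair:
  assumes "set vs \<in> K" "\<iota> ` set vs \<in> K'" "length vs = Suc n"
  shows "singular_simplex n (prod_topology (realization K') (realization K)) (lin_pair \<iota> n vs)"
proof -
  have "singular_simplex n (realization K') (lin n (map \<iota> vs))" "singular_simplex n (realization K) (lin n vs)"
    by (intro singular_simplex_lin; simp add: assms)+
  then have "continuous_map (subtopology (powertop_real UNIV) (standard_simplex n)) (prod_topology (realization K') (realization K))
      (\<lambda>t. (lin n (map \<iota> vs) t, lin n vs t))"
    unfolding singular_simplex_def by (intro continuous_map_pairedI) blast+
  then have "continuous_map (subtopology (powertop_real UNIV) (standard_simplex n)) (prod_topology (realization K') (realization K))
      (lin_pair \<iota> n vs)"
    by (rule continuous_map_eq) (simp add: lin_pair_def)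
  then show ?thesis unfolding singular_simplex_def by (simp add: lin_pair_def)
qed

lemma singular_face_lin:
  assumes "length vs = Suc (Suc n)" "i \<le> Suc n" "x \<in> standard_simplex n"
  shows "lin (Suc n) vs (simplical_face i x) = lin n (take i vs @ drop (Suc i) vs) x"
proof -
  have "simplical_face i x \<in> standard_simplex (Suc n)"
    using simplical_face_in_standard_simplex[of "Suc n" i x] assms by simp
  then show ?thesis using lin_simplical_face[OF assms] assms(3) unfolding lin_def by simp
qed

lemma singular_face_lin_pair:
  assumes "length vs = Suc (Suc n)" "i \<le> Suc n"
  shows "singular_face (Suc n) i (lin_pair \<iota> (Suc n) vs) = lin_pair \<iota> n (take i vs @ drop (Suc i) vs)"
proof
  fix x
  show "singular_face (Suc n) i (lin_pair \<iota> (Suc n) vs) x = lin_pair \<iota> n (take i vs @ drop (Suc i) vs) x"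
  proof (cases "x \<in> standard_simplex n")
    case True
    have "simplical_face i x \<in> standard_simplex (Suc n)"
      using simplical_face_in_standard_simplex[of "Suc n" i x] assms True by simp
    moreover have "lin (Suc n) (map \<iota> vs) (simplical_face i x) = lin n (map \<iota> (take i vs @ drop (Suc i) vs)) x"
      using singular_face_lin[of "map \<iota> vs" n i x] assms True by (simp add: take_map drop_map)
    ultimately show ?thesis
      using singular_face_lin[OF assms True] True by (simp add: singular_face_def lin_pair_def)
  next
    case False
    then show ?thesis by (simp add: singular_face_def lin_pair_def)
  qed
qed

lemma simplex_map_lin_pair:
  assumes "length vs = Suc n" "\<And>v. v \<in> set vs \<Longrightarrow> \<iota> (h v) = h' (\<iota> v)"
  shows "simplex_map n (map_prod (realization_map h') (realization_map h)) (lin_pair \<iota> n vs) = lin_pair \<iota> n (map h vs)"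
proof
  fix x
  show "simplex_map n (map_prod (realization_map h') (realization_map h)) (lin_pair \<iota> n vs) x = lin_pair \<iota> n (map h vs) x"
  proof (cases "x \<in> standard_simplex n")
    case True
    have eq: "map h' (map \<iota> vs) = map \<iota> (map h vs)" using assms(2) by simp
    have "realization_map h' (lin n (map \<iota> vs) x) = lin n (map \<iota> (map h vs)) x"
      unfolding eq[symmetric] using fun_cong[OF simplex_map_lin[of "map \<iota> vs" n h'], of x] assms(1) True
      by (simp add: simplex_map_def)
    moreover have "realization_map h (lin n vs x) = lin n (map h vs) x"
      using fun_cong[OF simplex_map_lin[OF assms(1), of h], of x] True by (simp add: simplex_map_def)
    ultimately show ?thesis using True by (simp add: simplex_map_def lin_pair_def)
  next
    case False
    then show ?thesis by (simp add: simplex_map_def lin_pair_def)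
  qed
qed

section \<open>The cyclic group acting on letters and on the board, and the low-degree half\<close>

context cyclic_cochains
begin

abbreviation G :: "(nat \<Rightarrow> nat) monoid" where "G \<equiv> cyclic_perm_group p"

lemma T_cycle: "T = cycle_of_list [1..<Suc p]"
proof
  fix j
  let ?c = "cycle_of_list [1..<Suc p]"
  show "T j = ?c j"
  proof (cases "j \<in> {1..p}")
    case True
    let ?l = "[1..<Suc p]"
    have "j - 1 < p" "1 + (j - 1) = j" using True by auto
    then have j: "j - 1 < length ?l" "?l ! (j - 1) = j" by (simp_all del: upt_Suc)
    have "map (?c ^^ 1) ?l = rotate 1 ?l" by (rule cyclic_rotation) (rule distinct_upt)
    then have "map ?c ?l ! (j - 1) = rotate 1 ?l ! (j - 1)" by (simp only: One_nat_def funpow.simps o_id)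
    then have "?c j = ?l ! ((1 + (j - 1)) mod length ?l)" unfolding nth_map[OF j(1)] nth_rotate[OF j(1)] j(2) .
    also have "\<dots> = T j" using True p_ge by (simp add: T_def del: upt_Suc)
    finally show ?thesis by simp
  next
    case False
    then have "j \<notin> set [1..<Suc p]" by auto
    from id_outside_supp[OF this] show ?thesis using False unfolding T_def by (simp only: if_False)
  qed
qed

lemma T_permutes: "T permutes {1..p}"
proof -
  have "set [1..<Suc p] = {1..p}" by auto
  then show ?thesis unfolding T_cycle using cycle_permutes[of "[1..<Suc p]"] by (simp only:)
qed

lemma T_power_id: "T ^^ p = id"
proof
  fix j show "(T ^^ p) j = id j"
  proof (cases "j \<in> {1..p}")
    case True
    then show ?thesis using T_pow_p by simp
  next
    case False
    from permutes_not_in[OF permutes_funpow[OF T_permutes] this] show ?thesis by simp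
  qed
qed

lemma group_G: "group G"
  unfolding cyclic_perm_group_def by (rule group.group_subgroup_generated[OF sym_group_is_group])

lemma mult_G [simp]: "g \<otimes>\<^bsub>G\<^esub> h = g \<circ> h" and one_G [simp]: "\<one>\<^bsub>G\<^esub> = id"
  by (simp_all add: cyclic_perm_group_def sym_group_def)

lemma carrier_G: "carrier G = range (\<lambda>i. T ^^ i)"
proof
  have Tc: "T \<in> carrier (sym_group p)" unfolding sym_group_carrier by (rule T_permutes)
  show "carrier G \<subseteq> range (\<lambda>i. T ^^ i)"
  proof
    fix g assume "g \<in> carrier G"
    then have "g \<in> generate (sym_group p) {T}"
      unfolding cyclic_perm_group_def carrier_subgroup_generated T_cycle[symmetric] using Tc by simp
    then show "g \<in> range (\<lambda>i. T ^^ i)"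
    proof induction
      case one
      show ?case by (rule range_eqI[of _ _ 0]) (simp add: sym_group_one)
    next
      case (incl h)
      then show ?case by (auto intro: range_eqI[of _ _ 1])
    next
      case (inv h)
      \<comment> \<open>The inverse of the cycle is itself a power with natural exponent, so such
        powers exhaust the group.\<close>
      have "T ^^ (p - 1) \<circ> T = id" using T_power_id p_ge funpow_Suc_right[of "p - 1" T] by simp
      then have "inv\<^bsub>sym_group p\<^esub> T = T ^^ (p - 1)"
        using permutes_funpow[OF T_permutes, of "p - 1"]
        by (intro group.inv_equality[OF sym_group_is_group] Tc) (unfold sym_group_mult sym_group_one sym_group_carrier)
      then show ?case using inv by auto
    next
      case (eng h1 h2)
      then obtain i j where "h1 = T ^^ i" "h2 = T ^^ j" by blast
      then show ?case by (intro range_eqI[of _ _ "i + j"]) (simp only: sym_group_mult funpow_add)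
    qed
  qed
  interpret group G by (rule group_G)
  have "T \<in> carrier G"
    unfolding cyclic_perm_group_def T_cycle[symmetric] carrier_subgroup_generated using Tc by (auto intro: generate.incl)
  then have "T ^^ i \<in> carrier G" for i
  proof (induction i)
    case 0
    show ?case using one_closed unfolding one_G by (simp only: funpow.simps)
  next
    case (Suc i)
    then show ?case using m_closed[OF \<open>T \<in> carrier G\<close>] unfolding mult_G by (simp only: funpow.simps)
  qed
  then show "range (\<lambda>i. T ^^ i) \<subseteq> carrier G" by blast
qed

lemma G_permutes: "g \<in> carrier G \<Longrightarrow> g permutes {1..p}"
  unfolding carrier_G using permutes_funpow[OF T_permutes] by blast

lemma G_in: "g \<in> carrier G \<Longrightarrow> j \<in> {1..p} \<Longrightarrow> g j \<in> {1..p}"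
  using permutes_in_image[OF G_permutes] by blast

lemma finite_G: "finite (carrier G)"
  by (rule finite_subset[OF _ finite_permutations[of "{1..p}"]]) (use G_permutes in auto)

lemma G_free:
  assumes "g \<in> carrier G" "j \<in> {1..p}" "g j = j"
  shows "g = id"
proof -
  obtain i where g: "g = T ^^ i" using assms(1) unfolding carrier_G by blast
  have "(j - 1 + i) mod p + 1 = j" using assms(3) unfolding g T_pow[OF assms(2)] .
  then have "(j - 1 + i) mod p = j - 1" by linarith
  also have "\<dots> = (j - 1) mod p" using assms(2) by (intro mod_less[symmetric]) auto
  finally have "p dvd (j - 1 + i) - (j - 1)" using mod_eq_dvd_iff_nat[of "j - 1" "j - 1 + i" p] by simp
  then have "p dvd i" by simp
  then obtain q where "i = p * q" by blast
  then show ?thesis unfolding g by (simp add: funpow_mult[symmetric] T_power_id)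
qed

lemma G_transitive: "j \<in> {1..p} \<Longrightarrow> \<exists>g\<in>carrier G. g 1 = j"
  unfolding carrier_G using T_pow[of 1 "j - 1"] p_ge by (intro bexI[of _ "T ^^ (j - 1)"]) auto

lemma list_action_G: "list_action G {1..p} {xs. set xs \<subseteq> {1..p}} (\<lambda>g. g)"
proof -
  interpret group G by (rule group_G)
  show ?thesis by unfold_locales (use G_in G_free in auto)
qed

lemma chessboard_colored:
  assumes "1 \<le> k"
  shows "colored_complex G ({1..k} \<times> {1..p}) (chessboard_complex k p) (\<lambda>g (i, j). (i, g j)) fst k"
proof -
  interpret group G by (rule group_G)
  have act: "(\<lambda>(i, j). (i, g j)) ` S \<in> chessboard_complex k p" if g: "g \<in> carrier G" and S: "S \<in> chessboard_complex k p" for g S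
  proof -
    let ?a = "\<lambda>(i, j). (i, g j)"
    have "inj g" using permutes_inj[OF G_permutes[OF g]] .
    have S': "inj_on fst S" "inj_on snd S" using S by (simp_all add: chessboard_complex_def)
    have "inj_on (g \<circ> snd) S" by (rule comp_inj_on[OF S'(2) inj_on_subset[OF \<open>inj g\<close> subset_UNIV]])
    moreover have "snd \<circ> ?a = g \<circ> snd" and fa: "fst \<circ> ?a = fst" by (simp_all add: fun_eq_iff)
    ultimately have "inj_on (snd \<circ> ?a) S" by metis
    then have "inj_on snd (?a ` S)" by (rule inj_on_imageI)
    moreover have "inj_on (fst \<circ> ?a) S" unfolding fa by (rule S'(1))
    then have "inj_on fst (?a ` S)" by (rule inj_on_imageI)
    moreover have "?a ` S \<subseteq> {1..k} \<times> {1..p}"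
    proof
      fix v assume "v \<in> ?a ` S"
      then obtain i j where "(i, j) \<in> S" "v = (i, g j)" by auto
      then show "v \<in> {1..k} \<times> {1..p}" using S G_in[OF g, of j] unfolding chessboard_complex_def by blast
    qed
    ultimately show ?thesis by (simp add: chessboard_complex_def)
  qed
  have free: "g = id" if "g \<in> carrier G" "v \<in> {1..k} \<times> {1..p}" "(case v of (i, j) \<Rightarrow> (i, g j)) = v" for g v
    using that G_free[of g "snd v"] by (cases v) simp
  have act_V: "(case v of (i, j) \<Rightarrow> (i, g j)) \<in> {1..k} \<times> {1..p}" if "g \<in> carrier G" "v \<in> {1..k} \<times> {1..p}" for g v
    using that G_in[of g "snd v"] by (cases v) simp
  show ?thesis
  proof unfold_locales
    show "T \<in> chessboard_complex k p" if "S \<in> chessboard_complex k p" "T \<subseteq> S" for S T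
      using that unfolding chessboard_complex_def by (blast intro: inj_on_subset)
  qed (use finite_G act free act_V in \<open>simp_all add: chessboard_complex_def split_beta mem_Times_iff\<close>)
qed

text \<open>The letters form a torsor, and \<open>\<gamma> j\<close> is the group element taking 1
  to \<open>j\<close>. It is used to turn board positions into vertices of \<open>EG\<close>, whose
  second coordinate is a group element.\<close>

lemma identification_exists:
  obtains \<gamma> where "\<And>j. j \<in> {1..p} \<Longrightarrow> \<gamma> j \<in> carrier G"
    "\<And>g j. g \<in> carrier G \<Longrightarrow> j \<in> {1..p} \<Longrightarrow> \<gamma> (g j) = g \<circ> \<gamma> j"
proof -
  interpret group G by (rule group_G)
  define \<gamma> where "\<gamma> j = (SOME g. g \<in> carrier G \<and> g 1 = j)" for j
  have \<gamma>: "\<gamma> j \<in> carrier G" "\<gamma> j 1 = j" if "j \<in> {1..p}" for j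
  proof -
    have "\<exists>g. g \<in> carrier G \<and> g 1 = j" using G_transitive[OF that] by blast
    from someI_ex[OF this] show "\<gamma> j \<in> carrier G" "\<gamma> j 1 = j" unfolding \<gamma>_def by blast+
  qed
  have one_in: "1 \<in> {1..p}" using p_ge by simp
  have eq: "g = h" if g: "g \<in> carrier G" and h: "h \<in> carrier G" and "g 1 = h 1" for g h
  proof -
    have "inv\<^bsub>G\<^esub> h \<otimes>\<^bsub>G\<^esub> h = \<one>\<^bsub>G\<^esub>" using h by (rule l_inv)
    from fun_cong[OF this, of 1] have hh: "(inv\<^bsub>G\<^esub> h) (h 1) = 1" unfolding mult_G one_G o_apply id_apply .
    have "(inv\<^bsub>G\<^esub> h \<otimes>\<^bsub>G\<^esub> g) 1 = 1" unfolding mult_G o_apply that(3) by (rule hh)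
    from G_free[OF m_closed[OF inv_closed[OF h] g] one_in this]
    have "inv\<^bsub>G\<^esub> h \<otimes>\<^bsub>G\<^esub> g = \<one>\<^bsub>G\<^esub>" unfolding one_G .
    from inv_equality[OF this g inv_closed[OF h]] have "inv\<^bsub>G\<^esub> (inv\<^bsub>G\<^esub> g) = inv\<^bsub>G\<^esub> (inv\<^bsub>G\<^esub> h)" by (rule arg_cong)
    then show ?thesis unfolding inv_inv[OF g] inv_inv[OF h] .
  qed
  show ?thesis
  proof (rule that[of \<gamma>])
    fix g j assume g: "g \<in> carrier G" and j: "j \<in> {1..p}"
    show "\<gamma> (g j) = g \<circ> \<gamma> j"
    proof (rule eq)
      show "\<gamma> (g j) \<in> carrier G" by (rule \<gamma>(1)[OF G_in[OF g j]])
      show "g \<circ> \<gamma> j \<in> carrier G" using m_closed[OF g \<gamma>(1)[OF j]] by simp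
      show "\<gamma> (g j) 1 = (g \<circ> \<gamma> j) 1" using \<gamma>(2)[OF j] \<gamma>(2)[OF G_in[OF g j]] by simp
    qed
  qed (rule \<gamma>(1))
qed

lemma G_invariant:
  assumes a: "invariant a" and g: "g \<in> carrier G" and xs: "set xs \<subseteq> {1..p}"
  shows "a (map g xs) = a xs"
proof -
  obtain i where g: "g = T ^^ i" using g unfolding carrier_G by blast
  show ?thesis
    unfolding g
  proof (induction i)
    case (Suc i)
    have "a (map (T ^^ Suc i) xs) = a (map T (map (T ^^ i) xs))" unfolding map_T_pow_Suc ..
    also have "\<dots> = a (map (T ^^ i) xs)" using a map_T_pow_set[OF xs] unfolding invariant_def by blast
    finally show ?case unfolding Suc .
  qed simp
qed

lemma T_in_G: "T \<in> carrier G"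
  unfolding carrier_G by (rule range_eqI[of _ _ 1]) simp

abbreviation lists_p :: "(nat list, nat \<Rightarrow> nat) gcx" where
  "lists_p \<equiv> lists_cx {xs. set xs \<subseteq> {1..p}} (\<lambda>g. g)"

text \<open>Passes from cochains on a basis in a single degree to functions on words of every
  length, applies the detection theorem there, and returns.\<close>

lemma inv_coboundary_if_cob:
  assumes f: "inv_cochain G lists_p n f" "cocycle_mod (int p) lists_p n f" and n: "n \<le> p - 2"
    and b: "inv_coboundary (int p) G (lists_cx {vs. set vs \<in> chessboard_complex k p} (\<lambda>g (i, j). (i, g j))) n (\<lambda>vs. f (map snd vs))"
    and k: "n < k"
  shows "inv_coboundary (int p) G lists_p n f"
proof -
  let ?K = "chessboard_complex k p" and ?a = "\<lambda>g (i, j). (i :: nat, g j :: nat)"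
  have k1: "1 \<le> k" using k by simp
  interpret C: colored_complex G "{1..k} \<times> {1..p}" ?K ?a fst k by (rule chessboard_colored[OF k1])
  obtain \<beta> where \<beta>: "inv_cochain G (lists_cx {vs. set vs \<in> ?K} ?a) (n - 1) \<beta>"
    "\<And>vs. set vs \<in> ?K \<Longrightarrow> length vs = Suc n \<Longrightarrow> [f (map snd vs) = ev \<beta> (if n = 0 then 0 else lbd vs)] (mod int p)"
    using b unfolding inv_coboundary_def by auto
  \<comment> \<open>The \<open>i\<close>-th letter goes to row \<open>i\<close>. Distinct letters
    and \<open>n < k\<close> make the result a simplex of the board.\<close>
  have word: "set (zip [1..<n + 2] xs) \<in> ?K" "length (zip [1..<n + 2] xs) = Suc n" "map snd (zip [1..<n + 2] xs) = xs"
    if xs: "xs \<in> L (n + 1)" "distinct xs" for xs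
  proof -
    have len: "length xs = n + 1" "set xs \<subseteq> {1..p}" using xs by (auto simp: L_def)
    show l: "length (zip [1..<n + 2] xs) = Suc n" using len by (simp del: upt_Suc)
    show s: "map snd (zip [1..<n + 2] xs) = xs" using len by (simp del: upt_Suc)
    have f: "map fst (zip [1..<n + 2] xs) = [1..<n + 2]" using len by (simp del: upt_Suc)
    have "distinct (map fst (zip [1..<n + 2] xs))" unfolding f by (rule distinct_upt)
    then have i1: "inj_on fst (set (zip [1..<n + 2] xs))" unfolding distinct_map by blast
    have "distinct (map snd (zip [1..<n + 2] xs))" unfolding s by (rule xs(2))
    then have i2: "inj_on snd (set (zip [1..<n + 2] xs))" unfolding distinct_map by blast
    have "v \<in> {1..k} \<times> {1..p}" if "v \<in> set (zip [1..<n + 2] xs)" for v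
    proof -
      have "fst v \<in> set (map fst (zip [1..<n + 2] xs))" "snd v \<in> set (map snd (zip [1..<n + 2] xs))"
        unfolding set_map using that by (rule imageI)+
      then have "fst v \<in> {1..<n + 2}" "snd v \<in> {1..p}" unfolding f s set_upt using len(2) by blast+
      then show ?thesis unfolding mem_Times_iff using k by simp
    qed
    then show "set (zip [1..<n + 2] xs) \<in> ?K" using i1 i2 unfolding chessboard_complex_def by blast
  qed
  show ?thesis
  proof (cases "n = 0")
    \<comment> \<open>Words with one letter are distinct, so the hypothesis already covers all words
      of degree 0.\<close>
    case True
    have "[f xs = ev (\<lambda>_. 0) (Bd lists_p n xs)] (mod int p)" if "xs \<in> Bas lists_p n" for xs
    proof -
      have "xs \<in> L (n + 1)" "length xs = 1" using that True by (auto simp: L_def)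
      moreover from this(2) have "distinct xs" by (cases xs) auto
      ultimately show ?thesis using \<beta>(2)[of "zip [1..<n + 2] xs"] word[of xs] True by (simp del: upt_Suc)
    qed
    then show ?thesis unfolding inv_coboundary_def by (intro exI[of _ "\<lambda>_. 0"]) (simp add: inv_cochain_def)
  next
    case False
    \<comment> \<open>Both functions are extended by 0, since \<open>invariant\<close> and
      \<open>levelled_invariant\<close> speak about words of all lengths and the primitive is known
      only on words of the complex.\<close>
    define f' where "f' xs = (if length xs = Suc n then f xs else 0)" for xs
    define \<beta>' where "\<beta>' vs = (if set vs \<in> ?K \<and> length vs = n then \<beta> vs else 0)" for vs
    have inv: "invariant f'"
      unfolding invariant_def f'_def
    proof (intro allI impI)
      fix xs :: "nat list" assume xs: "set xs \<subseteq> {1..p}"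
      have "f (map T xs) = f xs" if "length xs = Suc n"
      proof -
        have "xs \<in> Bas lists_p n" using xs that by simp
        then have "f (Act lists_p n T xs) = f xs" using f(1) T_in_G unfolding inv_cochain_def by blast
        then show ?thesis by simp
      qed
      then show "(if length (map T xs) = Suc n then f (map T xs) else 0) = (if length xs = Suc n then f xs else 0)" by simp
    qed
    have eq: "lcob f' xs = lcob f xs" if "xs \<in> L (n + 2)" for xs
      unfolding ev_lbd[symmetric]
    proof (rule ev_cong_on)
      show "Poly_Mapping.keys (lbd xs) \<subseteq> {ys \<in> {xs. set xs \<subseteq> {1..p}}. length ys = Suc n}"
        by (rule list_action.keys_lbd_L[OF list_action_G]) (use that in \<open>simp_all add: L_def\<close>)
    qed (simp add: f'_def)
    have coc: "cocyc n f'"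
      unfolding cocyc_def
    proof
      fix xs assume xs: "xs \<in> L (n + 2)"
      have "xs \<in> Bas lists_p (Suc n)" using xs by (simp add: L_def)
      then have "[ev f (Bd lists_p (Suc n) xs) = 0] (mod int p)" using f(2) unfolding cocycle_mod_def by blast
      then show "[lcob f' xs = 0] (mod int p)" unfolding eq[OF xs] by (simp add: ev_lbd)
    qed
    have lev: "levelled_invariant \<beta>'"
      unfolding levelled_invariant_def
    proof (intro allI impI)
      fix w :: "(nat \<times> nat) list" assume w: "snd ` set w \<subseteq> {1..p}"
      have Ta: "apsnd T = ?a T" by (auto simp: fun_eq_iff)
      have inv_ok: "?a (inv\<^bsub>G\<^esub> T) (?a T v) = v" for v
      proof -
        have "inv\<^bsub>G\<^esub> T \<otimes>\<^bsub>G\<^esub> T = \<one>\<^bsub>G\<^esub>" by (rule C.l_inv[OF T_in_G])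
        then show ?thesis by (cases v) (simp add: fun_eq_iff)
      qed
      have K_iff: "?a T ` set w \<in> ?K \<longleftrightarrow> set w \<in> ?K"
      proof
        assume "?a T ` set w \<in> ?K"
        then have "?a (inv\<^bsub>G\<^esub> T) ` ?a T ` set w \<in> ?K" by (rule C.K_act[OF C.inv_closed[OF T_in_G]])
        then show "set w \<in> ?K" unfolding image_image inv_ok by simp
      qed (rule C.K_act[OF T_in_G])
      have "\<beta> (map (?a T) w) = \<beta> w" if "set w \<in> ?K" "length w = n"
      proof -
        have "w \<in> Bas (lists_cx {vs. set vs \<in> ?K} ?a) (n - 1)" using that False by simp
        then have "\<beta> (Act (lists_cx {vs. set vs \<in> ?K} ?a) (n - 1) T w) = \<beta> w" using \<beta>(1) T_in_G unfolding inv_cochain_def by blast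
        then show ?thesis by simp
      qed
      then show "\<beta>' (map (apsnd T) w) = \<beta>' w" unfolding \<beta>'_def Ta set_map K_iff length_map by simp
    qed
    have "cob n f'"
    proof (rule cob_if_levelled_coboundary[OF inv coc _ n lev])
      show "1 \<le> n" using False by simp
      fix xs assume xs: "xs \<in> L (n + 1)" "distinct xs"
      have "lcob \<beta>' (zip [1..<n + 2] xs) = lcob \<beta> (zip [1..<n + 2] xs)"
        unfolding ev_lbd[symmetric]
      proof (rule ev_cong_on)
        show "Poly_Mapping.keys (lbd (zip [1..<n + 2] xs)) \<subseteq> {ys \<in> {vs. set vs \<in> ?K}. length ys = n}"
          by (rule list_action.keys_lbd_L[OF C.simplex_lists]) (use word[OF xs] in simp_all)
      qed (simp add: \<beta>'_def)
      moreover have "length xs = Suc n" using xs(1) by (simp add: L_def)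
      moreover have "[f xs = ev \<beta> (lbd (zip [1..<n + 2] xs))] (mod int p)"
        using \<beta>(2)[OF word(1,2)[OF xs]] word(3)[OF xs] False by (simp del: upt_Suc)
      ultimately show "[f' xs = lcob \<beta>' (zip [1..<n + 2] xs)] (mod int p)" unfolding f'_def ev_lbd by simp
    qed
    then obtain a where a: "invariant a" "\<And>xs. xs \<in> L (n + 1) \<Longrightarrow> [f' xs = lcob a xs] (mod int p)"
      unfolding cob_def using False by auto
    show ?thesis
      unfolding inv_coboundary_def
    proof (intro exI[of _ a] conjI ballI)
      show "inv_cochain G lists_p (n - 1) a"
        unfolding inv_cochain_def using G_invariant[OF a(1)] by simp
      fix xs assume "xs \<in> Bas lists_p n"
      then have xs: "xs \<in> L (n + 1)" "length xs = Suc n" by (simp_all add: L_def)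
      from a(2)[OF xs(1)] show "[f xs = ev a (Bd lists_p n xs)] (mod int p)"
        using xs(2) False by (simp add: f'_def ev_lbd)
    qed
  qed
qed

text \<open>Words and singular simplices of \<open>EG\<close> admit equivariant chain maps in both
  directions, so exactness can be tested on words. Words of board vertices reach \<open>EG\<close>
  in two ways, through \<open>EG \<times> X\<close> and by forgetting the rows; their comparison
  carries the assumption over to words of letters.\<close>

lemma low_degree_pullback:
  fixes z :: "((nat \<Rightarrow> real) \<Rightarrow> (nat \<times> (nat \<Rightarrow> nat) \<Rightarrow> real) set) \<Rightarrow> int"
  assumes z: "\<And>\<tau>. singular_simplex (Suc n) (BG_space G) \<tau> \<Longrightarrow> [ev z (chain_boundary (Suc n) (frag_of \<tau>)) = 0] (mod int p)"
    and n: "n < k" "k \<le> p - 1"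
    and w: "\<And>\<tau>. singular_simplex n (borel_space G (chessboard_space k p) chessboard_action) \<tau> \<Longrightarrow>
      [z (simplex_map n borel_projection \<tau>) = ev w (chain_boundary n (frag_of \<tau>))] (mod int p)"
  shows "\<exists>w. \<forall>\<tau>. singular_simplex n (BG_space G) \<tau> \<longrightarrow> [z \<tau> = ev w (chain_boundary n (frag_of \<tau>))] (mod int p)"
proof -
  let ?K = "chessboard_complex k p" and ?a = "\<lambda>g (i, j). (i :: nat, g j :: nat)"
  have k1: "1 \<le> k" using n by simp
  interpret C: colored_complex G "{1..k} \<times> {1..p}" ?K ?a fst k by (rule chessboard_colored[OF k1])
  interpret B: covering_action G "EG_space G" "EG_action G" by (rule C.covering_action_EG)
  interpret P: covering_action G C.E C.\<phi> by (rule C.covering_E)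
  define f where "f \<sigma> = z (simplex_map n B.q \<sigma>)" for \<sigma>
  let ?EG = "sing (EG_space G) (EG_action G)" and ?E = "sing C.E C.\<phi>" and ?L = "lists_cx {vs. set vs \<in> ?K} ?a"
  have gEG: "gcomplex G ?EG" by (rule B.gcomplex_sing)
  have gE: "gcomplex G ?E" by (rule P.gcomplex_sing)
  have gp: "gcomplex G lists_p" by (rule list_action.gcomplex_lists[OF list_action_G])
  have gL: "gcomplex G ?L" by (rule list_action.gcomplex_lists[OF C.simplex_lists])
  have ac: "acyclic_cx ?EG" by (rule C.acyclic_EG[OF finite_G])
  have pp: "gcomplex_pair G lists_p ?EG" and pL: "gcomplex_pair G ?L ?EG" and pEG: "gcomplex_pair G ?EG ?EG"
    by (intro gcomplex_pair.intro gcomplex_pair_axioms.intro gp gL gEG ac)+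
  have f_inv: "inv_cochain G ?EG n f" unfolding f_def by (rule B.inv_cochain_pull)
  have f_coc: "cocycle_mod (int p) ?EG n f" unfolding f_def by (rule B.cocycle_pull) (use z in \<open>simp add: BG_space_def\<close>)
  obtain \<nu> where \<nu>: "equivariant_chain_map G lists_p ?EG \<nu>" by (rule gcomplex_pair.chain_map_exists[OF pp])
  have bs: "borel_space G (chessboard_space k p) chessboard_action = P.Q"
    unfolding borel_space_def chessboard_space_def chessboard_action_def ..
  have "inv_coboundary (int p) G ?E n (\<lambda>\<sigma>. z (simplex_map n borel_projection (simplex_map n P.q \<sigma>)))"
    using w unfolding bs by (intro P.inv_coboundary_pull_iff[where z = "\<lambda>\<tau>. z (simplex_map n borel_projection \<tau>)", THEN iffD2]) blast
  then have cobE: "inv_coboundary (int p) G ?E n (\<lambda>\<sigma>. f (simplex_map n fst \<sigma>))"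
    unfolding C.borel_projection_simplex f_def .
  obtain \<gamma> where \<gamma>: "\<And>j. j \<in> {1..p} \<Longrightarrow> \<gamma> j \<in> carrier G"
    "\<And>g j. g \<in> carrier G \<Longrightarrow> j \<in> {1..p} \<Longrightarrow> \<gamma> (g j) = g \<circ> \<gamma> j" by (rule identification_exists) blast
  \<comment> \<open>Rows become join factors of \<open>EG\<close>. As a simplex of the board has at
    most one vertex in each row, its image is a simplex.\<close>
  define \<iota> where "\<iota> v = (fst v, \<gamma> (snd v))" for v :: "nat \<times> nat"
  have \<iota>_face: "\<iota> ` S \<in> EG_complex G" if "S \<in> ?K" for S
  proof -
    have S: "S \<subseteq> {1..k} \<times> {1..p}" "inj_on fst S" using that by (simp_all add: chessboard_complex_def)
    have "finite S" by (rule finite_subset[OF S(1)]) simp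
    moreover have "inj_on (fst \<circ> \<iota>) S" using S(2) by (simp add: \<iota>_def o_def)
    then have "inj_on fst (\<iota> ` S)" by (rule inj_on_imageI)
    moreover have "\<iota> v \<in> UNIV \<times> carrier G" if "v \<in> S" for v using that S(1) \<gamma>(1)[of "snd v"] by (cases v) (auto simp: \<iota>_def)
    ultimately show ?thesis unfolding EG_complex_def by blast
  qed
  have "equivariant_chain_map G ?L ?E (\<lambda>n vs. frag_of (lin_pair \<iota> n vs))"
  proof (rule simplex_family_chain_map)
    fix n and vs :: "(nat \<times> nat) list" assume vs: "vs \<in> {vs. set vs \<in> ?K}" "length vs = Suc n"
    show "singular_simplex n C.E (lin_pair \<iota> n vs)"
      unfolding EG_space_eq by (rule singular_simplex_lin_pair) (use vs \<iota>_face in simp_all)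
    fix g assume g: "g \<in> carrier G"
    show "simplex_map n (C.\<phi> g) (lin_pair \<iota> n vs) = lin_pair \<iota> n (map (?a g) vs)"
      unfolding EG_action_eq
    proof (rule simplex_map_lin_pair[OF vs(2)])
      fix v assume "v \<in> set vs"
      then have "snd v \<in> {1..p}" using vs(1) unfolding chessboard_complex_def by auto
      from \<gamma>(2)[OF g this] show "\<iota> (?a g v) = EG_vertex_action G g (\<iota> v)" by (cases v) (simp add: \<iota>_def)
    qed
  qed (rule singular_face_lin_pair, assumption+)
  note \<rho> = this
  have "inv_coboundary (int p) G ?L n (\<lambda>vs. ev (\<lambda>\<sigma>. f (simplex_map n fst \<sigma>)) (frag_of (lin_pair \<iota> n vs)))"
    by (rule pullback_inv_coboundary[OF gL gE \<rho> cobE])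
  then have cobL: "inv_coboundary (int p) G ?L n (\<lambda>vs. ev f (frag_of (simplex_map n fst (lin_pair \<iota> n vs))))"
    unfolding ev_of .
  have \<rho>1: "equivariant_chain_map G ?L ?EG (\<lambda>n vs. frag_of (simplex_map n fst (lin_pair \<iota> n vs)))"
    using equivariant_chain_map_comp[OF \<rho> C.projection_chain_map] unfolding frag_extend_of .
  have sm: "equivariant_chain_map G ?L lists_p (\<lambda>n vs. frag_of (map snd vs))"
  proof (rule list_map_chain_map)
    show "map snd vs \<in> {xs. set xs \<subseteq> {1..p}}" if "vs \<in> {vs. set vs \<in> ?K}" for vs :: "(nat \<times> nat) list"
      using that unfolding chessboard_complex_def by auto
    show "set vs \<subseteq> UNIV" for vs :: "(nat \<times> nat) list" by simp
    show "snd (?a g v) = g (snd v)" for g and v :: "nat \<times> nat" by (cases v) simp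
  qed
  have \<rho>2: "equivariant_chain_map G ?L ?EG (\<lambda>n vs. \<nu> n (map snd vs))"
    using equivariant_chain_map_comp[OF sm \<nu>] unfolding frag_extend_of .
  have "inv_coboundary (int p) G ?L n (\<lambda>vs. ev f (\<nu> n (map snd vs)))"
    using inv_coboundary_diff_iff[OF gcomplex_pair.chain_maps_cohomologous[OF pL \<rho>1 \<rho>2 f_inv f_coc]] cobL by blast
  from inv_coboundary_if_cob[OF pullback_inv_cochain[OF gEG \<nu> f_inv] pullback_cocycle[OF gp \<nu> f_coc] _ this n(1)]
  have cobp: "inv_coboundary (int p) G lists_p n (\<lambda>xs. ev f (\<nu> n xs))" using n by simp
  \<comment> \<open>An equivariant labelling of points by letters, which provides the chain map from
    \<open>EG\<close> back to words.\<close>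
  obtain \<Phi> where \<Phi>: "\<And>y. y \<in> topspace (EG_space G) \<Longrightarrow> \<Phi> y \<in> {1..p}"
    "\<And>g y. g \<in> carrier G \<Longrightarrow> y \<in> topspace (EG_space G) \<Longrightarrow> \<Phi> (EG_action G g y) = g (\<Phi> y)"
  proof (rule B.equivariant_point_choice[where R = "\<lambda>y v. v \<in> {1..p}" and w = "\<lambda>g. g"])
    show "\<exists>v. v \<in> {1..p}" using p_ge by (intro exI[of _ 1]) simp
    show "g v \<in> {1..p}" if "g \<in> carrier G" "v \<in> {1..p}" for g v by (rule G_in[OF that])
    show "(g \<otimes>\<^bsub>G\<^esub> h) v = g (h v)" for g h v by simp
  qed blast
  have "equivariant_chain_map G ?EG lists_p (\<lambda>n \<sigma>. frag_of (vertices \<Phi> n \<sigma>))"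
    by (rule vertices_chain_map) (use \<Phi> in simp_all)
  note vm = this
  have \<nu>\<Phi>: "equivariant_chain_map G ?EG ?EG (\<lambda>n \<sigma>. \<nu> n (vertices \<Phi> n \<sigma>))"
    using equivariant_chain_map_comp[OF vm \<nu>] unfolding frag_extend_of .
  have "inv_coboundary (int p) G ?EG n (\<lambda>\<sigma>. ev f (\<nu> n (vertices \<Phi> n \<sigma>)))"
    using pullback_inv_coboundary[OF gEG gp vm cobp] unfolding ev_of .
  then have "inv_coboundary (int p) G ?EG n f"
    using inv_coboundary_diff_iff[OF gcomplex_pair.chain_maps_cohomologous[OF pEG identity_chain_map[OF gEG] \<nu>\<Phi> f_inv f_coc]]
    unfolding ev_of by blast
  then show ?thesis unfolding f_def B.inv_coboundary_pull_iff unfolding BG_space_def .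
qed

end

section \<open>Cohomology rings with coefficients in a residue ring\<close>

locale mod_cochains =
  fixes m :: int
  assumes m_gt_1: "1 < m"
begin

abbreviation R :: "int ring" where "R \<equiv> residue_ring m"

abbreviation cochains :: "'a topology \<Rightarrow> ('a, int) cochain set" where
  "cochains X \<equiv> carrier (cochain_ring R X)"

abbreviation B :: "'a topology \<Rightarrow> ('a, int) cochain set" where
  "B X \<equiv> coboundaries R X"

text \<open>A normal form: residues on singular simplices, \<open>undefined\<close> elsewhere. With
  it, equality in the cochain ring becomes congruence on simplices.\<close>

definition reduce :: "'a topology \<Rightarrow> ('a, int) cochain \<Rightarrow> ('a, int) cochain" where
  "reduce X f = (\<lambda>n. \<lambda>\<sigma>\<in>singular_simplex_set n X. f n \<sigma> mod m)"

lemma residues_R: "residues m"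
  by unfold_locales (rule m_gt_1)

lemma carrier_R: "carrier R = {0..m - 1}" and zero_R: "\<zero>\<^bsub>R\<^esub> = 0" and add_R: "x \<oplus>\<^bsub>R\<^esub> y = (x + y) mod m"
  by (simp_all add: residue_ring_def)

lemma cochains_iff:
  "c \<in> cochains X \<longleftrightarrow> (\<forall>n. c n \<in> singular_simplex_set n X \<rightarrow>\<^sub>E {0..m - 1}) \<and>
     finite {n. \<exists>\<sigma>\<in>singular_simplex_set n X. c n \<sigma> \<noteq> 0}"
  by (simp add: cochain_ring_def carrier_R zero_R)

lemma reduce_in:
  assumes "finite {n. \<exists>\<sigma>. singular_simplex n X \<sigma> \<and> f n \<sigma> mod m \<noteq> 0}"
  shows "reduce X f \<in> cochains X"
  unfolding cochains_iff reduce_def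
proof
  show "\<forall>n. (\<lambda>\<sigma>\<in>singular_simplex_set n X. f n \<sigma> mod m) \<in> singular_simplex_set n X \<rightarrow>\<^sub>E {0..m - 1}"
    using m_gt_1 by auto
  show "finite {n. \<exists>\<sigma>\<in>singular_simplex_set n X. (\<lambda>\<sigma>\<in>singular_simplex_set n X. f n \<sigma> mod m) \<sigma> \<noteq> 0}"
    by (rule finite_subset[OF _ assms]) auto
qed

lemma reduce_cochain: "c \<in> cochains X \<Longrightarrow> reduce X c = c"
proof (intro ext)
  fix n \<sigma> assume c: "c \<in> cochains X"
  then have "c n \<in> singular_simplex_set n X \<rightarrow>\<^sub>E {0..m - 1}" unfolding cochains_iff by blast
  then show "reduce X c n \<sigma> = c n \<sigma>"
    unfolding reduce_def by (cases "\<sigma> \<in> singular_simplex_set n X") (auto simp: PiE_def Pi_def extensional_def)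
qed

lemma reduce_cong:
  assumes "\<And>n \<sigma>. singular_simplex n X \<sigma> \<Longrightarrow> [f n \<sigma> = g n \<sigma>] (mod m)"
  shows "reduce X f = reduce X g"
  unfolding reduce_def by (intro ext) (use assms in \<open>simp add: cong_def restrict_def\<close>)

lemma reduce_at: "singular_simplex n X \<sigma> \<Longrightarrow> reduce X f n \<sigma> = f n \<sigma> mod m"
  by (simp add: reduce_def)

lemma reduce_at_cong: "singular_simplex n X \<sigma> \<Longrightarrow> [reduce X f n \<sigma> = f n \<sigma>] (mod m)"
  by (simp add: reduce_at cong_def)

lemma cochain_eqI:
  assumes "c \<in> cochains X" "d \<in> cochains X" "\<And>n \<sigma>. singular_simplex n X \<sigma> \<Longrightarrow> [c n \<sigma> = d n \<sigma>] (mod m)"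
  shows "c = d"
  using reduce_cong[of X c d, OF assms(3)] reduce_cochain[OF assms(1)] reduce_cochain[OF assms(2)] by simp

lemma support_finite:
  assumes "c \<in> cochains X"
  shows "finite {n. \<exists>\<sigma>. singular_simplex n X \<sigma> \<and> c n \<sigma> \<noteq> 0}"
proof -
  have "finite {n. \<exists>\<sigma>\<in>singular_simplex_set n X. c n \<sigma> \<noteq> 0}" using assms unfolding cochains_iff by blast
  then show ?thesis by (rule rev_finite_subset) blast
qed

lemma zero_cochain_ring: "\<zero>\<^bsub>cochain_ring R X\<^esub> = reduce X (\<lambda>_ _. 0)"
  by (simp add: cochain_ring_def reduce_def zero_R)

lemma add_cochain_ring: "a \<oplus>\<^bsub>cochain_ring R X\<^esub> b = reduce X (\<lambda>n \<sigma>. a n \<sigma> + b n \<sigma>)"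
  by (simp add: cochain_ring_def reduce_def add_R)

lemma finsum_R:
  assumes "finite A" "\<And>i. i \<in> A \<Longrightarrow> f i \<in> {0..m - 1}"
  shows "finsum R f A = (\<Sum>i\<in>A. f i) mod m"
proof -
  interpret abelian_group R by (rule residues.abelian_group[OF residues_R])
  show ?thesis
    using assms
  proof (induction A rule: finite_induct)
    case empty
    then show ?case by (simp add: zero_R)
  next
    case (insert x A)
    have "finsum R f (insert x A) = f x \<oplus>\<^bsub>R\<^esub> finsum R f A"
      using insert by (intro finsum_insert) (auto simp: carrier_R)
    then show ?case using insert by (simp add: add_R mod_add_right_eq)
  qed
qed

lemma add_pow_R:
  assumes "x \<in> {0..m - 1}"
  shows "[((- 1) ^ i :: int)] \<cdot>\<^bsub>R\<^esub> x = ((- 1) ^ i * x) mod m"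
proof -
  interpret abelian_group R by (rule residues.abelian_group[OF residues_R])
  have x: "x \<in> carrier R" using assms by (simp add: carrier_R)
  have "[(1 :: int)] \<cdot>\<^bsub>R\<^esub> x = x" using add.int_pow_1[OF x] .
  moreover have "[(- 1 :: int)] \<cdot>\<^bsub>R\<^esub> x = \<ominus>\<^bsub>R\<^esub> x" using add.int_pow_neg[OF x, of 1] add.int_pow_1[OF x] by simp
  moreover have "\<ominus>\<^bsub>R\<^esub> x = (- x) mod m" by (rule residues.res_neg_eq[OF residues_R])
  ultimately show ?thesis using assms by (cases "even i") simp_all
qed

text \<open>Replaces arithmetic in the residue ring by an integer evaluation followed by one
  reduction, which connects the definition to \<open>ev\<close> and congruences.\<close>

lemma coboundary_eq:
  assumes c: "c \<in> cochains X"
  shows "coboundary R X c = reduce X (\<lambda>n \<sigma>. ev (c (n - 1)) (chain_boundary n (frag_of \<sigma>)))"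
  unfolding coboundary_def reduce_def
proof (rule ext, rule restrict_ext)
  fix n \<sigma> assume "\<sigma> \<in> singular_simplex_set n X"
  then have \<sigma>: "singular_simplex n X \<sigma>" by simp
  show "(if n = 0 then \<zero>\<^bsub>R\<^esub> else \<Oplus>\<^bsub>R\<^esub>i\<in>{..n}. [((- 1) ^ i :: int)] \<cdot>\<^bsub>R\<^esub> c (n - 1) (singular_face n i \<sigma>))
      = ev (c (n - 1)) (chain_boundary n (frag_of \<sigma>)) mod m"
  proof (cases "n = 0")
    case True
    then show ?thesis by (simp add: chain_boundary_of zero_R)
  next
    case False
    have ci: "c (n - 1) (singular_face n i \<sigma>) \<in> {0..m - 1}" if "i \<le> n" for i
    proof -
      have "singular_simplex (n - 1) X (singular_face n i \<sigma>)"
        using singular_simplex_singular_face[OF \<sigma>, of i] that False by simp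
      moreover have "c (n - 1) \<in> singular_simplex_set (n - 1) X \<rightarrow>\<^sub>E {0..m - 1}" using c unfolding cochains_iff by blast
      ultimately show ?thesis by blast
    qed
    have "(\<Oplus>\<^bsub>R\<^esub>i\<in>{..n}. [((- 1) ^ i :: int)] \<cdot>\<^bsub>R\<^esub> c (n - 1) (singular_face n i \<sigma>))
        = (\<Sum>i\<in>{..n}. [((- 1) ^ i :: int)] \<cdot>\<^bsub>R\<^esub> c (n - 1) (singular_face n i \<sigma>)) mod m"
      by (rule finsum_R) (use ci m_gt_1 in \<open>simp_all add: add_pow_R\<close>)
    also have "\<dots> = (\<Sum>i\<in>{..n}. (- 1) ^ i * c (n - 1) (singular_face n i \<sigma>)) mod m"
      using ci by (simp add: add_pow_R mod_sum_eq)
    also have "(\<Sum>i\<in>{..n}. (- 1) ^ i * c (n - 1) (singular_face n i \<sigma>)) = ev (c (n - 1)) (chain_boundary n (frag_of \<sigma>))"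
      using False by (simp add: chain_boundary_of ev_sum ev_cmul)
    finally show ?thesis using False by simp
  qed
qed

lemma coboundary_in:
  assumes c: "c \<in> cochains X"
  shows "coboundary R X c \<in> cochains X"
  unfolding coboundary_eq[OF c]
proof (rule reduce_in, rule finite_subset)
  show "finite (Suc ` {n. \<exists>\<sigma>. singular_simplex n X \<sigma> \<and> c n \<sigma> \<noteq> 0})" using support_finite[OF c] by simp
  show "{n. \<exists>\<sigma>. singular_simplex n X \<sigma> \<and> ev (c (n - 1)) (chain_boundary n (frag_of \<sigma>)) mod m \<noteq> 0}
      \<subseteq> Suc ` {n. \<exists>\<sigma>. singular_simplex n X \<sigma> \<and> c n \<sigma> \<noteq> 0}"
  proof
    fix n assume "n \<in> {n. \<exists>\<sigma>. singular_simplex n X \<sigma> \<and> ev (c (n - 1)) (chain_boundary n (frag_of \<sigma>)) mod m \<noteq> 0}"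
    then obtain \<sigma> where \<sigma>: "singular_simplex n X \<sigma>" "ev (c (n - 1)) (chain_boundary n (frag_of \<sigma>)) mod m \<noteq> 0" by blast
    have "n \<noteq> 0" using \<sigma>(2) by (metis chain_boundary_def ev_0 mod_0)
    then obtain k where k: "n = Suc k" by (cases n) auto
    have keys: "Poly_Mapping.keys (chain_boundary n (frag_of \<sigma>)) \<subseteq> singular_simplex_set k X"
      using singular_chain_boundary[of n X "frag_of \<sigma>"] \<sigma>(1) unfolding singular_chain_of singular_chain_def k by simp
    have "\<exists>\<rho>. singular_simplex k X \<rho> \<and> c k \<rho> \<noteq> 0"
    proof (rule ccontr)
      assume "\<nexists>\<rho>. singular_simplex k X \<rho> \<and> c k \<rho> \<noteq> 0"
      then have "ev (c k) (chain_boundary n (frag_of \<sigma>)) = ev (\<lambda>_. 0) (chain_boundary n (frag_of \<sigma>))"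
        by (intro ev_cong_on[OF keys]) blast
      then show False using \<sigma>(2) k by simp
    qed
    then show "n \<in> Suc ` {n. \<exists>\<sigma>. singular_simplex n X \<sigma> \<and> c n \<sigma> \<noteq> 0}" unfolding k by blast
  qed
qed

lemma B_sub: "B X \<subseteq> cochains X"
  unfolding coboundaries_def using coboundary_in by blast

text \<open>The degrees are independent, so primitives may be found degree by degree and as
  arbitrary integer-valued functions.\<close>

lemma B_iff:
  assumes y: "y \<in> cochains X"
  shows "y \<in> B X \<longleftrightarrow> (\<forall>n. \<exists>w. \<forall>\<tau>. singular_simplex n X \<tau> \<longrightarrow> [y n \<tau> = ev w (chain_boundary n (frag_of \<tau>))] (mod m))"
proof
  assume "y \<in> B X"
  then obtain c where c: "c \<in> cochains X" "y = coboundary R X c" unfolding coboundaries_def by blast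
  then show "\<forall>n. \<exists>w. \<forall>\<tau>. singular_simplex n X \<tau> \<longrightarrow> [y n \<tau> = ev w (chain_boundary n (frag_of \<tau>))] (mod m)"
    unfolding c(2) coboundary_eq[OF c(1)] using reduce_at_cong by blast
next
  assume "\<forall>n. \<exists>w. \<forall>\<tau>. singular_simplex n X \<tau> \<longrightarrow> [y n \<tau> = ev w (chain_boundary n (frag_of \<tau>))] (mod m)"
  then obtain W where W: "\<And>n \<tau>. singular_simplex n X \<tau> \<Longrightarrow> [y n \<tau> = ev (W n) (chain_boundary n (frag_of \<tau>))] (mod m)"
    by metis
  define nz where "nz n \<longleftrightarrow> (\<exists>\<tau>. singular_simplex n X \<tau> \<and> y n \<tau> \<noteq> 0)" for n
  \<comment> \<open>A primitive is kept only where \<open>y\<close> is nonzero one degree higher.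
    The assembled cochain then has finite support, as membership in the ring demands.\<close>
  define c0 where "c0 n = (if nz (Suc n) then W (Suc n) else (\<lambda>_. 0))" for n
  define c where "c = reduce X c0"
  have c: "c \<in> cochains X"
    unfolding c_def
  proof (rule reduce_in, rule finite_subset)
    have "finite {n. nz n}" using support_finite[OF y] unfolding nz_def .
    then show "finite ((\<lambda>n. n - 1) ` {n. nz n})" by simp
    show "{n. \<exists>\<sigma>. singular_simplex n X \<sigma> \<and> c0 n \<sigma> mod m \<noteq> 0} \<subseteq> (\<lambda>n. n - 1) ` {n. nz n}"
    proof
      fix n assume "n \<in> {n. \<exists>\<sigma>. singular_simplex n X \<sigma> \<and> c0 n \<sigma> mod m \<noteq> 0}"
      then have "nz (Suc n)" unfolding c0_def by (auto split: if_splits)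
      then show "n \<in> (\<lambda>n. n - 1) ` {n. nz n}" by (intro image_eqI[of _ _ "Suc n"]) simp_all
    qed
  qed
  have "y = coboundary R X c"
  proof (rule cochain_eqI[OF y coboundary_in[OF c]])
    fix n \<tau> assume \<tau>: "singular_simplex n X \<tau>"
    have "[y n \<tau> = ev (c (n - 1)) (chain_boundary n (frag_of \<tau>))] (mod m)"
    proof (cases n)
      case 0
      then show ?thesis using W[OF \<tau>] by (simp add: chain_boundary_of)
    next
      case (Suc k)
      have keys: "Poly_Mapping.keys (chain_boundary n (frag_of \<tau>)) \<subseteq> singular_simplex_set k X"
        using singular_chain_boundary[of n X "frag_of \<tau>"] \<tau> unfolding singular_chain_of singular_chain_def Suc by simp
      have "[ev (c k) (chain_boundary n (frag_of \<tau>)) = ev (c0 k) (chain_boundary n (frag_of \<tau>))] (mod m)"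
        unfolding c_def by (rule ev_mod_cong_on[OF keys]) (simp add: reduce_at_cong)
      moreover have "[y n \<tau> = ev (c0 k) (chain_boundary n (frag_of \<tau>))] (mod m)"
      proof (cases "nz n")
        case True
        then show ?thesis using W[OF \<tau>] unfolding c0_def Suc by simp
      next
        case False
        then have "y n \<tau> = 0" using \<tau> unfolding nz_def by blast
        then show ?thesis using False unfolding c0_def Suc by simp
      qed
      ultimately show ?thesis unfolding Suc diff_Suc_1 by (rule cong_trans[OF _ cong_sym, rotated])
    qed
    then show "[y n \<tau> = coboundary R X c n \<tau>] (mod m)"
      unfolding coboundary_eq[OF c] by (rule cong_trans[OF _ cong_sym[OF reduce_at_cong[OF \<tau>]]])
  qed
  then show "y \<in> B X" unfolding coboundaries_def using c by blast
qed

lemma combination_in: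
  assumes "a \<in> cochains X" "b \<in> cochains X"
  shows "reduce X (\<lambda>n \<sigma>. a n \<sigma> + u * b n \<sigma>) \<in> cochains X"
proof (rule reduce_in, rule finite_subset)
  show "finite ({n. \<exists>\<sigma>. singular_simplex n X \<sigma> \<and> a n \<sigma> \<noteq> 0} \<union> {n. \<exists>\<sigma>. singular_simplex n X \<sigma> \<and> b n \<sigma> \<noteq> 0})"
    using support_finite[OF assms(1)] support_finite[OF assms(2)] by simp
  show "{n. \<exists>\<sigma>. singular_simplex n X \<sigma> \<and> (a n \<sigma> + u * b n \<sigma>) mod m \<noteq> 0}
      \<subseteq> {n. \<exists>\<sigma>. singular_simplex n X \<sigma> \<and> a n \<sigma> \<noteq> 0} \<union> {n. \<exists>\<sigma>. singular_simplex n X \<sigma> \<and> b n \<sigma> \<noteq> 0}"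
    by fastforce
qed

lemma B_combination:
  assumes "a \<in> B X" "b \<in> B X"
  shows "reduce X (\<lambda>n \<sigma>. a n \<sigma> + u * b n \<sigma>) \<in> B X"
proof -
  have ab: "a \<in> cochains X" "b \<in> cochains X" using assms B_sub by blast+
  show ?thesis
    unfolding B_iff[OF combination_in[OF ab]]
  proof
    fix n
    obtain v w where "\<forall>\<tau>. singular_simplex n X \<tau> \<longrightarrow> [a n \<tau> = ev v (chain_boundary n (frag_of \<tau>))] (mod m)"
      "\<forall>\<tau>. singular_simplex n X \<tau> \<longrightarrow> [b n \<tau> = ev w (chain_boundary n (frag_of \<tau>))] (mod m)"
      using assms unfolding B_iff[OF ab(1)] B_iff[OF ab(2)] by blast
    moreover have "ev (\<lambda>\<sigma>. v \<sigma> + u * w \<sigma>) c = ev v c + u * ev w c" for c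
      unfolding ev_add_left by (simp add: ev_def sum_distrib_left algebra_simps)
    ultimately have "[reduce X (\<lambda>n \<sigma>. a n \<sigma> + u * b n \<sigma>) n \<tau> = ev (\<lambda>\<sigma>. v \<sigma> + u * w \<sigma>) (chain_boundary n (frag_of \<tau>))] (mod m)"
      if "singular_simplex n X \<tau>" for \<tau>
      using that by (intro cong_trans[OF reduce_at_cong]) (simp_all add: cong_add cong_mult)
    then show "\<exists>w. \<forall>\<tau>. singular_simplex n X \<tau> \<longrightarrow>
        [reduce X (\<lambda>n \<sigma>. a n \<sigma> + u * b n \<sigma>) n \<tau> = ev w (chain_boundary n (frag_of \<tau>))] (mod m)" by blast
  qed
qed

definition cl :: "'a topology \<Rightarrow> ('a, int) cochain \<Rightarrow> ('a, int) cochain set" where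
  "cl X z = {reduce X (\<lambda>n \<sigma>. b n \<sigma> + z n \<sigma>) | b. b \<in> B X}"

lemma cl_eq: "B X +>\<^bsub>cocycle_ring R X\<^esub> z = cl X z"
  by (auto simp: a_r_coset_def' cl_def cocycle_ring_def add_cochain_ring[symmetric])

lemma cl_absorb:
  assumes b: "b \<in> B X"
  shows "cl X (reduce X (\<lambda>n \<sigma>. b n \<sigma> + y n \<sigma>)) = cl X y"
proof
  show "cl X (reduce X (\<lambda>n \<sigma>. b n \<sigma> + y n \<sigma>)) \<subseteq> cl X y"
  proof
    fix x assume "x \<in> cl X (reduce X (\<lambda>n \<sigma>. b n \<sigma> + y n \<sigma>))"
    then obtain a where a: "a \<in> B X" "x = reduce X (\<lambda>n \<sigma>. a n \<sigma> + reduce X (\<lambda>n \<sigma>. b n \<sigma> + y n \<sigma>) n \<sigma>)" unfolding cl_def by blast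
    have "x = reduce X (\<lambda>n \<sigma>. reduce X (\<lambda>n \<sigma>. a n \<sigma> + 1 * b n \<sigma>) n \<sigma> + y n \<sigma>)"
      unfolding a(2) by (rule reduce_cong) (simp add: reduce_at cong_def mod_add_left_eq mod_add_right_eq add.assoc)
    then show "x \<in> cl X y" unfolding cl_def using B_combination[OF a(1) b, of 1] by blast
  qed
  show "cl X y \<subseteq> cl X (reduce X (\<lambda>n \<sigma>. b n \<sigma> + y n \<sigma>))"
  proof
    fix x assume "x \<in> cl X y"
    then obtain a where a: "a \<in> B X" "x = reduce X (\<lambda>n \<sigma>. a n \<sigma> + y n \<sigma>)" unfolding cl_def by blast
    have "x = reduce X (\<lambda>n \<sigma>. reduce X (\<lambda>n \<sigma>. a n \<sigma> + (- 1) * b n \<sigma>) n \<sigma> + reduce X (\<lambda>n \<sigma>. b n \<sigma> + y n \<sigma>) n \<sigma>)"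
      unfolding a(2) by (rule reduce_cong) (simp add: reduce_at cong_def mod_add_eq)
    then show "x \<in> cl X (reduce X (\<lambda>n \<sigma>. b n \<sigma> + y n \<sigma>))"
      unfolding cl_def using B_combination[OF a(1) b, of "- 1"] by blast
  qed
qed

lemma zero_in_B: "reduce X (\<lambda>_ _. 0) \<in> B X"
proof -
  have "reduce X (\<lambda>_ _. 0) \<in> cochains X" by (rule reduce_in) simp
  from B_iff[OF this] show ?thesis
    using reduce_at_cong[of _ X _ "\<lambda>_ _. 0"] by (auto intro!: exI[of _ "\<lambda>_. 0"])
qed

lemma self_in_cl: "z \<in> cochains X \<Longrightarrow> z \<in> cl X z"
proof -
  assume z: "z \<in> cochains X"
  have "z = reduce X (\<lambda>n \<sigma>. reduce X (\<lambda>_ _. 0) n \<sigma> + z n \<sigma>)"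
    by (subst reduce_cochain[OF z, symmetric], rule reduce_cong) (simp add: reduce_at)
  then show "z \<in> cl X z" unfolding cl_def using zero_in_B by blast
qed

lemma cl_B: "y \<in> cochains X \<Longrightarrow> cl X y = B X \<longleftrightarrow> y \<in> B X"
proof
  assume "y \<in> cochains X" "cl X y = B X"
  then show "y \<in> B X" using self_in_cl by blast
next
  assume y: "y \<in> B X"
  have yc: "y \<in> cochains X" using y B_sub by blast
  have "reduce X (\<lambda>n \<sigma>. y n \<sigma> + reduce X (\<lambda>_ _. 0) n \<sigma>) = y"
    by (subst (2) reduce_cochain[OF yc, symmetric], rule reduce_cong) (simp add: reduce_at)
  with cl_absorb[OF y, of "reduce X (\<lambda>_ _. 0)"] have "cl X y = cl X (reduce X (\<lambda>_ _. 0))" by simp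
  also have "\<dots> = B X"
  proof -
    have "reduce X (\<lambda>n \<sigma>. b n \<sigma> + reduce X (\<lambda>_ _. 0) n \<sigma>) = b" if "b \<in> B X" for b
    proof -
      have bc: "b \<in> cochains X" using that B_sub by blast
      show ?thesis by (subst (2) reduce_cochain[OF bc, symmetric], rule reduce_cong) (simp add: reduce_at)
    qed
    then show ?thesis unfolding cl_def by force
  qed
  finally show "cl X y = B X" .
qed

lemma cocycle_iff:
  "z \<in> carrier (cocycle_ring R X) \<longleftrightarrow> z \<in> cochains X \<and>
     (\<forall>n \<tau>. singular_simplex (Suc n) X \<tau> \<longrightarrow> [ev (z n) (chain_boundary (Suc n) (frag_of \<tau>)) = 0] (mod m))"
proof (cases "z \<in> cochains X")
  case True
  have "coboundary R X z = \<zero>\<^bsub>cochain_ring R X\<^esub> \<longleftrightarrow>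
      (\<forall>n \<tau>. singular_simplex n X \<tau> \<longrightarrow> [ev (z (n - 1)) (chain_boundary n (frag_of \<tau>)) = 0] (mod m))"
    unfolding coboundary_eq[OF True] zero_cochain_ring
  proof
    assume eq: "reduce X (\<lambda>n \<sigma>. ev (z (n - 1)) (chain_boundary n (frag_of \<sigma>))) = reduce X (\<lambda>_ _. 0)"
    show "\<forall>n \<tau>. singular_simplex n X \<tau> \<longrightarrow> [ev (z (n - 1)) (chain_boundary n (frag_of \<tau>)) = 0] (mod m)"
    proof (intro allI impI)
      fix n \<tau> assume \<tau>: "singular_simplex n X \<tau>"
      show "[ev (z (n - 1)) (chain_boundary n (frag_of \<tau>)) = 0] (mod m)"
        using fun_cong[OF fun_cong[OF eq, of n], of \<tau>] unfolding reduce_at[OF \<tau>] cong_def .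
    qed
  next
    assume "\<forall>n \<tau>. singular_simplex n X \<tau> \<longrightarrow> [ev (z (n - 1)) (chain_boundary n (frag_of \<tau>)) = 0] (mod m)"
    then show "reduce X (\<lambda>n \<sigma>. ev (z (n - 1)) (chain_boundary n (frag_of \<sigma>))) = reduce X (\<lambda>_ _. 0)"
      by (intro reduce_cong) blast
  qed
  also have "\<dots> \<longleftrightarrow> (\<forall>n \<tau>. singular_simplex (Suc n) X \<tau> \<longrightarrow> [ev (z n) (chain_boundary (Suc n) (frag_of \<tau>)) = 0] (mod m))"
  proof (intro iffI allI impI)
    fix n \<tau>
    assume *: "\<forall>n \<tau>. singular_simplex (Suc n) X \<tau> \<longrightarrow> [ev (z n) (chain_boundary (Suc n) (frag_of \<tau>)) = 0] (mod m)"
      and \<tau>: "singular_simplex n X \<tau>"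
    show "[ev (z (n - 1)) (chain_boundary n (frag_of \<tau>)) = 0] (mod m)"
      using * \<tau> by (cases n) (simp_all add: chain_boundary_of)
  qed (metis diff_Suc_1)
  finally show ?thesis using True unfolding cocycle_ring_def by simp
qed (simp add: cocycle_ring_def)

lemma pullback_in:
  assumes c: "c \<in> cochains Y" and f: "continuous_map X Y f"
  shows "cochain_pullback X f c \<in> cochains X"
proof -
  have cn: "c n \<tau> \<in> {0..m - 1}" if "singular_simplex n Y \<tau>" for n \<tau>
    using c that unfolding cochains_iff by blast
  have "finite {n. \<exists>\<sigma>\<in>singular_simplex_set n X. cochain_pullback X f c n \<sigma> \<noteq> 0}"
    by (rule finite_subset[OF _ support_finite[OF c]])
      (use singular_simplex_simplex_map[OF _ f] in \<open>auto simp: cochain_pullback_def\<close>)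
  moreover have "cochain_pullback X f c n \<in> singular_simplex_set n X \<rightarrow>\<^sub>E {0..m - 1}" for n
    unfolding cochain_pullback_def by (intro restrict_PiE_iff[THEN iffD2] ballI cn) (use singular_simplex_simplex_map[OF _ f] in simp)
  ultimately show ?thesis unfolding cochains_iff by blast
qed

lemma pullback_at: "singular_simplex n X \<sigma> \<Longrightarrow> cochain_pullback X f c n \<sigma> = c n (simplex_map n f \<sigma>)"
  by (simp add: cochain_pullback_def)

lemma pullback_B:
  assumes b: "b \<in> B Y" and f: "continuous_map X Y f"
  shows "cochain_pullback X f b \<in> B X"
proof -
  have bc: "b \<in> cochains Y" using b B_sub by blast
  show ?thesis
    unfolding B_iff[OF pullback_in[OF bc f]]
  proof
    fix n
    obtain w where w: "\<And>\<tau>. singular_simplex n Y \<tau> \<Longrightarrow> [b n \<tau> = ev w (chain_boundary n (frag_of \<tau>))] (mod m)"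
      using b unfolding B_iff[OF bc] by blast
    have "[cochain_pullback X f b n \<sigma> = ev (\<lambda>\<rho>. w (simplex_map (n - 1) f \<rho>)) (chain_boundary n (frag_of \<sigma>))] (mod m)"
      if \<sigma>: "singular_simplex n X \<sigma>" for \<sigma>
    proof -
      have "chain_boundary n (frag_of (simplex_map n f \<sigma>)) = chain_map (n - 1) f (chain_boundary n (frag_of \<sigma>))"
        using chain_boundary_chain_map[of n X "frag_of \<sigma>" f] \<sigma> by (simp add: singular_chain_of)
      then show ?thesis
        using w[OF singular_simplex_simplex_map[OF \<sigma> f]] pullback_at[OF \<sigma>, of f b] by (simp add: chain_map_def ev_frag_extend)
    qed
    then show "\<exists>w. \<forall>\<tau>. singular_simplex n X \<tau> \<longrightarrow> [cochain_pullback X f b n \<tau> = ev w (chain_boundary n (frag_of \<tau>))] (mod m)" by blast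
  qed
qed

text \<open>The image of a class is a union over all its representatives. These differ by
  coboundaries, and coboundaries pull back to coboundaries.\<close>

lemma cohomology_map_zero_iff:
  assumes z: "z \<in> cochains Y" and f: "continuous_map X Y f"
  shows "cohomology_map R X f (cl Y z) = B X \<longleftrightarrow> cochain_pullback X f z \<in> B X"
proof
  assume eq: "cohomology_map R X f (cl Y z) = B X"
  have "cl X (cochain_pullback X f z) \<subseteq> B X"
    using eq self_in_cl[OF z] unfolding cohomology_map_def cl_eq by blast
  then show "cochain_pullback X f z \<in> B X" using self_in_cl[OF pullback_in[OF z f]] by blast
next
  assume pz: "cochain_pullback X f z \<in> B X"
  have "cl X (cochain_pullback X f c) = B X" if c: "c \<in> cl Y z" for c
  proof -
    obtain b where b: "b \<in> B Y" "c = reduce Y (\<lambda>n \<sigma>. b n \<sigma> + z n \<sigma>)" using c unfolding cl_def by blast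
    have bc: "b \<in> cochains Y" using b B_sub by blast
    have cc: "c \<in> cochains Y" using combination_in[OF bc z, of 1] unfolding b(2) by simp
    have "cochain_pullback X f c = reduce X (\<lambda>n \<sigma>. cochain_pullback X f b n \<sigma> + 1 * cochain_pullback X f z n \<sigma>)"
    proof (rule cochain_eqI[OF pullback_in[OF cc f] combination_in[OF pullback_in[OF bc f] pullback_in[OF z f]]])
      fix n \<sigma> assume \<sigma>: "singular_simplex n X \<sigma>"
      show "[cochain_pullback X f c n \<sigma> = reduce X (\<lambda>n \<sigma>. cochain_pullback X f b n \<sigma> + 1 * cochain_pullback X f z n \<sigma>) n \<sigma>] (mod m)"
        unfolding reduce_at[OF \<sigma>] pullback_at[OF \<sigma>] b(2) reduce_at[OF singular_simplex_simplex_map[OF \<sigma> f]]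
        by (simp add: cong_def)
    qed
    then have "cochain_pullback X f c \<in> B X" using B_combination[OF pullback_B[OF b(1) f] pz, of 1] by simp
    then show ?thesis using cl_B[OF pullback_in[OF cc f]] by blast
  qed
  then show "cohomology_map R X f (cl Y z) = B X"
    unfolding cohomology_map_def cl_eq using self_in_cl[OF z] by blast
qed

lemma cohomology_carrier: "carrier (cohomology_ring R X) = {cl X z | z. z \<in> carrier (cocycle_ring R X)}"
  unfolding cohomology_ring_def FactRing_def A_RCOSETS_def' cl_eq by auto

lemma cohomology_kernel:
  assumes f: "continuous_map X Y f"
  shows "a_kernel (cohomology_ring R Y) (cohomology_ring R X) (cohomology_map R X f)
    = {cl Y z | z. z \<in> carrier (cocycle_ring R Y) \<and> cochain_pullback X f z \<in> B X}"
proof -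
  have "\<zero>\<^bsub>cohomology_ring R X\<^esub> = B X" by (simp add: cohomology_ring_def FactRing_def)
  then have "a_kernel (cohomology_ring R Y) (cohomology_ring R X) (cohomology_map R X f)
      = {A \<in> {cl Y z | z. z \<in> carrier (cocycle_ring R Y)}. cohomology_map R X f A = B X}"
    unfolding a_kernel_def kernel_def cohomology_carrier[symmetric] by simp
  also have "\<dots> = {cl Y z | z. z \<in> carrier (cocycle_ring R Y) \<and> cochain_pullback X f z \<in> B X}"
    using cohomology_map_zero_iff[OF _ f] unfolding cocycle_iff by blast
  finally show ?thesis .
qed

text \<open>The cocycle and coboundary conditions hold degree by degree, so a cocycle can be cut at
  degree \<open>k\<close>. For a class in the kernel the lower piece is a coboundary by
  \<open>low\<close>, leaving a representative concentrated in degrees at least \<open>k\<close>;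
  conversely \<open>high\<close> makes such representatives pull back to coboundaries.\<close>

lemma kernel_eq_cohomology_geq:
  assumes f: "continuous_map X Y f"
    and low: "\<And>z n w. z \<in> carrier (cocycle_ring R Y) \<Longrightarrow> n < k \<Longrightarrow>
        (\<And>\<tau>. singular_simplex n X \<tau> \<Longrightarrow> [z n (simplex_map n f \<tau>) = ev w (chain_boundary n (frag_of \<tau>))] (mod m)) \<Longrightarrow>
        \<exists>w. \<forall>\<tau>. singular_simplex n Y \<tau> \<longrightarrow> [z n \<tau> = ev w (chain_boundary n (frag_of \<tau>))] (mod m)"
    and high: "\<And>z n. z \<in> carrier (cocycle_ring R Y) \<Longrightarrow> k \<le> n \<Longrightarrow>
        \<exists>w. \<forall>\<tau>. singular_simplex n X \<tau> \<longrightarrow> [z n (simplex_map n f \<tau>) = ev w (chain_boundary n (frag_of \<tau>))] (mod m)"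
  shows "a_kernel (cohomology_ring R Y) (cohomology_ring R X) (cohomology_map R X f) = cohomology_geq R Y k"
  unfolding cohomology_kernel[OF f] cohomology_geq_def cl_eq
proof
  show "{cl Y z |z. z \<in> carrier (cocycle_ring R Y) \<and> (\<forall>n<k. z n = \<zero>\<^bsub>cochain_ring R Y\<^esub> n)}
      \<subseteq> {cl Y z |z. z \<in> carrier (cocycle_ring R Y) \<and> cochain_pullback X f z \<in> B X}"
  proof
    fix A assume "A \<in> {cl Y z |z. z \<in> carrier (cocycle_ring R Y) \<and> (\<forall>n<k. z n = \<zero>\<^bsub>cochain_ring R Y\<^esub> n)}"
    then obtain z where z: "A = cl Y z" "z \<in> carrier (cocycle_ring R Y)" "\<And>n. n < k \<Longrightarrow> z n = \<zero>\<^bsub>cochain_ring R Y\<^esub> n" by blast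
    have zc: "z \<in> cochains Y" using z(2) unfolding cocycle_iff by blast
    have "cochain_pullback X f z \<in> B X"
      unfolding B_iff[OF pullback_in[OF zc f]]
    proof
      fix n
      show "\<exists>w. \<forall>\<tau>. singular_simplex n X \<tau> \<longrightarrow> [cochain_pullback X f z n \<tau> = ev w (chain_boundary n (frag_of \<tau>))] (mod m)"
      proof (cases "k \<le> n")
        case True
        then show ?thesis using high[OF z(2)] pullback_at by metis
      next
        case False
        then have "z n = reduce Y (\<lambda>_ _. 0) n" using z(3) unfolding zero_cochain_ring by simp
        then have "cochain_pullback X f z n \<tau> = 0" if "singular_simplex n X \<tau>" for \<tau>
          using pullback_at[OF that, of f z] reduce_at[OF singular_simplex_simplex_map[OF that f], of "\<lambda>_ _. 0"] by simp
        then show ?thesis by (intro exI[of _ "\<lambda>_. 0"]) simp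
      qed
    qed
    then show "A \<in> {cl Y z |z. z \<in> carrier (cocycle_ring R Y) \<and> cochain_pullback X f z \<in> B X}" using z by blast
  qed
  show "{cl Y z |z. z \<in> carrier (cocycle_ring R Y) \<and> cochain_pullback X f z \<in> B X}
      \<subseteq> {cl Y z |z. z \<in> carrier (cocycle_ring R Y) \<and> (\<forall>n<k. z n = \<zero>\<^bsub>cochain_ring R Y\<^esub> n)}"
  proof
    fix A assume "A \<in> {cl Y z |z. z \<in> carrier (cocycle_ring R Y) \<and> cochain_pullback X f z \<in> B X}"
    then obtain z where z: "A = cl Y z" "z \<in> carrier (cocycle_ring R Y)" "cochain_pullback X f z \<in> B X" by blast
    have zc: "z \<in> cochains Y" and zz: "\<And>n \<tau>. singular_simplex (Suc n) Y \<tau> \<Longrightarrow> [ev (z n) (chain_boundary (Suc n) (frag_of \<tau>)) = 0] (mod m)"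
      using z(2) unfolding cocycle_iff by blast+
    have trunc: "reduce Y (\<lambda>n \<sigma>. if P n then z n \<sigma> else 0) \<in> cochains Y" for P
      by (rule reduce_in, rule finite_subset[OF _ support_finite[OF zc]]) auto
    define l where "l = reduce Y (\<lambda>n \<sigma>. if n < k then z n \<sigma> else 0)"
    define h where "h = reduce Y (\<lambda>n \<sigma>. if k \<le> n then z n \<sigma> else 0)"
    have lc: "l \<in> cochains Y" and hc: "h \<in> cochains Y" unfolding l_def h_def by (rule trunc)+
    have l: "l \<in> B Y"
      unfolding B_iff[OF lc]
    proof
      fix n
      show "\<exists>w. \<forall>\<tau>. singular_simplex n Y \<tau> \<longrightarrow> [l n \<tau> = ev w (chain_boundary n (frag_of \<tau>))] (mod m)"
      proof (cases "n < k")
        case True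
        obtain w where w: "\<And>\<tau>. singular_simplex n X \<tau> \<Longrightarrow> [cochain_pullback X f z n \<tau> = ev w (chain_boundary n (frag_of \<tau>))] (mod m)"
          using z(3) unfolding B_iff[OF pullback_in[OF zc f]] by blast
        obtain w' where w': "\<And>\<tau>. singular_simplex n Y \<tau> \<Longrightarrow> [z n \<tau> = ev w' (chain_boundary n (frag_of \<tau>))] (mod m)"
          using low[OF z(2) True, of w] w pullback_at by metis
        have "[l n \<tau> = ev w' (chain_boundary n (frag_of \<tau>))] (mod m)" if \<tau>: "singular_simplex n Y \<tau>" for \<tau>
          unfolding l_def by (rule cong_trans[OF reduce_at_cong[OF \<tau>]]) (use True w'[OF \<tau>] in simp)
        then show ?thesis by blast
      next
        case False
        then have "[l n \<tau> = ev (\<lambda>_. 0) (chain_boundary n (frag_of \<tau>))] (mod m)" if "singular_simplex n Y \<tau>" for \<tau>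
          unfolding l_def reduce_at[OF that] by simp
        then show ?thesis by blast
      qed
    qed
    have zlh: "z = reduce Y (\<lambda>n \<sigma>. l n \<sigma> + h n \<sigma>)"
      by (subst reduce_cochain[OF zc, symmetric], rule reduce_cong)
        (auto simp: l_def h_def reduce_at cong_def)
    have "h \<in> carrier (cocycle_ring R Y)"
      unfolding cocycle_iff
    proof (intro conjI hc allI impI)
      fix n \<tau> assume \<tau>: "singular_simplex (Suc n) Y \<tau>"
      have keys: "Poly_Mapping.keys (chain_boundary (Suc n) (frag_of \<tau>)) \<subseteq> singular_simplex_set n Y"
        using singular_chain_boundary[of "Suc n" Y "frag_of \<tau>"] \<tau> unfolding singular_chain_of singular_chain_def by simp
      have "[ev (h n) (chain_boundary (Suc n) (frag_of \<tau>)) = ev (\<lambda>\<sigma>. if k \<le> n then z n \<sigma> else 0) (chain_boundary (Suc n) (frag_of \<tau>))] (mod m)"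
        unfolding h_def by (rule ev_mod_cong_on[OF keys], drule CollectD, erule reduce_at_cong)
      moreover have "[ev (\<lambda>\<sigma>. if k \<le> n then z n \<sigma> else 0) (chain_boundary (Suc n) (frag_of \<tau>)) = 0] (mod m)"
        using zz[OF \<tau>] by (cases "k \<le> n") simp_all
      ultimately show "[ev (h n) (chain_boundary (Suc n) (frag_of \<tau>)) = 0] (mod m)" by (rule cong_trans)
    qed
    moreover have "h n = \<zero>\<^bsub>cochain_ring R Y\<^esub> n" if "n < k" for n
      unfolding h_def zero_cochain_ring reduce_def using that by simp
    moreover have "A = cl Y h" unfolding z(1) zlh by (rule cl_absorb[OF l])
    ultimately show "A \<in> {cl Y z |z. z \<in> carrier (cocycle_ring R Y) \<and> (\<forall>n<k. z n = \<zero>\<^bsub>cochain_ring R Y\<^esub> n)}" by blast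
  qed
qed

end

theorem theorem6p8:
  fixes p k :: nat
  assumes "prime p" and "odd p" and "1 \<le> k" and "k \<le> p - 1"
  shows "fadell_husseini_index (residue_ring (int p)) (cyclic_perm_group p)
           (chessboard_space k p) chessboard_action
         = cohomology_geq (residue_ring (int p)) (BG_space (cyclic_perm_group p)) k"
proof -
  interpret cyclic_cochains p by unfold_locales (rule assms)+
  interpret mod_cochains "int p" by unfold_locales (use p_ge in simp)
  interpret C: colored_complex G "{1..k} \<times> {1..p}" "chessboard_complex k p" "\<lambda>g (i, j). (i, g j)" fst k
    by (rule chessboard_colored[OF assms(3)])
  interpret B: covering_action G "EG_space G" "EG_action G" by (rule C.covering_action_EG)
  interpret P: covering_action G C.E C.\<phi> by (rule C.covering_E)
  have borel: "borel_space G (chessboard_space k p) chessboard_action = P.Q"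
    unfolding borel_space_def chessboard_space_def chessboard_action_def ..
  have cont: "continuous_map P.Q (BG_space G) borel_projection"
    unfolding continuous_map_def
  proof (intro conjI allI impI funcsetI)
    fix A assume "A \<in> topspace P.Q"
    then obtain y where y: "y \<in> topspace C.E" "A = P.q y" unfolding topspace_orbit_space orbits_def by blast
    then have "fst y \<in> topspace (EG_space G)" by auto
    then show "borel_projection A \<in> topspace (BG_space G)"
      unfolding y(2) C.borel_projection_orbit BG_space_def topspace_orbit_space orbits_def by blast
  next
    fix U assume "openin (BG_space G) U"
    then have U: "openin (EG_space G) {x \<in> topspace (EG_space G). B.q x \<in> U}"
      unfolding BG_space_def openin_orbit_space by blast
    have "openin C.E {y \<in> topspace C.E. fst y \<in> {x \<in> topspace (EG_space G). B.q x \<in> U}}"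
      by (rule openin_continuous_map_preimage[OF continuous_map_fst U])
    \<comment> \<open>The projection sends the orbit of \<open>y\<close> to the orbit of
      \<open>fst y\<close>, so the two conditions describe the same preimage.\<close>
    moreover have "{y \<in> topspace C.E. fst y \<in> {x \<in> topspace (EG_space G). B.q x \<in> U}}
        = {y \<in> topspace C.E. P.q y \<in> {A \<in> topspace P.Q. borel_projection A \<in> U}}"
      using P.continuous_q unfolding continuous_map_def by (auto simp: C.borel_projection_orbit)
    ultimately show "openin P.Q {A \<in> topspace P.Q. borel_projection A \<in> U}"
      unfolding openin_orbit_space topspace_orbit_space by auto
  qed
  show ?thesis
    unfolding fadell_husseini_index_def
  proof (rule kernel_eq_cohomology_geq)
    show "continuous_map (borel_space G (chessboard_space k p) chessboard_action) (BG_space G) borel_projection"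
      unfolding borel by (rule cont)
    fix z :: "((nat \<times> (nat \<Rightarrow> nat) \<Rightarrow> real) set, int) cochain" and n
    assume "z \<in> carrier (cocycle_ring R (BG_space G))"
    then have z: "[ev (z n) (chain_boundary (Suc n) (frag_of \<tau>)) = 0] (mod int p)"
      if "singular_simplex (Suc n) (BG_space G) \<tau>" for \<tau>
      using that unfolding cocycle_iff by blast
    show "\<exists>w. \<forall>\<tau>. singular_simplex n (BG_space G) \<tau> \<longrightarrow> [z n \<tau> = ev w (chain_boundary n (frag_of \<tau>))] (mod int p)"
      if "n < k" "\<And>\<tau>. singular_simplex n (borel_space G (chessboard_space k p) chessboard_action) \<tau> \<Longrightarrow>
        [z n (simplex_map n borel_projection \<tau>) = ev w (chain_boundary n (frag_of \<tau>))] (mod int p)" for w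
      by (rule low_degree_pullback[OF z that(1) assms(4) that(2)])
    show "\<exists>w. \<forall>\<tau>. singular_simplex n (borel_space G (chessboard_space k p) chessboard_action) \<tau> \<longrightarrow>
        [z n (simplex_map n borel_projection \<tau>) = ev w (chain_boundary n (frag_of \<tau>))] (mod int p)" if "k \<le> n"
      \<comment> \<open>The positivity of \<open>n\<close> comes from
        \<open>1 \<le> k\<close>.\<close>
      using C.high_degree_pullback[OF z that] that assms(3)
      unfolding borel_space_def chessboard_space_def chessboard_action_def by simp
  qed
qed

end
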